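(* Let $(R,\mathfrak m)$ be a one-dimensional Noetherian Cohen-Macaulay local ring with $R/\mathfrak m$ infinite, having a canonical module $\omega_R$ that is a fractional ideal with $R\subseteq\omega_R\subseteq\overline R$. Let $I$ be an $\mathfrak m$-primary (proper) ideal of $R$, let $I^\vee=(\omega_R:I)$, let $zR$ (with $z\in Q(R)$) be a minimal reduction of $I^\vee$, and let $a,b\in R$. Suppose that $R(I)_{a,b}$ is almost Gorenstein. Then the Cohen-Macaulay type of $R(I)_{a,b}$ is $$t(R(I)_{a,b})=2\lambda_R\left(\frac{z^{-1}I^\vee}{R}\right)+1=2\lambda_R\left(\frac{\omega_R}{zI}\right)+1 .$$
   Context: All rings are commutative with unity. For a Noetherian ring $R$, a nonzero proper ideal $I$ and $a,b\in R$, the Rees algebra is the subring $\bigoplus_{n\ge 0} I^n t^n$ of $R[t]$, and $R(I)_{a,b}$ denotes the quotient of $\bigoplus_{n\ge 0} I^n t^n$ by the ideal $\big((t^2+at+b)R[t]\big)\cap \bigoplus_{n\ge 0} I^n t^n$. As an $R$-module $R(I)_{a,b}\cong R\oplus I$; its elements are written uniquely as $r+it$ with $r\in R$, $i\in I$, with product $(r+it)(s+jt)=rs-bij+(rj+is-aij)t$. If $(R,\mathfrak m)$ is local, then $R(I)_{a,b}$ is local with maximal ideal $\{m+it \mid m\in\mathfrak m, i\in I\}$. $Q(R)$ is the total ring of fractions of $R$, $\overline R$ the integral closure of $R$ in $Q(R)$, $(A:B)=\{q\in Q(R)\mid qB\subseteq A\}$, and $\lambda_R(\cdot)$ denotes length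 of an $R$-module. If $H$ is a fractional ideal and $y\in R$ is regular with $yH\subseteq R$, then for a minimal reduction $xR$ of the ideal $yH$ one calls $xy^{-1}R$ a minimal reduction of $H$; the element $z$ is then invertible in $Q(R)$. A one-dimensional Cohen-Macaulay local ring $(S,\mathfrak n)$ is almost Gorenstein if it has a canonical module that is isomorphic to a fractional ideal $\omega_S$ of $S$ with $S\subseteq\omega_S\subseteq(\mathfrak n:\mathfrak n)$ (colon in $Q(S)$); its Cohen-Macaulay type is $t(S)=\lambda_S(\operatorname{Ext}^1_S(S/\mathfrak n,S))$. *)

theory Defs
  imports "HOL-Algebra.Algebra" "HOL-Library.Extended_Nat"
begin

section \<open>Modules\<close>

text \<open>
  The HOL-Algebra record of modules extends that of rings. Where a mere module is built below, the
  fields \<open>mult\<close> and \<open>one\<close> carry no meaning and are left undefined. A submodule \<open>N\<close> of \<open>M\<close>, regarded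
  as a module, is \<open>M\<lparr>carrier := N\<rparr>\<close>.
\<close>

definition ring_module :: "('a, 'm) ring_scheme \<Rightarrow> ('a, 'a) module" where
  "ring_module R = \<lparr>carrier = carrier R, monoid.mult = monoid.mult R, one = \<one>\<^bsub>R\<^esub>,
     ring.zero = \<zero>\<^bsub>R\<^esub>, add = ring.add R,
     smult = monoid.mult R\<rparr>"

definition quotient_module :: "('a, 'b) module \<Rightarrow> 'b set \<Rightarrow> ('a, 'b set) module" where
  "quotient_module M N = \<lparr>carrier = a_rcosets\<^bsub>M\<^esub> N, monoid.mult = undefined, one = undefined,
     ring.zero = N, add = set_add M, smult = (\<lambda>r C. \<Union>x\<in>C. N +>\<^bsub>M\<^esub> (r \<odot>\<^bsub>M\<^esub> x))\<rparr>"

definition module_span :: "('a, 'm) ring_scheme \<Rightarrow> ('a, 'b) module \<Rightarrow> 'b set \<Rightarrow> 'b set" where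
  "module_span R M A = \<Inter>{N. submodule N R M \<and> A \<subseteq> N}"

definition finitely_generated_module :: "('a, 'm) ring_scheme \<Rightarrow> ('a, 'b) module \<Rightarrow> bool" where
  "finitely_generated_module R M \<longleftrightarrow>
     (\<exists>A. finite A \<and> A \<subseteq> carrier M \<and> module_span R M A = carrier M)"

definition module_length :: "('a, 'm) ring_scheme \<Rightarrow> ('a, 'b) module \<Rightarrow> enat" where
  "module_length R M = Sup {enat n |n. \<exists>N :: nat \<Rightarrow> 'b set.
     (\<forall>i\<le>n. submodule (N i) R M) \<and> (\<forall>i<n. N i \<subset> N (Suc i))}"

definition module_homs ::
    "('a, 'm) ring_scheme \<Rightarrow> ('a, 'b) module \<Rightarrow> ('a, 'c) module \<Rightarrow> ('b \<Rightarrow> 'c) set" where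
  "module_homs R M N = {f. f \<in> carrier M \<rightarrow>\<^sub>E carrier N \<and>
     (\<forall>x\<in>carrier M. \<forall>y\<in>carrier M. f (x \<oplus>\<^bsub>M\<^esub> y) = f x \<oplus>\<^bsub>N\<^esub> f y) \<and>
     (\<forall>r\<in>carrier R. \<forall>x\<in>carrier M. f (r \<odot>\<^bsub>M\<^esub> x) = r \<odot>\<^bsub>N\<^esub> f x)}"

definition hom_module ::
    "('a, 'm) ring_scheme \<Rightarrow> ('a, 'b) module \<Rightarrow> ('a, 'c) module \<Rightarrow> ('a, 'b \<Rightarrow> 'c) module" where
  "hom_module R M N = \<lparr>carrier = module_homs R M N, monoid.mult = undefined, one = undefined,
     ring.zero = (\<lambda>x\<in>carrier M. \<zero>\<^bsub>N\<^esub>),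
     add = (\<lambda>f g. \<lambda>x\<in>carrier M. f x \<oplus>\<^bsub>N\<^esub> g x),
     smult = (\<lambda>r f. \<lambda>x\<in>carrier M. r \<odot>\<^bsub>N\<^esub> f x)\<rparr>"

definition free_module :: "('a, 'm) ring_scheme \<Rightarrow> 'b set \<Rightarrow> ('a, 'b \<Rightarrow> 'a) module" where
  "free_module R B = \<lparr>carrier = {v. (\<forall>x. v x \<in> carrier R) \<and> {x. v x \<noteq> \<zero>\<^bsub>R\<^esub>} \<subseteq> B \<and>
       finite {x. v x \<noteq> \<zero>\<^bsub>R\<^esub>}},
     monoid.mult = undefined, one = undefined,
     ring.zero = (\<lambda>x. \<zero>\<^bsub>R\<^esub>), add = (\<lambda>v w x. v x \<oplus>\<^bsub>R\<^esub> w x), smult = (\<lambda>r v x. r \<otimes>\<^bsub>R\<^esub> v x)\<rparr>"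

text \<open>
  The kernel \<open>K\<close> in the standard free presentation \<open>0 \<rightarrow> K \<rightarrow> F \<rightarrow> M \<rightarrow> 0\<close>, where \<open>F\<close> is free on
  the set of all elements of \<open>M\<close>.
\<close>

definition relation_module ::
    "('a, 'm) ring_scheme \<Rightarrow> ('a, 'b) module \<Rightarrow> ('a, 'b \<Rightarrow> 'a) module" where
  "relation_module R M = (free_module R (carrier M))\<lparr>carrier :=
     {v \<in> carrier (free_module R (carrier M)).
        (\<Oplus>\<^bsub>M\<^esub>x\<in>{x. v x \<noteq> \<zero>\<^bsub>R\<^esub>}. v x \<odot>\<^bsub>M\<^esub> x) = \<zero>\<^bsub>M\<^esub>}\<rparr>"

text \<open>
  \<open>Ext\<^sup>1(M, N)\<close> is the cokernel of the restriction map \<open>Hom(F, N) \<rightarrow> Hom(K, N)\<close>, for this free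
  presentation of \<open>M\<close>.
\<close>

definition Ext1 :: "('a, 'm) ring_scheme \<Rightarrow> ('a, 'b) module \<Rightarrow> ('a, 'c) module \<Rightarrow>
    ('a, (('b \<Rightarrow> 'a) \<Rightarrow> 'c) set) module" where
  "Ext1 R M N = quotient_module (hom_module R (relation_module R M) N)
     ((\<lambda>g. restrict g (carrier (relation_module R M))) `
        module_homs R (free_module R (carrier M)) N)"

text \<open>
  Injectivity as the extension property for homomorphisms defined on submodules. The test modules
  \<open>M\<close> are those whose elements belong to the type of elements of \<open>R\<close>; since \<open>R\<close> itself is one of
  them, Baer's criterion gives the extension property for all modules.
\<close>

definition injective_module :: "('a, 'm) ring_scheme \<Rightarrow> ('a, 'e) module \<Rightarrow> bool" where
  "injective_module R E \<longleftrightarrow> module R E \<and>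
     (\<forall>(M :: ('a, 'a) module) N. module R M \<and> submodule N R M \<longrightarrow>
        (\<forall>f\<in>module_homs R (M\<lparr>carrier := N\<rparr>) E. \<exists>g\<in>module_homs R M E. \<forall>x\<in>N. g x = f x))"

text \<open>
  Existence of an injective resolution \<open>0 \<rightarrow> M \<rightarrow> E\<^sub>0 \<rightarrow> \<dots> \<rightarrow> E\<^sub>n \<rightarrow> 0\<close>. HOL does not quantify over
  types, so the elements of the \<open>E\<^sub>i\<close> are taken from one fixed type. This is no restriction:
  if \<open>\<kappa>\<close> is an infinite cardinal bounding the types \<open>'a\<close> and \<open>'b\<close>, then every \<open>R\<close>-module with at
  most \<open>2\<^sup>\<kappa>\<close> elements lies in a divisible group \<open>D\<close> with at most \<open>2\<^sup>\<kappa>\<close> elements, hence in the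
  injective \<open>R\<close>-module of additive maps from \<open>R\<close> to \<open>D\<close>, which again has at most \<open>2\<^sup>\<kappa>\<close> elements;
  so injective resolutions can be formed among modules of that size.
\<close>

definition finite_injective_dimension ::
    "('a, 'm) ring_scheme \<Rightarrow> ('a, 'b) module \<Rightarrow> bool" where
  "finite_injective_dimension R M \<longleftrightarrow>
     (\<exists>n (E :: nat \<Rightarrow> ('a, ('a \<times> 'b \<times> nat) set) module) \<epsilon> d.
        (\<forall>i. injective_module R (E i)) \<and>
        (\<forall>i>n. carrier (E i) = {\<zero>\<^bsub>E i\<^esub>}) \<and>
        \<epsilon> \<in> module_homs R M (E 0) \<and> inj_on \<epsilon> (carrier M) \<and>
        (\<forall>i. d i \<in> module_homs R (E i) (E (Suc i))) \<and>
        \<epsilon> ` carrier M = a_kernel (E 0) (E 1) (d 0) \<and>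
        (\<forall>i. d i ` carrier (E i) = a_kernel (E (Suc i)) (E (Suc (Suc i))) (d (Suc i))))"


section \<open>Local rings, dimension and depth\<close>

definition local_ring :: "('a, 'm) ring_scheme \<Rightarrow> bool" where
  "local_ring R \<longleftrightarrow> cring R \<and> (\<exists>!\<mm>. maximalideal \<mm> R)"

definition max_ideal :: "('a, 'm) ring_scheme \<Rightarrow> 'a set" where
  "max_ideal R = (THE \<mm>. maximalideal \<mm> R)"

definition krull_dim :: "('a, 'm) ring_scheme \<Rightarrow> enat" where
  "krull_dim R = Sup {enat n |n. \<exists>P :: nat \<Rightarrow> 'a set.
     (\<forall>i\<le>n. primeideal (P i) R) \<and> (\<forall>i<n. P i \<subset> P (Suc i))}"

text \<open>The submodule \<open>(x\<^sub>1, \<dots>, x\<^sub>n) M\<close>.\<close>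

definition list_smult :: "('a, 'm) ring_scheme \<Rightarrow> 'a list \<Rightarrow> ('a, 'b) module \<Rightarrow> 'b set" where
  "list_smult R xs M = module_span R M {x \<odot>\<^bsub>M\<^esub> v |x v. x \<in> set xs \<and> v \<in> carrier M}"

definition regular_sequence :: "('a, 'm) ring_scheme \<Rightarrow> ('a, 'b) module \<Rightarrow> 'a list \<Rightarrow> bool" where
  "regular_sequence R M xs \<longleftrightarrow> set xs \<subseteq> carrier R \<and>
     (\<forall>i<length xs. \<forall>v\<in>carrier M.
        (xs ! i) \<odot>\<^bsub>M\<^esub> v \<in> list_smult R (take i xs) M \<longrightarrow> v \<in> list_smult R (take i xs) M) \<and>
     list_smult R xs M \<noteq> carrier M"

definition depth :: "('a, 'm) ring_scheme \<Rightarrow> ('a, 'b) module \<Rightarrow> enat" where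
  "depth R M = Sup {enat (length xs) |xs. set xs \<subseteq> max_ideal R \<and> regular_sequence R M xs}"

definition one_dim_cm_local_ring :: "('a, 'm) ring_scheme \<Rightarrow> bool" where
  "one_dim_cm_local_ring R \<longleftrightarrow> local_ring R \<and> noetherian_ring R \<and> krull_dim R = 1 \<and>
     depth R (ring_module R) = krull_dim R"

text \<open>
  The Cohen-Macaulay type of a module of depth one, and of a one-dimensional ring. For a module of
  depth \<open>d\<close> the exponent of \<open>Ext\<close> would be \<open>d\<close>.
\<close>

definition module_type :: "('a, 'm) ring_scheme \<Rightarrow> ('a, 'b) module \<Rightarrow> enat" where
  "module_type R M =
     module_length R (Ext1 R (quotient_module (ring_module R) (max_ideal R)) M)"

definition cm_type :: "('a, 'm) ring_scheme \<Rightarrow> enat" where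
  "cm_type R = module_type R (ring_module R)"

text \<open>
  A canonical module of a Cohen-Macaulay local ring is a maximal Cohen-Macaulay module of type one
  and finite injective dimension. As \<open>module_type\<close> is the type in depth one only, this is the
  definition for one-dimensional rings.
\<close>

definition canonical_module :: "('a, 'm) ring_scheme \<Rightarrow> ('a, 'b) module \<Rightarrow> bool" where
  "canonical_module R C \<longleftrightarrow> module R C \<and> finitely_generated_module R C \<and>
     depth R C = krull_dim R \<and> module_type R C = 1 \<and> finite_injective_dimension R C"


section \<open>The total ring of fractions and fractional ideals\<close>

definition regular_elements :: "('a, 'm) ring_scheme \<Rightarrow> 'a set" where
  "regular_elements R = {s \<in> carrier R. \<forall>x\<in>carrier R. s \<otimes>\<^bsub>R\<^esub> x = \<zero>\<^bsub>R\<^esub> \<longrightarrow> x = \<zero>\<^bsub>R\<^esub>}"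

text \<open>The fraction \<open>r/s\<close>, as the set of all pairs representing it.\<close>

definition fraction :: "('a, 'm) ring_scheme \<Rightarrow> 'a \<Rightarrow> 'a \<Rightarrow> ('a \<times> 'a) set" where
  "fraction R r s =
     {(u, v). u \<in> carrier R \<and> v \<in> regular_elements R \<and> r \<otimes>\<^bsub>R\<^esub> v = u \<otimes>\<^bsub>R\<^esub> s}"

text \<open>The total ring of fractions \<open>Q(R)\<close>, both as a ring and as an \<open>R\<close>-module.\<close>

definition total_fractions :: "('a, 'm) ring_scheme \<Rightarrow> ('a, ('a \<times> 'a) set) module" where
  "total_fractions R = \<lparr>carrier = {fraction R r s |r s. r \<in> carrier R \<and> s \<in> regular_elements R},
     monoid.mult = (\<lambda>p q. \<Union>(r, s)\<in>p. \<Union>(u, v)\<in>q. fraction R (r \<otimes>\<^bsub>R\<^esub> u) (s \<otimes>\<^bsub>R\<^esub> v)),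
     one = fraction R \<one>\<^bsub>R\<^esub> \<one>\<^bsub>R\<^esub>,
     ring.zero = fraction R \<zero>\<^bsub>R\<^esub> \<one>\<^bsub>R\<^esub>,
     add = (\<lambda>p q. \<Union>(r, s)\<in>p. \<Union>(u, v)\<in>q.
       fraction R (r \<otimes>\<^bsub>R\<^esub> v \<oplus>\<^bsub>R\<^esub> u \<otimes>\<^bsub>R\<^esub> s) (s \<otimes>\<^bsub>R\<^esub> v)),
     smult = (\<lambda>x p. \<Union>(r, s)\<in>p. fraction R (x \<otimes>\<^bsub>R\<^esub> r) s)\<rparr>"

text \<open>The image in \<open>Q(R)\<close> of a subset of \<open>R\<close>.\<close>

definition frac_embed :: "('a, 'm) ring_scheme \<Rightarrow> 'a set \<Rightarrow> ('a \<times> 'a) set set" where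
  "frac_embed R A = (\<lambda>r. fraction R r \<one>\<^bsub>R\<^esub>) ` A"

definition scale ::
    "('a, 'm) ring_scheme \<Rightarrow> ('a \<times> 'a) set \<Rightarrow> ('a \<times> 'a) set set \<Rightarrow> ('a \<times> 'a) set set" where
  "scale R q H = (\<lambda>h. q \<otimes>\<^bsub>total_fractions R\<^esub> h) ` H"

definition colon ::
    "('a, 'm) ring_scheme \<Rightarrow> ('a \<times> 'a) set set \<Rightarrow> ('a \<times> 'a) set set \<Rightarrow> ('a \<times> 'a) set set" where
  "colon R A B = {q \<in> carrier (total_fractions R). scale R q B \<subseteq> A}"

definition fractional_ideal :: "('a, 'm) ring_scheme \<Rightarrow> ('a \<times> 'a) set set \<Rightarrow> bool" where
  "fractional_ideal R H \<longleftrightarrow> submodule H R (total_fractions R) \<and>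
     (\<exists>y\<in>regular_elements R. scale R (fraction R y \<one>\<^bsub>R\<^esub>) H \<subseteq> frac_embed R (carrier R))"

definition as_module ::
    "('a, 'm) ring_scheme \<Rightarrow> ('a \<times> 'a) set set \<Rightarrow> ('a, ('a \<times> 'a) set) module" where
  "as_module R H = (total_fractions R)\<lparr>carrier := H\<rparr>"

text \<open>The length of \<open>A/B\<close>, for submodules \<open>B \<subseteq> A\<close> of \<open>Q(R)\<close>.\<close>

definition quotient_length ::
    "('a, 'm) ring_scheme \<Rightarrow> ('a \<times> 'a) set set \<Rightarrow> ('a \<times> 'a) set set \<Rightarrow> enat" where
  "quotient_length R A B = module_length R (quotient_module (as_module R A) B)"

definition integral_closure :: "('a, 'm) ring_scheme \<Rightarrow> ('a \<times> 'a) set set" where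
  "integral_closure R = {q \<in> carrier (total_fractions R).
     \<exists>(n :: nat) c. (\<forall>i<n. c i \<in> carrier R) \<and>
       q [^]\<^bsub>total_fractions R\<^esub> n \<oplus>\<^bsub>total_fractions R\<^esub>
         (\<Oplus>\<^bsub>total_fractions R\<^esub>i\<in>{..<n}.
            c i \<odot>\<^bsub>total_fractions R\<^esub> (q [^]\<^bsub>total_fractions R\<^esub> i)) =
       \<zero>\<^bsub>total_fractions R\<^esub>}"


section \<open>Primary ideals and reductions\<close>

definition radical :: "('a, 'm) ring_scheme \<Rightarrow> 'a set \<Rightarrow> 'a set" where
  "radical R I = {x \<in> carrier R. \<exists>n :: nat. x [^]\<^bsub>R\<^esub> n \<in> I}"

definition primary_ideal :: "('a, 'm) ring_scheme \<Rightarrow> 'a set \<Rightarrow> bool" where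
  "primary_ideal R I \<longleftrightarrow> ideal I R \<and> I \<noteq> carrier R \<and>
     (\<forall>x\<in>carrier R. \<forall>y\<in>carrier R. x \<otimes>\<^bsub>R\<^esub> y \<in> I \<longrightarrow> x \<in> I \<or> y \<in> radical R I)"

definition ideal_power :: "('a, 'm) ring_scheme \<Rightarrow> 'a set \<Rightarrow> nat \<Rightarrow> 'a set" where
  "ideal_power R J n = J [^]\<^bsub>ideals_set R\<^esub> n"

definition reduction :: "('a, 'm) ring_scheme \<Rightarrow> 'a set \<Rightarrow> 'a set \<Rightarrow> bool" where
  "reduction R L J \<longleftrightarrow> ideal L R \<and> ideal J R \<and> L \<subseteq> J \<and>
     (\<exists>n. L \<cdot>\<^bsub>R\<^esub> ideal_power R J n = ideal_power R J (Suc n))"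

definition minimal_reduction :: "('a, 'm) ring_scheme \<Rightarrow> 'a set \<Rightarrow> 'a set \<Rightarrow> bool" where
  "minimal_reduction R L J \<longleftrightarrow> reduction R L J \<and> (\<forall>L'. reduction R L' J \<and> L' \<subseteq> L \<longrightarrow> L' = L)"

text \<open>
  \<open>z R\<close> is a minimal reduction of the fractional ideal \<open>H\<close>. The equation of the last line says
  \<open>z R = (x/y) R\<close>.
\<close>

definition fractional_minimal_reduction ::
    "('a, 'm) ring_scheme \<Rightarrow> ('a \<times> 'a) set \<Rightarrow> ('a \<times> 'a) set set \<Rightarrow> bool" where
  "fractional_minimal_reduction R z H \<longleftrightarrow> fractional_ideal R H \<and>
     z \<in> carrier (total_fractions R) \<and>
     (\<exists>x\<in>carrier R. \<exists>y\<in>regular_elements R.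
        scale R (fraction R y \<one>\<^bsub>R\<^esub>) H \<subseteq> frac_embed R (carrier R) \<and>
        minimal_reduction R (PIdl\<^bsub>R\<^esub> x)
          {r \<in> carrier R. fraction R r \<one>\<^bsub>R\<^esub> \<in> scale R (fraction R y \<one>\<^bsub>R\<^esub>) H} \<and>
        scale R z (frac_embed R (carrier R)) = scale R (fraction R x y) (frac_embed R (carrier R)))"


section \<open>Quadratic quotients of the Rees algebra\<close>

definition rees_algebra :: "('a, 'm) ring_scheme \<Rightarrow> 'a set \<Rightarrow> ('a, nat \<Rightarrow> 'a) up_ring" where
  "rees_algebra R I =
     (UP R)\<lparr>carrier := {p \<in> carrier (UP R). \<forall>n. coeff (UP R) p n \<in> ideal_power R I n}\<rparr>"

definition quadratic :: "('a, 'm) ring_scheme \<Rightarrow> 'a \<Rightarrow> 'a \<Rightarrow> nat \<Rightarrow> 'a" where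
  "quadratic R a b =
     monom (UP R) \<one>\<^bsub>R\<^esub> 2 \<oplus>\<^bsub>UP R\<^esub> monom (UP R) a 1 \<oplus>\<^bsub>UP R\<^esub> monom (UP R) b 0"

definition rees_quotient ::
    "('a, 'm) ring_scheme \<Rightarrow> 'a set \<Rightarrow> 'a \<Rightarrow> 'a \<Rightarrow> (nat \<Rightarrow> 'a) set ring" where
  "rees_quotient R I a b =
     rees_algebra R I Quot (PIdl\<^bsub>UP R\<^esub> (quadratic R a b) \<inter> carrier (rees_algebra R I))"


section \<open>Almost Gorenstein rings\<close>

text \<open>
  Since being a canonical module is invariant under isomorphism, a canonical module isomorphic to
  the fractional ideal \<open>\<omega>\<close> exists if and only if \<open>\<omega>\<close> is itself a canonical module.
\<close>

definition almost_gorenstein :: "('a, 'm) ring_scheme \<Rightarrow> bool" where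
  "almost_gorenstein S \<longleftrightarrow> one_dim_cm_local_ring S \<and>
     (\<exists>\<omega>. fractional_ideal S \<omega> \<and> canonical_module S (as_module S \<omega>) \<and>
        frac_embed S (carrier S) \<subseteq> \<omega> \<and>
        \<omega> \<subseteq> colon S (frac_embed S (max_ideal S)) (frac_embed S (max_ideal S)))"

end

theory Submission
  imports Defs
begin

text \<open>
  Write \<open>A\<close> for the image of \<open>R\<close> in \<open>Q = Q(R)\<close>, \<open>J\<close> for that of \<open>I\<close>, and \<open>D = (\<omega> : J)\<close> for the dual of \<open>I\<close>.
  The quotient \<open>S\<close> of the Rees algebra embeds as \<open>A + J t\<close> into the quadratic extension
  \<open>P = Q + Q t\<close> with \<open>t\<^sup>2 = - a t - b\<close>, and every regular element of \<open>S\<close> is invertible in \<open>P\<close>, so that \<open>P\<close>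
  serves as its total ring of fractions. All lengths are lengths of chains of submodules of \<open>Q\<close> or \<open>P\<close>.

  The proof rests on a duality for fractional ideals of a one-dimensional local ring. If \<open>\<omega>\<close> is a
  fractional ideal for which \<open>(\<omega> : n) / \<omega>\<close> has length one, \<open>n\<close> being the maximal ideal, then
  \<open>(\<omega> : H) / (\<omega> : Y)\<close> is at most as long as \<open>Y / H\<close>: a simple quotient \<open>Y / H\<close>
  generated by \<open>b\<close> gives, through multiplication by \<open>b\<close>, an embedding of \<open>(\<omega> : H) / (\<omega> : Y)\<close> into
  \<open>(\<omega> : n) / \<omega>\<close>. For \<open>H = y Y\<close> both lengths equal that of \<open>A / y A\<close>, and as any \<open>H \<subseteq> Y\<close> contains
  such a \<open>y Y\<close>, equality holds everywhere (\<open>len_colon\<close>). Consequences are \<open>(\<omega> : (\<omega> : H)) = H\<close> and the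
  uniqueness of \<open>\<omega>\<close> up to an invertible factor (\<open>canon_unique\<close>). The type condition in the definition of a canonical
  module enters through an identification of \<open>Ext\<^sup>1(R/m, M)\<close> with \<open>(M : m) / M\<close> that preserves
  lengths (\<open>module_type_colon\<close>).

  The \<open>S\<close>-module \<open>K = D + \<omega> t\<close> satisfies \<open>(K : n) = D + (\<omega> : m) t\<close>, where now \<open>n\<close> and \<open>m\<close> are
  the maximal ideals of \<open>S\<close> and \<open>R\<close>, so it is canonical. Let \<open>\<omega>'\<close> be
  the canonical ideal given by the almost Gorenstein property of \<open>S\<close>. Then \<open>\<omega>' n = n\<close>, whence \<open>(S : n) = (\<omega>' : n)\<close>,
  and the type of \<open>S\<close> is the length of \<open>\<omega>' / S\<close> plus one (\<open>almost_gorenstein_type\<close>). By uniqueness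
  \<open>\<omega>' = u K\<close>, so \<open>\<omega>' / S\<close> is as long as \<open>K / u\<^sup>-\<^sup>1 S\<close>. This is in turn as long as \<open>K / z S\<close>,
  because \<open>z u\<close> maps a suitable fractional ideal of \<open>S\<close> onto itself: \<open>z u\<close> lies in \<open>\<omega>' \<subseteq> (n : n)\<close>, and its
  inverse lies in \<open>z\<^sup>-\<^sup>1 K\<close>, which is contained in the ring \<open>W + W t\<close>, where
  \<open>W\<close> is a ring between \<open>A\<close> and \<open>Q\<close> with \<open>z\<^sup>-\<^sup>1 D \<subseteq> W\<close> that the reduction \<open>z\<close>
  provides (\<open>reduction_overring\<close>). Finally \<open>K / z S\<close> splits over \<open>R\<close> into \<open>D / z A\<close> and \<open>\<omega> / z J\<close>, and duality
  over \<open>R\<close> gives these two the same length.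
\<close>

section \<open>Lengths of intervals of submodules\<close>

definition chain_in :: "'b set set \<Rightarrow> 'b set \<Rightarrow> 'b set \<Rightarrow> nat \<Rightarrow> (nat \<Rightarrow> 'b set) \<Rightarrow> bool" where
  "chain_in F A B n N \<longleftrightarrow> (\<forall>i\<le>n. N i \<in> F \<and> A \<subseteq> N i \<and> N i \<subseteq> B) \<and> (\<forall>i<n. N i \<subset> N (Suc i))"

definition chain_len :: "'b set set \<Rightarrow> 'b set \<Rightarrow> 'b set \<Rightarrow> enat" where
  "chain_len F A B = Sup {enat n |n. \<exists>N. chain_in F A B n N}"

lemma chain_len_upper: "chain_in F A B n N \<Longrightarrow> enat n \<le> chain_len F A B"
  unfolding chain_len_def by (rule Sup_upper) blast

lemma chain_len_least: "(\<And>n N. chain_in F A B n N \<Longrightarrow> enat n \<le> k) \<Longrightarrow> chain_len F A B \<le> k"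
  unfolding chain_len_def by (rule Sup_least) blast

text \<open>All comparisons of lengths below go through this one: a strictly monotone map between intervals
  carries chains to chains.\<close>

lemma chain_len_transfer:
  assumes "\<And>N. N \<in> F \<Longrightarrow> A \<subseteq> N \<Longrightarrow> N \<subseteq> B \<Longrightarrow> g N \<in> G \<and> C \<subseteq> g N \<and> g N \<subseteq> D"
    and "\<And>N N'. \<lbrakk>N \<in> F; A \<subseteq> N; N' \<in> F; N' \<subseteq> B; N \<subset> N'\<rbrakk> \<Longrightarrow> g N \<subset> g N'"
  shows "chain_len F A B \<le> chain_len G C D"
proof (rule chain_len_least)
  fix n N assume N: "chain_in F A B n N"
  have "chain_in G C D n (\<lambda>i. g (N i))"
    unfolding chain_in_def using N assms unfolding chain_in_def by (meson Suc_leI less_or_eq_imp_le)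
  thus "enat n \<le> chain_len G C D" by (rule chain_len_upper)
qed

lemma chain_len_mono:
  assumes "F \<subseteq> G" "C \<subseteq> A" "B \<subseteq> D"
  shows "chain_len F A B \<le> chain_len G C D"
  using assms by (intro chain_len_transfer[where g = "\<lambda>N. N"]) auto

lemma chain_len_attained:
  assumes "A \<in> F" "A \<subseteq> B" "chain_len F A B = enat n"
  obtains N where "chain_in F A B n N"
proof -
  let ?S = "{enat n |n. \<exists>N. chain_in F A B n N}"
  have "chain_in F A B 0 (\<lambda>_. A)" using assms by (simp add: chain_in_def)
  hence ne: "?S \<noteq> {}" by blast
  have S: "Sup ?S = enat n" using assms(3) by (simp add: chain_len_def)
  hence fin: "finite ?S" using ne by (auto simp: Sup_enat_def split: if_splits)
  have "Sup ?S = Max ?S" using ne fin by (simp only: Sup_enat_def if_False if_True)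
  hence "Sup ?S \<in> ?S" using Max_in[OF fin ne] by (simp only:)
  hence "enat n \<in> ?S" using S by simp
  thus thesis using that by blast
qed

lemma chain_in_mono: "chain_in F A B n N \<Longrightarrow> i \<le> j \<Longrightarrow> j \<le> n \<Longrightarrow> N i \<subseteq> N j"
proof (induction j)
  case (Suc j)
  then show ?case
    by (cases "i = Suc j") (auto simp: chain_in_def dest!: spec[where x = j])
qed simp

text \<open>Dropping the repetitions from a weakly increasing sequence leaves a chain with one step for each
  jump. This is what remains of a chain after intersecting with, or adding, a fixed submodule.\<close>

lemma chain_of_jumps:
  assumes "\<And>i. i \<le> k \<Longrightarrow> M i \<in> F \<and> A \<subseteq> M i \<and> M i \<subseteq> B" "\<And>i. i < k \<Longrightarrow> M i \<subseteq> M (Suc i)"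
  shows "\<exists>N. chain_in F A B (card {i. i < k \<and> M i \<noteq> M (Suc i)}) N \<and>
    N (card {i. i < k \<and> M i \<noteq> M (Suc i)}) = M k"
  using assms
proof (induction k)
  case 0
  then show ?case by (auto simp: chain_in_def)
next
  case (Suc k)
  let ?c = "card {i. i < k \<and> M i \<noteq> M (Suc i)}"
  obtain N where N: "chain_in F A B ?c N" "N ?c = M k"
    using Suc.IH Suc.prems by (metis (no_types, lifting) le_SucI less_SucI)
  show ?case
  proof (cases "M k = M (Suc k)")
    case True
    have "{i. i < Suc k \<and> M i \<noteq> M (Suc i)} = {i. i < k \<and> M i \<noteq> M (Suc i)}"
      using True by (auto simp: less_Suc_eq)
    thus ?thesis using N True by auto
  next
    case False
    have "{i. i < Suc k \<and> M i \<noteq> M (Suc i)} = insert k {i. i < k \<and> M i \<noteq> M (Suc i)}"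
      using False by (auto simp: less_Suc_eq)
    hence c: "card {i. i < Suc k \<and> M i \<noteq> M (Suc i)} = Suc ?c" by simp
    have k: "M (Suc k) \<in> F" "A \<subseteq> M (Suc k)" "M (Suc k) \<subseteq> B" "M k \<subset> M (Suc k)"
      using Suc.prems(2)[of k] Suc.prems(1)[of "Suc k"] False by auto
    have "chain_in F A B (Suc ?c) (N(Suc ?c := M (Suc k)))"
      unfolding chain_in_def
    proof (intro conjI allI impI)
      fix i assume "i \<le> Suc ?c"
      thus "(N(Suc ?c := M (Suc k))) i \<in> F" "A \<subseteq> (N(Suc ?c := M (Suc k))) i"
        "(N(Suc ?c := M (Suc k))) i \<subseteq> B"
        using N(1) k by (auto simp: chain_in_def le_Suc_eq)
    next
      fix i assume "i < Suc ?c"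
      then consider "i < ?c" | "i = ?c" by linarith
      thus "(N(Suc ?c := M (Suc k))) i \<subset> (N(Suc ?c := M (Suc k))) (Suc i)"
        using N k by cases (auto simp: chain_in_def)
    qed
    moreover have "(N(Suc ?c := M (Suc k))) (Suc ?c) = M (Suc k)" by simp
    ultimately show ?thesis unfolding c by blast
  qed
qed

lemma jumps_le_chain_len:
  assumes "\<And>i. i \<le> k \<Longrightarrow> M i \<in> F \<and> A \<subseteq> M i \<and> M i \<subseteq> B" "\<And>i. i < k \<Longrightarrow> M i \<subseteq> M (Suc i)"
  shows "enat (card {i. i < k \<and> M i \<noteq> M (Suc i)}) \<le> chain_len F A B"
proof -
  obtain N where "chain_in F A B (card {i. i < k \<and> M i \<noteq> M (Suc i)}) N"
    using chain_of_jumps[of k M F A B, OF assms] by blast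
  thus ?thesis by (rule chain_len_upper)
qed

definition dilate :: "('b, 'm) ring_scheme \<Rightarrow> 'b \<Rightarrow> 'b set \<Rightarrow> 'b set" where
  "dilate Q u H = (\<lambda>x. u \<otimes>\<^bsub>Q\<^esub> x) ` H"

definition colonq :: "('b, 'm) ring_scheme \<Rightarrow> 'b set \<Rightarrow> 'b set \<Rightarrow> 'b set" where
  "colonq Q H Y = {q \<in> carrier Q. \<forall>y\<in>Y. q \<otimes>\<^bsub>Q\<^esub> y \<in> H}"

text \<open>Closure under negation is implied for a subring \<open>A\<close>, which contains \<open>- 1\<close>.\<close>

definition submods :: "('b, 'm) ring_scheme \<Rightarrow> 'b set \<Rightarrow> 'b set set" where
  "submods Q A = {N. N \<subseteq> carrier Q \<and> \<zero>\<^bsub>Q\<^esub> \<in> N \<and> (\<forall>x\<in>N. \<forall>y\<in>N. x \<oplus>\<^bsub>Q\<^esub> y \<in> N) \<and>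
     (\<forall>a\<in>A. \<forall>x\<in>N. a \<otimes>\<^bsub>Q\<^esub> x \<in> N)}"

abbreviation mlen :: "('b, 'm) ring_scheme \<Rightarrow> 'b set \<Rightarrow> 'b set \<Rightarrow> 'b set \<Rightarrow> enat" where
  "mlen Q A \<equiv> chain_len (submods Q A)"

locale over_ring = cring Q for Q (structure) +
  fixes A
  assumes sub: "subring A Q"
begin

abbreviation "SM \<equiv> submods Q A"
abbreviation "len \<equiv> chain_len SM"

lemma A_car: "a \<in> A \<Longrightarrow> a \<in> carrier Q" using subringE(1)[OF sub] by blast
lemma A_one: "\<one> \<in> A" using subringE(3)[OF sub] .
lemma A_zero: "\<zero> \<in> A" using subringE(2)[OF sub] .
lemma A_mult: "a \<in> A \<Longrightarrow> b \<in> A \<Longrightarrow> a \<otimes> b \<in> A" using subringE(6)[OF sub] .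
lemma A_add: "a \<in> A \<Longrightarrow> b \<in> A \<Longrightarrow> a \<oplus> b \<in> A" using subringE(7)[OF sub] .
lemma A_neg: "a \<in> A \<Longrightarrow> \<ominus> a \<in> A" using subringE(5)[OF sub] .

lemma SM_car: "N \<in> SM \<Longrightarrow> x \<in> N \<Longrightarrow> x \<in> carrier Q" by (auto simp: submods_def)
lemma SM_zero: "N \<in> SM \<Longrightarrow> \<zero> \<in> N" by (auto simp: submods_def)
lemma SM_add: "N \<in> SM \<Longrightarrow> x \<in> N \<Longrightarrow> y \<in> N \<Longrightarrow> x \<oplus> y \<in> N" by (auto simp: submods_def)
lemma SM_smult: "N \<in> SM \<Longrightarrow> a \<in> A \<Longrightarrow> x \<in> N \<Longrightarrow> a \<otimes> x \<in> N" by (auto simp: submods_def)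
lemma SM_neg: assumes "N \<in> SM" "x \<in> N" shows "\<ominus> x \<in> N"
proof -
  have "\<ominus> \<one> \<otimes> x \<in> N" using assms SM_smult A_neg A_one by blast
  thus ?thesis using SM_car[OF assms] by (simp add: l_minus)
qed
lemma SM_diff: "N \<in> SM \<Longrightarrow> x \<in> N \<Longrightarrow> y \<in> N \<Longrightarrow> x \<ominus> y \<in> N"
  by (simp add: a_minus_def SM_add SM_neg)

lemma SM_I:
  assumes "N \<subseteq> carrier Q" "\<zero> \<in> N" "\<And>x y. x \<in> N \<Longrightarrow> y \<in> N \<Longrightarrow> x \<oplus> y \<in> N"
    "\<And>a x. a \<in> A \<Longrightarrow> x \<in> N \<Longrightarrow> a \<otimes> x \<in> N"
  shows "N \<in> SM"
  using assms by (auto simp: submods_def)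

lemma A_SM: "A \<in> SM"
  using A_car A_zero A_add A_mult by (auto intro: SM_I)

lemma SM_inter: "M \<in> SM \<Longrightarrow> N \<in> SM \<Longrightarrow> M \<inter> N \<in> SM"
  by (auto simp: submods_def)

definition msum :: "'a set \<Rightarrow> 'a set \<Rightarrow> 'a set" where
  "msum M N = {x \<oplus> y |x y. x \<in> M \<and> y \<in> N}"

lemma msumI: "x \<in> M \<Longrightarrow> y \<in> N \<Longrightarrow> x \<oplus> y \<in> msum M N" by (auto simp: msum_def)

lemma SM_msum: assumes M: "M \<in> SM" and N: "N \<in> SM" shows "msum M N \<in> SM"
proof (rule SM_I)
  show "msum M N \<subseteq> carrier Q" using SM_car M N by (auto simp: msum_def)
  have "\<zero> \<oplus> \<zero> \<in> msum M N" using M N SM_zero by (intro msumI)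
  thus "\<zero> \<in> msum M N" by simp
next
  fix x y assume "x \<in> msum M N" "y \<in> msum M N"
  then obtain m n m' n' where mn: "m \<in> M" "n \<in> N" "m' \<in> M" "n' \<in> N" "x = m \<oplus> n" "y = m' \<oplus> n'"
    by (auto simp: msum_def)
  note [simp] = mn(1-4)[THEN SM_car[rotated]]
  have "x \<oplus> y = (m \<oplus> m') \<oplus> (n \<oplus> n')" using mn M N SM_car by (simp add: a_ac)
  thus "x \<oplus> y \<in> msum M N" using mn M N SM_add by (auto intro!: msumI)
next
  fix a x assume "a \<in> A" "x \<in> msum M N"
  then obtain m n where mn: "m \<in> M" "n \<in> N" "x = m \<oplus> n" by (auto simp: msum_def)
  have "a \<otimes> x = a \<otimes> m \<oplus> a \<otimes> n" using mn M N SM_car A_car \<open>a \<in> A\<close> by (simp add: r_distr)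
  thus "a \<otimes> x \<in> msum M N" using mn M N SM_smult \<open>a \<in> A\<close> by (auto intro!: msumI)
qed

lemma msum_upper1: "M \<in> SM \<Longrightarrow> N \<in> SM \<Longrightarrow> M \<subseteq> msum M N"
  using msumI[of _ M \<zero> N] SM_zero SM_car by fastforce
lemma msum_upper2: "M \<in> SM \<Longrightarrow> N \<in> SM \<Longrightarrow> N \<subseteq> msum M N"
  using msumI[of \<zero> M _ N] SM_zero SM_car by fastforce
lemma msum_least: "L \<in> SM \<Longrightarrow> M \<subseteq> L \<Longrightarrow> N \<subseteq> L \<Longrightarrow> msum M N \<subseteq> L"
  unfolding msum_def using SM_add by blast
lemma msum_mono: "M \<subseteq> M' \<Longrightarrow> N \<subseteq> N' \<Longrightarrow> msum M N \<subseteq> msum M' N'"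
  by (auto simp: msum_def)

text \<open>If an element \<open>n\<close> of \<open>N\<close> equals \<open>m + b\<close> with \<open>m\<close> in \<open>M\<close>, then \<open>b = n - m\<close> is in
  \<open>N \<inter> B\<close>, hence in \<open>M\<close>, and so is \<open>n\<close>.\<close>

lemma modular_strict:
  assumes M: "M \<in> SM" and N: "N \<in> SM" and B: "B \<in> SM" and "M \<subset> N" "M \<inter> B = N \<inter> B"
  shows "msum M B \<noteq> msum N B"
proof
  assume eq: "msum M B = msum N B"
  obtain n where n: "n \<in> N" "n \<notin> M" using assms by blast
  have "n \<in> msum M B" using msum_upper1[OF N B] n eq by blast
  then obtain m b where mb: "m \<in> M" "b \<in> B" "n = m \<oplus> b" by (auto simp: msum_def)
  have car: "m \<in> carrier Q" "b \<in> carrier Q" using mb M B SM_car by auto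
  have "b = n \<ominus> m" unfolding mb(3) using car by algebra
  moreover have "n \<ominus> m \<in> N" using n mb N SM_diff \<open>M \<subset> N\<close> by blast
  ultimately have "b \<in> N" by simp
  hence "b \<in> M" using mb assms by blast
  thus False using n mb M SM_add by blast
qed

text \<open>By the modular law each step of a chain from \<open>H\<close> to \<open>Z\<close> remains strict after intersecting with
  \<open>Y\<close> or after adding \<open>Y\<close>, so the two resulting sequences have at least as many jumps
  together as the chain has steps.\<close>

theorem len_add:
  assumes A: "H \<in> SM" and B: "Y \<in> SM" and C: "Z \<in> SM" and XY: "H \<subseteq> Y" and YZ: "Y \<subseteq> Z"
  shows "len H Z = len H Y + len Y Z"
proof (rule antisym)
  show "len H Z \<le> len H Y + len Y Z"
  proof (rule chain_len_least)
    fix k N assume N: "chain_in SM H Z k N"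
    hence Ni: "\<And>i. i \<le> k \<Longrightarrow> N i \<in> SM \<and> H \<subseteq> N i \<and> N i \<subseteq> Z" "\<And>i. i < k \<Longrightarrow> N i \<subset> N (Suc i)"
      by (auto simp: chain_in_def)
    let ?I = "\<lambda>i. N i \<inter> Y" and ?S = "\<lambda>i. msum (N i) Y"
    let ?p = "{i. i < k \<and> ?I i \<noteq> ?I (Suc i)}" and ?q = "{i. i < k \<and> ?S i \<noteq> ?S (Suc i)}"
    have p: "enat (card ?p) \<le> len H Y"
    proof (rule jumps_le_chain_len)
      fix i
      show "i \<le> k \<Longrightarrow> ?I i \<in> SM \<and> H \<subseteq> ?I i \<and> ?I i \<subseteq> Y" using Ni(1) B XY SM_inter by blast
      show "i < k \<Longrightarrow> ?I i \<subseteq> ?I (Suc i)" using Ni(2) by blast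
    qed
    have q: "enat (card ?q) \<le> len Y Z"
      using Ni B C YZ
      by (intro jumps_le_chain_len) (simp_all add: SM_msum msum_upper2 msum_least msum_mono psubset_imp_subset)
    have "{..<k} \<subseteq> ?p \<union> ?q"
    proof
      fix i assume i: "i \<in> {..<k}"
      have a: "N i \<in> SM" "N (Suc i) \<in> SM" "N i \<subset> N (Suc i)" using i Ni by auto
      show "i \<in> ?p \<union> ?q" using modular_strict[OF a(1,2) B a(3)] i by blast
    qed
    hence "k \<le> card (?p \<union> ?q)" using card_mono[of "?p \<union> ?q" "{..<k}"] by simp
    also have "\<dots> \<le> card ?p + card ?q" by (rule card_Un_le)
    finally have "enat k \<le> enat (card ?p) + enat (card ?q)" by simp
    also have "\<dots> \<le> len H Y + len Y Z" using p q by (rule add_mono)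
    finally show "enat k \<le> len H Y + len Y Z" .
  qed
  show "len H Y + len Y Z \<le> len H Z"
  proof (cases "len H Y = \<infinity> \<or> len Y Z = \<infinity>")
    case True
    moreover have "len H Y \<le> len H Z" "len Y Z \<le> len H Z"
      using XY YZ by (auto intro: chain_len_mono)
    ultimately show ?thesis by auto
  next
    case False
    then obtain p q where pq: "len H Y = enat p" "len Y Z = enat q" by auto
    obtain N1 where N1: "chain_in SM H Y p N1" using chain_len_attained[OF A XY pq(1)] .
    obtain N2 where N2: "chain_in SM Y Z q N2" using chain_len_attained[OF B YZ pq(2)] .
    let ?N = "\<lambda>i. if i \<le> p then N1 i else N2 (i - p)"
    have "chain_in SM H Z (p + q) ?N"
      unfolding chain_in_def
    proof (intro conjI allI impI)
      fix i assume i: "i \<le> p + q"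
      have "?N i \<in> SM \<and> H \<subseteq> ?N i \<and> ?N i \<subseteq> Z"
      proof (cases "i \<le> p")
        case True
        hence "N1 i \<in> SM \<and> H \<subseteq> N1 i \<and> N1 i \<subseteq> Y" using N1 by (auto simp: chain_in_def)
        thus ?thesis using True YZ by auto
      next
        case False
        hence "i - p \<le> q" using i by linarith
        hence "N2 (i - p) \<in> SM \<and> Y \<subseteq> N2 (i - p) \<and> N2 (i - p) \<subseteq> Z"
          using N2 by (auto simp: chain_in_def)
        thus ?thesis using False XY by auto
      qed
      thus "?N i \<in> SM" "H \<subseteq> ?N i" "?N i \<subseteq> Z" by blast+
    next
      fix i assume i: "i < p + q"
      consider "i < p" | "i = p" | "i > p" by linarith
      thus "?N i \<subset> ?N (Suc i)"
      proof cases
        case 2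
        have "N1 p \<subseteq> Y" "Y \<subseteq> N2 0" "N2 0 \<subset> N2 1"
          using N1 N2 i 2 by (auto simp: chain_in_def)
        thus ?thesis using 2 by auto
      next
        case 3
        hence "i - p < q" using i by linarith
        hence "N2 (i - p) \<subset> N2 (Suc (i - p))" using N2 by (auto simp: chain_in_def)
        thus ?thesis using 3 by (simp add: Suc_diff_le)
      qed (use N1 in \<open>auto simp: chain_in_def\<close>)
    qed
    thus ?thesis using chain_len_upper pq by fastforce
  qed
qed

lemma len_pos: assumes "H \<in> SM" "Y \<in> SM" "H \<subset> Y" shows "1 \<le> len H Y"
proof -
  have "chain_in SM H Y 1 (\<lambda>i. if i = 0 then H else Y)" using assms by (auto simp: chain_in_def)
  from chain_len_upper[OF this] show ?thesis by (simp add: one_enat_def)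
qed

lemma len_zero_eq: "H \<in> SM \<Longrightarrow> Y \<in> SM \<Longrightarrow> H \<subseteq> Y \<Longrightarrow> len H Y = 0 \<Longrightarrow> H = Y"
  using len_pos[of H Y] by fastforce

lemma len_self: "len H H = 0"
proof -
  have "len H H \<le> 0"
  proof (rule chain_len_least)
    fix n N assume N: "chain_in SM H H n N"
    show "enat n \<le> 0"
    proof (cases n)
      case (Suc m)
      hence "N 0 \<subset> N 1" "H \<subseteq> N 0" "N 1 \<subseteq> H" using N by (auto simp: chain_in_def)
      thus ?thesis by blast
    qed (simp add: zero_enat_def)
  qed
  thus ?thesis by simp
qed

text \<open>The first step of a chain of maximal length is simple, for otherwise additivity would give a
  longer chain.\<close>

lemma composition_step:
  assumes H: "H \<in> SM" and Y: "Y \<in> SM" and XY: "H \<subseteq> Y" and n: "len H Y = enat (Suc n)"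
  obtains Z where "Z \<in> SM" "H \<subset> Z" "Z \<subseteq> Y" "len H Z = 1" "len Z Y = enat n"
proof -
  obtain N where N: "chain_in SM H Y (Suc n) N" using chain_len_attained[OF H XY n] .
  let ?Z = "N 1"
  have Z: "?Z \<in> SM" "H \<subset> ?Z" "?Z \<subseteq> Y" using N by (auto simp: chain_in_def)
  have a: "1 \<le> len H ?Z" using len_pos[OF H Z(1,2)] .
  have "chain_in SM ?Z Y n (\<lambda>i. N (Suc i))"
    unfolding chain_in_def
    using N chain_in_mono[OF N, of 1] by (auto simp: chain_in_def)
  hence b: "enat n \<le> len ?Z Y" by (rule chain_len_upper)
  have s: "len H ?Z + len ?Z Y = enat (Suc n)" using len_add[OF H Z(1) Y] Z n by auto
  then obtain p q where pq: "len H ?Z = enat p" "len ?Z Y = enat q"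
    by (metis enat_ord_simps(4) not_infinity_eq plus_eq_infty_iff_enat enat.distinct(1))
  have "p = 1" "q = n" using a b s pq by (auto simp: one_enat_def)
  thus thesis using that[of ?Z] Z pq by (auto simp: one_enat_def)
qed

lemma exists_maximal_proper:
  assumes H: "H \<in> SM" and Y: "Y \<in> SM" and XY: "H \<subset> Y" and n: "len H Y \<noteq> \<infinity>"
  obtains Z where "Z \<in> SM" "H \<subseteq> Z" "Z \<subset> Y" "len Z Y = 1"
proof -
  have "\<exists>Z. Z \<in> SM \<and> H \<subseteq> Z \<and> Z \<subset> Y \<and> len Z Y = 1" if "len H Y = enat n" for n
    using H XY that
  proof (induction n arbitrary: H)
    case 0
    then show ?case using len_pos[of H Y] Y by (auto simp: zero_enat_def one_enat_def)
  next
    case (Suc n)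
    obtain Z where Z: "Z \<in> SM" "H \<subset> Z" "Z \<subseteq> Y" "len H Z = 1" "len Z Y = enat n"
      using composition_step[OF Suc.prems(1) Y _ Suc.prems(3)] Suc.prems by auto
    show ?case
    proof (cases "Z = Y")
      case True
      thus ?thesis using Z Suc.prems by auto
    next
      case False
      then obtain W where "W \<in> SM \<and> Z \<subseteq> W \<and> W \<subset> Y \<and> len W Y = 1"
        using Suc.IH[of Z] Z by auto
      thus ?thesis using Z(2) by blast
    qed
  qed
  thus thesis using n that by (metis not_infinity_eq)
qed

lemma simple_interval:
  assumes "H \<in> SM" "Y \<in> SM" "Z \<in> SM" "H \<subset> Z" "Z \<subseteq> Y" "len H Y = 1"
  shows "Z = Y"
proof (rule ccontr)
  assume "Z \<noteq> Y"
  hence "1 \<le> len H Z" "1 \<le> len Z Y" using assms by (auto intro!: len_pos)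
  moreover have "len H Z + len Z Y = 1" using len_add[of H Z Y] assms by auto
  ultimately show False
    by (cases "len H Z"; cases "len Z Y") (auto simp: one_enat_def)
qed

lemma SM_dil: assumes u: "u \<in> carrier Q" and N: "N \<in> SM" shows "dilate Q u N \<in> SM"
proof (rule SM_I)
  show "dilate Q u N \<subseteq> carrier Q" using u N SM_car by (auto simp: dilate_def)
  show "\<zero> \<in> dilate Q u N" using u N SM_zero unfolding dilate_def by (metis image_eqI r_null)
next
  fix x y assume "x \<in> dilate Q u N" "y \<in> dilate Q u N"
  then obtain m n where "m \<in> N" "n \<in> N" "x = u \<otimes> m" "y = u \<otimes> n" by (auto simp: dilate_def)
  moreover from this have "x \<oplus> y = u \<otimes> (m \<oplus> n)" using u N SM_car by (simp add: r_distr)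
  ultimately show "x \<oplus> y \<in> dilate Q u N" using N SM_add by (auto simp: dilate_def)
next
  fix a x assume a: "a \<in> A" "x \<in> dilate Q u N"
  then obtain m where "m \<in> N" "x = u \<otimes> m" by (auto simp: dilate_def)
  moreover from this have "a \<otimes> x = u \<otimes> (a \<otimes> m)" using u N SM_car a A_car by (simp add: m_lcomm)
  ultimately show "a \<otimes> x \<in> dilate Q u N" using N SM_smult a by (auto simp: dilate_def)
qed

lemma dil_mono: "H \<subseteq> Y \<Longrightarrow> dilate Q u H \<subseteq> dilate Q u Y" by (auto simp: dilate_def)

lemma dil_dil: "u \<in> carrier Q \<Longrightarrow> v \<in> carrier Q \<Longrightarrow> H \<subseteq> carrier Q \<Longrightarrow>
    dilate Q u (dilate Q v H) = dilate Q (u \<otimes> v) H"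
  by (auto simp: dilate_def image_image m_assoc subset_iff intro!: image_cong)

lemma dil_one: "H \<subseteq> carrier Q \<Longrightarrow> dilate Q \<one> H = H"
  by (force simp: dilate_def subset_iff)

lemma SM_sub: "N \<in> SM \<Longrightarrow> N \<subseteq> carrier Q" by (auto simp: submods_def)

lemma dil_inv: "u \<in> Units Q \<Longrightarrow> H \<subseteq> carrier Q \<Longrightarrow> dilate Q (inv u) (dilate Q u H) = H"
  "u \<in> Units Q \<Longrightarrow> H \<subseteq> carrier Q \<Longrightarrow> dilate Q u (dilate Q (inv u) H) = H"
  by (simp_all add: dil_dil Units_closed dil_one)

lemma len_dil: assumes u: "u \<in> Units Q" and XY: "H \<subseteq> carrier Q" "Y \<subseteq> carrier Q"
  shows "len (dilate Q u H) (dilate Q u Y) = len H Y"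
proof -
  have le: "len H Y \<le> len (dilate Q u H) (dilate Q u Y)"
    if u: "u \<in> Units Q" and XY: "H \<subseteq> carrier Q" "Y \<subseteq> carrier Q" for u H Y
  proof (rule chain_len_transfer[where g = "dilate Q u"])
    fix N N' assume N: "N \<in> SM" "N' \<in> SM" "N \<subset> N'"
    have "dilate Q u N \<noteq> dilate Q u N'"
      using dil_inv(1)[OF u SM_sub] N by (metis less_irrefl)
    thus "dilate Q u N \<subset> dilate Q u N'" using N dil_mono by blast
  qed (use u SM_dil dil_mono in \<open>auto simp: Units_closed\<close>)
  have "len (dilate Q u H) (dilate Q u Y) \<le> len H Y"
    using le[of "inv u" "dilate Q u H" "dilate Q u Y"] XY u dil_inv
    by (auto simp: dilate_def Units_closed subset_iff)
  thus ?thesis using le[OF u XY] by (rule antisym)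
qed

lemma SM_colon: assumes H: "H \<in> SM" and Y: "Y \<subseteq> carrier Q" shows "colonq Q H Y \<in> SM"
proof (rule SM_I)
  show "colonq Q H Y \<subseteq> carrier Q" by (auto simp: colonq_def)
  show "\<zero> \<in> colonq Q H Y" using H Y SM_zero by (auto simp: colonq_def)
next
  fix p q assume "p \<in> colonq Q H Y" "q \<in> colonq Q H Y"
  thus "p \<oplus> q \<in> colonq Q H Y" using H Y SM_add by (auto simp: colonq_def subset_iff l_distr)
next
  fix a p assume "a \<in> A" "p \<in> colonq Q H Y"
  thus "a \<otimes> p \<in> colonq Q H Y" using H Y SM_smult A_car by (auto simp: colonq_def subset_iff m_assoc)
qed

lemma colon_anti: "Y \<subseteq> Z \<Longrightarrow> colonq Q H Z \<subseteq> colonq Q H Y" by (auto simp: colonq_def)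
lemma colonD: "q \<in> colonq Q H Y \<Longrightarrow> y \<in> Y \<Longrightarrow> q \<otimes> y \<in> H" by (auto simp: colonq_def)
lemma colonI: "q \<in> carrier Q \<Longrightarrow> (\<And>y. y \<in> Y \<Longrightarrow> q \<otimes> y \<in> H) \<Longrightarrow> q \<in> colonq Q H Y"
  by (auto simp: colonq_def)
lemma colon_bidual: "Y \<subseteq> carrier Q \<Longrightarrow> Y \<subseteq> colonq Q H (colonq Q H Y)"
  by (auto simp: colonq_def subset_iff m_comm)
lemma colon_tridual:
  assumes "Y \<subseteq> carrier Q"
  shows "colonq Q H (colonq Q H (colonq Q H Y)) = colonq Q H Y"
proof
  show "colonq Q H (colonq Q H (colonq Q H Y)) \<subseteq> colonq Q H Y"
    using assms by (intro colon_anti colon_bidual)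
  show "colonq Q H Y \<subseteq> colonq Q H (colonq Q H (colonq Q H Y))"
    by (rule colon_bidual) (auto simp: colonq_def)
qed

lemma colon_dil:
  assumes u: "u \<in> Units Q" and H: "H \<subseteq> carrier Q" and Y: "Y \<subseteq> carrier Q"
  shows "colonq Q H (dilate Q u Y) = dilate Q (inv u) (colonq Q H Y)"
proof
  have uc: "u \<in> carrier Q" "inv u \<in> carrier Q" using u by (auto simp: Units_closed)
  show "colonq Q H (dilate Q u Y) \<subseteq> dilate Q (inv u) (colonq Q H Y)"
  proof
    fix q assume q: "q \<in> colonq Q H (dilate Q u Y)"
    hence qc: "q \<in> carrier Q" by (auto simp: colonq_def)
    have "u \<otimes> q \<in> colonq Q H Y"
      using q uc qc Y by (auto simp: colonq_def dilate_def subset_iff m_assoc m_lcomm)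
    moreover have "q = inv u \<otimes> (u \<otimes> q)" using u qc uc by (simp add: m_assoc[symmetric])
    ultimately show "q \<in> dilate Q (inv u) (colonq Q H Y)" by (auto simp: dilate_def)
  qed
  show "dilate Q (inv u) (colonq Q H Y) \<subseteq> colonq Q H (dilate Q u Y)"
  proof
    fix q assume "q \<in> dilate Q (inv u) (colonq Q H Y)"
    then obtain p where p: "p \<in> colonq Q H Y" "q = inv u \<otimes> p" by (auto simp: dilate_def)
    have pc: "p \<in> carrier Q" using p by (auto simp: colonq_def)
    have "q \<otimes> (u \<otimes> y) = p \<otimes> y" if "y \<in> Y" for y
    proof -
      have y: "y \<in> carrier Q" using that Y by blast
      have "q \<otimes> (u \<otimes> y) = (inv u \<otimes> u) \<otimes> (p \<otimes> y)" using p pc uc y by (simp add: m_ac)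
      thus ?thesis using u pc y by simp
    qed
    thus "q \<in> colonq Q H (dilate Q u Y)" using p pc uc by (auto simp: colonq_def dilate_def)
  qed
qed

text \<open>Multiplication by \<open>b\<close> induces an injection of \<open>H / H0\<close> into \<open>Y / Y0\<close>. A chain in the first
  quotient is carried to the second by \<open>N \<mapsto> b N + Y0\<close>.\<close>

lemma len_le_by_mult:
  assumes b: "b \<in> carrier Q" and H0: "H0 \<in> SM" and H: "H \<subseteq> carrier Q" and Y0: "Y0 \<in> SM" and Y: "Y \<in> SM"
    and Y0Y: "Y0 \<subseteq> Y"
    and map: "\<And>x. x \<in> H \<Longrightarrow> x \<otimes> b \<in> Y" and inj: "\<And>x. x \<in> H \<Longrightarrow> x \<otimes> b \<in> Y0 \<Longrightarrow> x \<in> H0"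
  shows "len H0 H \<le> len Y0 Y"
proof (rule chain_len_transfer[where g = "\<lambda>N. msum (dilate Q b N) Y0"])
  fix N assume N: "N \<in> SM" "H0 \<subseteq> N" "N \<subseteq> H"
  have d: "dilate Q b N \<in> SM" using SM_dil[OF b N(1)] .
  have "dilate Q b N \<subseteq> Y" using N map H b by (auto simp: dilate_def m_comm subset_iff)
  thus "msum (dilate Q b N) Y0 \<in> SM \<and> Y0 \<subseteq> msum (dilate Q b N) Y0 \<and> msum (dilate Q b N) Y0 \<subseteq> Y"
    using SM_msum[OF d Y0] msum_upper2[OF d Y0] msum_least[OF Y _ Y0Y] by blast
next
  fix N N' assume N: "N \<in> SM" "H0 \<subseteq> N" "N' \<in> SM" "N' \<subseteq> H" "N \<subset> N'"
  have d: "dilate Q b N \<in> SM" "dilate Q b N' \<in> SM" using SM_dil[OF b] N by auto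
  have sub: "msum (dilate Q b N) Y0 \<subseteq> msum (dilate Q b N') Y0"
    using N by (intro msum_mono dil_mono) auto
  moreover have "msum (dilate Q b N) Y0 \<noteq> msum (dilate Q b N') Y0"
  proof
    assume eq: "msum (dilate Q b N) Y0 = msum (dilate Q b N') Y0"
    obtain x where x: "x \<in> N'" "x \<notin> N" using N by blast
    have "b \<otimes> x \<in> msum (dilate Q b N) Y0"
      using x eq msum_upper1[OF d(2) Y0] by (auto simp: dilate_def)
    then obtain x' y where xy: "x' \<in> N" "y \<in> Y0" "b \<otimes> x = b \<otimes> x' \<oplus> y"
      by (auto simp: msum_def dilate_def)
    have c: "x \<in> carrier Q" "x' \<in> carrier Q" "y \<in> carrier Q" using x xy N Y0 SM_car by auto
    have "(x \<ominus> x') \<otimes> b = b \<otimes> x \<ominus> b \<otimes> x'" using c b by algebra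
    also have "\<dots> = y" using c b unfolding xy(3) by algebra
    finally have "(x \<ominus> x') \<otimes> b \<in> Y0" using xy by simp
    moreover have "x \<ominus> x' \<in> N'" using x xy N SM_diff by blast
    ultimately have "x \<ominus> x' \<in> N" using inj N by blast
    hence "(x \<ominus> x') \<oplus> x' \<in> N" using xy N SM_add by blast
    moreover have "(x \<ominus> x') \<oplus> x' = x" using c by algebra
    ultimately show False using x by simp
  qed
  ultimately show "msum (dilate Q b N) Y0 \<subset> msum (dilate Q b N') Y0" by blast
qed

end

section \<open>Duality for fractional ideals of type one\<close>

lemma enat_cancel_right: "a + c = b + c \<Longrightarrow> c \<noteq> \<infinity> \<Longrightarrow> a = (b :: enat)"
  by (cases a; cases b; cases c) auto

lemma enat_squeeze: "a + b = p + q \<Longrightarrow> p + q \<noteq> \<infinity> \<Longrightarrow> a \<le> p \<Longrightarrow> b \<le> q \<Longrightarrow> a = (p :: enat)"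
  by (cases a; cases b; cases p; cases q) auto

lemma (in cring) unit_if_inverse:
  "u \<in> carrier R \<Longrightarrow> v \<in> carrier R \<Longrightarrow> u \<otimes> v = \<one> \<Longrightarrow> u \<in> Units R"
  unfolding Units_def by (auto simp: m_comm intro!: bexI[of _ v])

lemma enat_le_finite: "a \<le> b \<Longrightarrow> b \<noteq> \<infinity> \<Longrightarrow> a \<noteq> (\<infinity> :: enat)"
  by (metis enat_ord_simps(5))

text \<open>The part of the theory of one-dimensional Cohen-Macaulay local rings that duality needs: \<open>A\<close> is local with
  maximal ideal \<open>n\<close>, all of \<open>Q\<close> consists of fractions of \<open>A\<close>, and principal ideals generated by
  units of \<open>Q\<close> have finite colength.\<close>

locale local_order = over_ring +
  fixes n
  assumes n_SM: "n \<in> submods Q A" and n_sub: "n \<subseteq> A" and one_notin: "\<one> \<notin> n"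
    and A_unit: "\<And>a. a \<in> A \<Longrightarrow> a \<notin> n \<Longrightarrow> \<exists>b\<in>A. a \<otimes> b = \<one>"
    and n_reg: "\<exists>c\<in>n. c \<in> Units Q"
    and denom: "\<And>q. q \<in> carrier Q \<Longrightarrow> \<exists>s\<in>A. s \<in> Units Q \<and> s \<otimes> q \<in> A"
    and fin: "\<And>s. s \<in> A \<Longrightarrow> s \<in> Units Q \<Longrightarrow> mlen Q A (dilate Q s A) A \<noteq> \<infinity>"
begin

definition frac :: "'a set \<Rightarrow> bool" where
  "frac B \<longleftrightarrow> B \<in> SM \<and> (\<exists>y\<in>Units Q. dilate Q y B \<subseteq> A) \<and> (\<exists>w\<in>Units Q. w \<in> B)"

lemma fracI:
  "B \<in> SM \<Longrightarrow> y \<in> Units Q \<Longrightarrow> dilate Q y B \<subseteq> A \<Longrightarrow> v \<in> Units Q \<Longrightarrow> v \<in> B \<Longrightarrow> frac B"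
  unfolding frac_def by blast

lemma frac_SM: "frac B \<Longrightarrow> B \<in> SM" by (simp add: frac_def)
lemma frac_car: "frac B \<Longrightarrow> B \<subseteq> carrier Q" using frac_SM SM_sub by blast

lemma frac_denom:
  assumes "frac B"
  obtains d where "d \<in> A" "d \<in> Units Q" "\<And>b. b \<in> B \<Longrightarrow> d \<otimes> b \<in> A"
proof -
  obtain y where y: "y \<in> Units Q" "dilate Q y B \<subseteq> A" using assms by (auto simp: frac_def)
  obtain s where s: "s \<in> A" "s \<in> Units Q" "s \<otimes> y \<in> A" using denom y(1) Units_closed by blast
  have "(s \<otimes> y) \<otimes> b \<in> A" if "b \<in> B" for b
  proof -
    have "y \<otimes> b \<in> A" using y that by (auto simp: dilate_def)
    hence "s \<otimes> (y \<otimes> b) \<in> A" using s A_mult by blast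
    thus ?thesis using s y frac_car[OF assms] that by (simp add: m_assoc Units_closed subset_iff)
  qed
  thus thesis using that[of "s \<otimes> y"] s y by blast
qed

lemma frac_unit: assumes "frac B" obtains w where "w \<in> B" "w \<in> Units Q"
  using assms by (auto simp: frac_def)

lemma dil_A_sub: assumes "B \<in> SM" "w \<in> B" shows "dilate Q w A \<subseteq> B"
proof
  fix x assume "x \<in> dilate Q w A"
  then obtain a where "a \<in> A" "x = w \<otimes> a" by (auto simp: dilate_def)
  thus "x \<in> B" using SM_smult[OF assms(1) _ assms(2), of a] SM_car[OF assms] A_car m_comm by metis
qed

lemma mem_dil_A: "w \<in> carrier Q \<Longrightarrow> w \<in> dilate Q w A"
  using A_one unfolding dilate_def by (metis image_eqI r_one)

lemma frac_A: "frac A"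
  using A_SM A_one dil_one[of A] A_car by (auto simp: frac_def intro!: bexI[of _ \<one>])

lemma frac_dil: assumes u: "u \<in> Units Q" and B: "frac B" shows "frac (dilate Q u B)"
proof -
  obtain y where y: "y \<in> Units Q" "dilate Q y B \<subseteq> A" using B by (auto simp: frac_def)
  have "y \<otimes> inv u \<in> Units Q" using y u by auto
  moreover have "dilate Q (y \<otimes> inv u) (dilate Q u B) = dilate Q y (dilate Q (inv u) (dilate Q u B))"
    using y u frac_car[OF B] by (subst dil_dil) (auto simp: dilate_def Units_closed)
  moreover have "\<dots> \<subseteq> A" using y u frac_car[OF B] by (simp add: dil_inv)
  moreover obtain w where "w \<in> B" "w \<in> Units Q" using frac_unit[OF B] .
  moreover from this have "u \<otimes> w \<in> dilate Q u B" "u \<otimes> w \<in> Units Q" using u by (auto simp: dilate_def)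
  ultimately show ?thesis using SM_dil u frac_SM[OF B] unfolding frac_def by (metis Units_closed)
qed

lemma frac_between: "frac B \<Longrightarrow> frac D \<Longrightarrow> C \<in> SM \<Longrightarrow> B \<subseteq> C \<Longrightarrow> C \<subseteq> D \<Longrightarrow> frac C"
  unfolding frac_def by (meson dil_mono subset_iff subset_trans)

lemma frac_colon: assumes H: "frac H" and B: "frac B" shows "frac (colonq Q H B)"
proof -
  obtain d where d: "d \<in> A" "d \<in> Units Q" "\<And>b. b \<in> B \<Longrightarrow> d \<otimes> b \<in> A" using frac_denom[OF B] by blast
  obtain w where w: "w \<in> H" "w \<in> Units Q" using frac_unit[OF H] .
  obtain e where e: "e \<in> A" "e \<in> Units Q" "\<And>b. b \<in> H \<Longrightarrow> e \<otimes> b \<in> A" using frac_denom[OF H] by blast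
  obtain v where v: "v \<in> B" "v \<in> Units Q" using frac_unit[OF B] .
  have c: "w \<in> carrier Q" "d \<in> carrier Q" "e \<in> carrier Q" "v \<in> carrier Q"
    using d w e v by (auto simp: Units_closed)
  have "w \<otimes> d \<in> colonq Q H B"
  proof (rule colonI)
    fix b assume b: "b \<in> B"
    hence bc: "b \<in> carrier Q" using frac_car[OF B] by blast
    have "(d \<otimes> b) \<otimes> w \<in> H" using SM_smult[OF frac_SM[OF H] d(3)[OF b] w(1)] .
    thus "(w \<otimes> d) \<otimes> b \<in> H" using c bc by (simp add: m_ac)
  qed (use c in simp)
  moreover have "w \<otimes> d \<in> Units Q" using w d by simp
  moreover have "dilate Q (e \<otimes> v) (colonq Q H B) \<subseteq> A"
  proof
    fix x assume "x \<in> dilate Q (e \<otimes> v) (colonq Q H B)"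
    then obtain q where q: "q \<in> colonq Q H B" "x = (e \<otimes> v) \<otimes> q" by (auto simp: dilate_def)
    hence "q \<in> carrier Q" by (auto simp: colonq_def)
    hence "x = e \<otimes> (q \<otimes> v)" using q c by (simp add: m_ac)
    thus "x \<in> A" using e(3) colonD[OF q(1) v(1)] by simp
  qed
  moreover have "e \<otimes> v \<in> Units Q" using e v by simp
  ultimately show ?thesis unfolding frac_def using SM_colon[OF frac_SM[OF H] frac_car[OF B]] by blast
qed

lemma len_finite:
  assumes B: "frac B" and C: "frac C" and BC: "B \<subseteq> C"
  shows "len B C \<noteq> \<infinity>"
proof -
  obtain d where d: "d \<in> A" "d \<in> Units Q" "\<And>b. b \<in> C \<Longrightarrow> d \<otimes> b \<in> A" using frac_denom[OF C] by blast
  obtain w where w: "w \<in> B" "w \<in> Units Q" using frac_unit[OF B] .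
  have "dilate Q d C \<subseteq> A" using d by (auto simp: dilate_def)
  hence C': "C \<subseteq> dilate Q (inv d) A"
    using dil_inv(1)[OF d(2) frac_car[OF C]] dil_mono by metis
  have "len B C \<le> len (dilate Q w A) (dilate Q (inv d) A)"
    using C' dil_A_sub[OF frac_SM[OF B] w(1)] by (intro chain_len_mono) auto
  also have "\<dots> = len (dilate Q d (dilate Q w A)) (dilate Q d (dilate Q (inv d) A))"
    using d w A_car by (intro len_dil[symmetric]) (auto simp: dilate_def Units_closed)
  also have "\<dots> = len (dilate Q (d \<otimes> w) A) A"
    using d w A_car by (subst dil_dil) (auto simp: dil_inv Units_closed subset_iff)
  finally have "len B C \<le> len (dilate Q (d \<otimes> w) A) A" .
  moreover have "len (dilate Q (d \<otimes> w) A) A \<noteq> \<infinity>" using d w BC by (intro fin) auto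
  ultimately show ?thesis by (rule enat_le_finite)
qed

text \<open>Embed \<open>B\<close> into some \<open>C = d\<^sup>-\<^sup>1 A\<close>. Then \<open>C / y B\<close> is filtered by \<open>C / B\<close> and \<open>B / y B\<close>, but
  also by \<open>C / y C\<close> and \<open>y C / y B\<close>. As \<open>y C / y B\<close> is as long as \<open>C / B\<close>, these finite terms cancel.\<close>

lemma len_dil_self:
  assumes B: "frac B" and y: "y \<in> A" "y \<in> Units Q"
  shows "len (dilate Q y B) B = len (dilate Q y A) A"
proof -
  obtain d where d: "d \<in> A" "d \<in> Units Q" "\<And>b. b \<in> B \<Longrightarrow> d \<otimes> b \<in> A" using frac_denom[OF B] by blast
  define C where "C = dilate Q (inv d) A"
  have idU: "inv d \<in> Units Q" using d by simp
  have Asub: "A \<subseteq> carrier Q" using A_car by blast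
  have C: "frac C" unfolding C_def using frac_dil[OF idU frac_A] .
  have "dilate Q d B \<subseteq> A" using d by (auto simp: dilate_def)
  hence BC: "B \<subseteq> C" unfolding C_def using dil_inv(1)[OF d(2) frac_car[OF B]] dil_mono by metis
  have yB: "dilate Q y H \<subseteq> H" if "frac H" for H
    using SM_smult[OF frac_SM[OF that] y(1)] by (auto simp: dilate_def)
  have frs: "frac (dilate Q y B)" "frac (dilate Q y C)" using frac_dil y B C by auto
  have "len (dilate Q y B) C = len (dilate Q y B) B + len B C"
    using yB[OF B] BC frs B C by (intro len_add) (auto intro: frac_SM)
  moreover have "len (dilate Q y B) C = len (dilate Q y B) (dilate Q y C) + len (dilate Q y C) C"
    using yB[OF C] dil_mono[OF BC] frs B C by (intro len_add) (auto intro: frac_SM)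
  moreover have "len (dilate Q y B) (dilate Q y C) = len B C"
    using len_dil[OF y(2) frac_car[OF B] frac_car[OF C]] .
  moreover have "len (dilate Q y C) C = len (dilate Q y A) A"
  proof -
    have "dilate Q y C = dilate Q (inv d) (dilate Q y A)"
      unfolding C_def using y idU Asub by (simp add: dil_dil Units_closed m_comm)
    thus ?thesis unfolding C_def using idU Asub y
      by (simp add: len_dil SM_dil A_SM SM_sub Units_closed)
  qed
  ultimately have "len (dilate Q y B) B + len B C = len (dilate Q y A) A + len B C"
    by (metis add.commute)
  thus ?thesis using enat_cancel_right len_finite[OF B C BC] by blast
qed

lemma A_unit_diff: assumes "r \<in> n" obtains t where "t \<in> A" "(\<one> \<ominus> r) \<otimes> t = \<one>"
proof -
  have r: "r \<in> A" "r \<in> carrier Q" using assms n_sub A_car by auto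
  have "\<one> \<ominus> r \<in> A" using r A_one A_add A_neg by (simp add: a_minus_def)
  moreover have "\<one> \<ominus> r \<notin> n"
  proof
    assume "\<one> \<ominus> r \<in> n"
    hence "(\<one> \<ominus> r) \<oplus> r \<in> n" using SM_add[OF n_SM] assms by blast
    moreover have "(\<one> \<ominus> r) \<oplus> r = \<one>" using r by algebra
    ultimately show False using one_notin by simp
  qed
  ultimately show thesis using A_unit that by blast
qed

lemma simple_generated:
  assumes H: "H \<in> SM" and Y: "Y \<in> SM" and HY: "H \<subset> Y" and l: "len H Y = 1" and b: "b \<in> Y" "b \<notin> H"
  shows "y \<in> Y \<Longrightarrow> \<exists>x\<in>H. \<exists>a\<in>A. y = x \<oplus> a \<otimes> b"
proof -
  assume y: "y \<in> Y"
  have bc: "b \<in> carrier Q" using b Y SM_car by blast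
  have d: "dilate Q b A \<in> SM" using SM_dil[OF bc A_SM] .
  let ?Z = "msum H (dilate Q b A)"
  have Z: "?Z \<in> SM" "H \<subseteq> ?Z" "?Z \<subseteq> Y" "b \<in> ?Z"
    using SM_msum[OF H d] msum_upper1[OF H d] msum_upper2[OF H d] mem_dil_A[OF bc]
      msum_least[OF Y _ dil_A_sub[OF Y b(1)]] HY by blast+
  hence "?Z = Y" using simple_interval[OF H Y Z(1) _ Z(3) l] b by blast
  hence "y \<in> ?Z" using y by simp
  then obtain x a where "x \<in> H" "a \<in> A" "y = x \<oplus> b \<otimes> a" by (auto simp: msum_def dilate_def)
  thus ?thesis using bc A_car m_comm by metis
qed

text \<open>If \<open>r y\<close> were not in \<open>H\<close>, it would generate \<open>Y / H\<close>, so that \<open>(1 - a r) y\<close> would be in \<open>H\<close> for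
  some \<open>a\<close>. But \<open>1 - a r\<close> is a unit.\<close>

lemma simple_killed:
  assumes H: "H \<in> SM" and Y: "Y \<in> SM" and HY: "H \<subset> Y" and l: "len H Y = 1" and r: "r \<in> n" and y: "y \<in> Y"
  shows "r \<otimes> y \<in> H"
proof (rule ccontr)
  assume c: "r \<otimes> y \<notin> H"
  have rc: "r \<in> A" "r \<in> carrier Q" using r n_sub A_car by auto
  have yc: "y \<in> carrier Q" using y Y SM_car by blast
  have "r \<otimes> y \<in> Y" using SM_smult[OF Y rc(1) y] .
  then obtain x a where x: "x \<in> H" "a \<in> A" "y = x \<oplus> a \<otimes> (r \<otimes> y)"
    using simple_generated[OF H Y HY l _ c y] by blast
  have xc: "x \<in> carrier Q" "a \<in> carrier Q" using x H SM_car A_car by auto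
  have "a \<otimes> r \<in> n" using SM_smult[OF n_SM x(2) r] .
  then obtain t where t: "t \<in> A" "(\<one> \<ominus> a \<otimes> r) \<otimes> t = \<one>" using A_unit_diff by blast
  have tc: "t \<in> carrier Q" using t A_car by blast
  have "x = (x \<oplus> a \<otimes> (r \<otimes> y)) \<ominus> a \<otimes> r \<otimes> y" using xc yc rc by algebra
  hence "x = y \<ominus> a \<otimes> r \<otimes> y" using x(3) by simp
  hence "t \<otimes> x = ((\<one> \<ominus> a \<otimes> r) \<otimes> t) \<otimes> y" using xc yc rc tc by simp algebra
  hence "t \<otimes> x = y" using t yc by simp
  hence "y \<in> H" using SM_smult[OF H t(1) x(1)] by simp
  hence "r \<otimes> y \<in> H" using SM_smult[OF H rc(1)] by blast
  thus False using c by simp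
qed

text \<open>The fractional ideals of type one, with the type expressed through colon ideals.\<close>

definition canon :: "'a set \<Rightarrow> bool" where
  "canon \<omega> \<longleftrightarrow> frac \<omega> \<and> len \<omega> (colonq Q \<omega> n) = 1"

lemma canon_frac: "canon \<omega> \<Longrightarrow> frac \<omega>" by (simp add: canon_def)

text \<open>Let \<open>b\<close> generate \<open>Y / H\<close>. As \<open>n b \<subseteq> H\<close>, multiplication by \<open>b\<close> maps \<open>(\<omega> : H)\<close> to \<open>(\<omega> : n)\<close>, and
  the preimage of \<open>\<omega>\<close> is \<open>(\<omega> : Y)\<close>.\<close>

lemma len_colon_simple:
  assumes w: "canon \<omega>" and H: "H \<in> SM" and Y: "Y \<in> SM" and HY: "H \<subset> Y" and l: "len H Y = 1"
  shows "len (colonq Q \<omega> Y) (colonq Q \<omega> H) \<le> 1"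
proof -
  obtain b where b: "b \<in> Y" "b \<notin> H" using HY by blast
  have bc: "b \<in> carrier Q" using b Y SM_car by blast
  note wSM = frac_SM[OF canon_frac[OF w]]
  have nc: "n \<subseteq> carrier Q" using n_sub A_car by blast
  have "len (colonq Q \<omega> Y) (colonq Q \<omega> H) \<le> len \<omega> (colonq Q \<omega> n)"
  proof (rule len_le_by_mult[OF bc])
    show "colonq Q \<omega> Y \<in> SM" using SM_colon[OF wSM SM_sub[OF Y]] .
    show "colonq Q \<omega> H \<subseteq> carrier Q" by (auto simp: colonq_def)
    show "\<omega> \<in> SM" using wSM .
    show "colonq Q \<omega> n \<in> SM" using SM_colon[OF wSM nc] .
    show "\<omega> \<subseteq> colonq Q \<omega> n"
    proof
      fix q assume "q \<in> \<omega>"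
      thus "q \<in> colonq Q \<omega> n"
        using SM_smult[OF wSM] n_sub SM_car[OF wSM] A_car by (auto simp: colonq_def m_comm subset_iff)
    qed
  next
    fix x assume x: "x \<in> colonq Q \<omega> H"
    hence xc: "x \<in> carrier Q" by (auto simp: colonq_def)
    show "x \<otimes> b \<in> colonq Q \<omega> n"
    proof (rule colonI)
      fix r assume r: "r \<in> n"
      have "r \<otimes> b \<in> H" using simple_killed[OF H Y HY l r b(1)] .
      hence "x \<otimes> (r \<otimes> b) \<in> \<omega>" using colonD[OF x] by blast
      thus "(x \<otimes> b) \<otimes> r \<in> \<omega>" using xc bc r nc by (simp add: m_ac subset_iff)
    qed (use xc bc in simp)
    assume xb: "x \<otimes> b \<in> \<omega>"
    show "x \<in> colonq Q \<omega> Y"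
    proof (rule colonI[OF xc])
      fix y assume "y \<in> Y"
      then obtain h a where h: "h \<in> H" "a \<in> A" "y = h \<oplus> a \<otimes> b"
        using simple_generated[OF H Y HY l b] by blast
      have hc: "h \<in> carrier Q" "a \<in> carrier Q" using h H SM_car A_car by auto
      have "x \<otimes> y = x \<otimes> h \<oplus> a \<otimes> (x \<otimes> b)" unfolding h(3) using xc bc hc by algebra
      thus "x \<otimes> y \<in> \<omega>" using colonD[OF x h(1)] SM_smult[OF wSM h(2) xb] SM_add[OF wSM] by simp
    qed
  qed
  thus ?thesis using w by (simp add: canon_def)
qed

lemma len_colon_le:
  assumes w: "canon \<omega>" and Y: "Y \<in> SM"
  shows "H \<in> SM \<Longrightarrow> H \<subseteq> Y \<Longrightarrow> len (colonq Q \<omega> Y) (colonq Q \<omega> H) \<le> len H Y"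
proof (cases "len H Y")
  case (enat k)
  assume "H \<in> SM" "H \<subseteq> Y"
  thus ?thesis using enat
  proof (induction k arbitrary: H)
    case 0
    hence "H = Y" using len_zero_eq[OF _ Y] by (simp add: zero_enat_def)
    thus ?case by (simp add: len_self)
  next
    case (Suc k)
    obtain Z where Z: "Z \<in> SM" "H \<subset> Z" "Z \<subseteq> Y" "len H Z = 1" "len Z Y = enat k"
      using composition_step[OF Suc.prems(1) Y Suc.prems(2,3)] .
    note wSM = frac_SM[OF canon_frac[OF w]]
    have "len (colonq Q \<omega> Y) (colonq Q \<omega> H) =
        len (colonq Q \<omega> Y) (colonq Q \<omega> Z) + len (colonq Q \<omega> Z) (colonq Q \<omega> H)"
      using Z Suc.prems Y by (intro len_add SM_colon wSM SM_sub colon_anti) auto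
    also have "\<dots> \<le> enat k + 1"
      using Suc.IH[OF Z(1,3,5)] Z(5) len_colon_simple[OF w Suc.prems(1) Z(1,2,4)]
      by (intro add_mono) auto
    also have "\<dots> = len H Y" using Suc.prems by (simp add: one_enat_def)
    finally show ?case .
  qed
qed simp

text \<open>Choose \<open>y\<close> with \<open>y Y \<subseteq> H\<close>. Over \<open>y Y \<subseteq> H \<subseteq> Y\<close> the inequality holds for both steps, while the
  lengths for \<open>y Y \<subseteq> Y\<close> agree by \<open>len_dil_self\<close>, since \<open>(\<omega> : y Y) = y\<^sup>-\<^sup>1 (\<omega> : Y)\<close>. Hence both inequalities are
  equalities.\<close>

theorem len_colon:
  assumes w: "canon \<omega>" and H: "frac H" and Y: "frac Y" and HY: "H \<subseteq> Y"
  shows "len (colonq Q \<omega> Y) (colonq Q \<omega> H) = len H Y"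
proof -
  note wf = canon_frac[OF w]
  note wSM = frac_SM[OF canon_frac[OF w]]
  obtain d where d: "d \<in> A" "d \<in> Units Q" "\<And>b. b \<in> Y \<Longrightarrow> d \<otimes> b \<in> A" using frac_denom[OF Y] by blast
  obtain v where v: "v \<in> H" "v \<in> Units Q" using frac_unit[OF H] .
  define y where "y = d \<otimes> v"
  have y: "y \<in> A" "y \<in> Units Q" using d v HY by (auto simp: y_def)
  have yY: "dilate Q y Y \<subseteq> H"
  proof
    fix x assume "x \<in> dilate Q y Y"
    then obtain b where b: "b \<in> Y" "x = d \<otimes> v \<otimes> b" by (auto simp: dilate_def y_def)
    hence "x = (d \<otimes> b) \<otimes> v" using d v frac_car[OF Y] by (simp add: m_ac Units_closed subset_iff)
    thus "x \<in> H" using SM_smult[OF frac_SM[OF H] d(3)[OF b(1)] v(1)] by simp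
  qed
  let ?D = "colonq Q \<omega>" and ?yY = "dilate Q y Y"
  have yf: "frac ?yY" using frac_dil[OF y(2) Y] .
  have Dy: "frac (?D ?yY)" using frac_colon[OF wf yf] .
  have "dilate Q y (?D ?yY) = ?D Y"
    unfolding colon_dil[OF y(2) frac_car[OF wf] frac_car[OF Y]]
    using y frac_car[OF frac_colon[OF wf Y]] by (simp add: dil_inv)
  hence "len (?D Y) (?D ?yY) = len (dilate Q y A) A" using len_dil_self[OF Dy y] by simp
  also have "\<dots> = len ?yY Y" using len_dil_self[OF Y y] by simp
  finally have e: "len (?D Y) (?D ?yY) = len ?yY Y" .
  have s1: "len (?D Y) (?D ?yY) = len (?D Y) (?D H) + len (?D H) (?D ?yY)"
    using yY HY by (intro len_add SM_colon wSM frac_car H Y yf colon_anti)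
  have s2: "len ?yY Y = len ?yY H + len H Y"
    using yY HY by (intro len_add frac_SM H Y yf)
  have "len (?D Y) (?D H) \<le> len H Y" using len_colon_le[OF w frac_SM[OF Y] frac_SM[OF H] HY] .
  moreover have "len (?D H) (?D ?yY) \<le> len ?yY H" using len_colon_le[OF w frac_SM[OF H] frac_SM[OF yf] yY] .
  moreover have "len H Y + len ?yY H \<noteq> \<infinity>"
    using len_finite[OF H Y HY] len_finite[OF yf H yY] by (simp only: plus_eq_infty_iff_enat) blast
  moreover have "len (?D Y) (?D H) + len (?D H) (?D ?yY) = len H Y + len ?yY H"
    using e s1 s2 by (simp add: add.commute)
  ultimately show ?thesis using enat_squeeze by blast
qed

text \<open>The inclusion \<open>H \<subseteq> (\<omega> : (\<omega> : H))\<close> becomes an equality after taking duals, so its length is zero.\<close>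

lemma colon_colon:
  assumes w: "canon \<omega>" and H: "frac H"
  shows "colonq Q \<omega> (colonq Q \<omega> H) = H"
proof -
  let ?D = "colonq Q \<omega>"
  have f: "frac (?D (?D H))" using frac_colon canon_frac[OF w] H by blast
  have sub: "H \<subseteq> ?D (?D H)" using colon_bidual[OF frac_car[OF H]] .
  have "len H (?D (?D H)) = len (?D (?D (?D H))) (?D H)" using len_colon[OF w H f sub] by simp
  also have "\<dots> = 0" using colon_tridual[OF frac_car[OF H]] len_self by simp
  finally show ?thesis using len_zero_eq[OF frac_SM[OF H] frac_SM[OF f] sub] by simp
qed

lemma colon_A: assumes "B \<in> SM" shows "colonq Q B A = B"
proof
  show "colonq Q B A \<subseteq> B" using A_one by (force simp: colonq_def)
  show "B \<subseteq> colonq Q B A"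
  proof
    fix q assume "q \<in> B"
    thus "q \<in> colonq Q B A"
      using SM_smult[OF assms] SM_car[OF assms] A_car by (auto simp: colonq_def m_comm)
  qed
qed

lemma colon_self: "canon \<omega> \<Longrightarrow> colonq Q \<omega> \<omega> = A"
  using colon_colon[OF _ frac_A] colon_A[OF frac_SM[OF canon_frac]] by metis

lemma sub_colon_n: assumes "B \<in> SM" shows "B \<subseteq> colonq Q B n"
  using colon_A[OF assms] colon_anti[OF n_sub] by blast

lemma n_car: "n \<subseteq> carrier Q" using n_sub A_car by blast

lemma frac_n: "frac n"
proof -
  obtain c where "c \<in> n" "c \<in> Units Q" using n_reg by blast
  moreover have "dilate Q \<one> n \<subseteq> A" using dil_one[OF n_car] n_sub by simp
  ultimately show ?thesis using n_SM unfolding frac_def by blast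
qed

text \<open>The hypotheses give \<open>\<omega> n = n\<close>. If \<open>q n \<subseteq> \<omega>\<close>, then \<open>q n \<omega> \<subseteq> q n \<subseteq> \<omega>\<close>, so
  \<open>q n \<subseteq> (\<omega> : \<omega>) = A\<close>. Thus \<open>(A : n) = (\<omega> : n)\<close>, and the quotient by \<open>A\<close> is filtered by \<open>\<omega> / A\<close> and
  \<open>(\<omega> : n) / \<omega>\<close>.\<close>

lemma almost_gorenstein_type:
  assumes w: "canon \<omega>" and A\<omega>: "A \<subseteq> \<omega>" and wn: "\<And>x r. x \<in> \<omega> \<Longrightarrow> r \<in> n \<Longrightarrow> x \<otimes> r \<in> n"
  shows "len A (colonq Q A n) = len A \<omega> + 1"
proof -
  note wf = canon_frac[OF w]
  have "colonq Q \<omega> n \<subseteq> colonq Q A n"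
  proof
    fix q assume q: "q \<in> colonq Q \<omega> n"
    hence qc: "q \<in> carrier Q" by (auto simp: colonq_def)
    show "q \<in> colonq Q A n"
    proof (rule colonI[OF qc])
      fix r assume r: "r \<in> n"
      have rc: "r \<in> carrier Q" using r n_car by blast
      have "q \<otimes> r \<in> colonq Q \<omega> \<omega>"
      proof (rule colonI)
        fix x assume x: "x \<in> \<omega>"
        hence "q \<otimes> (x \<otimes> r) \<in> \<omega>" using colonD[OF q] wn r by blast
        thus "q \<otimes> r \<otimes> x \<in> \<omega>" using qc rc x frac_car[OF wf] by (simp add: m_ac subset_iff)
      qed (use qc rc in simp)
      thus "q \<otimes> r \<in> A" using colon_self[OF w] by simp
    qed
  qed
  moreover have "colonq Q A n \<subseteq> colonq Q \<omega> n" using A\<omega> by (auto simp: colonq_def)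
  ultimately have "colonq Q A n = colonq Q \<omega> n" by blast
  moreover have "len A (colonq Q \<omega> n) = len A \<omega> + len \<omega> (colonq Q \<omega> n)"
    using A\<omega> by (intro len_add SM_colon sub_colon_n n_car A_SM frac_SM[OF wf])
  ultimately show ?thesis using w by (simp add: canon_def)
qed

text \<open>The ideal \<open>H = (\<omega> : \<omega>')\<close> is principal. By duality the maximal fractional subideals \<open>Z\<close> of \<open>H\<close>
  correspond to simple extensions of \<open>\<omega>' = (\<omega> : H)\<close>, and \<open>(\<omega>' : n)\<close> is the only one. So there is a single maximal
  \<open>J\<close>, and every \<open>u\<close> in \<open>H\<close> outside \<open>J\<close> generates \<open>H\<close>. This requires \<open>u\<close> to be
  invertible in \<open>Q\<close>, as otherwise \<open>u A\<close> is not a fractional ideal; for this reason \<open>u A + r H\<close> with a small \<open>r\<close> is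
  considered first.\<close>

theorem canon_unique:
  assumes w: "canon \<omega>" and w': "canon \<omega>'"
  obtains u where "u \<in> Units Q" "\<omega>' = dilate Q u \<omega>"
proof -
  let ?D = "colonq Q \<omega>"
  note wf = canon_frac[OF w] and wf' = canon_frac[OF w']
  define H where "H = ?D \<omega>'"
  have Hf: "frac H" unfolding H_def using frac_colon[OF wf wf'] .
  have DH: "?D H = \<omega>'" unfolding H_def using colon_colon[OF w wf'] .
  define T where "T = colonq Q \<omega>' n"
  have Tf: "frac T" unfolding T_def using frac_colon[OF wf' frac_n] .
  have wT: "\<omega>' \<subseteq> T" unfolding T_def using sub_colon_n[OF frac_SM[OF wf']] .
  have lT: "len \<omega>' T = 1" using w' by (simp add: canon_def T_def)
  define J where "J = ?D T"
  have lJ: "len J H = 1" unfolding J_def H_def using len_colon[OF w wf' Tf wT] lT by simp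
  have JH: "J \<subseteq> H" unfolding J_def H_def using colon_anti[OF wT] .
  have sub_J: "L \<subseteq> J" if L: "frac L" "L \<subset> H" for L
  proof -
    obtain Z where Z: "Z \<in> SM" "L \<subseteq> Z" "Z \<subset> H" "len Z H = 1"
      using exists_maximal_proper[OF frac_SM[OF L(1)] frac_SM[OF Hf] L(2) len_finite[OF L(1) Hf]] L
      by blast
    have Zf: "frac Z" using frac_between[OF L(1) Hf Z(1,2)] Z by blast
    have l: "len \<omega>' (?D Z) = 1" using len_colon[OF w Zf Hf] Z DH by auto
    have wZ: "\<omega>' \<subseteq> ?D Z" using colon_anti[of Z H \<omega>] Z DH by blast
    have "?D Z \<subseteq> T"
    proof
      fix q assume q: "q \<in> ?D Z"
      hence qc: "q \<in> carrier Q" by (auto simp: colonq_def)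
      show "q \<in> T" unfolding T_def
      proof (rule colonI[OF qc])
        fix r assume r: "r \<in> n"
        hence rc: "r \<in> carrier Q" using n_car by blast
        have "q \<otimes> r \<in> ?D H"
        proof (rule colonI)
          fix h assume h: "h \<in> H"
          have "r \<otimes> h \<in> Z" using simple_killed[OF Z(1) frac_SM[OF Hf] Z(3,4) r h] .
          hence "q \<otimes> (r \<otimes> h) \<in> \<omega>" using colonD[OF q] by blast
          thus "q \<otimes> r \<otimes> h \<in> \<omega>" using qc rc h frac_car[OF Hf] by (simp add: m_assoc subset_iff)
        qed (use qc rc in simp)
        thus "q \<otimes> r \<in> \<omega>'" using DH by simp
      qed
    qed
    moreover have "\<omega>' \<noteq> ?D Z" using l len_self by auto
    ultimately have "?D Z = T"
      using simple_interval[OF frac_SM[OF wf'] frac_SM[OF Tf] SM_colon[OF frac_SM[OF wf] SM_sub[OF Z(1)]] _ _ lT] wZ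
      by blast
    hence "Z = J" using colon_colon[OF w Zf] by (simp add: J_def)
    thus ?thesis using Z by blast
  qed
  have "J \<noteq> H" using lJ len_self by auto
  then obtain u where u: "u \<in> H" "u \<notin> J" using JH by blast
  have uc: "u \<in> carrier Q" using u frac_car[OF Hf] by blast
  have full: "L = H" if "frac L" "L \<subseteq> H" "u \<in> L" for L using sub_J[of L] that u by blast
  obtain d where d: "d \<in> A" "d \<in> Units Q" "\<And>b. b \<in> H \<Longrightarrow> d \<otimes> b \<in> A" using frac_denom[OF Hf] by blast
  obtain v where v: "v \<in> H" "v \<in> Units Q" using frac_unit[OF Hf] .
  obtain c where c: "c \<in> n" "c \<in> Units Q" using n_reg by blast
  \<comment> \<open>A regular element \<open>r\<close> of the maximal ideal with \<open>r H \<subseteq> v n\<close>, so that \<open>r H\<close> is negligible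
    compared to \<open>v\<close>.\<close>
  define r where "r = (d \<otimes> v) \<otimes> (d \<otimes> c)"
  have cc: "c \<in> carrier Q" "d \<in> carrier Q" "v \<in> carrier Q" using c d v by (auto simp: Units_closed)
  have rU: "r \<in> Units Q" using c d v by (simp add: r_def)
  have rA: "r \<in> A" unfolding r_def using A_mult[OF d(3)[OF v(1)] A_mult[OF d(1)]] c n_sub by blast
  let ?L = "msum (dilate Q u A) (dilate Q r H)"
  have du: "dilate Q u A \<in> SM" using SM_dil[OF uc A_SM] .
  have dr: "dilate Q r H \<in> SM" using SM_dil[OF _ frac_SM[OF Hf]] rU by (simp add: Units_closed)
  have LSM: "?L \<in> SM" using SM_msum[OF du dr] .
  have "dilate Q r H \<subseteq> H" using SM_smult[OF frac_SM[OF Hf] rA] by (auto simp: dilate_def)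
  hence LH: "?L \<subseteq> H" using msum_least[OF frac_SM[OF Hf] dil_A_sub[OF frac_SM[OF Hf] u(1)]] by blast
  have "frac ?L"
    using frac_between[OF frac_dil[OF rU Hf] Hf LSM msum_upper2[OF du dr] LH] .
  hence "?L = H" using full[OF _ LH] msum_upper1[OF du dr] mem_dil_A[OF uc] by blast
  hence "v \<in> ?L" using v by simp
  then obtain a h where ah: "a \<in> A" "h \<in> H" "v = u \<otimes> a \<oplus> r \<otimes> h" by (auto simp: msum_def dilate_def)
  have ac: "a \<in> carrier Q" "h \<in> carrier Q" using ah A_car frac_car[OF Hf] by auto
  have "(d \<otimes> h) \<otimes> (d \<otimes> c) \<in> n" using d ah c by (intro SM_smult[OF n_SM]) auto
  then obtain t where t: "t \<in> A" "(\<one> \<ominus> (d \<otimes> h) \<otimes> (d \<otimes> c)) \<otimes> t = \<one>" using A_unit_diff by blast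
  have tc: "t \<in> carrier Q" using t A_car by blast
  have "u \<otimes> a = v \<ominus> r \<otimes> h"
  proof -
    have "u \<otimes> a = (u \<otimes> a \<oplus> r \<otimes> h) \<ominus> r \<otimes> h" using uc ac rU Units_closed[OF rU] by algebra
    thus ?thesis using ah(3) by simp
  qed
  also have "\<dots> = v \<otimes> (\<one> \<ominus> (d \<otimes> h) \<otimes> (d \<otimes> c))" unfolding r_def using cc ac by algebra
  finally have e: "u \<otimes> a = v \<otimes> (\<one> \<ominus> (d \<otimes> h) \<otimes> (d \<otimes> c))" .
  have "u \<otimes> (a \<otimes> t \<otimes> inv v) = (u \<otimes> a) \<otimes> (t \<otimes> inv v)"
    using uc ac tc v by (simp add: m_assoc)
  also have "\<dots> = ((\<one> \<ominus> (d \<otimes> h) \<otimes> (d \<otimes> c)) \<otimes> t) \<otimes> (v \<otimes> inv v)"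
  proof -
    have "(v \<otimes> g) \<otimes> (t \<otimes> w) = (g \<otimes> t) \<otimes> (v \<otimes> w)"
      if "g \<in> carrier Q" "w \<in> carrier Q" for g w
      using that cc tc by (simp add: m_ac)
    thus ?thesis unfolding e using cc ac v by simp
  qed
  also have "\<dots> = \<one>" using t v by simp
  finally have uU: "u \<in> Units Q" using uc ac tc v
    by (intro unit_if_inverse[of u "a \<otimes> t \<otimes> inv v"]) auto
  have "frac (dilate Q u A)" using frac_dil[OF uU frac_A] .
  hence "dilate Q u A = H" using full dil_A_sub[OF frac_SM[OF Hf] u(1)] mem_dil_A[OF uc] by blast
  hence "\<omega>' = ?D (dilate Q u A)" using DH by simp
  also have "\<dots> = dilate Q (inv u) \<omega>"
    using colon_dil[OF uU frac_car[OF wf] frac_car[OF frac_A]] colon_A[OF frac_SM[OF wf]] by simp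
  finally show thesis using that[of "inv u"] uU by simp
qed

text \<open>Two elements of \<open>K\<close> whose quotient is a unit of some overring generate submodules of the same
  colength; the overring enters through one of its modules \<open>B\<close>.\<close>

lemma len_dil_A_cong:
  assumes K: "frac K" and B: "frac B" and BA: "B \<subseteq> A" and x: "x \<in> Units Q" "x \<in> K"
    and y: "y \<in> Units Q" "y \<in> K" and eq: "dilate Q x B = dilate Q y B"
  shows "len (dilate Q x A) K = len (dilate Q y A) K"
proof -
  have *: "len (dilate Q u B) K = len B A + len (dilate Q u A) K" if u: "u \<in> Units Q" "u \<in> K" for u
  proof -
    have "len (dilate Q u B) K = len (dilate Q u B) (dilate Q u A) + len (dilate Q u A) K"
      using dil_A_sub[OF frac_SM[OF K] u(2)] dil_mono[OF BA] frac_dil[OF u(1)] B K frac_A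
      by (intro len_add frac_SM) auto
    thus ?thesis using len_dil[OF u(1) frac_car[OF B] frac_car[OF frac_A]] by simp
  qed
  have "len (dilate Q x A) K + len B A = len (dilate Q y A) K + len B A"
    using *[OF x] *[OF y] eq by (metis add.commute)
  thus ?thesis by (rule enat_cancel_right) (rule len_finite[OF B frac_A BA])
qed

end

section \<open>One-dimensional Cohen-Macaulay local rings\<close>

text \<open>By Zorn's lemma, since in a Noetherian ring the union of a nonempty chain of ideals belongs to the chain.\<close>

lemma (in noetherian_ring) exists_maximal_member:
  assumes "S \<noteq> {}" and S: "\<And>J. J \<in> S \<Longrightarrow> ideal J R"
  shows "\<exists>M\<in>S. \<forall>J\<in>S. M \<subseteq> J \<longrightarrow> J = M"
proof (rule subset_Zorn_nonempty[OF assms(1)])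
  fix C assume C: "C \<noteq> {}" "subset.chain S C"
  hence "subset.chain {I. ideal I R} C" using S by (auto simp: subset.chain_def)
  hence "\<Union>C \<in> C" using ideal_chain_is_trivial C(1) by blast
  thus "\<Union>C \<in> S" using C(2) by (auto simp: subset.chain_def)
qed

lemma (in cring) over_ring_self: "over_ring R (carrier R)"
  unfolding over_ring_def over_ring_axioms_def
  using carrier_is_subring is_cring by blast

lemma (in cring) submods_self: "submods R (carrier R) = {J. ideal J R}"
proof (intro equalityI subsetI)
  fix J assume "J \<in> {J. ideal J R}"
  then interpret ideal J R by simp
  show "J \<in> submods R (carrier R)"
    by (auto simp: submods_def I_l_closed a_subset[THEN subsetD])
next
  interpret O: over_ring R "carrier R" using over_ring_self .
  fix J assume J: "J \<in> submods R (carrier R)"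
  have "subgroup J (add_monoid R)"
    using O.SM_car[OF J] O.SM_zero[OF J] O.SM_add[OF J] O.SM_neg[OF J]
    by (intro add.subgroupI) (auto simp: a_inv_def)
  moreover have "x \<otimes> a \<in> J" "a \<otimes> x \<in> J" if "a \<in> J" "x \<in> carrier R" for a x
    using O.SM_smult[OF J that(2,1)] O.SM_car[OF J that(1)] that by (auto simp: m_comm)
  ultimately have "ideal J R" by (intro idealI) (auto intro: local.ring_axioms)
  thus "J \<in> {J. ideal J R}" by simp
qed

lemma (in cring) dil_ideal: "x \<in> carrier R \<Longrightarrow> ideal (dilate R x (carrier R)) R"
  using over_ring.SM_dil[OF over_ring_self, of x "carrier R"] over_ring.A_SM[OF over_ring_self]
    submods_self by blast

text \<open>An ideal that is maximal among those disjoint from a multiplicatively closed set is prime.\<close>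

lemma (in noetherian_ring) prime_avoiding:
  assumes "cring R" and T: "T \<subseteq> carrier R" "\<one> \<in> T" "\<zero> \<notin> T" and mult: "\<And>s t. s \<in> T \<Longrightarrow> t \<in> T \<Longrightarrow> s \<otimes> t \<in> T"
  obtains P where "primeideal P R" "P \<inter> T = {}"
proof -
  interpret cring R by fact
  interpret O: over_ring R "carrier R" using over_ring_self .
  let ?S = "{J. ideal J R \<and> J \<inter> T = {}}"
  have "{\<zero>} \<in> ?S" using zeroideal T by auto
  hence ne: "?S \<noteq> {}" by blast
  have id: "\<And>J. J \<in> ?S \<Longrightarrow> ideal J R" by simp
  obtain P where P': "P \<in> ?S" and max0: "\<forall>J\<in>?S. P \<subseteq> J \<longrightarrow> J = P"
    using exists_maximal_member[OF ne id] by (rule bexE)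
  note max' = max0[rule_format]
  have P: "ideal P R" "P \<inter> T = {}" using P' by auto
  have max: "J = P" if "ideal J R" "J \<inter> T = {}" "P \<subseteq> J" for J using max' that by blast
  have PS: "P \<in> O.SM" using P submods_self by simp
  have hit: "\<exists>p\<in>P. \<exists>u\<in>carrier R. p \<oplus> x \<otimes> u \<in> T" if x: "x \<in> carrier R" "x \<notin> P" for x
  proof -
    let ?d = "dilate R x (carrier R)"
    have d: "?d \<in> O.SM" using dil_ideal[OF x(1)] submods_self by simp
    have "ideal (O.msum P ?d) R" using O.SM_msum[OF PS d] submods_self by simp
    moreover have "P \<subseteq> O.msum P ?d" using O.msum_upper1[OF PS d] .
    moreover have "x \<in> O.msum P ?d"
      using O.msum_upper2[OF PS d] x(1) by (auto simp: dilate_def intro!: image_eqI[of _ _ \<one>])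
    ultimately have "O.msum P ?d \<inter> T \<noteq> {}" using max x(2) by blast
    thus ?thesis by (auto simp: O.msum_def dilate_def)
  qed
  have "primeideal P R"
  proof (rule primeidealI[OF P(1) is_cring])
    show "carrier R \<noteq> P" using P T by blast
  next
    fix x y assume x: "x \<in> carrier R" and y: "y \<in> carrier R" and xy: "x \<otimes> y \<in> P"
    show "x \<in> P \<or> y \<in> P"
    proof (rule ccontr)
      assume "\<not> (x \<in> P \<or> y \<in> P)"
      hence nx: "x \<notin> P" and ny: "y \<notin> P" by auto
      obtain p u where pu: "p \<in> P" "u \<in> carrier R" "p \<oplus> x \<otimes> u \<in> T" using hit[OF x nx] by blast
      obtain q v where qv: "q \<in> P" "v \<in> carrier R" "q \<oplus> y \<otimes> v \<in> T" using hit[OF y ny] by blast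
      note a = pu qv
      have pq: "p \<in> carrier R" "q \<in> carrier R" using a O.SM_car[OF PS] by auto
      have "(p \<oplus> x \<otimes> u) \<otimes> (q \<oplus> y \<otimes> v) = (q \<oplus> y \<otimes> v) \<otimes> p \<oplus> ((x \<otimes> u) \<otimes> q \<oplus> (u \<otimes> v) \<otimes> (x \<otimes> y))"
        using pq a x y by algebra
      moreover have "(q \<oplus> y \<otimes> v) \<otimes> p \<in> P" "(x \<otimes> u) \<otimes> q \<in> P" "(u \<otimes> v) \<otimes> (x \<otimes> y) \<in> P"
        using pq a x y xy by (auto intro!: O.SM_smult[OF PS])
      ultimately have "(p \<oplus> x \<otimes> u) \<otimes> (q \<oplus> y \<otimes> v) \<in> P" using O.SM_add[OF PS] by simp
      thus False using mult[OF a(3,6)] P by blast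
    qed
  qed
  thus thesis using that P by blast
qed

lemma (in cring) reg_closed: "s \<in> regular_elements R \<Longrightarrow> s \<in> carrier R"
  by (simp add: regular_elements_def)

lemma (in cring) reg_zero: "s \<in> regular_elements R \<Longrightarrow> x \<in> carrier R \<Longrightarrow> s \<otimes> x = \<zero> \<Longrightarrow> x = \<zero>"
  unfolding regular_elements_def by blast

locale one_dim_cm =
  fixes R (structure)
  assumes one_dim_cm: "one_dim_cm_local_ring R"
begin

lemma is_cring: "cring R" using one_dim_cm by (simp add: one_dim_cm_local_ring_def local_ring_def)

end

sublocale one_dim_cm \<subseteq> cring R by (rule is_cring)
sublocale one_dim_cm \<subseteq> noetherian_ring R using one_dim_cm by (simp add: one_dim_cm_local_ring_def)
sublocale one_dim_cm \<subseteq> O: over_ring R "carrier R" by (rule over_ring_self)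

context one_dim_cm
begin

abbreviation "\<mm> \<equiv> max_ideal R"

lemma unique_max: "\<exists>!M. maximalideal M R"
  using one_dim_cm by (simp add: one_dim_cm_local_ring_def local_ring_def)

lemma max: "maximalideal \<mm> R"
  unfolding max_ideal_def using theI'[OF unique_max] .

lemma max_eq: "maximalideal M R \<Longrightarrow> M = \<mm>" using unique_max max by metis

lemma m_ideal: "ideal \<mm> R" using max by (simp add: maximalideal_def)
lemma m_sub: "\<mm> \<subseteq> carrier R" using ideal.Icarr[OF m_ideal] by blast

lemma ideal_one: "ideal J R \<Longrightarrow> \<one> \<in> J \<Longrightarrow> J = carrier R"
  by (rule ideal.one_imp_carrier)

lemma one_notin_m: "\<one> \<notin> \<mm>"
  using maximalideal.I_notcarr[OF max] ideal_one[OF m_ideal] by blast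

lemma proper_sub_m: assumes "ideal J R" "J \<noteq> carrier R" shows "J \<subseteq> \<mm>"
proof -
  let ?S = "{K. ideal K R \<and> J \<subseteq> K \<and> K \<noteq> carrier R}"
  have ne: "?S \<noteq> {}" using assms by blast
  have id: "\<And>K. K \<in> ?S \<Longrightarrow> ideal K R" by simp
  obtain M where M: "M \<in> ?S" and max0: "\<forall>K\<in>?S. M \<subseteq> K \<longrightarrow> K = M"
    using exists_maximal_member[OF ne id] by (rule bexE)
  note max = max0[rule_format]
  have "maximalideal M R"
  proof (rule maximalidealI)
    show "ideal M R" "carrier R \<noteq> M" using M by auto
    fix K assume "ideal K R" "M \<subseteq> K" "K \<subseteq> carrier R"
    thus "K = M \<or> K = carrier R" using max[of K] M by blast
  qed
  thus ?thesis using max_eq M by blast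
qed

lemma unit_of_notin_m: assumes "x \<in> carrier R" "x \<notin> \<mm>" shows "\<exists>y\<in>carrier R. x \<otimes> y = \<one>"
proof -
  have "x \<in> dilate R x (carrier R)" using assms by (auto simp: dilate_def intro!: image_eqI[of _ _ \<one>])
  hence "dilate R x (carrier R) = carrier R" using proper_sub_m[OF dil_ideal[OF assms(1)]] assms by blast
  hence "\<one> \<in> dilate R x (carrier R)" by simp
  thus ?thesis by (auto simp: dilate_def)
qed

text \<open>A regular element lies in no minimal prime, so in dimension one the maximal ideal is the only
  prime that can contain it.\<close>

lemma prime_containing_regular:
  assumes P: "primeideal P R" and r: "r \<in> regular_elements R" "r \<in> P"
  shows "P = \<mm>"
proof (rule ccontr)
  assume ne: "P \<noteq> \<mm>"
  interpret P: primeideal P R by fact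
  have Pm: "P \<subset> \<mm>" using proper_sub_m[OF P.is_ideal P.I_notcarr[symmetric]] ne by (simp add: psubset_eq)
  let ?T = "{s \<otimes> r [^] k |s k. s \<in> carrier R \<and> s \<notin> P \<and> k \<in> (UNIV :: nat set)}"
  have rc: "r \<in> carrier R" using reg_closed[OF r(1)] .
  have pow: "x = \<zero>" if "x \<in> carrier R" "x \<otimes> r [^] (k :: nat) = \<zero>" for x k
    using that(2)
  proof (induction k)
    case (Suc k)
    have e: "r \<otimes> (x \<otimes> r [^] k) = x \<otimes> r [^] Suc k" using rc that(1) by (simp add: m_ac)
    have "x \<otimes> r [^] k = \<zero>"
      by (rule reg_zero[OF r(1)]) (use e Suc.prems rc that(1) in simp_all)
    thus ?case by (rule Suc.IH)
  qed (use that(1) in simp)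
  obtain P0 where P0: "primeideal P0 R" "P0 \<inter> ?T = {}"
  proof (rule prime_avoiding[OF is_cring, of ?T])
    show "?T \<subseteq> carrier R" using rc by auto
    have "\<one> \<notin> P" using P.I_notcarr ideal_one[OF P.is_ideal] by metis
    hence "\<one> \<otimes> r [^] (0 :: nat) \<in> ?T" by blast
    thus "\<one> \<in> ?T" by simp
    show "\<zero> \<notin> ?T"
    proof
      assume "\<zero> \<in> ?T"
      then obtain s k where "s \<in> carrier R" "s \<notin> P" "s \<otimes> r [^] (k :: nat) = \<zero>" by auto
      thus False using pow P.zero_closed by blast
    qed
    fix s t assume "s \<in> ?T" "t \<in> ?T"
    then obtain a b k l where a: "a \<in> carrier R" "a \<notin> P" "b \<in> carrier R" "b \<notin> P"
      "s = a \<otimes> r [^] (k :: nat)" "t = b \<otimes> r [^] (l :: nat)" by auto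
    have "s \<otimes> t = (a \<otimes> b) \<otimes> r [^] (k + l)"
      using a rc by (simp add: nat_pow_mult[symmetric] m_ac)
    moreover have "a \<otimes> b \<notin> P" using P.I_prime a by blast
    ultimately show "s \<otimes> t \<in> ?T" using a by blast
  qed (use that in blast)
  have in_T: "s \<in> ?T" if "s \<in> carrier R" "s \<notin> P" for s
  proof -
    have "s \<otimes> r [^] (0 :: nat) \<in> ?T" using that by blast
    thus ?thesis using that by simp
  qed
  interpret P0: primeideal P0 R by fact
  have P0c: "P0 \<subseteq> carrier R" using P0.Icarr by blast
  have "\<one> \<notin> P" using P.I_notcarr ideal_one[OF P.is_ideal] by metis
  hence "\<one> \<otimes> r [^] (1 :: nat) \<in> ?T" by blast
  hence "r \<in> ?T" using rc by simp
  hence "r \<notin> P0" using P0(2) by blast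
  moreover have "P0 \<subseteq> P"
  proof
    fix s assume s: "s \<in> P0"
    show "s \<in> P"
    proof (rule ccontr)
      assume "s \<notin> P"
      hence "s \<in> ?T" using in_T P0c s by blast
      thus False using P0(2) s by blast
    qed
  qed
  ultimately have P0P: "P0 \<subset> P" using r(2) by blast
  have mp: "primeideal \<mm> R" using maximalideal_prime[OF max] .
  let ?C = "\<lambda>i :: nat. if i = 0 then P0 else if i = 1 then P else \<mm>"
  have "(\<forall>i\<le>2. primeideal (?C i) R) \<and> (\<forall>i<2. ?C i \<subset> ?C (Suc i))"
    using P P0 mp P0P Pm by (auto simp: less_2_cases_iff)
  hence "\<exists>k. enat 2 = enat k \<and> (\<exists>C :: nat \<Rightarrow> 'a set.
      (\<forall>i\<le>k. primeideal (C i) R) \<and> (\<forall>i<k. C i \<subset> C (Suc i)))"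
    by (intro exI[of _ 2] conjI[OF refl] exI[of _ ?C])
  hence "enat 2 \<le> krull_dim R" unfolding krull_dim_def by (intro Sup_upper CollectI)
  thus False using one_dim_cm by (simp add: one_dim_cm_local_ring_def one_enat_def)
qed

lemma len_m: "O.len \<mm> (carrier R) \<le> 1"
proof (rule chain_len_least)
  fix k N assume N: "chain_in O.SM \<mm> (carrier R) k N"
  show "enat k \<le> 1"
  proof (rule ccontr)
    assume "\<not> enat k \<le> 1"
    hence k: "2 \<le> k" by (simp add: one_enat_def)
    have c: "N 0 \<subset> N 1" "N 1 \<subset> N 2" "\<mm> \<subseteq> N 0" "N 1 \<in> O.SM" "N 2 \<subseteq> carrier R"
      using N k by (auto simp: chain_in_def numeral_2_eq_2)
    have "ideal (N 1) R" using c submods_self by simp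
    hence "N 1 = \<mm> \<or> N 1 = carrier R"
      using maximalideal.I_maximal[OF max] c by blast
    thus False using c by blast
  qed
qed

text \<open>Otherwise there would be an ideal maximal among those of infinite colength that contain
  \<open>r\<close>. It would be prime, hence equal to the maximal ideal, which has colength one.\<close>

theorem finite_colength:
  assumes r: "r \<in> regular_elements R"
  shows "O.len (dilate R r (carrier R)) (carrier R) \<noteq> \<infinity>"
proof
  assume inf: "O.len (dilate R r (carrier R)) (carrier R) = \<infinity>"
  have rc: "r \<in> carrier R" using reg_closed[OF r(1)] .
  let ?S = "{J. ideal J R \<and> r \<in> J \<and> O.len J (carrier R) = \<infinity>}"
  have "r \<in> dilate R r (carrier R)" using rc by (auto simp: dilate_def intro!: image_eqI[of _ _ \<one>])
  hence "dilate R r (carrier R) \<in> ?S" using inf dil_ideal[OF rc] by blast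
  hence ne: "?S \<noteq> {}" by blast
  have id: "\<And>J. J \<in> ?S \<Longrightarrow> ideal J R" by simp
  obtain J where J': "J \<in> ?S" and max0: "\<forall>K\<in>?S. J \<subseteq> K \<longrightarrow> K = J"
    using exists_maximal_member[OF ne id] by (rule bexE)
  note max' = max0[rule_format]
  have J: "ideal J R" "r \<in> J" "O.len J (carrier R) = \<infinity>" using J' by auto
  have max: "O.len K (carrier R) \<noteq> \<infinity>" if "ideal K R" "J \<subset> K" for K
  proof
    assume "O.len K (carrier R) = \<infinity>"
    hence "K \<in> ?S" using that J(2) by (simp add: subset_iff psubset_eq)
    thus False using max'[of K] that(2) by (simp add: psubset_eq)
  qed
  have JS: "J \<in> O.SM" using J submods_self by simp
  note Jc = O.SM_car[OF JS]
  have "primeideal J R"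
  proof (rule primeidealI[OF J(1) is_cring])
    show "carrier R \<noteq> J" using J(3) O.len_self[of J] by auto
  next
    fix x y assume x: "x \<in> carrier R" and y: "y \<in> carrier R" and xy: "x \<otimes> y \<in> J"
    show "x \<in> J \<or> y \<in> J"
    proof (rule ccontr)
      assume n: "\<not> (x \<in> J \<or> y \<in> J)"
      let ?d = "dilate R x (carrier R)" and ?q = "{s \<in> carrier R. s \<otimes> x \<in> J}"
      have d: "?d \<in> O.SM" using dil_ideal[OF x(1)] submods_self by simp
      let ?K = "O.msum J ?d"
      have K: "?K \<in> O.SM" "J \<subseteq> ?K" using O.SM_msum[OF JS d] O.msum_upper1[OF JS d] by auto
      have "x \<in> ?K" using O.msum_upper2[OF JS d] x(1) by (auto simp: dilate_def intro!: image_eqI[of _ _ \<one>])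
      hence fK: "O.len ?K (carrier R) \<noteq> \<infinity>" using max[of ?K] K submods_self n by blast
      have qS: "?q \<in> O.SM"
      proof (rule O.SM_I)
        show "\<zero> \<in> ?q" using O.SM_zero[OF JS] x by simp
      qed (use x O.SM_add[OF JS] O.SM_smult[OF JS] in \<open>auto simp: l_distr m_assoc\<close>)
      have "J \<subseteq> ?q" using Jc O.SM_smult[OF JS x] x by (auto simp: m_comm)
      moreover have "y \<in> ?q" using x y xy by (simp add: m_comm)
      ultimately have fq: "O.len ?q (carrier R) \<noteq> \<infinity>" using max[of ?q] qS submods_self n by blast
      \<comment> \<open>\<open>(J + xR) / J\<close> is isomorphic to \<open>R / (J : x)\<close>.\<close>
      have "O.len J ?K \<le> O.len ?q (carrier R)"
      proof (rule chain_len_transfer[where g = "\<lambda>N. {s \<in> carrier R. s \<otimes> x \<in> N}"])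
        fix N assume N: "N \<in> O.SM" "J \<subseteq> N" "N \<subseteq> ?K"
        have "{s \<in> carrier R. s \<otimes> x \<in> N} \<in> O.SM"
        proof (rule O.SM_I)
          show "\<zero> \<in> {s \<in> carrier R. s \<otimes> x \<in> N}" using O.SM_zero[OF N(1)] x by simp
        qed (use x O.SM_add[OF N(1)] O.SM_smult[OF N(1)] in \<open>auto simp: l_distr m_assoc\<close>)
        thus "{s \<in> carrier R. s \<otimes> x \<in> N} \<in> O.SM \<and> ?q \<subseteq> {s \<in> carrier R. s \<otimes> x \<in> N} \<and>
          {s \<in> carrier R. s \<otimes> x \<in> N} \<subseteq> carrier R" using N by blast
      next
        fix N N' assume N: "N \<in> O.SM" "J \<subseteq> N" "N' \<in> O.SM" "N' \<subseteq> ?K" "N \<subset> N'"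
        then obtain e where e: "e \<in> N'" "e \<notin> N" by blast
        hence "e \<in> ?K" using N by blast
        then obtain j s where js: "j \<in> J" "s \<in> carrier R" "e = j \<oplus> x \<otimes> s"
          by (auto simp: O.msum_def dilate_def)
        have "e \<ominus> j \<in> N'" using e js N by (intro O.SM_diff[OF N(3)]) auto
        moreover have "e \<ominus> j = s \<otimes> x" unfolding js(3) using Jc[OF js(1)] js x by algebra
        moreover have "s \<otimes> x \<notin> N"
        proof
          assume "s \<otimes> x \<in> N"
          hence "j \<oplus> s \<otimes> x \<in> N" using js N O.SM_add[OF N(1)] by blast
          thus False using e js x by (simp add: m_comm)
        qed
        ultimately show "{s \<in> carrier R. s \<otimes> x \<in> N} \<subset> {s \<in> carrier R. s \<otimes> x \<in> N'}"
          using js N by auto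
      qed
      hence "O.len J ?K \<noteq> \<infinity>" using fq enat_le_finite by blast
      moreover have "O.len J (carrier R) = O.len J ?K + O.len ?K (carrier R)"
        using K O.SM_sub[OF K(1)] by (intro O.len_add JS O.A_SM) auto
      ultimately show False using J(3) fK by (metis plus_eq_infty_iff_enat)
    qed
  qed
  hence "J = \<mm>" using prime_containing_regular r J(2) by blast
  thus False using J(3) len_m by simp
qed

end

lemma add_monoid_ring_module [simp]: "add_monoid (ring_module R) = add_monoid R"
  by (simp add: ring_module_def)

lemma ring_module_simps [simp]: "carrier (ring_module R) = carrier R"
  "\<zero>\<^bsub>ring_module R\<^esub> = \<zero>\<^bsub>R\<^esub>" "add (ring_module R) = add R"
  "smult (ring_module R) = monoid.mult R"
  by (simp_all add: ring_module_def)

lemma (in cring) module_ring_module: "module R (ring_module R)"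
proof (rule moduleI[OF is_cring])
  show "abelian_group (ring_module R)"
    by (rule abelian_groupI) (auto simp: a_ac intro: l_neg)
qed (auto simp: l_distr r_distr m_assoc)

context one_dim_cm
begin

lemma regular_in_m: obtains r where "r \<in> regular_elements R" "r \<in> \<mm>"
proof -
  let ?M = "ring_module R"
  let ?S = "{enat (length xs) |xs. set xs \<subseteq> \<mm> \<and> regular_sequence R ?M xs}"
  have "depth R ?M = 1" using one_dim_cm by (simp add: one_dim_cm_local_ring_def)
  hence S: "Sup ?S = 1" by (simp add: depth_def)
  have "\<exists>xs. set xs \<subseteq> \<mm> \<and> regular_sequence R ?M xs \<and> xs \<noteq> []"
  proof (rule ccontr)
    assume n: "\<not> (\<exists>xs. set xs \<subseteq> \<mm> \<and> regular_sequence R ?M xs \<and> xs \<noteq> [])"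
    have "Sup ?S \<le> 0" by (rule Sup_least) (use n in \<open>auto simp: zero_enat_def\<close>)
    thus False using S by simp
  qed
  then obtain xs where xs: "set xs \<subseteq> \<mm>" "regular_sequence R ?M xs" "xs \<noteq> []" by blast
  interpret M: module R ?M using module_ring_module .
  have "submodule {\<zero>} R ?M"
    by (rule M.submoduleI) (use M.add.inv_one in \<open>auto simp: a_inv_def\<close>)
  moreover have "\<zero> \<in> N" if "submodule N R ?M" for N
    using subgroup.one_closed[OF submodule.axioms(1)[OF that]] by simp
  ultimately have z: "list_smult R [] ?M = {\<zero>}"
    unfolding list_smult_def module_span_def by auto
  have "xs ! 0 \<in> \<mm>" using xs by (meson length_greater_0_conv nth_mem subsetD)
  moreover have "xs ! 0 \<in> regular_elements R"
    using xs calculation m_sub z unfolding regular_sequence_def regular_elements_def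
    by (auto dest!: spec[where x = 0])
  ultimately show thesis using that by blast
qed

text \<open>This makes the duality theory available in \<open>Q(R)\<close> and, for the quotient of the Rees algebra, in the
  quadratic extension of \<open>Q(R)\<close>.\<close>

theorem local_order_image:
  assumes Q: "cring Q" and h: "h \<in> ring_hom R Q" and inj: "inj_on h (carrier R)"
    and units: "\<And>r. r \<in> regular_elements R \<Longrightarrow> h r \<in> Units Q"
    and denom: "\<And>q. q \<in> carrier Q \<Longrightarrow> \<exists>s\<in>regular_elements R. h s \<otimes>\<^bsub>Q\<^esub> q \<in> h ` carrier R"
  shows "local_order Q (h ` carrier R) (h ` \<mm>)"
proof -
  interpret Q: cring Q by fact
  interpret h: ring_hom_cring R Q h
    using h Q is_cring by (simp add: ring_hom_cring_def ring_hom_cring_axioms_def)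
  have sub: "subring (h ` carrier R) Q"
    using ring_hom_ring.img_is_subring[OF ring_hom_ringI2[OF ring_axioms Q.ring_axioms h] carrier_is_subring] .
  interpret V: over_ring Q "h ` carrier R"
    using Q sub by (simp add: over_ring_def over_ring_axioms_def)
  have mS: "\<mm> \<in> O.SM" using m_ideal submods_self by simp
  have injD: "x = y" if "h x = h y" "x \<in> carrier R" "y \<in> carrier R" for x y
    using inj that by (auto simp: inj_on_def)
  show ?thesis
  proof
    show "h ` \<mm> \<in> V.SM"
    proof (rule V.SM_I)
      show "h ` \<mm> \<subseteq> carrier Q" using m_sub by auto
      have "h \<zero> = \<zero>\<^bsub>Q\<^esub>" by simp
      thus "\<zero>\<^bsub>Q\<^esub> \<in> h ` \<mm>" using O.SM_zero[OF mS] by force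
    next
      fix x y assume "x \<in> h ` \<mm>" "y \<in> h ` \<mm>"
      then obtain a b where "a \<in> \<mm>" "b \<in> \<mm>" "x = h a" "y = h b" by blast
      moreover from this have "h a \<oplus>\<^bsub>Q\<^esub> h b = h (a \<oplus> b)" using subsetD[OF m_sub] by simp
      ultimately show "x \<oplus>\<^bsub>Q\<^esub> y \<in> h ` \<mm>" using O.SM_add[OF mS] by auto
    next
      fix x y assume "x \<in> h ` carrier R" "y \<in> h ` \<mm>"
      then obtain a b where "a \<in> carrier R" "b \<in> \<mm>" "x = h a" "y = h b" by blast
      moreover from this have "h a \<otimes>\<^bsub>Q\<^esub> h b = h (a \<otimes> b)" using subsetD[OF m_sub] by simp
      ultimately show "x \<otimes>\<^bsub>Q\<^esub> y \<in> h ` \<mm>" using O.SM_smult[OF mS] by auto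
    qed
    show "h ` \<mm> \<subseteq> h ` carrier R" using m_sub by auto
    show "\<one>\<^bsub>Q\<^esub> \<notin> h ` \<mm>"
    proof
      assume "\<one>\<^bsub>Q\<^esub> \<in> h ` \<mm>"
      then obtain x where "x \<in> \<mm>" "h x = h \<one>" by auto
      thus False using injD[of x \<one>] m_sub one_notin_m by auto
    qed
    obtain r where "r \<in> regular_elements R" "r \<in> \<mm>" using regular_in_m .
    thus "\<exists>c\<in>h ` \<mm>. c \<in> Units Q" using units by blast
  next
    fix a assume "a \<in> h ` carrier R" "a \<notin> h ` \<mm>"
    then obtain x where x: "x \<in> carrier R" "x \<notin> \<mm>" "a = h x" by blast
    then obtain y where y: "y \<in> carrier R" "x \<otimes> y = \<one>" using unit_of_notin_m by blast
    have "h x \<otimes>\<^bsub>Q\<^esub> h y = \<one>\<^bsub>Q\<^esub>" using x y h.hom_mult[of x y] by simp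
    thus "\<exists>b\<in>h ` carrier R. a \<otimes>\<^bsub>Q\<^esub> b = \<one>\<^bsub>Q\<^esub>" using x y by blast
  next
    fix q assume "q \<in> carrier Q"
    thus "\<exists>s\<in>h ` carrier R. s \<in> Units Q \<and> s \<otimes>\<^bsub>Q\<^esub> q \<in> h ` carrier R"
      using denom units reg_closed by (meson imageI)
  next
    fix s assume "s \<in> h ` carrier R" and sU: "s \<in> Units Q"
    then obtain r where r: "r \<in> carrier R" "s = h r" by blast
    have "x = \<zero>" if "x \<in> carrier R" "r \<otimes> x = \<zero>" for x
    proof -
      have "s \<otimes>\<^bsub>Q\<^esub> h x = s \<otimes>\<^bsub>Q\<^esub> \<zero>\<^bsub>Q\<^esub>"
        using that r h.hom_mult[of r x] h.hom_zero Q.Units_closed[OF sU] Q.r_null by metis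
      hence "h x = \<zero>\<^bsub>Q\<^esub>" using Q.Units_l_cancel[OF sU] that by simp
      thus ?thesis using injD[of x \<zero>] that by simp
    qed
    hence rr: "r \<in> regular_elements R" using r by (simp add: regular_elements_def)
    have "V.len (dilate Q s (h ` carrier R)) (h ` carrier R) \<le> O.len (dilate R r (carrier R)) (carrier R)"
    proof (rule chain_len_transfer[where g = "\<lambda>N. {x \<in> carrier R. h x \<in> N}"])
      fix N assume N: "N \<in> V.SM" "dilate Q s (h ` carrier R) \<subseteq> N" "N \<subseteq> h ` carrier R"
      have "{x \<in> carrier R. h x \<in> N} \<in> O.SM"
        by (rule O.SM_I) (use V.SM_zero[OF N(1)] V.SM_add[OF N(1)] V.SM_smult[OF N(1)] in auto)
      moreover have "h (r \<otimes> x) \<in> N" if "x \<in> carrier R" for x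
        using N(2) that r by (auto simp: dilate_def)
      hence "dilate R r (carrier R) \<subseteq> {x \<in> carrier R. h x \<in> N}"
        using r by (auto simp: dilate_def)
      ultimately show "{x \<in> carrier R. h x \<in> N} \<in> O.SM \<and> dilate R r (carrier R) \<subseteq> {x \<in> carrier R. h x \<in> N} \<and>
          {x \<in> carrier R. h x \<in> N} \<subseteq> carrier R" by blast
    next
      fix N N' assume "N \<in> V.SM" "dilate Q s (h ` carrier R) \<subseteq> N" "N' \<in> V.SM" "N' \<subseteq> h ` carrier R" "N \<subset> N'"
      thus "{x \<in> carrier R. h x \<in> N} \<subset> {x \<in> carrier R. h x \<in> N'}" by blast
    qed
    thus "V.len (dilate Q s (h ` carrier R)) (h ` carrier R) \<noteq> \<infinity>"
      using finite_colength[OF rr] enat_le_finite by blast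
  qed
qed

end

section \<open>Modules and their lengths\<close>

abbreviation submodules :: "('a, 'm) ring_scheme \<Rightarrow> ('a, 'b) module \<Rightarrow> 'b set set" where
  "submodules R M \<equiv> {N. submodule N R M}"

lemma (in module) submodule_zero: "submodule N R M \<Longrightarrow> \<zero>\<^bsub>M\<^esub> \<in> N"
  using subgroup.one_closed[OF submodule.axioms(1)] by force

lemma (in module) submodule_iff:
  "submodule N R M \<longleftrightarrow> N \<subseteq> carrier M \<and> \<zero>\<^bsub>M\<^esub> \<in> N \<and> (\<forall>x\<in>N. \<forall>y\<in>N. x \<oplus>\<^bsub>M\<^esub> y \<in> N) \<and>
     (\<forall>r\<in>carrier R. \<forall>x\<in>N. r \<odot>\<^bsub>M\<^esub> x \<in> N)" (is "_ \<longleftrightarrow> ?P")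
proof
  assume sm: "submodule N R M"
  thus ?P using submoduleE(1,4,5)[OF sm] submodule_zero[OF sm] by auto
next
  assume P: ?P
  show "submodule N R M"
  proof (rule submoduleI)
    fix x assume x: "x \<in> N"
    hence "\<ominus>\<^bsub>R\<^esub> \<one>\<^bsub>R\<^esub> \<odot>\<^bsub>M\<^esub> x \<in> N" using P by simp
    moreover have "\<ominus>\<^bsub>R\<^esub> \<one>\<^bsub>R\<^esub> \<odot>\<^bsub>M\<^esub> x = \<ominus>\<^bsub>M\<^esub> x" using x P smult_l_minus[of "\<one>\<^bsub>R\<^esub>" x] by auto
    ultimately show "\<ominus>\<^bsub>M\<^esub> x \<in> N" by simp
  qed (use P in auto)
qed

lemma module_length_eq: assumes "module R M"
  shows "module_length R M = chain_len (submodules R M) {\<zero>\<^bsub>M\<^esub>} (carrier M)"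
proof -
  interpret module R M by fact
  have *: "N \<in> submodules R M \<and> {\<zero>\<^bsub>M\<^esub>} \<subseteq> N \<and> N \<subseteq> carrier M \<longleftrightarrow> submodule N R M" for N
    by (auto simp: submodule_iff)
  have "(\<exists>N :: nat \<Rightarrow> _. (\<forall>i\<le>n. submodule (N i) R M) \<and> (\<forall>i<n. N i \<subset> N (Suc i))) \<longleftrightarrow>
      (\<exists>N. chain_in (submodules R M) {\<zero>\<^bsub>M\<^esub>} (carrier M) n N)" for n
    unfolding chain_in_def using * by (simp only:)
  thus ?thesis unfolding module_length_def chain_len_def by simp
qed

text \<open>Quotient modules are given as bare records. The module axioms for them are transported along the surjection
  onto them.\<close>

lemma module_of_surj:
  assumes M: "module R M" and im: "f ` carrier M = carrier M2"
    and fadd: "\<And>x y. x \<in> carrier M \<Longrightarrow> y \<in> carrier M \<Longrightarrow> f (x \<oplus>\<^bsub>M\<^esub> y) = f x \<oplus>\<^bsub>M2\<^esub> f y"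
    and fsm: "\<And>r x. r \<in> carrier R \<Longrightarrow> x \<in> carrier M \<Longrightarrow> f (r \<odot>\<^bsub>M\<^esub> x) = r \<odot>\<^bsub>M2\<^esub> f x"
    and fzero: "f \<zero>\<^bsub>M\<^esub> = \<zero>\<^bsub>M2\<^esub>"
  shows "module R M2"
proof -
  interpret module R M by fact
  have c: "f x \<in> carrier M2" if "x \<in> carrier M" for x using im that by blast
  have e: "\<exists>x\<in>carrier M. y = f x" if "y \<in> carrier M2" for y using im that by blast
  show ?thesis
  proof (rule moduleI)
    show "cring R" using M by (simp add: module_def)
    show "abelian_group M2"
    proof (rule abelian_groupI)
      fix x y assume xy: "x \<in> carrier M2" "y \<in> carrier M2"
      then obtain a b where ab: "a \<in> carrier M" "b \<in> carrier M" "x = f a" "y = f b" using e by metis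
      show "x \<oplus>\<^bsub>M2\<^esub> y \<in> carrier M2" using ab fadd[of a b] c[of "a \<oplus>\<^bsub>M\<^esub> b"] by simp
      show "x \<oplus>\<^bsub>M2\<^esub> y = y \<oplus>\<^bsub>M2\<^esub> x" using ab fadd[of a b] fadd[of b a] M.a_comm[of a b] by simp
      fix z assume "z \<in> carrier M2"
      then obtain d where "d \<in> carrier M" "z = f d" using e by metis
      thus "x \<oplus>\<^bsub>M2\<^esub> y \<oplus>\<^bsub>M2\<^esub> z = x \<oplus>\<^bsub>M2\<^esub> (y \<oplus>\<^bsub>M2\<^esub> z)"
        using ab M.a_assoc[of a b d] by (simp add: fadd[symmetric])
    next
      show "\<zero>\<^bsub>M2\<^esub> \<in> carrier M2" using c[of "\<zero>\<^bsub>M\<^esub>"] fzero by simp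
      fix x assume "x \<in> carrier M2"
      then obtain a where a: "a \<in> carrier M" "x = f a" using e by metis
      show "\<zero>\<^bsub>M2\<^esub> \<oplus>\<^bsub>M2\<^esub> x = x" using a fadd[of "\<zero>\<^bsub>M\<^esub>" a] fzero by simp
      have "f (\<ominus>\<^bsub>M\<^esub> a) \<oplus>\<^bsub>M2\<^esub> x = \<zero>\<^bsub>M2\<^esub>" using a fadd[of "\<ominus>\<^bsub>M\<^esub> a" a] fzero by (simp add: M.l_neg)
      thus "\<exists>y\<in>carrier M2. y \<oplus>\<^bsub>M2\<^esub> x = \<zero>\<^bsub>M2\<^esub>" using a c by blast
    qed
  next
    fix r s x assume r: "r \<in> carrier R" and s: "s \<in> carrier R" and "x \<in> carrier M2"
    then obtain a where a: "a \<in> carrier M" "x = f a" using e by metis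
    show "(r \<oplus>\<^bsub>R\<^esub> s) \<odot>\<^bsub>M2\<^esub> x = r \<odot>\<^bsub>M2\<^esub> x \<oplus>\<^bsub>M2\<^esub> s \<odot>\<^bsub>M2\<^esub> x"
      using a r s by (simp add: fadd[symmetric] fsm[symmetric] smult_l_distr)
    show "r \<otimes>\<^bsub>R\<^esub> s \<odot>\<^bsub>M2\<^esub> x = r \<odot>\<^bsub>M2\<^esub> (s \<odot>\<^bsub>M2\<^esub> x)"
      using a r s by (simp add: fsm[symmetric] smult_assoc1)
  next
    fix r x assume r: "r \<in> carrier R" and "x \<in> carrier M2"
    then obtain a where a: "a \<in> carrier M" "x = f a" using e by metis
    show "r \<odot>\<^bsub>M2\<^esub> x \<in> carrier M2" using a r c[of "r \<odot>\<^bsub>M\<^esub> a"] fsm[of r a] by simp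
    fix y assume "y \<in> carrier M2"
    then obtain b where b: "b \<in> carrier M" "y = f b" using e by metis
    show "r \<odot>\<^bsub>M2\<^esub> (x \<oplus>\<^bsub>M2\<^esub> y) = r \<odot>\<^bsub>M2\<^esub> x \<oplus>\<^bsub>M2\<^esub> r \<odot>\<^bsub>M2\<^esub> y"
      using a b r by (simp add: fadd[symmetric] fsm[symmetric] smult_r_distr)
  next
    fix x assume "x \<in> carrier M2"
    then obtain a where a: "a \<in> carrier M" "x = f a" using e by metis
    show "\<one>\<^bsub>R\<^esub> \<odot>\<^bsub>M2\<^esub> x = x" using a fsm[of "\<one>\<^bsub>R\<^esub>" a] by simp
  qed
qed

text \<open>Taking preimages identifies the submodules of \<open>M2\<close> with the submodules of \<open>M\<close> that contain the kernel.\<close>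

lemma length_of_surj:
  assumes M: "module R M" and im: "f ` carrier M = carrier M2"
    and fadd: "\<And>x y. x \<in> carrier M \<Longrightarrow> y \<in> carrier M \<Longrightarrow> f (x \<oplus>\<^bsub>M\<^esub> y) = f x \<oplus>\<^bsub>M2\<^esub> f y"
    and fsm: "\<And>r x. r \<in> carrier R \<Longrightarrow> x \<in> carrier M \<Longrightarrow> f (r \<odot>\<^bsub>M\<^esub> x) = r \<odot>\<^bsub>M2\<^esub> f x"
    and fzero: "f \<zero>\<^bsub>M\<^esub> = \<zero>\<^bsub>M2\<^esub>"
  shows "module_length R M2 = chain_len (submodules R M) {x \<in> carrier M. f x = \<zero>\<^bsub>M2\<^esub>} (carrier M)"
proof -
  interpret M: module R M by fact
  have M2: "module R M2" using module_of_surj[OF assms] .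
  interpret M2: module R M2 by fact
  have c: "f x \<in> carrier M2" if "x \<in> carrier M" for x using im that by blast
  let ?K = "{x \<in> carrier M. f x = \<zero>\<^bsub>M2\<^esub>}"
  show ?thesis unfolding module_length_eq[OF M2]
  proof (rule antisym)
    show "chain_len (submodules R M2) {\<zero>\<^bsub>M2\<^esub>} (carrier M2) \<le> chain_len (submodules R M) ?K (carrier M)"
    proof (rule chain_len_transfer[where g = "\<lambda>N. {x \<in> carrier M. f x \<in> N}"])
      fix N assume N: "N \<in> submodules R M2" "{\<zero>\<^bsub>M2\<^esub>} \<subseteq> N" "N \<subseteq> carrier M2"
      have "submodule {x \<in> carrier M. f x \<in> N} R M"
        using N unfolding M.submodule_iff by (auto simp: M2.submodule_iff fadd fsm fzero)
      thus "{x \<in> carrier M. f x \<in> N} \<in> submodules R M \<and> ?K \<subseteq> {x \<in> carrier M. f x \<in> N} \<and>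
          {x \<in> carrier M. f x \<in> N} \<subseteq> carrier M" using N by auto
    next
      fix N N' assume N: "N \<in> submodules R M2" "N' \<in> submodules R M2" "N' \<subseteq> carrier M2" "N \<subset> N'"
      then obtain y where "y \<in> N'" "y \<notin> N" by blast
      moreover from this obtain x where "x \<in> carrier M" "y = f x" using N im by blast
      ultimately show "{x \<in> carrier M. f x \<in> N} \<subset> {x \<in> carrier M. f x \<in> N'}" using N by blast
    qed
    show "chain_len (submodules R M) ?K (carrier M) \<le> chain_len (submodules R M2) {\<zero>\<^bsub>M2\<^esub>} (carrier M2)"
    proof (rule chain_len_transfer[where g = "\<lambda>N. f ` N"])
      fix N assume N: "N \<in> submodules R M" "?K \<subseteq> N" "N \<subseteq> carrier M"
      have s: "x \<in> N \<Longrightarrow> y \<in> N \<Longrightarrow> x \<oplus>\<^bsub>M\<^esub> y \<in> N" "r \<in> carrier R \<Longrightarrow> x \<in> N \<Longrightarrow> r \<odot>\<^bsub>M\<^esub> x \<in> N"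
        "x \<in> N \<Longrightarrow> x \<in> carrier M" "\<zero>\<^bsub>M\<^esub> \<in> N" for x y r
        using N by (auto simp: M.submodule_iff)
      have z: "\<zero>\<^bsub>M2\<^esub> \<in> f ` N" using s(4) fzero by force
      have "submodule (f ` N) R M2" unfolding M2.submodule_iff
      proof (intro conjI ballI)
        show "f ` N \<subseteq> carrier M2" using s c by auto
        show "\<zero>\<^bsub>M2\<^esub> \<in> f ` N" using z .
        fix x y assume "x \<in> f ` N" "y \<in> f ` N"
        then obtain a b where "a \<in> N" "b \<in> N" "x = f a" "y = f b" by blast
        thus "x \<oplus>\<^bsub>M2\<^esub> y \<in> f ` N" using s by (simp add: fadd[symmetric])
      next
        fix r x assume "r \<in> carrier R" "x \<in> f ` N"
        moreover from this obtain a where "a \<in> N" "x = f a" by blast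
        ultimately show "r \<odot>\<^bsub>M2\<^esub> x \<in> f ` N" using s by (simp add: fsm[symmetric])
      qed
      thus "f ` N \<in> submodules R M2 \<and> {\<zero>\<^bsub>M2\<^esub>} \<subseteq> f ` N \<and> f ` N \<subseteq> carrier M2"
        using z s c by auto
    next
      fix N N' assume N: "N \<in> submodules R M" "?K \<subseteq> N" "N' \<in> submodules R M" "N' \<subseteq> carrier M" "N \<subset> N'"
      have "f ` N \<noteq> f ` N'"
      proof
        assume eq: "f ` N = f ` N'"
        obtain x where x: "x \<in> N'" "x \<notin> N" using N by blast
        then obtain y where y: "y \<in> N" "f x = f y" using eq by blast
        have xc: "x \<in> carrier M" "y \<in> carrier M" using x y N by auto
        have my: "(\<ominus>\<^bsub>R\<^esub> \<one>\<^bsub>R\<^esub>) \<odot>\<^bsub>M\<^esub> y \<in> N" using N y by (simp add: M.submodule_iff)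
        have my': "(\<ominus>\<^bsub>R\<^esub> \<one>\<^bsub>R\<^esub>) \<odot>\<^bsub>M\<^esub> y = \<ominus>\<^bsub>M\<^esub> y" using xc by (simp add: M.smult_l_minus)
        have "f (x \<oplus>\<^bsub>M\<^esub> \<ominus>\<^bsub>M\<^esub> y) = f y \<oplus>\<^bsub>M2\<^esub> f (\<ominus>\<^bsub>M\<^esub> y)" using xc y by (simp add: fadd)
        also have "\<dots> = f (y \<oplus>\<^bsub>M\<^esub> \<ominus>\<^bsub>M\<^esub> y)" using xc by (simp add: fadd)
        finally have "f (x \<oplus>\<^bsub>M\<^esub> \<ominus>\<^bsub>M\<^esub> y) = \<zero>\<^bsub>M2\<^esub>" using xc fzero by (simp add: M.r_neg)
        hence "x \<oplus>\<^bsub>M\<^esub> \<ominus>\<^bsub>M\<^esub> y \<in> ?K" using xc by simp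
        hence "x \<oplus>\<^bsub>M\<^esub> \<ominus>\<^bsub>M\<^esub> y \<in> N" using N(2) by (rule subsetD[rotated])
        hence "(x \<oplus>\<^bsub>M\<^esub> \<ominus>\<^bsub>M\<^esub> y) \<oplus>\<^bsub>M\<^esub> y \<in> N" using y N by (simp add: M.submodule_iff)
        thus False using x xc by (simp add: M.a_assoc M.l_neg)
      qed
      thus "f ` N \<subset> f ` N'" using N by blast
    qed
  qed
qed

section \<open>Quotient modules\<close>

lemma quotient_module_simps [simp]:
  "carrier (quotient_module M N) = a_rcosets\<^bsub>M\<^esub> N" "\<zero>\<^bsub>quotient_module M N\<^esub> = N"
  "add (quotient_module M N) = set_add M"
  "smult (quotient_module M N) = (\<lambda>r C. \<Union>x\<in>C. N +>\<^bsub>M\<^esub> (r \<odot>\<^bsub>M\<^esub> x))"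
  by (simp_all add: quotient_module_def)

context module
begin

lemma submodule_abelian_subgroup: "submodule N R M \<Longrightarrow> abelian_subgroup N M"
  by (intro abelian_subgroupI3 additive_subgroupI) (auto dest: submodule.axioms(1) intro: M.abelian_group_axioms)

lemma coset_im: "(+>\<^bsub>M\<^esub>) N ` carrier M = a_rcosets\<^bsub>M\<^esub> N"
  by (auto simp: A_RCOSETS_def RCOSETS_def a_r_coset_def)

lemma coset_add: assumes "submodule N R M" "x \<in> carrier M" "y \<in> carrier M"
  shows "N +>\<^bsub>M\<^esub> (x \<oplus>\<^bsub>M\<^esub> y) = set_add M (N +>\<^bsub>M\<^esub> x) (N +>\<^bsub>M\<^esub> y)"
  using abelian_subgroup.a_rcos_sum[OF submodule_abelian_subgroup[OF assms(1)] assms(2,3)] by simp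

lemma coset_smult: assumes N: "submodule N R M" and r: "r \<in> carrier R" and x: "x \<in> carrier M"
  shows "N +>\<^bsub>M\<^esub> (r \<odot>\<^bsub>M\<^esub> x) = (\<Union>y\<in>N +>\<^bsub>M\<^esub> x. N +>\<^bsub>M\<^esub> (r \<odot>\<^bsub>M\<^esub> y))"
proof -
  interpret N: abelian_subgroup N M using submodule_abelian_subgroup[OF N] .
  have "N +>\<^bsub>M\<^esub> (r \<odot>\<^bsub>M\<^esub> y) = N +>\<^bsub>M\<^esub> (r \<odot>\<^bsub>M\<^esub> x)" if y: "y \<in> N +>\<^bsub>M\<^esub> x" for y
  proof -
    obtain k where k: "k \<in> N" "y = k \<oplus>\<^bsub>M\<^esub> x" using y by (auto simp: a_r_coset_def')
    have kc: "k \<in> carrier M" using k N by (auto simp: submodule_iff)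
    have "r \<odot>\<^bsub>M\<^esub> y = r \<odot>\<^bsub>M\<^esub> k \<oplus>\<^bsub>M\<^esub> r \<odot>\<^bsub>M\<^esub> x" using k kc x r by (simp add: smult_r_distr)
    moreover have "r \<odot>\<^bsub>M\<^esub> k \<in> N" using N k r by (simp add: submodule_iff)
    ultimately have "r \<odot>\<^bsub>M\<^esub> y \<in> N +>\<^bsub>M\<^esub> (r \<odot>\<^bsub>M\<^esub> x)" by (auto simp: a_r_coset_def')
    thus ?thesis using N.a_repr_independence' x r by simp
  qed
  moreover have "x \<in> N +>\<^bsub>M\<^esub> x" using N.a_rcos_self x by simp
  ultimately show ?thesis by blast
qed

lemma coset_eq_iff: assumes "submodule N R M" "x \<in> carrier M" shows "N +>\<^bsub>M\<^esub> x = N \<longleftrightarrow> x \<in> N"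
  using a_coset_join1[of N x] a_coset_join2[of x N] submodule.axioms(1)[OF assms(1)] assms(2) by blast

end

lemma module_quotient: assumes M: "module R M" and N: "submodule N R M"
  shows "module R (quotient_module M N)"
proof -
  interpret module R M by fact
  show ?thesis
    by (rule module_of_surj[where f = "(+>\<^bsub>M\<^esub>) N", OF module_axioms])
      (use coset_im coset_add[OF N] coset_smult[OF N] coset_eq_iff[OF N] submodule_zero[OF N] in simp_all)
qed

lemma length_quotient: assumes M: "module R M" and N: "submodule N R M"
  shows "module_length R (quotient_module M N) = chain_len (submodules R M) N (carrier M)"
proof -
  interpret module R M by fact
  have "module_length R (quotient_module M N) =
      chain_len (submodules R M) {x \<in> carrier M. N +>\<^bsub>M\<^esub> x = \<zero>\<^bsub>quotient_module M N\<^esub>} (carrier M)"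
    by (rule length_of_surj[where f = "(+>\<^bsub>M\<^esub>) N", OF module_axioms])
      (use coset_im coset_add[OF N] coset_smult[OF N] coset_eq_iff[OF N] submodule_zero[OF N] in simp_all)
  moreover have "{x \<in> carrier M. N +>\<^bsub>M\<^esub> x = \<zero>\<^bsub>quotient_module M N\<^esub>} = N"
    using coset_eq_iff[OF N] N by (auto simp: submodule_iff)
  ultimately show ?thesis by simp
qed

section \<open>Homomorphisms and free modules\<close>

lemma module_homs_E:
  assumes "f \<in> module_homs R M N"
  shows "x \<in> carrier M \<Longrightarrow> f x \<in> carrier N" "x \<in> carrier M \<Longrightarrow> y \<in> carrier M \<Longrightarrow> f (x \<oplus>\<^bsub>M\<^esub> y) = f x \<oplus>\<^bsub>N\<^esub> f y"
    "r \<in> carrier R \<Longrightarrow> x \<in> carrier M \<Longrightarrow> f (r \<odot>\<^bsub>M\<^esub> x) = r \<odot>\<^bsub>N\<^esub> f x" "f \<in> extensional (carrier M)"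
  using assms by (auto simp: module_homs_def PiE_def)

lemma module_homs_I:
  assumes "\<And>x. x \<in> carrier M \<Longrightarrow> f x \<in> carrier N" "f \<in> extensional (carrier M)"
    "\<And>x y. x \<in> carrier M \<Longrightarrow> y \<in> carrier M \<Longrightarrow> f (x \<oplus>\<^bsub>M\<^esub> y) = f x \<oplus>\<^bsub>N\<^esub> f y"
    "\<And>r x. r \<in> carrier R \<Longrightarrow> x \<in> carrier M \<Longrightarrow> f (r \<odot>\<^bsub>M\<^esub> x) = r \<odot>\<^bsub>N\<^esub> f x"
  shows "f \<in> module_homs R M N"
  using assms by (auto simp: module_homs_def PiE_def)

lemma hom_module_simps [simp]: "carrier (hom_module R M N) = module_homs R M N"
  "\<zero>\<^bsub>hom_module R M N\<^esub> = (\<lambda>x\<in>carrier M. \<zero>\<^bsub>N\<^esub>)"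
  "add (hom_module R M N) = (\<lambda>f g. \<lambda>x\<in>carrier M. f x \<oplus>\<^bsub>N\<^esub> g x)"
  "smult (hom_module R M N) = (\<lambda>r f. \<lambda>x\<in>carrier M. r \<odot>\<^bsub>N\<^esub> f x)"
  by (simp_all add: hom_module_def)

lemma module_hom_module:
  assumes M: "module R M" and N: "module R N"
  shows "module R (hom_module R M N)"
proof -
  interpret R: cring R using M by (simp add: module_def)
  interpret M: module R M by fact
  interpret N: module R N by fact
  have addc: "(\<lambda>x\<in>carrier M. f x \<oplus>\<^bsub>N\<^esub> g x) \<in> module_homs R M N"
    if "f \<in> module_homs R M N" "g \<in> module_homs R M N" for f g
    using module_homs_E[OF that(1)] module_homs_E[OF that(2)]
    by (intro module_homs_I) (auto simp: N.a_ac N.smult_r_distr)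
  have smc: "(\<lambda>x\<in>carrier M. r \<odot>\<^bsub>N\<^esub> f x) \<in> module_homs R M N"
    if "r \<in> carrier R" "f \<in> module_homs R M N" for r f
    using module_homs_E[OF that(2)] that(1)
    by (intro module_homs_I) (auto simp: N.smult_r_distr N.smult_assoc1[symmetric] R.m_comm)
  have zc: "(\<lambda>x\<in>carrier M. \<zero>\<^bsub>N\<^esub>) \<in> module_homs R M N"
    by (intro module_homs_I) auto
  have ext: "f = g" if "f \<in> module_homs R M N" "g \<in> extensional (carrier M)"
      "\<And>x. x \<in> carrier M \<Longrightarrow> f x = g x" for f g
    using that module_homs_E(4)[OF that(1)] by (intro extensionalityI[of f "carrier M"])
  show ?thesis
  proof (rule moduleI)
    show "cring R" using M by (simp add: module_def)
    show "abelian_group (hom_module R M N)"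
    proof (rule abelian_groupI)
      fix f assume f: "f \<in> carrier (hom_module R M N)"
      hence f': "f \<in> module_homs R M N" by simp
      note fE = module_homs_E[OF f']
      show "\<zero>\<^bsub>hom_module R M N\<^esub> \<oplus>\<^bsub>hom_module R M N\<^esub> f = f"
        using fE by (intro ext[symmetric, OF f']) auto
      have "(\<lambda>x\<in>carrier M. (\<ominus>\<^bsub>R\<^esub> \<one>\<^bsub>R\<^esub>) \<odot>\<^bsub>N\<^esub> f x) \<oplus>\<^bsub>hom_module R M N\<^esub> f = \<zero>\<^bsub>hom_module R M N\<^esub>"
        using fE by (auto simp: N.smult_l_minus N.l_neg)
      thus "\<exists>g\<in>carrier (hom_module R M N). g \<oplus>\<^bsub>hom_module R M N\<^esub> f = \<zero>\<^bsub>hom_module R M N\<^esub>"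
        using smc[OF _ f', of "\<ominus>\<^bsub>R\<^esub> \<one>\<^bsub>R\<^esub>"] by (metis R.a_inv_closed R.one_closed hom_module_simps(1))
    qed (use addc zc in \<open>auto dest!: module_homs_E(1) simp: N.a_ac intro!: restrict_ext\<close>)
  next
    fix f assume "f \<in> carrier (hom_module R M N)"
    hence f: "f \<in> module_homs R M N" by simp
    show "\<one>\<^bsub>R\<^esub> \<odot>\<^bsub>hom_module R M N\<^esub> f = f"
      using module_homs_E(1)[OF f] by (intro ext[symmetric, OF f]) auto
  qed (use addc smc in \<open>auto dest!: module_homs_E(1) simp: N.smult_l_distr N.smult_r_distr N.smult_assoc1 intro!: restrict_ext\<close>)
qed

lemma free_module_simps [simp]:
  "carrier (free_module R B) = {v. (\<forall>x. v x \<in> carrier R) \<and> {x. v x \<noteq> \<zero>\<^bsub>R\<^esub>} \<subseteq> B \<and>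
       finite {x. v x \<noteq> \<zero>\<^bsub>R\<^esub>}}"
  "\<zero>\<^bsub>free_module R B\<^esub> = (\<lambda>x. \<zero>\<^bsub>R\<^esub>)"
  "add (free_module R B) = (\<lambda>v w x. v x \<oplus>\<^bsub>R\<^esub> w x)"
  "smult (free_module R B) = (\<lambda>r v x. r \<otimes>\<^bsub>R\<^esub> v x)"
  by (simp_all add: free_module_def)

lemma (in cring) module_free_module: "module R (free_module R B)"
proof -
  have fin: "finite {x. f x \<noteq> \<zero>} \<and> {x. f x \<noteq> \<zero>} \<subseteq> B"
    if "{x. f x \<noteq> \<zero>} \<subseteq> {x. v x \<noteq> \<zero>} \<union> {x. w x \<noteq> \<zero>}" "v \<in> carrier (free_module R B)"
      "w \<in> carrier (free_module R B)" for f v w :: "'c \<Rightarrow> 'a"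
    using that finite_subset[OF that(1)] by auto
  have addc: "(\<lambda>x. v x \<oplus> w x) \<in> carrier (free_module R B)"
    if "v \<in> carrier (free_module R B)" "w \<in> carrier (free_module R B)" for v w :: "'c \<Rightarrow> 'a"
    using that fin[of "\<lambda>x. v x \<oplus> w x" v w] by fastforce
  have smc: "(\<lambda>x. r \<otimes> v x) \<in> carrier (free_module R B)"
    if "r \<in> carrier R" "v \<in> carrier (free_module R B)" for r and v :: "'c \<Rightarrow> 'a"
    using that fin[of "\<lambda>x. r \<otimes> v x" v v] by fastforce
  show ?thesis
  proof (rule moduleI[OF is_cring])
    show "abelian_group (free_module R B)"
    proof (rule abelian_groupI)
      fix v assume v: "v \<in> carrier (free_module R B)"
      have "(\<lambda>x. \<ominus> \<one> \<otimes> v x) \<oplus>\<^bsub>free_module R B\<^esub> v = \<zero>\<^bsub>free_module R B\<^esub>"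
        using v by (auto simp: l_minus l_neg)
      thus "\<exists>w\<in>carrier (free_module R B). w \<oplus>\<^bsub>free_module R B\<^esub> v = \<zero>\<^bsub>free_module R B\<^esub>"
        using smc[OF _ v, of "\<ominus> \<one>"] by blast
    next
      fix v w assume "v \<in> carrier (free_module R B)" "w \<in> carrier (free_module R B)"
      thus "v \<oplus>\<^bsub>free_module R B\<^esub> w \<in> carrier (free_module R B)" using addc by (simp only: free_module_simps(3))
    qed (auto simp: a_ac)
  next
    fix r v assume "r \<in> carrier R" "v \<in> carrier (free_module R B)"
    thus "r \<odot>\<^bsub>free_module R B\<^esub> v \<in> carrier (free_module R B)" using smc by (simp only: free_module_simps(4))
  qed (auto simp: l_distr r_distr m_assoc)
qed

section \<open>Ext of the residue field\<close>

lemma chain_len_cong: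
  assumes "\<And>N. A \<subseteq> N \<Longrightarrow> N \<subseteq> B \<Longrightarrow> N \<in> F \<longleftrightarrow> N \<in> G"
  shows "chain_len F A B = chain_len G A B"
proof -
  have "N \<in> F \<and> A \<subseteq> N \<and> N \<subseteq> B \<longleftrightarrow> N \<in> G \<and> A \<subseteq> N \<and> N \<subseteq> B" for N
    using assms[of N] by blast
  hence "chain_in F A B n N \<longleftrightarrow> chain_in G A B n N" for n N
    by (simp only: chain_in_def)
  thus ?thesis by (simp add: chain_len_def)
qed

definition restrict_scalars :: "('b, 'n) ring_scheme \<Rightarrow> ('a \<Rightarrow> 'b) \<Rightarrow> ('a, 'b) module" where
  "restrict_scalars P h = \<lparr>carrier = carrier P, monoid.mult = undefined, one = undefined,
     ring.zero = \<zero>\<^bsub>P\<^esub>, add = add P, smult = (\<lambda>s x. h s \<otimes>\<^bsub>P\<^esub> x)\<rparr>"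

lemma restrict_scalars_simps [simp]: "carrier (restrict_scalars P h) = carrier P"
  "\<zero>\<^bsub>restrict_scalars P h\<^esub> = \<zero>\<^bsub>P\<^esub>" "add (restrict_scalars P h) = add P"
  "smult (restrict_scalars P h) = (\<lambda>s x. h s \<otimes>\<^bsub>P\<^esub> x)"
  by (simp_all add: restrict_scalars_def)

lemma module_restrict_scalars:
  assumes "cring R" "cring P" "h \<in> ring_hom R P"
  shows "module R (restrict_scalars P h)"
proof -
  interpret R: cring R by fact
  interpret P: cring P by fact
  interpret h: ring_hom_cring R P h
    using assms by (simp add: ring_hom_cring_def ring_hom_cring_axioms_def)
  show ?thesis
  proof (rule moduleI[OF assms(1)])
    show "abelian_group (restrict_scalars P h)"
      by (rule abelian_groupI) (auto simp: P.a_ac intro: P.l_neg)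
  qed (auto simp: P.l_distr P.r_distr P.m_assoc)
qed

lemma submodules_restrict_scalars:
  assumes "cring R" "cring P" "h \<in> ring_hom R P"
  shows "submodules R (restrict_scalars P h) = submods P (h ` carrier R)"
proof -
  interpret M: module R "restrict_scalars P h" using module_restrict_scalars[OF assms] .
  show ?thesis by (auto simp: M.submodule_iff submods_def)
qed

context one_dim_cm
begin

abbreviation "\<kappa> \<equiv> quotient_module (ring_module R) \<mm>"
abbreviation "F\<kappa> \<equiv> free_module R (carrier \<kappa>)"
abbreviation "K\<kappa> \<equiv> relation_module R \<kappa>"

lemma m_submodule: "submodule \<mm> R (ring_module R)"
proof -
  interpret M: module R "ring_module R" using module_ring_module .
  interpret ideal \<mm> R using m_ideal .
  show ?thesis unfolding M.submodule_iff using m_sub by (auto simp: I_l_closed)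
qed

lemma module_residue: "module R \<kappa>"
  using module_quotient[OF module_ring_module m_submodule] .

abbreviation res :: "'a \<Rightarrow> 'a set" where "res x \<equiv> \<mm> +>\<^bsub>ring_module R\<^esub> x"

lemma res_props:
  "res ` carrier R = carrier \<kappa>"
  "x \<in> carrier R \<Longrightarrow> y \<in> carrier R \<Longrightarrow> res (x \<oplus> y) = res x \<oplus>\<^bsub>\<kappa>\<^esub> res y"
  "r \<in> carrier R \<Longrightarrow> x \<in> carrier R \<Longrightarrow> res (r \<otimes> x) = r \<odot>\<^bsub>\<kappa>\<^esub> res x"
  "x \<in> carrier R \<Longrightarrow> res x = \<zero>\<^bsub>\<kappa>\<^esub> \<longleftrightarrow> x \<in> \<mm>"
proof -
  interpret M: module R "ring_module R" using module_ring_module .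
  show "res ` carrier R = carrier \<kappa>" using M.coset_im by simp
  show "x \<in> carrier R \<Longrightarrow> y \<in> carrier R \<Longrightarrow> res (x \<oplus> y) = res x \<oplus>\<^bsub>\<kappa>\<^esub> res y"
    using M.coset_add[OF m_submodule] by simp
  show "r \<in> carrier R \<Longrightarrow> x \<in> carrier R \<Longrightarrow> res (r \<otimes> x) = r \<odot>\<^bsub>\<kappa>\<^esub> res x"
    using M.coset_smult[OF m_submodule] by simp
  show "x \<in> carrier R \<Longrightarrow> res x = \<zero>\<^bsub>\<kappa>\<^esub> \<longleftrightarrow> x \<in> \<mm>"
    using M.coset_eq_iff[OF m_submodule] by simp
qed

text \<open>The choice of \<open>\<one>\<close> for its own class makes \<open>lift\<close> below invert \<open>unitv\<close>.\<close>

definition rep :: "'a set \<Rightarrow> 'a" where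
  "rep c = (if c = res \<one> then \<one> else SOME x. x \<in> carrier R \<and> res x = c)"

lemma rep: assumes "c \<in> carrier \<kappa>" shows "rep c \<in> carrier R" "res (rep c) = c"
proof -
  obtain x where "x \<in> carrier R \<and> res x = c" using assms res_props(1) by (metis (no_types, lifting) imageE)
  hence "(SOME x. x \<in> carrier R \<and> res x = c) \<in> carrier R \<and> res (SOME x. x \<in> carrier R \<and> res x = c) = c"
    by (rule someI)
  thus "rep c \<in> carrier R" "res (rep c) = c" by (auto simp: rep_def)
qed

text \<open>A linear lift to \<open>R\<close> of the surjection from the free module onto the residue field.\<close>

definition lift :: "('a set \<Rightarrow> 'a) \<Rightarrow> 'a" where
  "lift v = (\<Oplus>c\<in>{c. v c \<noteq> \<zero>}. v c \<otimes> rep c)"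

lemma F_E: assumes "v \<in> carrier F\<kappa>"
  shows "v c \<in> carrier R" "finite {c. v c \<noteq> \<zero>}" "v c \<noteq> \<zero> \<Longrightarrow> c \<in> carrier \<kappa>"
  using assms by auto

lemma lift_eq:
  assumes v: "v \<in> carrier F\<kappa>" and T: "finite T" "T \<subseteq> carrier \<kappa>" "{c. v c \<noteq> \<zero>} \<subseteq> T"
  shows "lift v = (\<Oplus>c\<in>T. v c \<otimes> rep c)"
  unfolding lift_def
proof (rule add.finprod_mono_neutral_cong_left[OF T(1,3)])
  show "v c \<otimes> rep c = \<zero>" if "c \<in> T - {c. v c \<noteq> \<zero>}" for c
    using that T(2) rep(1)[of c] by auto
  show "(\<lambda>c. v c \<otimes> rep c) \<in> T \<rightarrow> carrier R" using F_E(1)[OF v] T(2) rep(1) by auto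
qed simp

lemma lift_closed: assumes v: "v \<in> carrier F\<kappa>" shows "lift v \<in> carrier R"
  unfolding lift_def using F_E[OF v] rep(1) by (intro finsum_closed) auto

lemma lift_add:
  assumes v: "v \<in> carrier F\<kappa>" and w: "w \<in> carrier F\<kappa>"
  shows "lift (v \<oplus>\<^bsub>F\<kappa>\<^esub> w) = lift v \<oplus> lift w"
proof -
  interpret F: module R F\<kappa> using module_free_module .
  let ?T = "{c. v c \<noteq> \<zero>} \<union> {c. w c \<noteq> \<zero>}"
  have T: "finite ?T" "?T \<subseteq> carrier \<kappa>" using F_E(2,3)[OF v] F_E(2,3)[OF w] by auto
  have vw: "v \<oplus>\<^bsub>F\<kappa>\<^esub> w \<in> carrier F\<kappa>" using v w by (rule F.M.a_closed)
  have sup: "{c. (v \<oplus>\<^bsub>F\<kappa>\<^esub> w) c \<noteq> \<zero>} \<subseteq> ?T" by auto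
  have cl: "v c \<otimes> rep c \<in> carrier R" "w c \<otimes> rep c \<in> carrier R" if "c \<in> ?T" for c
    using F_E(1)[OF v] F_E(1)[OF w] rep(1)[of c] T(2) that by blast+
  have "lift (v \<oplus>\<^bsub>F\<kappa>\<^esub> w) = (\<Oplus>c\<in>?T. (v \<oplus>\<^bsub>F\<kappa>\<^esub> w) c \<otimes> rep c)" using lift_eq[OF vw T sup] .
  also have "\<dots> = (\<Oplus>c\<in>?T. v c \<otimes> rep c \<oplus> w c \<otimes> rep c)"
  proof (rule add.finprod_cong')
    fix c assume c: "c \<in> ?T"
    hence "rep c \<in> carrier R" using T(2) rep(1) by blast
    thus "(v \<oplus>\<^bsub>F\<kappa>\<^esub> w) c \<otimes> rep c = v c \<otimes> rep c \<oplus> w c \<otimes> rep c"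
      using F_E(1)[OF v] F_E(1)[OF w] by (simp add: l_distr)
  qed (use cl in auto)
  also have "\<dots> = (\<Oplus>c\<in>?T. v c \<otimes> rep c) \<oplus> (\<Oplus>c\<in>?T. w c \<otimes> rep c)"
    using cl by (intro finsum_addf) auto
  also have "\<dots> = lift v \<oplus> lift w" using lift_eq[OF v T] lift_eq[OF w T] by simp
  finally show ?thesis .
qed

lemma lift_smult:
  assumes r: "r \<in> carrier R" and v: "v \<in> carrier F\<kappa>"
  shows "lift (r \<odot>\<^bsub>F\<kappa>\<^esub> v) = r \<otimes> lift v"
proof -
  interpret F: module R F\<kappa> using module_free_module .
  let ?T = "{c. v c \<noteq> \<zero>}"
  have T: "finite ?T" "?T \<subseteq> carrier \<kappa>" using F_E(2,3)[OF v] by auto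
  have rv: "r \<odot>\<^bsub>F\<kappa>\<^esub> v \<in> carrier F\<kappa>" using r v by (rule F.smult_closed)
  have sup: "{c. (r \<odot>\<^bsub>F\<kappa>\<^esub> v) c \<noteq> \<zero>} \<subseteq> ?T" using r by auto
  have cl: "v c \<otimes> rep c \<in> carrier R" if "c \<in> ?T" for c
    using F_E(1)[OF v] rep(1)[of c] T(2) that by blast
  have "lift (r \<odot>\<^bsub>F\<kappa>\<^esub> v) = (\<Oplus>c\<in>?T. (r \<odot>\<^bsub>F\<kappa>\<^esub> v) c \<otimes> rep c)" using lift_eq[OF rv T sup] .
  also have "\<dots> = (\<Oplus>c\<in>?T. r \<otimes> (v c \<otimes> rep c))"
  proof (rule add.finprod_cong')
    fix c assume c: "c \<in> ?T"
    hence "rep c \<in> carrier R" using T(2) rep(1) by blast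
    thus "(r \<odot>\<^bsub>F\<kappa>\<^esub> v) c \<otimes> rep c = r \<otimes> (v c \<otimes> rep c)"
      using F_E(1)[OF v] r by (simp add: m_assoc)
  qed (use cl r in auto)
  also have "\<dots> = r \<otimes> lift v" unfolding lift_def using cl r T(1) by (intro finsum_rdistr[symmetric]) auto
  finally show ?thesis .
qed

lemma res_lift:
  assumes v: "v \<in> carrier F\<kappa>"
  shows "(\<Oplus>\<^bsub>\<kappa>\<^esub>c\<in>{c. v c \<noteq> \<zero>}. v c \<odot>\<^bsub>\<kappa>\<^esub> c) = res (lift v)"
proof -
  interpret K: module R \<kappa> using module_residue .
  have "res (\<Oplus>c\<in>T. v c \<otimes> rep c) = (\<Oplus>\<^bsub>\<kappa>\<^esub>c\<in>T. v c \<odot>\<^bsub>\<kappa>\<^esub> c)" if "finite T" "T \<subseteq> carrier \<kappa>" for T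
    using that
  proof (induction T)
    case empty
    thus ?case using res_props(4)[of \<zero>] O.SM_zero[of \<mm>] m_ideal submods_self by simp
  next
    case (insert c T)
    have cl: "v c \<otimes> rep c \<in> carrier R" "v c \<odot>\<^bsub>\<kappa>\<^esub> c \<in> carrier \<kappa>" if "c \<in> carrier \<kappa>" for c
      using m_closed[OF F_E(1)[OF v] rep(1)[OF that]] K.smult_closed[OF F_E(1)[OF v] that] by blast+
    have e: "res (v c \<otimes> rep c) = v c \<odot>\<^bsub>\<kappa>\<^esub> c"
      using res_props(3)[OF F_E(1)[OF v] rep(1)[of c]] rep(2)[of c] insert.prems by simp
    have "res (\<Oplus>c\<in>insert c T. v c \<otimes> rep c) = res (v c \<otimes> rep c \<oplus> (\<Oplus>c\<in>T. v c \<otimes> rep c))"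
      using insert cl by (subst finsum_insert) auto
    also have "\<dots> = res (v c \<otimes> rep c) \<oplus>\<^bsub>\<kappa>\<^esub> res (\<Oplus>c\<in>T. v c \<otimes> rep c)"
      using insert cl by (intro res_props(2) finsum_closed) auto
    also have "\<dots> = v c \<odot>\<^bsub>\<kappa>\<^esub> c \<oplus>\<^bsub>\<kappa>\<^esub> (\<Oplus>\<^bsub>\<kappa>\<^esub>c\<in>T. v c \<odot>\<^bsub>\<kappa>\<^esub> c)" using e insert by simp
    also have "\<dots> = (\<Oplus>\<^bsub>\<kappa>\<^esub>c\<in>insert c T. v c \<odot>\<^bsub>\<kappa>\<^esub> c)"
      using insert cl by (subst K.M.finsum_insert) auto
    finally show ?case .
  qed
  from this[of "{c. v c \<noteq> \<zero>}"] show ?thesis using F_E(2,3)[OF v] unfolding lift_def by auto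
qed

text \<open>The sum over a vector with the residue classes as coordinates is the class of its lift, so the relations are the vectors
  whose lift is in \<open>\<mm>\<close>.\<close>

lemma carrier_relations: "carrier K\<kappa> = {v \<in> carrier F\<kappa>. lift v \<in> \<mm>}"
proof -
  have "carrier K\<kappa> = {v \<in> carrier F\<kappa>. res (lift v) = \<zero>\<^bsub>\<kappa>\<^esub>}"
    unfolding relation_module_def using res_lift by auto
  thus ?thesis using res_props(4) lift_closed by auto
qed

lemma relation_ops: "add K\<kappa> = add F\<kappa>" "\<zero>\<^bsub>K\<kappa>\<^esub> = \<zero>\<^bsub>F\<kappa>\<^esub>" "smult K\<kappa> = smult F\<kappa>"
  by (simp_all add: relation_module_def)

lemma module_relations: "module R K\<kappa>"
proof -
  interpret F: module R F\<kappa> using module_free_module .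
  have mS: "\<mm> \<in> O.SM" using m_ideal submods_self by simp
  have "lift \<zero>\<^bsub>F\<kappa>\<^esub> = \<zero>" by (simp add: lift_def)
  hence "submodule (carrier K\<kappa>) R F\<kappa>"
    unfolding F.submodule_iff carrier_relations
    using lift_add lift_smult O.SM_add[OF mS] O.SM_smult[OF mS] O.SM_zero[OF mS] F.M.a_closed F.smult_closed F.M.zero_closed
    by (simp del: free_module_simps)
  from submodule.submodule_is_module[OF this F.module_axioms]
  show ?thesis by (simp add: relation_module_def)
qed

definition unitv :: "'a \<Rightarrow> 'a set \<Rightarrow> 'a" where
  "unitv r = (\<lambda>c. if c = res \<one> then r else \<zero>)"

lemma unitv_closed: assumes "r \<in> carrier R" shows "unitv r \<in> carrier F\<kappa>"
proof -
  have s: "{c. unitv r c \<noteq> \<zero>} \<subseteq> {res \<one>}" by (auto simp: unitv_def)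
  moreover have "res \<one> \<in> carrier \<kappa>" using res_props(1) by blast
  ultimately show ?thesis using assms finite_subset[OF s] by (auto simp: unitv_def)
qed

lemma lift_unitv: assumes r: "r \<in> carrier R" shows "lift (unitv r) = r"
proof -
  have "res \<one> \<in> carrier \<kappa>" using res_props(1) by blast
  hence "lift (unitv r) = (\<Oplus>c\<in>{res \<one>}. unitv r c \<otimes> rep c)"
    by (intro lift_eq unitv_closed r) (auto simp: unitv_def)
  thus ?thesis using r by (simp add: unitv_def rep_def)
qed

lemma unitv_add: "unitv (r \<oplus> s) = unitv r \<oplus>\<^bsub>F\<kappa>\<^esub> unitv s" if "r \<in> carrier R" "s \<in> carrier R"
  by (auto simp: unitv_def)

lemma unitv_smult: "unitv (r \<otimes> s) = r \<odot>\<^bsub>F\<kappa>\<^esub> unitv s" if "r \<in> carrier R"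
  using that by (auto simp: unitv_def)

end

context one_dim_cm
begin

lemma relation_carrier_F: "v \<in> carrier K\<kappa> \<Longrightarrow> v \<in> carrier F\<kappa>"
  by (simp only: carrier_relations mem_Collect_eq)

lemma restriction_submodule:
  assumes M: "module R M"
  shows "submodule ((\<lambda>g. restrict g (carrier K\<kappa>)) ` module_homs R F\<kappa> M) R (hom_module R K\<kappa> M)"
    (is "submodule ?B R ?H")
proof -
  interpret M: module R M by fact
  interpret F: module R F\<kappa> using module_free_module .
  interpret K: module R K\<kappa> using module_relations .
  interpret H: module R ?H using module_hom_module[OF module_relations M] .
  interpret FM: module R "hom_module R F\<kappa> M" using module_hom_module[OF module_free_module M] .
  have KF: "v \<in> carrier F\<kappa>" if "v \<in> carrier K\<kappa>" for v using relation_carrier_F[OF that] .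
  have Bc: "restrict g (carrier K\<kappa>) \<in> module_homs R K\<kappa> M" if g: "g \<in> module_homs R F\<kappa> M" for g
  proof (rule module_homs_I)
    fix x assume x: "x \<in> carrier K\<kappa>"
    show "restrict g (carrier K\<kappa>) x \<in> carrier M" using module_homs_E(1)[OF g KF[OF x]] x by simp
    fix y assume y: "y \<in> carrier K\<kappa>"
    have "x \<oplus>\<^bsub>K\<kappa>\<^esub> y \<in> carrier K\<kappa>" using x y by (rule K.M.a_closed)
    thus "restrict g (carrier K\<kappa>) (x \<oplus>\<^bsub>K\<kappa>\<^esub> y) =
        restrict g (carrier K\<kappa>) x \<oplus>\<^bsub>M\<^esub> restrict g (carrier K\<kappa>) y"
      using module_homs_E(2)[OF g KF[OF x] KF[OF y]] x y by (simp only: restrict_apply' relation_ops)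
  next
    fix r x assume r: "r \<in> carrier R" and x: "x \<in> carrier K\<kappa>"
    have "r \<odot>\<^bsub>K\<kappa>\<^esub> x \<in> carrier K\<kappa>" using r x by (rule K.smult_closed)
    thus "restrict g (carrier K\<kappa>) (r \<odot>\<^bsub>K\<kappa>\<^esub> x) = r \<odot>\<^bsub>M\<^esub> restrict g (carrier K\<kappa>) x"
      using module_homs_E(3)[OF g r KF[OF x]] x by (simp only: restrict_apply' relation_ops)
  qed simp
  show ?thesis unfolding H.submodule_iff
  proof (intro conjI ballI)
    show "?B \<subseteq> carrier ?H" using Bc by auto
    have "\<zero>\<^bsub>?H\<^esub> = restrict \<zero>\<^bsub>hom_module R F\<kappa> M\<^esub> (carrier K\<kappa>)"
      unfolding hom_module_simps using KF by (intro extensionalityI[of _ "carrier K\<kappa>"]) (simp_all only: restrict_apply' restrict_extensional)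
    thus "\<zero>\<^bsub>?H\<^esub> \<in> ?B" using FM.M.zero_closed by (metis hom_module_simps(1) image_eqI)
  next
    fix f g assume "f \<in> ?B" "g \<in> ?B"
    then obtain f' g' where fg: "f' \<in> module_homs R F\<kappa> M" "g' \<in> module_homs R F\<kappa> M"
      "f = restrict f' (carrier K\<kappa>)" "g = restrict g' (carrier K\<kappa>)" by blast
    have "f \<oplus>\<^bsub>?H\<^esub> g = restrict (f' \<oplus>\<^bsub>hom_module R F\<kappa> M\<^esub> g') (carrier K\<kappa>)"
      unfolding hom_module_simps fg(3,4) using KF
      by (intro extensionalityI[of _ "carrier K\<kappa>"]) (simp_all only: restrict_apply' restrict_extensional)
    moreover have "f' \<oplus>\<^bsub>hom_module R F\<kappa> M\<^esub> g' \<in> module_homs R F\<kappa> M"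
      using FM.M.a_closed[of f' g'] fg by (simp only: hom_module_simps(1))
    ultimately show "f \<oplus>\<^bsub>?H\<^esub> g \<in> ?B" by blast
  next
    fix r f assume r: "r \<in> carrier R" "f \<in> ?B"
    then obtain f' where f: "f' \<in> module_homs R F\<kappa> M" "f = restrict f' (carrier K\<kappa>)" by blast
    have "r \<odot>\<^bsub>?H\<^esub> f = restrict (r \<odot>\<^bsub>hom_module R F\<kappa> M\<^esub> f') (carrier K\<kappa>)"
      unfolding hom_module_simps f(2) using KF
      by (intro extensionalityI[of _ "carrier K\<kappa>"]) (simp_all only: restrict_apply' restrict_extensional)
    moreover have "r \<odot>\<^bsub>hom_module R F\<kappa> M\<^esub> f' \<in> module_homs R F\<kappa> M"
      using FM.smult_closed[of r f'] f r by (simp only: hom_module_simps(1))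
    ultimately show "r \<odot>\<^bsub>?H\<^esub> f \<in> ?B" by blast
  qed
qed

text \<open>An element \<open>q\<close> of \<open>(M : \<mm>)\<close> gives the homomorphism \<open>v \<mapsto> lift v \<cdot> q\<close> on the relations, whose
  lifts are in \<open>\<mm>\<close>. It extends to the free module precisely for \<open>q \<in> M\<close>, and up to restrictions of
  homomorphisms of the free module every homomorphism has this form.\<close>

theorem module_type_colon:
  assumes P: "cring P" and h: "h \<in> ring_hom R P"
    and reg: "\<exists>r\<in>\<mm>. h r \<in> Units P" and M: "module R M"
    and \<iota>c: "\<And>m. m \<in> carrier M \<Longrightarrow> \<iota> m \<in> carrier P" and \<iota>inj: "inj_on \<iota> (carrier M)"
    and \<iota>add: "\<And>x y. x \<in> carrier M \<Longrightarrow> y \<in> carrier M \<Longrightarrow> \<iota> (x \<oplus>\<^bsub>M\<^esub> y) = \<iota> x \<oplus>\<^bsub>P\<^esub> \<iota> y"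
    and \<iota>sm: "\<And>r x. r \<in> carrier R \<Longrightarrow> x \<in> carrier M \<Longrightarrow> \<iota> (r \<odot>\<^bsub>M\<^esub> x) = h r \<otimes>\<^bsub>P\<^esub> \<iota> x"
  shows "module_type R M =
    mlen P (h ` carrier R) (\<iota> ` carrier M) (colonq P (\<iota> ` carrier M) (h ` \<mm>))"
proof -
  interpret P: cring P by fact
  interpret M: module R M by fact
  interpret F: module R F\<kappa> using module_free_module .
  interpret K: module R K\<kappa> using module_relations .
  interpret h: ring_hom_cring R P h
    using h P is_cring by (simp add: ring_hom_cring_def ring_hom_cring_axioms_def)
  have sub: "subring (h ` carrier R) P"
    using ring_hom_ring.img_is_subring[OF ring_hom_ringI2[OF ring_axioms P.ring_axioms h] carrier_is_subring] .
  interpret V: over_ring P "h ` carrier R"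
    using P sub by (simp add: over_ring_def over_ring_axioms_def)
  let ?H = "hom_module R K\<kappa> M"
  let ?B = "(\<lambda>g. restrict g (carrier K\<kappa>)) ` module_homs R F\<kappa> M"
  have Hm: "module R ?H" using module_hom_module[OF module_relations M] .
  interpret H: module R ?H by fact
  have B: "submodule ?B R ?H" using restriction_submodule[OF M] .
  interpret B: abelian_subgroup ?B ?H using H.submodule_abelian_subgroup[OF B] .
  define Y where "Y = \<iota> ` carrier M"
  have YS: "Y \<in> V.SM"
  proof (rule V.SM_I)
    have "\<iota> \<zero>\<^bsub>M\<^esub> = \<zero>\<^bsub>P\<^esub>" using \<iota>sm[of \<zero> "\<zero>\<^bsub>M\<^esub>"] \<iota>c by simp
    thus "\<zero>\<^bsub>P\<^esub> \<in> Y" unfolding Y_def by (metis M.M.zero_closed image_eqI)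
    fix x y assume "x \<in> Y" "y \<in> Y"
    then obtain a b where "a \<in> carrier M" "b \<in> carrier M" "x = \<iota> a" "y = \<iota> b" by (auto simp: Y_def)
    thus "x \<oplus>\<^bsub>P\<^esub> y \<in> Y" unfolding Y_def by (simp add: \<iota>add[symmetric])
  next
    fix r x assume "r \<in> h ` carrier R" "x \<in> Y"
    then obtain a b where "a \<in> carrier R" "b \<in> carrier M" "r = h a" "x = \<iota> b" by (auto simp: Y_def)
    thus "r \<otimes>\<^bsub>P\<^esub> x \<in> Y" unfolding Y_def by (simp add: \<iota>sm[symmetric])
  qed (use \<iota>c in \<open>auto simp: Y_def\<close>)
  define D where "D = colonq P Y (h ` \<mm>)"
  have DS: "D \<in> V.SM" unfolding D_def using m_sub by (intro V.SM_colon YS) auto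
  have Dc: "q \<in> carrier P" if "q \<in> D" for q using that by (auto simp: D_def colonq_def)
  have Dm: "q \<otimes>\<^bsub>P\<^esub> h s \<in> Y" if "q \<in> D" "s \<in> \<mm>" for q s using that by (auto simp: D_def colonq_def)
  let ?P = "restrict_scalars P h"
  let ?D = "?P\<lparr>carrier := D\<rparr>"
  interpret P': module R ?P using module_restrict_scalars[OF is_cring P h] .
  have Ds: "submodule D R ?P" using DS submodules_restrict_scalars[OF is_cring P h] by blast
  have Dmod: "module R ?D" using submodule.submodule_is_module[OF Ds P'.module_axioms] .
  interpret D: module R ?D by fact
  define \<eta> where "\<eta> = inv_into (carrier M) \<iota>"
  have \<eta>: "\<eta> y \<in> carrier M" "\<iota> (\<eta> y) = y" if "y \<in> Y" for y
    using that inv_into_into[of y \<iota> "carrier M"] f_inv_into_f[of y \<iota> "carrier M"]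
    by (auto simp: \<eta>_def Y_def)
  have \<iota>D: "x = y" if "\<iota> x = \<iota> y" "x \<in> carrier M" "y \<in> carrier M" for x y
    using \<iota>inj that by (auto dest: inj_onD)
  have Kl: "lift v \<in> \<mm>" if "v \<in> carrier K\<kappa>" for v
    using that by (simp only: carrier_relations mem_Collect_eq)
  have KF: "v \<in> carrier F\<kappa>" if "v \<in> carrier K\<kappa>" for v using relation_carrier_F[OF that] .
  have Kin: "v \<in> carrier K\<kappa>" if "v \<in> carrier F\<kappa>" "lift v \<in> \<mm>" for v
    using that by (simp only: carrier_relations mem_Collect_eq)
  have mc: "s \<in> carrier R" if "s \<in> \<mm>" for s using m_sub that by blast
  have unitvK: "unitv s \<in> carrier K\<kappa>" if "s \<in> \<mm>" for s
    using that lift_unitv[OF mc[OF that]] by (intro Kin unitv_closed mc) simp_all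
  define f where "f q = (\<lambda>v\<in>carrier K\<kappa>. \<eta> (q \<otimes>\<^bsub>P\<^esub> h (lift v)))" for q
  have \<iota>f: "\<iota> (f q v) = q \<otimes>\<^bsub>P\<^esub> h (lift v)" "f q v \<in> carrier M"
    if "q \<in> D" "v \<in> carrier K\<kappa>" for q v
    using \<eta>[OF Dm[OF that(1) Kl[OF that(2)]]] that(2) by (simp_all add: f_def)
  have Kadd: "v \<oplus>\<^bsub>K\<kappa>\<^esub> w \<in> carrier K\<kappa>" "lift (v \<oplus>\<^bsub>K\<kappa>\<^esub> w) = lift v \<oplus> lift w"
    if "v \<in> carrier K\<kappa>" "w \<in> carrier K\<kappa>" for v w
    using K.M.a_closed[OF that] lift_add[OF KF[OF that(1)] KF[OF that(2)]] by (simp_all only: relation_ops)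
  have Ksm: "r \<odot>\<^bsub>K\<kappa>\<^esub> v \<in> carrier K\<kappa>" "lift (r \<odot>\<^bsub>K\<kappa>\<^esub> v) = r \<otimes> lift v"
    if "r \<in> carrier R" "v \<in> carrier K\<kappa>" for r v
    using K.smult_closed[OF that] lift_smult[OF that(1) KF[OF that(2)]] by (simp_all only: relation_ops)
  have Klc: "lift v \<in> carrier R" if "v \<in> carrier K\<kappa>" for v using Kl[OF that] by (rule mc)
  have fH: "f q \<in> module_homs R K\<kappa> M" if q: "q \<in> D" for q
  proof (rule module_homs_I)
    fix v assume v: "v \<in> carrier K\<kappa>"
    show "f q v \<in> carrier M" using \<iota>f(2)[OF q v] .
    fix w assume w: "w \<in> carrier K\<kappa>"
    show "f q (v \<oplus>\<^bsub>K\<kappa>\<^esub> w) = f q v \<oplus>\<^bsub>M\<^esub> f q w"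
      by (rule \<iota>D) (simp_all add: \<iota>f[OF q] v w Kadd \<iota>add Klc Dc[OF q] P.r_distr)
  next
    fix r v assume r: "r \<in> carrier R" and v: "v \<in> carrier K\<kappa>"
    show "f q (r \<odot>\<^bsub>K\<kappa>\<^esub> v) = r \<odot>\<^bsub>M\<^esub> f q v"
      by (rule \<iota>D) (simp_all add: \<iota>f[OF q] v r Ksm \<iota>sm Klc Dc[OF q] P.m_lcomm)
  qed (simp add: f_def)
  have fext: "g = k" if "g \<in> module_homs R K\<kappa> M" "k \<in> extensional (carrier K\<kappa>)"
      "\<And>v. v \<in> carrier K\<kappa> \<Longrightarrow> \<iota> (g v) = \<iota> (k v) \<and> k v \<in> carrier M" for g k
    using that module_homs_E(1,4)[OF that(1)] by (intro extensionalityI[of g "carrier K\<kappa>"]) (auto intro: \<iota>D)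
  have fadd: "f (p \<oplus>\<^bsub>P\<^esub> q) = f p \<oplus>\<^bsub>?H\<^esub> f q" if p: "p \<in> D" and q: "q \<in> D" for p q
    using V.SM_add[OF DS p q]
    by (intro fext fH) (simp_all add: \<iota>f p q \<iota>add Dc Klc P.l_distr)
  have fsm: "f (h r \<otimes>\<^bsub>P\<^esub> q) = r \<odot>\<^bsub>?H\<^esub> f q" if r: "r \<in> carrier R" and q: "q \<in> D" for r q
    using V.SM_smult[OF DS _ q, of "h r"] r
    by (intro fext fH) (simp_all add: \<iota>f q \<iota>sm Dc Klc P.m_assoc)
  obtain r0 where r0: "r0 \<in> \<mm>" "h r0 \<in> Units P" using reg by blast
  have r0c: "r0 \<in> carrier R" using mc[OF r0(1)] .
  \<comment> \<open>An extension of \<open>f q\<close> to the free module has the value \<open>q\<close> at \<open>unitv \<one>\<close>: its value at the relation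
    \<open>unitv r0\<close> is \<open>r0\<close> times that, and \<open>r0\<close> can be cancelled.\<close>
  have fB: "f q \<in> ?B \<longleftrightarrow> q \<in> Y" if q: "q \<in> D" for q
  proof
    assume "f q \<in> ?B"
    then obtain g where g: "g \<in> module_homs R F\<kappa> M" "f q = restrict g (carrier K\<kappa>)" by blast
    have one: "unitv \<one> \<in> carrier F\<kappa>" by (rule unitv_closed) simp
    have "h r0 \<otimes>\<^bsub>P\<^esub> q = \<iota> (f q (unitv r0))"
      using \<iota>f(1)[OF q unitvK[OF r0(1)]] lift_unitv[OF r0c] Dc[OF q] r0c by (simp add: P.m_comm)
    also have "f q (unitv r0) = g (unitv (r0 \<otimes> \<one>))" using g(2) unitvK[OF r0(1)] r0c by simp
    also have "\<dots> = r0 \<odot>\<^bsub>M\<^esub> g (unitv \<one>)"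
      unfolding unitv_smult[OF r0c] using module_homs_E(3)[OF g(1) r0c one] .
    also have "\<iota> \<dots> = h r0 \<otimes>\<^bsub>P\<^esub> \<iota> (g (unitv \<one>))" using \<iota>sm[OF r0c module_homs_E(1)[OF g(1) one]] .
    finally have "q = \<iota> (g (unitv \<one>))"
      using P.Units_l_cancel[OF r0(2)] Dc[OF q] \<iota>c[OF module_homs_E(1)[OF g(1) one]] by simp
    thus "q \<in> Y" unfolding Y_def using module_homs_E(1)[OF g(1) one] by blast
  next
    assume "q \<in> Y"
    then obtain m where m: "m \<in> carrier M" "q = \<iota> m" by (auto simp: Y_def)
    define g where "g = (\<lambda>v\<in>carrier F\<kappa>. lift v \<odot>\<^bsub>M\<^esub> m)"
    have g: "g \<in> module_homs R F\<kappa> M"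
    proof (rule module_homs_I)
      fix v assume v: "v \<in> carrier F\<kappa>"
      show "g v \<in> carrier M" unfolding g_def restrict_apply'[OF v] using lift_closed[OF v] m(1) by (rule M.smult_closed)
      fix w assume w: "w \<in> carrier F\<kappa>"
      show "g (v \<oplus>\<^bsub>F\<kappa>\<^esub> w) = g v \<oplus>\<^bsub>M\<^esub> g w"
        unfolding g_def restrict_apply'[OF v] restrict_apply'[OF w] restrict_apply'[OF F.M.a_closed[OF v w]] lift_add[OF v w]
        using lift_closed[OF v] lift_closed[OF w] m(1) by (rule M.smult_l_distr)
    next
      fix r v assume r: "r \<in> carrier R" and v: "v \<in> carrier F\<kappa>"
      show "g (r \<odot>\<^bsub>F\<kappa>\<^esub> v) = r \<odot>\<^bsub>M\<^esub> g v"
        unfolding g_def restrict_apply'[OF v] restrict_apply'[OF F.smult_closed[OF r v]] lift_smult[OF r v]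
        using r lift_closed[OF v] m(1) by (rule M.smult_assoc1)
    qed (simp only: g_def restrict_extensional)
    have "f q = restrict g (carrier K\<kappa>)"
    proof (rule fext[OF fH[OF q]])
      fix v assume v: "v \<in> carrier K\<kappa>"
      show "\<iota> (f q v) = \<iota> (restrict g (carrier K\<kappa>) v) \<and> restrict g (carrier K\<kappa>) v \<in> carrier M"
        unfolding restrict_apply'[OF v] g_def restrict_apply'[OF KF[OF v]]
        using \<iota>f(1)[OF q v] Klc[OF v] m Dc[OF q] by (simp add: \<iota>sm P.m_comm)
    qed simp
    thus "f q \<in> ?B" using g by blast
  qed
  \<comment> \<open>The values of \<open>\<phi>\<close> at the relations \<open>unitv s\<close> are all of the form \<open>q s\<close> for one \<open>q\<close>. Subtracting
    \<open>unitv (lift v)\<close> projects the free module onto relations with lift zero, where \<open>f q\<close> vanishes, so that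
    composing \<open>\<phi>\<close> with this projection extends \<open>\<phi> - f q\<close>.\<close>
  have surj: "\<exists>q\<in>D. ?B +>\<^bsub>?H\<^esub> \<phi> = ?B +>\<^bsub>?H\<^esub> f q" if \<phi>: "\<phi> \<in> module_homs R K\<kappa> M" for \<phi>
  proof -
    note \<phi>E = module_homs_E[OF \<phi>]
    have swap: "r \<odot>\<^bsub>M\<^esub> \<phi> (unitv s) = s \<odot>\<^bsub>M\<^esub> \<phi> (unitv r)" if r: "r \<in> \<mm>" and s: "s \<in> \<mm>" for r s
    proof -
      have "r \<odot>\<^bsub>M\<^esub> \<phi> (unitv s) = \<phi> (unitv (r \<otimes> s))"
        unfolding unitv_smult[OF mc[OF r]] using \<phi>E(3)[OF mc[OF r] unitvK[OF s]] by (simp only: relation_ops)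
      also have "\<dots> = \<phi> (unitv (s \<otimes> r))" using mc[OF r] mc[OF s] by (simp add: m_comm)
      also have "\<dots> = s \<odot>\<^bsub>M\<^esub> \<phi> (unitv r)"
        unfolding unitv_smult[OF mc[OF s]] using \<phi>E(3)[OF mc[OF s] unitvK[OF r]] by (simp only: relation_ops)
      finally show ?thesis .
    qed
    define q where "q = inv\<^bsub>P\<^esub> (h r0) \<otimes>\<^bsub>P\<^esub> \<iota> (\<phi> (unitv r0))"
    have \<phi>c: "\<iota> (\<phi> (unitv s)) \<in> carrier P" if "s \<in> \<mm>" for s using \<iota>c[OF \<phi>E(1)[OF unitvK[OF that]]] .
    have qc: "q \<in> carrier P" unfolding q_def using r0 \<phi>c by simp
    have qs: "q \<otimes>\<^bsub>P\<^esub> h s = \<iota> (\<phi> (unitv s))" if s: "s \<in> \<mm>" for s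
    proof -
      have "h s \<otimes>\<^bsub>P\<^esub> \<iota> (\<phi> (unitv r0)) = h r0 \<otimes>\<^bsub>P\<^esub> \<iota> (\<phi> (unitv s))"
        using swap[OF s r0(1)] \<iota>sm[OF mc[OF s] \<phi>E(1)[OF unitvK[OF r0(1)]]]
          \<iota>sm[OF r0c \<phi>E(1)[OF unitvK[OF s]]] by simp
      hence "q \<otimes>\<^bsub>P\<^esub> h s = inv\<^bsub>P\<^esub> (h r0) \<otimes>\<^bsub>P\<^esub> (h r0 \<otimes>\<^bsub>P\<^esub> \<iota> (\<phi> (unitv s)))"
        unfolding q_def using P.Units_inv_closed[OF r0(2)] \<phi>c[OF r0(1)] h.hom_closed[OF mc[OF s]]
        by (simp only: P.m_comm[of _ "h s"] P.m_lcomm[of "h s"] P.m_closed)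
      thus ?thesis using r0 \<phi>c[OF s] r0c by (simp add: P.m_assoc[symmetric])
    qed
    have qD: "q \<in> D" unfolding D_def
    proof (rule V.colonI[OF qc])
      fix y assume "y \<in> h ` \<mm>"
      then obtain s where "s \<in> \<mm>" "y = h s" by blast
      thus "q \<otimes>\<^bsub>P\<^esub> y \<in> Y" using qs[of s] \<phi>E(1)[OF unitvK] by (auto simp: Y_def)
    qed
    define \<tau> where "\<tau> v = v \<oplus>\<^bsub>F\<kappa>\<^esub> unitv (\<ominus> lift v)" for v
    have \<tau>K: "\<tau> v \<in> carrier K\<kappa>" if v: "v \<in> carrier F\<kappa>" for v
    proof (rule Kin)
      have lc: "lift v \<in> carrier R" using lift_closed[OF v] .
      have u: "unitv (\<ominus> lift v) \<in> carrier F\<kappa>" by (rule unitv_closed) (use lc in simp)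
      show "\<tau> v \<in> carrier F\<kappa>" unfolding \<tau>_def using v u by (rule F.M.a_closed)
      have "lift (\<tau> v) = \<zero>" unfolding \<tau>_def lift_add[OF v u]
        using lift_unitv[of "\<ominus> lift v"] lc by (simp add: r_neg)
      thus "lift (\<tau> v) \<in> \<mm>" using O.SM_zero[of \<mm>] m_ideal submods_self by simp
    qed
    have \<tau>add: "\<tau> (v \<oplus>\<^bsub>F\<kappa>\<^esub> w) = \<tau> v \<oplus>\<^bsub>K\<kappa>\<^esub> \<tau> w" if v: "v \<in> carrier F\<kappa>" and w: "w \<in> carrier F\<kappa>" for v w
    proof -
      have c: "\<ominus> lift v \<in> carrier R" "\<ominus> lift w \<in> carrier R" using lift_closed v w by auto
      note uc = unitv_closed[OF c(1)] unitv_closed[OF c(2)]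
      have "\<ominus> lift (v \<oplus>\<^bsub>F\<kappa>\<^esub> w) = \<ominus> lift v \<oplus> \<ominus> lift w"
        unfolding lift_add[OF v w] using lift_closed[OF v] lift_closed[OF w] by (simp add: minus_add)
      hence "\<tau> (v \<oplus>\<^bsub>F\<kappa>\<^esub> w) = (v \<oplus>\<^bsub>F\<kappa>\<^esub> w) \<oplus>\<^bsub>F\<kappa>\<^esub> (unitv (\<ominus> lift v) \<oplus>\<^bsub>F\<kappa>\<^esub> unitv (\<ominus> lift w))"
        unfolding \<tau>_def using unitv_add[OF c] by (simp only:)
      also have "\<dots> = \<tau> v \<oplus>\<^bsub>F\<kappa>\<^esub> \<tau> w" unfolding \<tau>_def
        using F.M.a_assoc F.M.a_lcomm F.M.a_closed v w uc by (simp del: free_module_simps)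
      finally show ?thesis by (simp only: relation_ops)
    qed
    have \<tau>sm: "\<tau> (r \<odot>\<^bsub>F\<kappa>\<^esub> v) = r \<odot>\<^bsub>K\<kappa>\<^esub> \<tau> v" if r: "r \<in> carrier R" and v: "v \<in> carrier F\<kappa>" for r v
    proof -
      have c: "\<ominus> lift v \<in> carrier R" using lift_closed v by auto
      have "\<ominus> lift (r \<odot>\<^bsub>F\<kappa>\<^esub> v) = r \<otimes> \<ominus> lift v"
        unfolding lift_smult[OF r v] using lift_closed[OF v] r by (simp add: r_minus)
      hence "\<tau> (r \<odot>\<^bsub>F\<kappa>\<^esub> v) = (r \<odot>\<^bsub>F\<kappa>\<^esub> v) \<oplus>\<^bsub>F\<kappa>\<^esub> (r \<odot>\<^bsub>F\<kappa>\<^esub> unitv (\<ominus> lift v))"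
        unfolding \<tau>_def using unitv_smult[OF r] by (simp only:)
      also have "\<dots> = r \<odot>\<^bsub>F\<kappa>\<^esub> \<tau> v" unfolding \<tau>_def
        using F.smult_r_distr[OF r v unitv_closed[OF c]] by (simp only:)
      finally show ?thesis by (simp only: relation_ops)
    qed
    define g where "g = (\<lambda>v\<in>carrier F\<kappa>. \<phi> (\<tau> v))"
    have g: "g \<in> module_homs R F\<kappa> M"
    proof (rule module_homs_I)
      fix v assume v: "v \<in> carrier F\<kappa>"
      show "g v \<in> carrier M" unfolding g_def restrict_apply'[OF v] using \<phi>E(1)[OF \<tau>K[OF v]] .
      fix w assume w: "w \<in> carrier F\<kappa>"
      show "g (v \<oplus>\<^bsub>F\<kappa>\<^esub> w) = g v \<oplus>\<^bsub>M\<^esub> g w"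
        unfolding g_def restrict_apply'[OF v] restrict_apply'[OF w] restrict_apply'[OF F.M.a_closed[OF v w]] \<tau>add[OF v w]
        using \<phi>E(2)[OF \<tau>K[OF v] \<tau>K[OF w]] .
    next
      fix r v assume r: "r \<in> carrier R" and v: "v \<in> carrier F\<kappa>"
      show "g (r \<odot>\<^bsub>F\<kappa>\<^esub> v) = r \<odot>\<^bsub>M\<^esub> g v"
        unfolding g_def restrict_apply'[OF v] restrict_apply'[OF F.smult_closed[OF r v]] \<tau>sm[OF r v]
        using \<phi>E(3)[OF r \<tau>K[OF v]] .
    qed (simp only: g_def restrict_extensional)
    have gB: "restrict g (carrier K\<kappa>) \<in> ?B" using g by blast
    hence gH: "restrict g (carrier K\<kappa>) \<in> carrier ?H" using B unfolding H.submodule_iff by blast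
    have fqH: "f q \<in> carrier ?H" using fH[OF qD] by simp
    have "\<phi> = restrict g (carrier K\<kappa>) \<oplus>\<^bsub>?H\<^esub> f q"
    proof (rule fext[OF \<phi>])
      fix v assume v: "v \<in> carrier K\<kappa>"
      note vF = KF[OF v]
      have u: "unitv (lift v) \<in> carrier K\<kappa>" using unitvK[OF Kl[OF v]] .
      have e1: "\<iota> (f q v) = \<iota> (\<phi> (unitv (lift v)))" using \<iota>f(1)[OF qD v] qs[OF Kl[OF v]] by simp
      hence e: "f q v = \<phi> (unitv (lift v))" using \<iota>D \<iota>f(2)[OF qD v] \<phi>E(1)[OF u] by blast
      have lc: "\<ominus> lift v \<in> carrier R" "lift v \<in> carrier R" using Klc[OF v] by auto
      have "unitv (\<ominus> lift v) \<oplus>\<^bsub>F\<kappa>\<^esub> unitv (lift v) = unitv \<zero>"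
        using unitv_add[OF lc] lc by (simp add: l_neg del: free_module_simps)
      moreover have "unitv \<zero> = \<zero>\<^bsub>F\<kappa>\<^esub>" by (auto simp: unitv_def)
      ultimately have "\<tau> v \<oplus>\<^bsub>F\<kappa>\<^esub> unitv (lift v) = v"
        unfolding \<tau>_def using F.M.a_assoc[OF vF unitv_closed[OF lc(1)] unitv_closed[OF lc(2)]] F.M.r_zero[OF vF]
        by (simp only:)
      hence "\<phi> v = \<phi> (\<tau> v \<oplus>\<^bsub>K\<kappa>\<^esub> unitv (lift v))" by (simp only: relation_ops)
      also have "\<dots> = \<phi> (\<tau> v) \<oplus>\<^bsub>M\<^esub> \<phi> (unitv (lift v))" using \<phi>E(2)[OF \<tau>K[OF vF] u] .
      also have "\<dots> = (restrict g (carrier K\<kappa>) \<oplus>\<^bsub>?H\<^esub> f q) v"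
        unfolding hom_module_simps restrict_apply'[OF v] g_def restrict_apply'[OF vF] e ..
      finally show "\<iota> (\<phi> v) = \<iota> ((restrict g (carrier K\<kappa>) \<oplus>\<^bsub>?H\<^esub> f q) v) \<and>
          (restrict g (carrier K\<kappa>) \<oplus>\<^bsub>?H\<^esub> f q) v \<in> carrier M" using \<phi>E(1)[OF v] by simp
    qed (simp only: hom_module_simps restrict_extensional)
    hence "\<phi> \<in> ?B +>\<^bsub>?H\<^esub> f q" using gB unfolding a_r_coset_def' by blast
    hence "?B +>\<^bsub>?H\<^esub> f q = ?B +>\<^bsub>?H\<^esub> \<phi>" using B.a_repr_independence' fqH by blast
    thus ?thesis using qD by metis
  qed
  let ?E = "quotient_module ?H ?B"
  have "module_length R ?E = chain_len (submodules R ?D) {q \<in> carrier ?D. ?B +>\<^bsub>?H\<^esub> f q = \<zero>\<^bsub>?E\<^esub>} (carrier ?D)"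
  proof (rule length_of_surj[OF Dmod])
    have "(\<lambda>q. ?B +>\<^bsub>?H\<^esub> f q) ` D = (+>\<^bsub>?H\<^esub>) ?B ` carrier ?H"
      using surj fH by (auto simp only: hom_module_simps(1)) blast+
    thus "(\<lambda>q. ?B +>\<^bsub>?H\<^esub> f q) ` carrier ?D = carrier ?E" using H.coset_im by simp
    fix p assume p: "p \<in> carrier ?D"
    {
      fix q assume q: "q \<in> carrier ?D"
      have "f (p \<oplus>\<^bsub>?D\<^esub> q) = f p \<oplus>\<^bsub>?H\<^esub> f q" using fadd p q by simp
      thus "?B +>\<^bsub>?H\<^esub> f (p \<oplus>\<^bsub>?D\<^esub> q) = (?B +>\<^bsub>?H\<^esub> f p) \<oplus>\<^bsub>?E\<^esub> (?B +>\<^bsub>?H\<^esub> f q)"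
        using H.coset_add[OF B, of "f p" "f q"] fH p q by simp
    }
    fix r assume r: "r \<in> carrier R"
    have "f (r \<odot>\<^bsub>?D\<^esub> p) = r \<odot>\<^bsub>?H\<^esub> f p" using fsm p r by simp
    thus "?B +>\<^bsub>?H\<^esub> f (r \<odot>\<^bsub>?D\<^esub> p) = r \<odot>\<^bsub>?E\<^esub> (?B +>\<^bsub>?H\<^esub> f p)"
      using H.coset_smult[OF B r, of "f p"] fH p by simp
  next
    have "\<zero>\<^bsub>P\<^esub> \<in> D" "f \<zero>\<^bsub>P\<^esub> \<in> ?B" using fB V.SM_zero[OF DS] V.SM_zero[OF YS] by auto
    thus "?B +>\<^bsub>?H\<^esub> f \<zero>\<^bsub>?D\<^esub> = \<zero>\<^bsub>?E\<^esub>" using H.coset_eq_iff[OF B, of "f \<zero>\<^bsub>P\<^esub>"] fH by simp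
  qed
  moreover have "{q \<in> carrier ?D. ?B +>\<^bsub>?H\<^esub> f q = \<zero>\<^bsub>?E\<^esub>} = Y"
  proof -
    have "Y \<subseteq> D"
    proof
      fix y assume y: "y \<in> Y"
      hence yc: "y \<in> carrier P" using V.SM_car[OF YS] by blast
      show "y \<in> D" unfolding D_def
      proof (rule V.colonI[OF yc])
        fix s assume "s \<in> h ` \<mm>"
        hence "s \<in> h ` carrier R" using m_sub by blast
        thus "y \<otimes>\<^bsub>P\<^esub> s \<in> Y" using V.SM_smult[OF YS _ y, of s] V.A_car[of s] yc by (simp add: P.m_comm)
      qed
    qed
    moreover have "?B +>\<^bsub>?H\<^esub> f q = \<zero>\<^bsub>?E\<^esub> \<longleftrightarrow> q \<in> Y" if q: "q \<in> D" for q
      using H.coset_eq_iff[OF B, of "f q"] fH[OF q] fB[OF q]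
      by (simp only: quotient_module_simps(2) hom_module_simps(1))
    moreover have "carrier ?D = D" by simp
    ultimately show ?thesis by blast
  qed
  ultimately have "module_length R ?E = chain_len (submodules R ?D) Y D" by simp
  also have "\<dots> = V.len Y D"
  proof (rule chain_len_cong)
    fix N assume "Y \<subseteq> N" "N \<subseteq> D"
    hence "N \<in> submodules R ?D \<longleftrightarrow> N \<in> submodules R ?P"
      using Dc by (auto simp: D.submodule_iff P'.submodule_iff)
    thus "N \<in> submodules R ?D \<longleftrightarrow> N \<in> V.SM" using submodules_restrict_scalars[OF is_cring P h] by simp
  qed
  finally show ?thesis unfolding module_type_def Ext1_def Y_def D_def .
qed

end

section \<open>The total ring of fractions\<close>

context cring
begin

abbreviation "reg \<equiv> regular_elements R"
abbreviation "TF \<equiv> total_fractions R"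
abbreviation fr :: "'a \<Rightarrow> 'a \<Rightarrow> ('a \<times> 'a) set" where "fr \<equiv> fraction R"
abbreviation emb :: "'a \<Rightarrow> ('a \<times> 'a) set" where "emb r \<equiv> fr r \<one>"

lemma reg_cancel:
  assumes s: "s \<in> reg" and ab: "a \<in> carrier R" "b \<in> carrier R" and eq: "s \<otimes> a = s \<otimes> b"
  shows "a = b"
proof -
  note sc = reg_closed[OF s]
  have "s \<otimes> (a \<ominus> b) = s \<otimes> a \<ominus> s \<otimes> b" using sc ab by algebra
  also have "\<dots> = \<zero>" unfolding eq a_minus_def using sc ab by (intro r_neg) simp
  finally have "s \<otimes> (a \<ominus> b) = \<zero>" .
  hence "a \<ominus> b = \<zero>" using reg_zero[OF s] ab minus_closed by blast
  moreover have "(a \<ominus> b) \<oplus> b = a" using ab by algebra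
  ultimately show ?thesis using ab by simp
qed

lemma reg_one: "\<one> \<in> reg" by (simp add: regular_elements_def)

lemma reg_mult: assumes s: "s \<in> reg" and t: "t \<in> reg" shows "s \<otimes> t \<in> reg"
proof -
  note c = reg_closed[OF s] reg_closed[OF t]
  have "x = \<zero>" if x: "x \<in> carrier R" "(s \<otimes> t) \<otimes> x = \<zero>" for x
  proof -
    have "s \<otimes> (t \<otimes> x) = \<zero>" using x(2) unfolding m_assoc[OF c x(1)] .
    hence "t \<otimes> x = \<zero>" using reg_zero[OF s] c x by blast
    thus ?thesis using reg_zero[OF t] x by blast
  qed
  thus ?thesis using c unfolding regular_elements_def by blast
qed

lemma mem_fr: "(u, v) \<in> fr r s \<longleftrightarrow> u \<in> carrier R \<and> v \<in> reg \<and> r \<otimes> v = u \<otimes> s"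
  by (simp add: fraction_def)

lemma fr_self: "r \<in> carrier R \<Longrightarrow> s \<in> reg \<Longrightarrow> (r, s) \<in> fr r s"
  by (simp add: mem_fr)

lemma fr_trans:
  assumes "r \<in> carrier R" "s \<in> reg" "u \<in> carrier R" "v \<in> reg" "x \<in> carrier R" "y \<in> reg"
    and eq: "r \<otimes> v = u \<otimes> s" and e: "r \<otimes> y = x \<otimes> s"
  shows "u \<otimes> y = x \<otimes> v"
proof (rule reg_cancel[OF assms(2)])
  note c = assms(1,3,5) reg_closed[OF assms(2)] reg_closed[OF assms(4)] reg_closed[OF assms(6)]
  show "u \<otimes> y \<in> carrier R" "x \<otimes> v \<in> carrier R" using c by auto
  have "s \<otimes> (u \<otimes> y) = (u \<otimes> s) \<otimes> y" using c by (simp add: m_ac)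
  also have "\<dots> = (r \<otimes> y) \<otimes> v" unfolding eq[symmetric] using c by (simp add: m_ac)
  also have "\<dots> = s \<otimes> (x \<otimes> v)" unfolding e using c by (simp add: m_ac)
  finally show "s \<otimes> (u \<otimes> y) = s \<otimes> (x \<otimes> v)" .
qed

lemma fr_eq_iff:
  assumes "r \<in> carrier R" "s \<in> reg" "u \<in> carrier R" "v \<in> reg"
  shows "fr r s = fr u v \<longleftrightarrow> r \<otimes> v = u \<otimes> s"
proof
  assume "fr r s = fr u v"
  hence "(r, s) \<in> fr u v" using fr_self assms by blast
  thus "r \<otimes> v = u \<otimes> s" by (simp add: mem_fr)
next
  assume eq: "r \<otimes> v = u \<otimes> s"
  have "(x, y) \<in> fr r s \<longleftrightarrow> (x, y) \<in> fr u v" for x y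
    unfolding mem_fr using fr_trans[OF assms _ _ eq] fr_trans[OF assms(3,4,1,2) _ _ eq[symmetric]] by blast
  thus "fr r s = fr u v" by (simp add: set_eq_iff split_paired_all)
qed

lemma TF_carrier: "carrier TF = {fr r s |r s. r \<in> carrier R \<and> s \<in> reg}"
  by (simp add: total_fractions_def)

lemma TF_E: assumes "q \<in> carrier TF" obtains r s where "r \<in> carrier R" "s \<in> reg" "q = fr r s"
  using assms by (auto simp: TF_carrier)

lemma fr_closed: "r \<in> carrier R \<Longrightarrow> s \<in> reg \<Longrightarrow> fr r s \<in> carrier TF"
  by (auto simp: TF_carrier)

lemma TF_one: "\<one>\<^bsub>TF\<^esub> = emb \<one>" and TF_zero: "\<zero>\<^bsub>TF\<^esub> = emb \<zero>"
  by (simp_all add: total_fractions_def)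

lemma Union_const: "p \<noteq> {} \<Longrightarrow> (\<And>x. x \<in> p \<Longrightarrow> g x = c) \<Longrightarrow> (\<Union>x\<in>p. g x) = c"
  by auto

text \<open>The operations on fractions are unions over all representing pairs. They take the expected value as soon as every
  choice of representatives gives it.\<close>

lemma fr_op:
  assumes "r \<in> carrier R" "s \<in> reg" "u \<in> carrier R" "v \<in> reg"
    and cong: "\<And>r' s' u' v'. (r', s') \<in> fr r s \<Longrightarrow> (u', v') \<in> fr u v \<Longrightarrow> g r' s' u' v' = c"
  shows "(\<Union>(r, s)\<in>fr r s. \<Union>(u, v)\<in>fr u v. g r s u v) = c"
proof (rule Union_const)
  show "fr r s \<noteq> {}" using fr_self assms by blast
  fix p assume "p \<in> fr r s"
  then obtain r' s' where p: "p = (r', s')" "(r', s') \<in> fr r s" by (cases p) auto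
  have "(\<Union>(u, v)\<in>fr u v. g r' s' u v) = c"
  proof (rule Union_const)
    show "fr u v \<noteq> {}" using fr_self assms by blast
  qed (use cong p in auto)
  thus "(case p of (r, s) \<Rightarrow> \<Union>(u, v)\<in>fr u v. g r s u v) = c" using p by simp
qed

lemma fr_mult:
  assumes "r \<in> carrier R" "s \<in> reg" "u \<in> carrier R" "v \<in> reg"
  shows "fr r s \<otimes>\<^bsub>TF\<^esub> fr u v = fr (r \<otimes> u) (s \<otimes> v)"
  unfolding total_fractions_def monoid.simps
proof (rule fr_op[OF assms])
  fix r' s' u' v' assume a: "(r', s') \<in> fr r s" "(u', v') \<in> fr u v"
  hence b: "r' \<in> carrier R" "s' \<in> reg" "r \<otimes> s' = r' \<otimes> s" "u' \<in> carrier R" "v' \<in> reg" "u \<otimes> v' = u' \<otimes> v"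
    by (auto simp: mem_fr)
  note c = assms(1,3) b(1,4) assms(2,4)[THEN reg_closed] b(2,5)[THEN reg_closed]
  have "(r' \<otimes> u') \<otimes> (s \<otimes> v) = (r' \<otimes> s) \<otimes> (u' \<otimes> v)" using c by (simp add: m_ac)
  also have "\<dots> = (r \<otimes> u) \<otimes> (s' \<otimes> v')" unfolding b(3,6)[symmetric] using c by (simp add: m_ac)
  finally show "fr (r' \<otimes> u') (s' \<otimes> v') = fr (r \<otimes> u) (s \<otimes> v)"
    using c assms b by (subst fr_eq_iff) (auto intro: reg_mult)
qed

lemma fr_add:
  assumes "r \<in> carrier R" "s \<in> reg" "u \<in> carrier R" "v \<in> reg"
  shows "fr r s \<oplus>\<^bsub>TF\<^esub> fr u v = fr (r \<otimes> v \<oplus> u \<otimes> s) (s \<otimes> v)"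
  unfolding total_fractions_def ring.simps
proof (rule fr_op[OF assms])
  fix r' s' u' v' assume a: "(r', s') \<in> fr r s" "(u', v') \<in> fr u v"
  hence b: "r' \<in> carrier R" "s' \<in> reg" "r \<otimes> s' = r' \<otimes> s" "u' \<in> carrier R" "v' \<in> reg" "u \<otimes> v' = u' \<otimes> v"
    by (auto simp: mem_fr)
  note c = assms(1,3) b(1,4) assms(2,4)[THEN reg_closed] b(2,5)[THEN reg_closed]
  have "(r' \<otimes> v' \<oplus> u' \<otimes> s') \<otimes> (s \<otimes> v) = (r' \<otimes> s) \<otimes> (v' \<otimes> v) \<oplus> (u' \<otimes> v) \<otimes> (s' \<otimes> s)"
    using c by algebra
  also have "\<dots> = (r \<otimes> v \<oplus> u \<otimes> s) \<otimes> (s' \<otimes> v')" unfolding b(3,6)[symmetric] using c by algebra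
  finally show "fr (r' \<otimes> v' \<oplus> u' \<otimes> s') (s' \<otimes> v') = fr (r \<otimes> v \<oplus> u \<otimes> s) (s \<otimes> v)"
    using c assms b by (subst fr_eq_iff) (auto intro: reg_mult)
qed

lemma fr_smult:
  assumes x: "x \<in> carrier R" and rs: "r \<in> carrier R" "s \<in> reg"
  shows "x \<odot>\<^bsub>TF\<^esub> fr r s = fr (x \<otimes> r) s"
  unfolding total_fractions_def module.simps
proof (rule Union_const)
  show "fr r s \<noteq> {}" using fr_self rs by blast
  fix p assume "p \<in> fr r s"
  then obtain r' s' where p: "p = (r', s')" "r' \<in> carrier R" "s' \<in> reg" "r \<otimes> s' = r' \<otimes> s"
    by (cases p) (auto simp: mem_fr)
  note c = x rs(1) p(2) rs(2)[THEN reg_closed] p(3)[THEN reg_closed]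
  have "fr (x \<otimes> r') s' = fr (x \<otimes> r) s"
    using c p rs by (subst fr_eq_iff) (auto simp: m_assoc)
  thus "(case p of (r, s) \<Rightarrow> fr (x \<otimes> r) s) = fr (x \<otimes> r) s" using p by simp
qed

lemma cring_TF: "cring TF"
proof (rule cringI)
  show "abelian_group TF"
  proof (rule abelian_groupI)
    fix p assume "p \<in> carrier TF"
    then obtain r s where p: "r \<in> carrier R" "s \<in> reg" "p = fr r s" by (rule TF_E)
    note c = p(1) reg_closed[OF p(2)]
    show "\<zero>\<^bsub>TF\<^esub> \<oplus>\<^bsub>TF\<^esub> p = p" unfolding TF_zero using c p reg_one by (simp add: fr_add)
    have "fr (\<ominus> r) s \<oplus>\<^bsub>TF\<^esub> p = fr (\<ominus> r \<otimes> s \<oplus> r \<otimes> s) (s \<otimes> s)" using c p by (simp add: fr_add)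
    also have "\<dots> = \<zero>\<^bsub>TF\<^esub>" unfolding TF_zero using c p reg_one reg_mult
      by (subst fr_eq_iff) (simp_all add: l_minus l_neg)
    finally show "\<exists>q\<in>carrier TF. q \<oplus>\<^bsub>TF\<^esub> p = \<zero>\<^bsub>TF\<^esub>" using fr_closed[of "\<ominus> r" s] c p by auto
    fix q assume "q \<in> carrier TF"
    then obtain u v where q: "u \<in> carrier R" "v \<in> reg" "q = fr u v" by (rule TF_E)
    note d = q(1) reg_closed[OF q(2)]
    show "p \<oplus>\<^bsub>TF\<^esub> q \<in> carrier TF" using c d p q by (simp add: fr_add fr_closed reg_mult)
    show "p \<oplus>\<^bsub>TF\<^esub> q = q \<oplus>\<^bsub>TF\<^esub> p" using c d p q by (simp add: fr_add a_comm m_comm)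
    fix t assume "t \<in> carrier TF"
    then obtain x y where t: "x \<in> carrier R" "y \<in> reg" "t = fr x y" by (rule TF_E)
    note e = t(1) reg_closed[OF t(2)]
    have "(r \<otimes> v \<oplus> u \<otimes> s) \<otimes> y \<oplus> x \<otimes> (s \<otimes> v) = r \<otimes> (v \<otimes> y) \<oplus> (u \<otimes> y \<oplus> x \<otimes> v) \<otimes> s"
      using c d e by algebra
    thus "p \<oplus>\<^bsub>TF\<^esub> q \<oplus>\<^bsub>TF\<^esub> t = p \<oplus>\<^bsub>TF\<^esub> (q \<oplus>\<^bsub>TF\<^esub> t)"
      using c d e p q t by (simp add: fr_add reg_mult m_assoc)
  next
    show "\<zero>\<^bsub>TF\<^esub> \<in> carrier TF" unfolding TF_zero using reg_one by (simp add: fr_closed)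
  qed
  show "comm_monoid TF"
  proof (rule comm_monoidI)
    show "\<one>\<^bsub>TF\<^esub> \<in> carrier TF" unfolding TF_one using reg_one by (simp add: fr_closed)
    fix p assume "p \<in> carrier TF"
    then obtain r s where p: "r \<in> carrier R" "s \<in> reg" "p = fr r s" by (rule TF_E)
    note c = p(1) reg_closed[OF p(2)]
    show "\<one>\<^bsub>TF\<^esub> \<otimes>\<^bsub>TF\<^esub> p = p" unfolding TF_one using c p reg_one by (simp add: fr_mult)
    fix q assume "q \<in> carrier TF"
    then obtain u v where q: "u \<in> carrier R" "v \<in> reg" "q = fr u v" by (rule TF_E)
    note d = q(1) reg_closed[OF q(2)]
    show "p \<otimes>\<^bsub>TF\<^esub> q \<in> carrier TF" using c d p q by (simp add: fr_mult fr_closed reg_mult)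
    show "p \<otimes>\<^bsub>TF\<^esub> q = q \<otimes>\<^bsub>TF\<^esub> p" using c d p q by (simp add: fr_mult m_comm)
    fix t assume "t \<in> carrier TF"
    then obtain x y where t: "x \<in> carrier R" "y \<in> reg" "t = fr x y" by (rule TF_E)
    note e = t(1) reg_closed[OF t(2)]
    show "p \<otimes>\<^bsub>TF\<^esub> q \<otimes>\<^bsub>TF\<^esub> t = p \<otimes>\<^bsub>TF\<^esub> (q \<otimes>\<^bsub>TF\<^esub> t)"
      using c d e p q t by (simp add: fr_mult reg_mult m_assoc)
  qed
  fix p q t assume "p \<in> carrier TF" "q \<in> carrier TF" "t \<in> carrier TF"
  obtain r s where p: "r \<in> carrier R" "s \<in> reg" "p = fr r s" using \<open>p \<in> carrier TF\<close> by (rule TF_E)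
  obtain u v where q: "u \<in> carrier R" "v \<in> reg" "q = fr u v" using \<open>q \<in> carrier TF\<close> by (rule TF_E)
  obtain x y where t: "x \<in> carrier R" "y \<in> reg" "t = fr x y" using \<open>t \<in> carrier TF\<close> by (rule TF_E)
  note c = p(1) reg_closed[OF p(2)] q(1) reg_closed[OF q(2)] t(1) reg_closed[OF t(2)]
  have "((r \<otimes> v \<oplus> u \<otimes> s) \<otimes> x) \<otimes> ((s \<otimes> y) \<otimes> (v \<otimes> y)) =
      ((r \<otimes> x) \<otimes> (v \<otimes> y) \<oplus> (u \<otimes> x) \<otimes> (s \<otimes> y)) \<otimes> ((s \<otimes> v) \<otimes> y)" using c by algebra
  thus "(p \<oplus>\<^bsub>TF\<^esub> q) \<otimes>\<^bsub>TF\<^esub> t = p \<otimes>\<^bsub>TF\<^esub> t \<oplus>\<^bsub>TF\<^esub> q \<otimes>\<^bsub>TF\<^esub> t"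
    using c p q t by (simp add: fr_add fr_mult reg_mult fr_eq_iff)
qed

lemma emb_hom: "emb \<in> ring_hom R TF"
proof (rule ring_hom_memI)
  show "emb x \<in> carrier TF" if "x \<in> carrier R" for x using that reg_one by (simp add: fr_closed)
  show "emb (x \<otimes> y) = emb x \<otimes>\<^bsub>TF\<^esub> emb y" if "x \<in> carrier R" "y \<in> carrier R" for x y
    using that reg_one by (simp add: fr_mult)
  show "emb (x \<oplus> y) = emb x \<oplus>\<^bsub>TF\<^esub> emb y" if "x \<in> carrier R" "y \<in> carrier R" for x y
    using that reg_one by (simp add: fr_add)
qed (simp add: TF_one)

lemma emb_inj: "inj_on emb (carrier R)"
  by (rule inj_onI) (use reg_one in \<open>simp add: fr_eq_iff\<close>)

lemma emb_mult_fr: "s \<in> reg \<Longrightarrow> r \<in> carrier R \<Longrightarrow> emb s \<otimes>\<^bsub>TF\<^esub> fr r s = emb r"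
  using reg_one reg_closed[of s] reg_mult by (simp add: fr_mult fr_eq_iff m_comm)

lemma emb_unit: assumes s: "s \<in> reg" shows "emb s \<in> Units TF"
proof -
  interpret TF: cring TF by (rule cring_TF)
  show ?thesis
    by (rule TF.unit_if_inverse[of _ "fr \<one> s"])
      (use s reg_closed reg_one emb_mult_fr[OF s, of \<one>] in \<open>auto simp: fr_closed TF_one\<close>)
qed

lemma emb_denom: assumes "q \<in> carrier TF" shows "\<exists>s\<in>reg. emb s \<otimes>\<^bsub>TF\<^esub> q \<in> emb ` carrier R"
proof -
  obtain r s where "r \<in> carrier R" "s \<in> reg" "q = fr r s" using assms by (rule TF_E)
  thus ?thesis using emb_mult_fr by blast
qed

lemma smult_eq: assumes x: "x \<in> carrier R" and "q \<in> carrier TF"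
  shows "x \<odot>\<^bsub>TF\<^esub> q = emb x \<otimes>\<^bsub>TF\<^esub> q"
proof -
  obtain r s where p: "r \<in> carrier R" "s \<in> reg" "q = fr r s" using assms(2) by (rule TF_E)
  thus ?thesis using x reg_one reg_closed[OF p(2)] by (simp add: fr_smult fr_mult)
qed

lemma module_TF: "module R TF"
proof (rule module_of_surj[OF module_restrict_scalars[OF is_cring cring_TF emb_hom], where f = "\<lambda>x. x"])
qed (simp_all add: smult_eq)

lemma submodules_TF: "submodules R TF = submods TF (emb ` carrier R)"
proof -
  interpret M: module R TF by (rule module_TF)
  show ?thesis using smult_eq by (auto simp: M.submodule_iff submods_def subset_iff)
qed

lemma frac_embed_eq: "frac_embed R B = emb ` B"
  by (simp add: frac_embed_def)

lemma scale_eq: "scale R q B = dilate TF q B"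
  by (simp add: scale_def dilate_def)

lemma colon_eq: "colon R B C = colonq TF B C"
  by (auto simp: colon_def colonq_def scale_def)

lemma quotient_length_eq:
  assumes B: "B \<in> submods TF (emb ` carrier R)" and C: "C \<in> submods TF (emb ` carrier R)" and "B \<subseteq> C"
  shows "quotient_length R C B = mlen TF (emb ` carrier R) B C"
proof -
  interpret M: module R TF by (rule module_TF)
  have Cs: "submodule C R TF" using C submodules_TF by blast
  have Cc: "C \<subseteq> carrier TF" using Cs unfolding M.submodule_iff by blast
  have Cm: "module R (as_module R C)" unfolding as_module_def
    using submodule.submodule_is_module[OF Cs M.module_axioms] .
  interpret C: module R "as_module R C" by (rule Cm)
  have sub: "submodule N R (as_module R C) \<longleftrightarrow> N \<in> submods TF (emb ` carrier R)" if "N \<subseteq> C" for N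
  proof -
    have "submodule N R (as_module R C) \<longleftrightarrow> submodule N R TF"
      using that Cc unfolding C.submodule_iff M.submodule_iff by (auto simp: as_module_def)
    thus ?thesis using submodules_TF by blast
  qed
  have "quotient_length R C B = chain_len (submodules R (as_module R C)) B C"
    unfolding quotient_length_def using sub[OF \<open>B \<subseteq> C\<close>] B
    by (subst length_quotient[OF Cm]) (simp_all add: as_module_def)
  also have "\<dots> = mlen TF (emb ` carrier R) B C"
    by (rule chain_len_cong) (simp add: sub)
  finally show ?thesis .
qed

text \<open>The universal property of the total ring of fractions.\<close>

definition extend :: "('c, 'n) ring_scheme \<Rightarrow> ('a \<Rightarrow> 'c) \<Rightarrow> ('a \<times> 'a) set \<Rightarrow> 'c" where
  "extend P h q = (case SOME x. x \<in> q of (r, s) \<Rightarrow> h r \<otimes>\<^bsub>P\<^esub> inv\<^bsub>P\<^esub> (h s))"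

lemma extend:
  assumes P: "cring P" and h: "h \<in> ring_hom R P" and inj: "inj_on h (carrier R)"
    and units: "\<And>s. s \<in> reg \<Longrightarrow> h s \<in> Units P"
  shows extend_emb: "x \<in> carrier R \<Longrightarrow> extend P h (emb x) = h x"
    and extend_hom: "extend P h \<in> ring_hom TF P"
    and extend_inj: "inj_on (extend P h) (carrier TF)"
proof -
  interpret P: cring P by fact
  interpret h: ring_hom_cring R P h
    using h P is_cring by (simp add: ring_hom_cring_def ring_hom_cring_axioms_def)
  let ?e = "extend P h"
  have cross: "h r \<otimes>\<^bsub>P\<^esub> inv\<^bsub>P\<^esub> (h s) = h u \<otimes>\<^bsub>P\<^esub> inv\<^bsub>P\<^esub> (h v) \<longleftrightarrow> h (r \<otimes> v) = h (u \<otimes> s)"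
    if "r \<in> carrier R" "s \<in> reg" "u \<in> carrier R" "v \<in> reg" for r s u v
  proof -
    note sU = units[OF that(2)] and vU = units[OF that(4)]
    note c = that(1,3) reg_closed[OF that(2)] reg_closed[OF that(4)]
    have sv: "h s \<otimes>\<^bsub>P\<^esub> h v \<in> Units P" using sU vU by simp
    have i: "inv\<^bsub>P\<^esub> (h s) \<in> carrier P" "inv\<^bsub>P\<^esub> (h v) \<in> carrier P" using sU vU by auto
    have e1: "(h s \<otimes>\<^bsub>P\<^esub> h v) \<otimes>\<^bsub>P\<^esub> (h r \<otimes>\<^bsub>P\<^esub> inv\<^bsub>P\<^esub> (h s)) = h (r \<otimes> v)"
    proof -
      have "(h s \<otimes>\<^bsub>P\<^esub> h v) \<otimes>\<^bsub>P\<^esub> (h r \<otimes>\<^bsub>P\<^esub> inv\<^bsub>P\<^esub> (h s)) = (h s \<otimes>\<^bsub>P\<^esub> inv\<^bsub>P\<^esub> (h s)) \<otimes>\<^bsub>P\<^esub> (h r \<otimes>\<^bsub>P\<^esub> h v)"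
        using c i h.hom_closed by (simp only: P.m_ac P.m_closed)
      thus ?thesis using sU c by simp
    qed
    have e2: "(h s \<otimes>\<^bsub>P\<^esub> h v) \<otimes>\<^bsub>P\<^esub> (h u \<otimes>\<^bsub>P\<^esub> inv\<^bsub>P\<^esub> (h v)) = h (u \<otimes> s)"
    proof -
      have "(h s \<otimes>\<^bsub>P\<^esub> h v) \<otimes>\<^bsub>P\<^esub> (h u \<otimes>\<^bsub>P\<^esub> inv\<^bsub>P\<^esub> (h v)) = (h v \<otimes>\<^bsub>P\<^esub> inv\<^bsub>P\<^esub> (h v)) \<otimes>\<^bsub>P\<^esub> (h u \<otimes>\<^bsub>P\<^esub> h s)"
        using c i h.hom_closed by (simp only: P.m_ac P.m_closed)
      thus ?thesis using vU c by simp
    qed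
    show ?thesis using P.Units_l_cancel[OF sv, of "h r \<otimes>\<^bsub>P\<^esub> inv\<^bsub>P\<^esub> (h s)" "h u \<otimes>\<^bsub>P\<^esub> inv\<^bsub>P\<^esub> (h v)"] e1 e2 c i
      by auto
  qed
  have ef: "?e (fr r s) = h r \<otimes>\<^bsub>P\<^esub> inv\<^bsub>P\<^esub> (h s)" if rs: "r \<in> carrier R" "s \<in> reg" for r s
  proof -
    obtain u v where uv: "(SOME x. x \<in> fr r s) = (u, v)" by fastforce
    have "(SOME x. x \<in> fr r s) \<in> fr r s" using fr_self[OF rs] by (rule someI)
    hence m: "u \<in> carrier R" "v \<in> reg" "r \<otimes> v = u \<otimes> s" using uv by (auto simp: mem_fr)
    have "?e (fr r s) = h u \<otimes>\<^bsub>P\<^esub> inv\<^bsub>P\<^esub> (h v)" by (simp add: extend_def uv)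
    also have "\<dots> = h r \<otimes>\<^bsub>P\<^esub> inv\<^bsub>P\<^esub> (h s)" using cross[OF m(1,2) rs] m(3) by simp
    finally show ?thesis .
  qed
  show "x \<in> carrier R \<Longrightarrow> ?e (emb x) = h x" using ef[of x \<one>] reg_one by simp
  have inv_mult: "inv\<^bsub>P\<^esub> (h (s \<otimes> v)) = inv\<^bsub>P\<^esub> (h s) \<otimes>\<^bsub>P\<^esub> inv\<^bsub>P\<^esub> (h v)" if "s \<in> reg" "v \<in> reg" for s v
  proof -
    have U: "h s \<in> Units P" "h v \<in> Units P" using that units by auto
    note c = P.Units_closed[OF U(1)] P.Units_closed[OF U(2)] P.Units_inv_closed[OF U(1)] P.Units_inv_closed[OF U(2)]
    have "(h s \<otimes>\<^bsub>P\<^esub> h v) \<otimes>\<^bsub>P\<^esub> (inv\<^bsub>P\<^esub> (h s) \<otimes>\<^bsub>P\<^esub> inv\<^bsub>P\<^esub> (h v)) =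
        (h s \<otimes>\<^bsub>P\<^esub> inv\<^bsub>P\<^esub> (h s)) \<otimes>\<^bsub>P\<^esub> (h v \<otimes>\<^bsub>P\<^esub> inv\<^bsub>P\<^esub> (h v))"
      using c by (simp only: P.m_ac P.m_closed)
    also have "\<dots> = \<one>\<^bsub>P\<^esub>" using U by simp
    finally have "inv\<^bsub>P\<^esub> (h s \<otimes>\<^bsub>P\<^esub> h v) = inv\<^bsub>P\<^esub> (h s) \<otimes>\<^bsub>P\<^esub> inv\<^bsub>P\<^esub> (h v)"
      using c by (intro P.comm_inv_char P.m_closed)
    thus ?thesis using h.hom_mult[OF reg_closed[OF that(1)] reg_closed[OF that(2)]] by simp
  qed
  show "?e \<in> ring_hom TF P"
  proof (rule ring_hom_memI)
    fix p assume "p \<in> carrier TF"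
    then obtain r s where p: "r \<in> carrier R" "s \<in> reg" "p = fr r s" by (rule TF_E)
    have sU: "h s \<in> Units P" using units[OF p(2)] .
    have c: "h r \<in> carrier P" "h s \<in> carrier P" "inv\<^bsub>P\<^esub> (h s) \<in> carrier P"
      using p reg_closed[OF p(2)] sU by auto
    show "?e p \<in> carrier P" using ef[OF p(1,2)] p c by simp
    fix q assume "q \<in> carrier TF"
    then obtain u v where q: "u \<in> carrier R" "v \<in> reg" "q = fr u v" by (rule TF_E)
    have vU: "h v \<in> Units P" using units[OF q(2)] .
    have d: "h u \<in> carrier P" "h v \<in> carrier P" "inv\<^bsub>P\<^esub> (h v) \<in> carrier P"
      using q reg_closed[OF q(2)] vU by auto
    have sv: "s \<otimes> v \<in> reg" using p q reg_mult by simp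
    show "?e (p \<otimes>\<^bsub>TF\<^esub> q) = ?e p \<otimes>\<^bsub>P\<^esub> ?e q"
      using p q c d sv ef inv_mult[OF p(2) q(2)] by (simp add: fr_mult P.m_ac)
    have "?e (p \<oplus>\<^bsub>TF\<^esub> q) = (h r \<otimes>\<^bsub>P\<^esub> h v \<oplus>\<^bsub>P\<^esub> h u \<otimes>\<^bsub>P\<^esub> h s) \<otimes>\<^bsub>P\<^esub> (inv\<^bsub>P\<^esub> (h s) \<otimes>\<^bsub>P\<^esub> inv\<^bsub>P\<^esub> (h v))"
      using p q reg_closed[OF p(2)] reg_closed[OF q(2)] sv ef[of "r \<otimes> v \<oplus> u \<otimes> s" "s \<otimes> v"] inv_mult[OF p(2) q(2)]
      by (simp add: fr_add)
    also have "\<dots> = (h v \<otimes>\<^bsub>P\<^esub> inv\<^bsub>P\<^esub> (h v)) \<otimes>\<^bsub>P\<^esub> (h r \<otimes>\<^bsub>P\<^esub> inv\<^bsub>P\<^esub> (h s)) \<oplus>\<^bsub>P\<^esub>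
        (h s \<otimes>\<^bsub>P\<^esub> inv\<^bsub>P\<^esub> (h s)) \<otimes>\<^bsub>P\<^esub> (h u \<otimes>\<^bsub>P\<^esub> inv\<^bsub>P\<^esub> (h v))"
      using c d by algebra
    also have "\<dots> = ?e p \<oplus>\<^bsub>P\<^esub> ?e q" using sU vU c d p q ef by simp
    finally show "?e (p \<oplus>\<^bsub>TF\<^esub> q) = ?e p \<oplus>\<^bsub>P\<^esub> ?e q" .
  next
    show "?e \<one>\<^bsub>TF\<^esub> = \<one>\<^bsub>P\<^esub>" unfolding TF_one using ef[of \<one> \<one>] reg_one by simp
  qed
  show "inj_on ?e (carrier TF)"
  proof (rule inj_onI)
    fix p q assume "p \<in> carrier TF" "q \<in> carrier TF" and eq: "?e p = ?e q"
    obtain r s where p: "r \<in> carrier R" "s \<in> reg" "p = fr r s" using \<open>p \<in> carrier TF\<close> by (rule TF_E)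
    obtain u v where q: "u \<in> carrier R" "v \<in> reg" "q = fr u v" using \<open>q \<in> carrier TF\<close> by (rule TF_E)
    have "h (r \<otimes> v) = h (u \<otimes> s)" using eq p q ef cross by simp
    hence "r \<otimes> v = u \<otimes> s"
      by (rule inj_onD[OF inj]) (use p q reg_closed in simp_all)
    thus "p = q" using p q by (simp add: fr_eq_iff)
  qed
qed

end

text \<open>If \<open>r / s\<close> is regular in \<open>Q(R)\<close>, then \<open>r\<close> is regular in \<open>R\<close>, and \<open>s / r\<close> is the inverse.\<close>

lemma (in cring) TF_unit:
  assumes q: "q \<in> carrier TF" and reg: "\<And>p. p \<in> carrier TF \<Longrightarrow> q \<otimes>\<^bsub>TF\<^esub> p = \<zero>\<^bsub>TF\<^esub> \<Longrightarrow> p = \<zero>\<^bsub>TF\<^esub>"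
  shows "q \<in> Units TF"
proof -
  interpret TF: cring TF by (rule cring_TF)
  obtain r s where rs: "r \<in> carrier R" "s \<in> reg" "q = fr r s" using q by (rule TF_E)
  note sc = reg_closed[OF rs(2)]
  have z: "emb x = \<zero>\<^bsub>TF\<^esub> \<longleftrightarrow> x = \<zero>" if "x \<in> carrier R" for x
    unfolding TF_zero using that reg_one by (simp add: fr_eq_iff)
  have "r \<in> reg" unfolding regular_elements_def
  proof (intro CollectI conjI ballI impI rs(1))
    fix x assume x: "x \<in> carrier R" "r \<otimes> x = \<zero>"
    have "q \<otimes>\<^bsub>TF\<^esub> emb x = \<zero>\<^bsub>TF\<^esub>"
      unfolding TF_zero using rs x sc reg_one by (simp add: fr_mult fr_eq_iff)
    thus "x = \<zero>" using reg[of "emb x"] z x fr_closed reg_one by simp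
  qed
  hence "q \<otimes>\<^bsub>TF\<^esub> fr s r = \<one>\<^bsub>TF\<^esub>"
    unfolding TF_one using rs sc reg_one by (simp add: fr_mult fr_eq_iff reg_mult m_comm)
  thus ?thesis using q fr_closed[OF sc \<open>r \<in> reg\<close>] by (rule TF.unit_if_inverse[rotated 2])
qed

section \<open>Quadratic extensions\<close>

text \<open>The ring \<open>Q[t] / (t\<^sup>2 + a t + b)\<close>, with the pair \<open>(x, y)\<close> for \<open>x + y t\<close>.\<close>

definition quad_ext :: "('q, 'n) ring_scheme \<Rightarrow> 'q \<Rightarrow> 'q \<Rightarrow> ('q \<times> 'q) ring" where
  "quad_ext Q a b = \<lparr>carrier = carrier Q \<times> carrier Q,
     monoid.mult = (\<lambda>p q. (fst p \<otimes>\<^bsub>Q\<^esub> fst q \<ominus>\<^bsub>Q\<^esub> b \<otimes>\<^bsub>Q\<^esub> (snd p \<otimes>\<^bsub>Q\<^esub> snd q),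
       fst p \<otimes>\<^bsub>Q\<^esub> snd q \<oplus>\<^bsub>Q\<^esub> snd p \<otimes>\<^bsub>Q\<^esub> fst q \<ominus>\<^bsub>Q\<^esub> a \<otimes>\<^bsub>Q\<^esub> (snd p \<otimes>\<^bsub>Q\<^esub> snd q))),
     one = (\<one>\<^bsub>Q\<^esub>, \<zero>\<^bsub>Q\<^esub>), ring.zero = (\<zero>\<^bsub>Q\<^esub>, \<zero>\<^bsub>Q\<^esub>),
     add = (\<lambda>p q. (fst p \<oplus>\<^bsub>Q\<^esub> fst q, snd p \<oplus>\<^bsub>Q\<^esub> snd q))\<rparr>"

lemma quad_ext_simps [simp]:
  "carrier (quad_ext Q a b) = carrier Q \<times> carrier Q"
  "(x, y) \<otimes>\<^bsub>quad_ext Q a b\<^esub> (u, v) = (x \<otimes>\<^bsub>Q\<^esub> u \<ominus>\<^bsub>Q\<^esub> b \<otimes>\<^bsub>Q\<^esub> (y \<otimes>\<^bsub>Q\<^esub> v),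
     x \<otimes>\<^bsub>Q\<^esub> v \<oplus>\<^bsub>Q\<^esub> y \<otimes>\<^bsub>Q\<^esub> u \<ominus>\<^bsub>Q\<^esub> a \<otimes>\<^bsub>Q\<^esub> (y \<otimes>\<^bsub>Q\<^esub> v))"
  "(x, y) \<oplus>\<^bsub>quad_ext Q a b\<^esub> (u, v) = (x \<oplus>\<^bsub>Q\<^esub> u, y \<oplus>\<^bsub>Q\<^esub> v)"
  "\<one>\<^bsub>quad_ext Q a b\<^esub> = (\<one>\<^bsub>Q\<^esub>, \<zero>\<^bsub>Q\<^esub>)" "\<zero>\<^bsub>quad_ext Q a b\<^esub> = (\<zero>\<^bsub>Q\<^esub>, \<zero>\<^bsub>Q\<^esub>)"
  by (simp_all add: quad_ext_def)

lemma (in cring) cring_quad_ext: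
  assumes ab: "a \<in> carrier R" "b \<in> carrier R"
  shows "cring (quad_ext R a b)"
proof (rule cringI)
  show "abelian_group (quad_ext R a b)"
  proof (rule abelian_groupI)
    fix p assume "p \<in> carrier (quad_ext R a b)"
    then obtain x y where p: "p = (x, y)" "x \<in> carrier R" "y \<in> carrier R" by auto
    have "(\<ominus> x, \<ominus> y) \<oplus>\<^bsub>quad_ext R a b\<^esub> p = \<zero>\<^bsub>quad_ext R a b\<^esub>" using p by (simp add: l_neg)
    thus "\<exists>q\<in>carrier (quad_ext R a b). q \<oplus>\<^bsub>quad_ext R a b\<^esub> p = \<zero>\<^bsub>quad_ext R a b\<^esub>"
      using p by (intro bexI[of _ "(\<ominus> x, \<ominus> y)"]) auto
  qed (auto simp: a_ac)
  show "comm_monoid (quad_ext R a b)"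
  proof (rule comm_monoidI)
    fix p q assume "p \<in> carrier (quad_ext R a b)" "q \<in> carrier (quad_ext R a b)"
    then obtain x y u v where p: "p = (x, y)" "x \<in> carrier R" "y \<in> carrier R"
      and q: "q = (u, v)" "u \<in> carrier R" "v \<in> carrier R" by auto
    show "p \<otimes>\<^bsub>quad_ext R a b\<^esub> q \<in> carrier (quad_ext R a b)" using p q ab by simp
    have "x \<otimes> v \<oplus> y \<otimes> u \<ominus> a \<otimes> (y \<otimes> v) = u \<otimes> y \<oplus> v \<otimes> x \<ominus> a \<otimes> (v \<otimes> y)" using p q ab by algebra
    thus "p \<otimes>\<^bsub>quad_ext R a b\<^esub> q = q \<otimes>\<^bsub>quad_ext R a b\<^esub> p" using p q ab by (simp add: m_comm)
    fix r assume "r \<in> carrier (quad_ext R a b)"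
    then obtain s t where r: "r = (s, t)" "s \<in> carrier R" "t \<in> carrier R" by auto
    have "(x \<otimes> u \<ominus> b \<otimes> (y \<otimes> v)) \<otimes> s \<ominus> b \<otimes> ((x \<otimes> v \<oplus> y \<otimes> u \<ominus> a \<otimes> (y \<otimes> v)) \<otimes> t) =
        x \<otimes> (u \<otimes> s \<ominus> b \<otimes> (v \<otimes> t)) \<ominus> b \<otimes> (y \<otimes> (u \<otimes> t \<oplus> v \<otimes> s \<ominus> a \<otimes> (v \<otimes> t)))"
      using p q r ab by algebra
    moreover have "(x \<otimes> u \<ominus> b \<otimes> (y \<otimes> v)) \<otimes> t \<oplus> (x \<otimes> v \<oplus> y \<otimes> u \<ominus> a \<otimes> (y \<otimes> v)) \<otimes> s \<ominus>
          a \<otimes> ((x \<otimes> v \<oplus> y \<otimes> u \<ominus> a \<otimes> (y \<otimes> v)) \<otimes> t) =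
        x \<otimes> (u \<otimes> t \<oplus> v \<otimes> s \<ominus> a \<otimes> (v \<otimes> t)) \<oplus> y \<otimes> (u \<otimes> s \<ominus> b \<otimes> (v \<otimes> t)) \<ominus>
          a \<otimes> (y \<otimes> (u \<otimes> t \<oplus> v \<otimes> s \<ominus> a \<otimes> (v \<otimes> t)))"
      using p q r ab by algebra
    ultimately show "p \<otimes>\<^bsub>quad_ext R a b\<^esub> q \<otimes>\<^bsub>quad_ext R a b\<^esub> r = p \<otimes>\<^bsub>quad_ext R a b\<^esub> (q \<otimes>\<^bsub>quad_ext R a b\<^esub> r)"
      using p q r by simp
  next
    fix p assume "p \<in> carrier (quad_ext R a b)"
    then obtain x y where p: "p = (x, y)" "x \<in> carrier R" "y \<in> carrier R" by auto
    thus "\<one>\<^bsub>quad_ext R a b\<^esub> \<otimes>\<^bsub>quad_ext R a b\<^esub> p = p" using ab by (simp add: a_minus_def)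
  qed simp
  fix p q r assume "p \<in> carrier (quad_ext R a b)" "q \<in> carrier (quad_ext R a b)" "r \<in> carrier (quad_ext R a b)"
  then obtain x y u v s t where p: "p = (x, y)" "x \<in> carrier R" "y \<in> carrier R"
    and q: "q = (u, v)" "u \<in> carrier R" "v \<in> carrier R" and r: "r = (s, t)" "s \<in> carrier R" "t \<in> carrier R" by auto
  have "(x \<oplus> u) \<otimes> s \<ominus> b \<otimes> ((y \<oplus> v) \<otimes> t) = (x \<otimes> s \<ominus> b \<otimes> (y \<otimes> t)) \<oplus> (u \<otimes> s \<ominus> b \<otimes> (v \<otimes> t))"
    using p q r ab by algebra
  moreover have "(x \<oplus> u) \<otimes> t \<oplus> (y \<oplus> v) \<otimes> s \<ominus> a \<otimes> ((y \<oplus> v) \<otimes> t) =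
      (x \<otimes> t \<oplus> y \<otimes> s \<ominus> a \<otimes> (y \<otimes> t)) \<oplus> (u \<otimes> t \<oplus> v \<otimes> s \<ominus> a \<otimes> (v \<otimes> t))"
    using p q r ab by algebra
  ultimately show "(p \<oplus>\<^bsub>quad_ext R a b\<^esub> q) \<otimes>\<^bsub>quad_ext R a b\<^esub> r =
      p \<otimes>\<^bsub>quad_ext R a b\<^esub> r \<oplus>\<^bsub>quad_ext R a b\<^esub> q \<otimes>\<^bsub>quad_ext R a b\<^esub> r"
    using p q r by simp
qed

lemma (in cring) quad_scalar_mult:
  assumes "a \<in> carrier R" "b \<in> carrier R" "c \<in> carrier R" "x \<in> carrier R" "y \<in> carrier R"
  shows "(c, \<zero>) \<otimes>\<^bsub>quad_ext R a b\<^esub> (x, y) = (c \<otimes> x, c \<otimes> y)"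
  using assms by (simp add: a_minus_def)

lemma (in cring) quad_scalar_unit:
  assumes ab: "a \<in> carrier R" "b \<in> carrier R" and c: "c \<in> Units R"
  shows "(c, \<zero>) \<in> Units (quad_ext R a b)" "inv\<^bsub>quad_ext R a b\<^esub> (c, \<zero>) = (inv c, \<zero>)"
proof -
  interpret P: cring "quad_ext R a b" using cring_quad_ext[OF ab] .
  have cc: "c \<in> carrier R" "inv c \<in> carrier R" using c by auto
  have e: "(c, \<zero>) \<otimes>\<^bsub>quad_ext R a b\<^esub> (inv c, \<zero>) = \<one>\<^bsub>quad_ext R a b\<^esub>"
    using quad_scalar_mult[OF ab cc(1) cc(2) zero_closed] c cc by simp
  show "(c, \<zero>) \<in> Units (quad_ext R a b)"
    by (rule P.unit_if_inverse[OF _ _ e]) (use cc in simp_all)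
  show "inv\<^bsub>quad_ext R a b\<^esub> (c, \<zero>) = (inv c, \<zero>)"
    by (rule P.comm_inv_char[OF _ _ e]) (use cc in simp_all)
qed

text \<open>The norm \<open>x\<^sup>2 - a x y + b y\<^sup>2\<close> of a regular element is regular, hence invertible if all regular
  elements of the base ring are.\<close>

lemma (in cring) quad_unit:
  assumes ab: "a \<in> carrier R" "b \<in> carrier R"
    and units: "\<And>x. x \<in> carrier R \<Longrightarrow> (\<And>c. c \<in> carrier R \<Longrightarrow> x \<otimes> c = \<zero> \<Longrightarrow> c = \<zero>) \<Longrightarrow> x \<in> Units R"
    and p: "p \<in> carrier (quad_ext R a b)"
    and reg: "\<And>q. q \<in> carrier (quad_ext R a b) \<Longrightarrow> p \<otimes>\<^bsub>quad_ext R a b\<^esub> q = \<zero>\<^bsub>quad_ext R a b\<^esub> \<Longrightarrow>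
      q = \<zero>\<^bsub>quad_ext R a b\<^esub>"
  shows "p \<in> Units (quad_ext R a b)"
proof -
  interpret P: cring "quad_ext R a b" using cring_quad_ext[OF ab] .
  obtain x y where xy: "p = (x, y)" "x \<in> carrier R" "y \<in> carrier R" using p by auto
  define N where "N = x \<otimes> x \<ominus> a \<otimes> (x \<otimes> y) \<oplus> b \<otimes> (y \<otimes> y)"
  have Nc: "N \<in> carrier R" using xy ab by (simp add: N_def)
  have conj: "p \<otimes>\<^bsub>quad_ext R a b\<^esub> (c \<otimes> (x \<ominus> a \<otimes> y), \<ominus> (c \<otimes> y)) = (c \<otimes> N, \<zero>)" if c: "c \<in> carrier R" for c
  proof -
    have "x \<otimes> (c \<otimes> (x \<ominus> a \<otimes> y)) \<ominus> b \<otimes> (y \<otimes> (\<ominus> (c \<otimes> y))) = c \<otimes> N"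
      unfolding N_def using xy ab c by algebra
    moreover have "x \<otimes> (\<ominus> (c \<otimes> y)) \<oplus> y \<otimes> (c \<otimes> (x \<ominus> a \<otimes> y)) \<ominus> a \<otimes> (y \<otimes> (\<ominus> (c \<otimes> y))) = \<zero>"
      using xy ab c by algebra
    ultimately show ?thesis by (simp add: xy)
  qed
  have NU: "N \<in> Units R"
  proof (rule units[OF Nc])
    fix c assume c: "c \<in> carrier R" "N \<otimes> c = \<zero>"
    have "(c \<otimes> (x \<ominus> a \<otimes> y), \<ominus> (c \<otimes> y)) = \<zero>\<^bsub>quad_ext R a b\<^esub>"
    proof (rule reg)
      show "(c \<otimes> (x \<ominus> a \<otimes> y), \<ominus> (c \<otimes> y)) \<in> carrier (quad_ext R a b)" using c xy ab by simp
      have "c \<otimes> N = \<zero>" using c(2) m_comm[OF c(1) Nc] by (simp only:)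
      thus "p \<otimes>\<^bsub>quad_ext R a b\<^esub> (c \<otimes> (x \<ominus> a \<otimes> y), \<ominus> (c \<otimes> y)) = \<zero>\<^bsub>quad_ext R a b\<^esub>"
        unfolding conj[OF c(1)] by simp
    qed
    hence 0: "c \<otimes> (x \<ominus> a \<otimes> y) = \<zero>" "\<ominus> (c \<otimes> y) = \<zero>" by auto
    have cy: "c \<otimes> y = \<zero>"
    proof -
      have "c \<otimes> y = \<ominus> (\<ominus> (c \<otimes> y))" using c xy by simp
      thus ?thesis unfolding 0(2) by simp
    qed
    have "c \<otimes> x = c \<otimes> (x \<ominus> a \<otimes> y) \<oplus> a \<otimes> (c \<otimes> y)" using c xy ab by algebra
    also have "\<dots> = \<zero>" unfolding 0(1) cy using ab by simp
    finally have cx: "c \<otimes> x = \<zero>" .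
    have cP: "(c, \<zero>) \<in> carrier (quad_ext R a b)" using c(1) by simp
    have "p \<otimes>\<^bsub>quad_ext R a b\<^esub> (c, \<zero>) = (c, \<zero>) \<otimes>\<^bsub>quad_ext R a b\<^esub> p"
      using p cP by (rule P.m_comm)
    also have "\<dots> = \<zero>\<^bsub>quad_ext R a b\<^esub>"
      unfolding xy(1) quad_scalar_mult[OF ab c(1) xy(2,3)] cx cy by simp
    finally have "p \<otimes>\<^bsub>quad_ext R a b\<^esub> (c, \<zero>) = \<zero>\<^bsub>quad_ext R a b\<^esub>" .
    hence "(c, \<zero>) = \<zero>\<^bsub>quad_ext R a b\<^esub>" using reg[OF cP] by blast
    thus "c = \<zero>" by simp
  qed
  have iN: "inv N \<in> carrier R" "inv N \<otimes> N = \<one>" using NU by auto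
  have "p \<otimes>\<^bsub>quad_ext R a b\<^esub> (inv N \<otimes> (x \<ominus> a \<otimes> y), \<ominus> (inv N \<otimes> y)) = \<one>\<^bsub>quad_ext R a b\<^esub>"
    unfolding conj[OF iN(1)] iN(2) by simp
  moreover have "(inv N \<otimes> (x \<ominus> a \<otimes> y), \<ominus> (inv N \<otimes> y)) \<in> carrier (quad_ext R a b)"
    using iN(1) xy ab by simp
  ultimately show ?thesis using p by (intro P.unit_if_inverse[of p])
qed

section \<open>Canonical ideals of the quadratic extension\<close>

text \<open>In the application \<open>Q\<close> is the total ring of fractions of \<open>R\<close>, and \<open>A\<close>, \<open>n\<close> and \<open>J\<close> are the images of \<open>R\<close>, its
  maximal ideal and \<open>I\<close>. The overring \<open>W\<close> of \<open>A\<close> expresses that \<open>z\<close> is a reduction of \<open>(\<omega> : J)\<close>: it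
  is a fractional ideal, and \<open>z\<^sup>-\<^sup>1\<close> carries \<open>(\<omega> : J)\<close> into it.\<close>

locale quad_setup = local_order Q A n for Q (structure) and A n +
  fixes J a b \<omega> z W
  assumes J: "J \<in> submods Q A" "J \<subseteq> n" and J_unit: "\<exists>i\<in>J. i \<in> Units Q"
    and ab: "a \<in> A" "b \<in> A"
    and w: "canon \<omega>" and A\<omega>: "A \<subseteq> \<omega>"
    and z: "z \<in> Units Q" "z \<in> colonq Q \<omega> J"
    and W: "W \<subseteq> carrier Q" "A \<subseteq> W" "\<And>x y. x \<in> W \<Longrightarrow> y \<in> W \<Longrightarrow> x \<oplus> y \<in> W"
      "\<And>x y. x \<in> W \<Longrightarrow> y \<in> W \<Longrightarrow> x \<otimes> y \<in> W"
    and Wfrac: "\<exists>d\<in>Units Q. dilate Q d W \<subseteq> A"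
    and zW: "\<And>j. j \<in> colonq Q \<omega> J \<Longrightarrow> inv z \<otimes> j \<in> W"
    and P_order: "local_order (quad_ext Q a b) (A \<times> J) (n \<times> J)"
begin

abbreviation "P \<equiv> quad_ext Q a b"
abbreviation "D \<equiv> colonq Q \<omega> J"
abbreviation "S \<equiv> A \<times> J"
abbreviation "K \<equiv> D \<times> \<omega>"
abbreviation "R0 \<equiv> A \<times> {\<zero>}"

lemma ab_car: "a \<in> carrier Q" "b \<in> carrier Q" using ab A_car by auto

end

sublocale quad_setup \<subseteq> P: local_order "quad_ext Q a b" "A \<times> J" "n \<times> J"
  by (rule P_order)

context quad_setup
begin

lemma omega_frac: "frac \<omega>" using canon_frac[OF w] .
lemma omega_SM: "\<omega> \<in> SM" using frac_SM[OF omega_frac] .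
lemma J_sub_A: "J \<subseteq> A" using J n_sub by blast

lemma frac_J: "frac J"
proof -
  have "dilate Q \<one> J \<subseteq> A" using dil_one[OF SM_sub[OF J(1)]] J_sub_A by simp
  thus ?thesis unfolding frac_def using J J_unit by blast
qed

lemma D_frac: "frac D" using frac_colon[OF omega_frac frac_J] .
lemma D_SM: "D \<in> SM" using frac_SM[OF D_frac] .

lemma omega_sub_D: "\<omega> \<subseteq> D"
proof
  fix x assume x: "x \<in> \<omega>"
  have xc: "x \<in> carrier Q" using x SM_car[OF omega_SM] by blast
  show "x \<in> D"
  proof (rule colonI[OF xc])
    fix i assume "i \<in> J"
    hence "i \<in> A" using J_sub_A by blast
    thus "x \<otimes> i \<in> \<omega>" using SM_smult[OF omega_SM _ x] xc A_car by (simp add: m_comm)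
  qed
qed

lemma D_mult_J: "j \<in> D \<Longrightarrow> i \<in> J \<Longrightarrow> j \<otimes> i \<in> \<omega>" by (rule colonD)

lemma omega_colon_mult_J: "y \<in> colonq Q \<omega> n \<Longrightarrow> i \<in> J \<Longrightarrow> y \<otimes> i \<in> \<omega>"
  using colonD J(2) by blast

text \<open>The second coordinate of \<open>(r + i t) (x + y t)\<close> is \<open>r y + i x - a i y\<close>. For \<open>x\<close> in \<open>D\<close> and
  \<open>y\<close> in \<open>(\<omega> : n)\<close> the last two terms are in \<open>\<omega>\<close>, so \<open>N\<close> may be any \<open>A\<close>-module between \<open>\<omega>\<close> and
  \<open>(\<omega> : n)\<close>.\<close>

lemma D_times_SM:
  assumes N: "N \<in> SM" "\<omega> \<subseteq> N" "N \<subseteq> colonq Q \<omega> n"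
  shows "D \<times> N \<in> P.SM"
proof (rule P.SM_I)
  show "D \<times> N \<subseteq> carrier P" using SM_car[OF D_SM] SM_car[OF N(1)] by auto
  show "\<zero>\<^bsub>P\<^esub> \<in> D \<times> N" using SM_zero[OF D_SM] SM_zero[OF N(1)] by simp
  show "p \<oplus>\<^bsub>P\<^esub> q \<in> D \<times> N" if "p \<in> D \<times> N" "q \<in> D \<times> N" for p q
    using that SM_add[OF D_SM] SM_add[OF N(1)] by auto
next
  fix s p assume "s \<in> S" "p \<in> D \<times> N"
  then obtain r i x y where e: "s = (r, i)" "p = (x, y)" and m: "r \<in> A" "i \<in> J" "x \<in> D" "y \<in> N" by auto
  have c: "r \<in> carrier Q" "i \<in> carrier Q" "x \<in> carrier Q" "y \<in> carrier Q"
    using m A_car SM_car[OF J(1)] SM_car[OF D_SM] SM_car[OF N(1)] by auto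
  have yi: "y \<otimes> i \<in> \<omega>" using omega_colon_mult_J m N(3) by blast
  have xi: "x \<otimes> i \<in> \<omega>" using D_mult_J m by blast
  have "r \<otimes> x \<ominus> b \<otimes> (y \<otimes> i) \<in> D"
    using SM_smult[OF D_SM m(1,3)] SM_smult[OF D_SM ab(2)] yi omega_sub_D by (intro SM_diff[OF D_SM]) auto
  moreover have "x \<otimes> i \<ominus> a \<otimes> (y \<otimes> i) \<in> \<omega>"
    using xi SM_smult[OF omega_SM ab(1) yi] by (intro SM_diff[OF omega_SM])
  hence "r \<otimes> y \<oplus> (x \<otimes> i \<ominus> a \<otimes> (y \<otimes> i)) \<in> N"
    using SM_smult[OF N(1) m(1,4)] N(2) by (intro SM_add[OF N(1)]) auto
  moreover have "r \<otimes> y \<oplus> (x \<otimes> i \<ominus> a \<otimes> (y \<otimes> i)) = r \<otimes> y \<oplus> i \<otimes> x \<ominus> a \<otimes> (i \<otimes> y)"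
    using c ab_car by algebra
  ultimately show "s \<otimes>\<^bsub>P\<^esub> p \<in> D \<times> N" unfolding e using c by (simp add: m_comm)
qed

lemma K_SM: "K \<in> P.SM" using D_times_SM[OF omega_SM subset_refl sub_colon_n[OF omega_SM]] .

lemma one_w: "\<one> \<in> \<omega>" using A\<omega> A_one by blast

lemma frac_K: "P.frac K"
proof -
  obtain y where y: "y \<in> A" "y \<in> Units Q" "\<And>x. x \<in> D \<Longrightarrow> y \<otimes> x \<in> A" using frac_denom[OF D_frac] by blast
  obtain i where i: "i \<in> J" "i \<in> Units Q" using J_unit by blast
  have c: "y \<in> carrier Q" "i \<in> carrier Q" using y i by auto
  have "dilate P (y \<otimes> i, \<zero>) K \<subseteq> S"
  proof
    fix p assume "p \<in> dilate P (y \<otimes> i, \<zero>) K"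
    then obtain x v where xv: "x \<in> D" "v \<in> \<omega>" "p = (y \<otimes> i, \<zero>) \<otimes>\<^bsub>P\<^esub> (x, v)" by (auto simp: dilate_def)
    have xc: "x \<in> carrier Q" "v \<in> carrier Q" using xv SM_car[OF D_SM] SM_car[OF omega_SM] by auto
    have mem: "(y \<otimes> i) \<otimes> q \<in> J" if "q \<in> D" for q
    proof -
      have "(y \<otimes> q) \<otimes> i \<in> J" using SM_smult[OF J(1) y(3)[OF that] i(1)] .
      moreover have "(y \<otimes> q) \<otimes> i = (y \<otimes> i) \<otimes> q" using c that SM_car[OF D_SM] by (simp add: m_ac)
      ultimately show ?thesis by simp
    qed
    have "p = ((y \<otimes> i) \<otimes> x, (y \<otimes> i) \<otimes> v)"
      unfolding xv(3) using c xc ab_car by (intro quad_scalar_mult) auto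
    thus "p \<in> S" using mem[OF xv(1)] mem[of v] xv omega_sub_D J_sub_A by auto
  qed
  moreover have "(y \<otimes> i, \<zero>) \<in> Units P"
    by (rule quad_scalar_unit(1)[OF ab_car]) (use y i in simp)
  moreover have "\<one>\<^bsub>P\<^esub> \<in> K" using one_w omega_sub_D SM_zero[OF omega_SM] by auto
  ultimately show ?thesis using P.fracI[OF K_SM _ _ P.Units_one_closed] by metis
qed

text \<open>Multiplying \<open>x + y t\<close> by \<open>r\<close> in \<open>n\<close> shows that \<open>y\<close> is in \<open>(\<omega> : n)\<close>. Multiplying it by \<open>i t\<close> shows
  that \<open>i x - a i y\<close> is in \<open>\<omega>\<close>, and \<open>i y\<close> already is, since \<open>J \<subseteq> n\<close>.\<close>

lemma K_colon: "colonq P K (n \<times> J) = D \<times> colonq Q \<omega> n"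
proof (intro equalityI subsetI)
  fix p assume p: "p \<in> colonq P K (n \<times> J)"
  then obtain x y where xy: "p = (x, y)" "x \<in> carrier Q" "y \<in> carrier Q" by (auto simp: colonq_def)
  have y: "y \<in> colonq Q \<omega> n"
  proof (rule colonI[OF xy(3)])
    fix r assume r: "r \<in> n"
    have rc: "r \<in> carrier Q" using r n_car by blast
    have "p \<otimes>\<^bsub>P\<^esub> (r, \<zero>) \<in> K" using P.colonD[OF p] r SM_zero[OF J(1)] by blast
    thus "y \<otimes> r \<in> \<omega>" unfolding xy using xy rc ab_car by (simp add: a_minus_def)
  qed
  have "x \<in> D"
  proof (rule colonI[OF xy(2)])
    fix i assume i: "i \<in> J"
    have ic: "i \<in> carrier Q" using i SM_car[OF J(1)] by blast
    have "p \<otimes>\<^bsub>P\<^esub> (\<zero>, i) \<in> K" using P.colonD[OF p] i SM_zero[OF n_SM] by blast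
    hence "x \<otimes> i \<ominus> a \<otimes> (y \<otimes> i) \<in> \<omega>" unfolding xy using xy ic ab_car by simp
    hence "(x \<otimes> i \<ominus> a \<otimes> (y \<otimes> i)) \<oplus> a \<otimes> (y \<otimes> i) \<in> \<omega>"
      using SM_add[OF omega_SM] SM_smult[OF omega_SM ab(1)] omega_colon_mult_J[OF y i] by blast
    moreover have "(x \<otimes> i \<ominus> a \<otimes> (y \<otimes> i)) \<oplus> a \<otimes> (y \<otimes> i) = x \<otimes> i" using xy ic ab_car by algebra
    ultimately show "x \<otimes> i \<in> \<omega>" by simp
  qed
  thus "p \<in> D \<times> colonq Q \<omega> n" using y xy by simp
next
  fix p assume "p \<in> D \<times> colonq Q \<omega> n"
  then obtain x y where xy: "p = (x, y)" "x \<in> D" "y \<in> colonq Q \<omega> n" by auto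
  have c: "x \<in> carrier Q" "y \<in> carrier Q" using xy by (auto simp: colonq_def)
  show "p \<in> colonq P K (n \<times> J)"
  proof (rule P.colonI)
    show "p \<in> carrier P" using xy c by simp
    fix q assume "q \<in> n \<times> J"
    then obtain r i where q: "q = (r, i)" "r \<in> n" "i \<in> J" by auto
    have rc: "r \<in> carrier Q" "i \<in> carrier Q" "r \<in> A" using q n_car SM_car[OF J(1)] n_sub by auto
    have yi: "y \<otimes> i \<in> \<omega>" and yr: "y \<otimes> r \<in> \<omega>" and xi: "x \<otimes> i \<in> \<omega>"
      using omega_colon_mult_J[OF xy(3) q(3)] colonD[OF xy(3) q(2)] D_mult_J[OF xy(2) q(3)] by auto
    have "r \<otimes> x \<ominus> b \<otimes> (y \<otimes> i) \<in> D"
      using SM_smult[OF D_SM rc(3) xy(2)] SM_smult[OF D_SM ab(2)] yi omega_sub_D by (intro SM_diff[OF D_SM]) auto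
    moreover have "x \<otimes> i \<oplus> y \<otimes> r \<ominus> a \<otimes> (y \<otimes> i) \<in> \<omega>"
      using xi yr SM_smult[OF omega_SM ab(1) yi] by (intro SM_diff[OF omega_SM] SM_add[OF omega_SM])
    ultimately show "p \<otimes>\<^bsub>P\<^esub> q \<in> K" unfolding xy q using c rc by (simp add: m_comm)
  qed
qed

lemma scalar_mult_P: "r \<in> carrier Q \<Longrightarrow> x \<in> carrier Q \<Longrightarrow> y \<in> carrier Q \<Longrightarrow> (r, \<zero>) \<otimes>\<^bsub>P\<^esub> (x, y) = (r \<otimes> x, r \<otimes> y)"
  using quad_scalar_mult[OF ab_car] .

lemma R0_sub: "over_ring P R0"
proof -
  have c: "\<And>x. x \<in> A \<Longrightarrow> x \<in> carrier Q" using A_car .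
  have "subring R0 P"
  proof (rule P.subringI)
    fix h assume "h \<in> R0"
    then obtain x where x: "h = (x, \<zero>)" "x \<in> A" by auto
    have "(\<ominus> x, \<zero>) \<oplus>\<^bsub>P\<^esub> h = \<zero>\<^bsub>P\<^esub>" using x c by (simp add: l_neg)
    hence "\<ominus>\<^bsub>P\<^esub> h = (\<ominus> x, \<zero>)" using x c by (intro P.minus_equality) auto
    thus "\<ominus>\<^bsub>P\<^esub> h \<in> R0" using x A_neg by simp
  next
    fix g h assume "g \<in> R0" "h \<in> R0"
    then obtain x y where xy: "g = (x, \<zero>)" "x \<in> A" "h = (y, \<zero>)" "y \<in> A" by auto
    show "g \<otimes>\<^bsub>P\<^esub> h \<in> R0" unfolding xy(1,3) using xy c A_mult by (simp add: scalar_mult_P del: quad_ext_simps(2))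
    show "g \<oplus>\<^bsub>P\<^esub> h \<in> R0" using xy A_add by simp
  qed (use c A_one in auto)
  thus ?thesis unfolding over_ring_def over_ring_axioms_def using P.is_cring by simp
qed

end

sublocale quad_setup \<subseteq> R0: over_ring "quad_ext Q a b" "A \<times> {\<zero>\<^bsub>Q\<^esub>}"
  by (rule R0_sub)

context quad_setup
begin

lemma SM_R0: "N \<in> P.SM \<Longrightarrow> N \<in> R0.SM"
  using SM_zero[OF J(1)] unfolding submods_def by blast

lemma R0_prod: assumes "X1 \<in> SM" "X2 \<in> SM" shows "X1 \<times> X2 \<in> R0.SM"
proof (rule R0.SM_I)
  show "X1 \<times> X2 \<subseteq> carrier P" using SM_car assms by auto
  show "\<zero>\<^bsub>P\<^esub> \<in> X1 \<times> X2" using SM_zero assms by simp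
  show "p \<oplus>\<^bsub>P\<^esub> q \<in> X1 \<times> X2" if "p \<in> X1 \<times> X2" "q \<in> X1 \<times> X2" for p q
    using that SM_add assms by auto
  fix r p assume "r \<in> R0" "p \<in> X1 \<times> X2"
  then obtain s x y where "r = (s, \<zero>)" "s \<in> A" "p = (x, y)" "x \<in> X1" "y \<in> X2" by auto
  moreover from this have "r \<otimes>\<^bsub>P\<^esub> p = (s \<otimes> x, s \<otimes> y)" using SM_car assms A_car by (simp add: scalar_mult_P del: quad_ext_simps(2))
  ultimately show "r \<otimes>\<^bsub>P\<^esub> p \<in> X1 \<times> X2" using SM_smult assms by simp
qed

lemma R0_fst: assumes N: "N \<in> R0.SM" shows "fst ` N \<in> SM"
proof (rule SM_I)
  show "fst ` N \<subseteq> carrier Q" using R0.SM_car[OF N] by fastforce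
  show "\<zero> \<in> fst ` N" using R0.SM_zero[OF N] by force
next
  fix x y assume "x \<in> fst ` N" "y \<in> fst ` N"
  then obtain x' y' where "(x, x') \<in> N" "(y, y') \<in> N" by auto
  hence "(x \<oplus> y, x' \<oplus> y') \<in> N" using R0.SM_add[OF N, of "(x, x')" "(y, y')"] by simp
  thus "x \<oplus> y \<in> fst ` N" by force
next
  fix r x assume r: "r \<in> A" and "x \<in> fst ` N"
  then obtain x' where x: "(x, x') \<in> N" by auto
  have "x \<in> carrier Q" "x' \<in> carrier Q" using R0.SM_car[OF N x] by auto
  hence "(r \<otimes> x, r \<otimes> x') \<in> N"
    using R0.SM_smult[OF N _ x, of "(r, \<zero>)"] r A_car by (simp add: scalar_mult_P del: quad_ext_simps(2))
  thus "r \<otimes> x \<in> fst ` N" by force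
qed

lemma R0_snd: assumes N: "N \<in> R0.SM" shows "snd ` N \<in> SM"
proof (rule SM_I)
  show "snd ` N \<subseteq> carrier Q" using R0.SM_car[OF N] by fastforce
  show "\<zero> \<in> snd ` N" using R0.SM_zero[OF N] by force
next
  fix x y assume "x \<in> snd ` N" "y \<in> snd ` N"
  then obtain x' y' where "(x', x) \<in> N" "(y', y) \<in> N" by auto
  hence "(x' \<oplus> y', x \<oplus> y) \<in> N" using R0.SM_add[OF N, of "(x', x)" "(y', y)"] by simp
  thus "x \<oplus> y \<in> snd ` N" by force
next
  fix r x assume r: "r \<in> A" and "x \<in> snd ` N"
  then obtain x' where x: "(x', x) \<in> N" by auto
  have "x \<in> carrier Q" "x' \<in> carrier Q" using R0.SM_car[OF N x] by auto
  hence "(r \<otimes> x', r \<otimes> x) \<in> N"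
    using R0.SM_smult[OF N _ x, of "(r, \<zero>)"] r A_car by (simp add: scalar_mult_P del: quad_ext_simps(2))
  thus "r \<otimes> x \<in> snd ` N" by force
qed

lemma R0_between_snd:
  assumes N: "N \<in> R0.SM" and H: "X1 \<times> X2 \<subseteq> N" "N \<subseteq> X1 \<times> Y2" and "\<zero> \<in> X2" "X1 \<in> SM"
  shows "N = X1 \<times> snd ` N"
proof
  show "N \<subseteq> X1 \<times> snd ` N" using H by force
  show "X1 \<times> snd ` N \<subseteq> N"
  proof
    fix p assume "p \<in> X1 \<times> snd ` N"
    then obtain x y x' where p: "p = (x, y)" "x \<in> X1" "(x', y) \<in> N" by auto
    have x': "x' \<in> X1" using p H by auto
    have c: "x \<in> carrier Q" "x' \<in> carrier Q" "y \<in> carrier Q"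
      using p x' SM_car[OF assms(5)] R0.SM_car[OF N p(3)] by auto
    have "(x \<ominus> x', \<zero>) \<in> N" using SM_diff[OF assms(5) p(2) x'] H assms(4) by blast
    hence "(x \<ominus> x', \<zero>) \<oplus>\<^bsub>P\<^esub> (x', y) \<in> N" using R0.SM_add[OF N] p by blast
    moreover have "(x \<ominus> x') \<oplus> x' = x" using c by algebra
    ultimately show "p \<in> N" using p c by simp
  qed
qed

lemma R0_between_fst:
  assumes N: "N \<in> R0.SM" and H: "X1 \<times> X2 \<subseteq> N" "N \<subseteq> Y1 \<times> X2" and "\<zero> \<in> X1" "X2 \<in> SM"
  shows "N = fst ` N \<times> X2"
proof
  show "N \<subseteq> fst ` N \<times> X2" using H by force
  show "fst ` N \<times> X2 \<subseteq> N"
  proof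
    fix p assume "p \<in> fst ` N \<times> X2"
    then obtain x y y' where p: "p = (x, y)" "y \<in> X2" "(x, y') \<in> N" by auto
    have y': "y' \<in> X2" using p H by auto
    have c: "y \<in> carrier Q" "y' \<in> carrier Q" "x \<in> carrier Q"
      using p y' SM_car[OF assms(5)] R0.SM_car[OF N p(3)] by auto
    have "(\<zero>, y \<ominus> y') \<in> N" using SM_diff[OF assms(5) p(2) y'] H assms(4) by blast
    hence "(\<zero>, y \<ominus> y') \<oplus>\<^bsub>P\<^esub> (x, y') \<in> N" using R0.SM_add[OF N] p by blast
    moreover have "(y \<ominus> y') \<oplus> y' = y" using c by algebra
    ultimately show "p \<in> N" using p c by simp
  qed
qed

lemma len_snd:
  assumes "X1 \<in> SM" "X2 \<in> SM"
  shows "R0.len (X1 \<times> X2) (X1 \<times> Y2) = len X2 Y2"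
proof (rule antisym)
  note z = SM_zero[OF assms(1)] SM_zero[OF assms(2)]
  show "R0.len (X1 \<times> X2) (X1 \<times> Y2) \<le> len X2 Y2"
  proof (rule chain_len_transfer[where g = "\<lambda>N. snd ` N"])
    show "snd ` N \<in> SM \<and> X2 \<subseteq> snd ` N \<and> snd ` N \<subseteq> Y2"
      if "N \<in> R0.SM" "X1 \<times> X2 \<subseteq> N" "N \<subseteq> X1 \<times> Y2" for N
    proof (intro conjI)
      show "snd ` N \<in> SM" using R0_snd[OF that(1)] .
      show "X2 \<subseteq> snd ` N" using that(2) z by force
      show "snd ` N \<subseteq> Y2" using that(3) by force
    qed
    fix N N' assume a: "N \<in> R0.SM" "X1 \<times> X2 \<subseteq> N" "N' \<in> R0.SM" "N' \<subseteq> X1 \<times> Y2" "N \<subset> N'"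
    have t: "N \<subseteq> X1 \<times> Y2" "X1 \<times> X2 \<subseteq> N'" using a by blast+
    have "N = X1 \<times> snd ` N" using R0_between_snd[OF a(1,2) t(1) z(2) assms(1)] .
    moreover have "N' = X1 \<times> snd ` N'" using R0_between_snd[OF a(3) t(2) a(4) z(2) assms(1)] .
    ultimately have "snd ` N \<noteq> snd ` N'" using a(5) by (metis less_irrefl)
    thus "snd ` N \<subset> snd ` N'" using a(5) by blast
  qed
  show "len X2 Y2 \<le> R0.len (X1 \<times> X2) (X1 \<times> Y2)"
  proof (rule chain_len_transfer[where g = "\<lambda>N. X1 \<times> N"])
    show "X1 \<times> N \<subset> X1 \<times> N'" if "N \<subset> N'" for N N' using that z(1) by blast
  qed (use assms R0_prod in auto)
qed

lemma len_fst:
  assumes "X1 \<in> SM" "X2 \<in> SM"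
  shows "R0.len (X1 \<times> X2) (Y1 \<times> X2) = len X1 Y1"
proof (rule antisym)
  note z = SM_zero[OF assms(1)] SM_zero[OF assms(2)]
  show "R0.len (X1 \<times> X2) (Y1 \<times> X2) \<le> len X1 Y1"
  proof (rule chain_len_transfer[where g = "\<lambda>N. fst ` N"])
    show "fst ` N \<in> SM \<and> X1 \<subseteq> fst ` N \<and> fst ` N \<subseteq> Y1"
      if "N \<in> R0.SM" "X1 \<times> X2 \<subseteq> N" "N \<subseteq> Y1 \<times> X2" for N
    proof (intro conjI)
      show "fst ` N \<in> SM" using R0_fst[OF that(1)] .
      show "X1 \<subseteq> fst ` N" using that(2) z by force
      show "fst ` N \<subseteq> Y1" using that(3) by force
    qed
    fix N N' assume a: "N \<in> R0.SM" "X1 \<times> X2 \<subseteq> N" "N' \<in> R0.SM" "N' \<subseteq> Y1 \<times> X2" "N \<subset> N'"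
    have t: "N \<subseteq> Y1 \<times> X2" "X1 \<times> X2 \<subseteq> N'" using a by blast+
    have "N = fst ` N \<times> X2" using R0_between_fst[OF a(1,2) t(1) z(1) assms(2)] .
    moreover have "N' = fst ` N' \<times> X2" using R0_between_fst[OF a(3) t(2) a(4) z(1) assms(2)] .
    ultimately have "fst ` N \<noteq> fst ` N'" using a(5) by (metis less_irrefl)
    thus "fst ` N \<subset> fst ` N'" using a(5) by blast
  qed
  show "len X1 Y1 \<le> R0.len (X1 \<times> X2) (Y1 \<times> X2)"
  proof (rule chain_len_transfer[where g = "\<lambda>N. N \<times> X2"])
    show "N \<times> X2 \<subset> N' \<times> X2" if "N \<subset> N'" for N N' using that z(2) by blast
  qed (use assms R0_prod in auto)
qed

text \<open>The quotient of \<open>(K : n) = D + (\<omega> : n) t\<close> by \<open>K\<close> is \<open>(\<omega> : n) / \<omega>\<close>, for \<open>S\<close>-submodules as well as for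
  \<open>A\<close>-submodules.\<close>

lemma canon_K: "P.canon K"
proof -
  have "P.len K (D \<times> colonq Q \<omega> n) = len \<omega> (colonq Q \<omega> n)"
  proof (rule antisym)
    have "P.len K (D \<times> colonq Q \<omega> n) \<le> R0.len K (D \<times> colonq Q \<omega> n)"
      using SM_R0 by (intro chain_len_mono) auto
    also have "\<dots> = len \<omega> (colonq Q \<omega> n)" using len_snd[OF D_SM omega_SM] .
    finally show "P.len K (D \<times> colonq Q \<omega> n) \<le> len \<omega> (colonq Q \<omega> n)" .
    show "len \<omega> (colonq Q \<omega> n) \<le> P.len K (D \<times> colonq Q \<omega> n)"
    proof (rule chain_len_transfer[where g = "\<lambda>N. D \<times> N"])
      show "D \<times> N \<subset> D \<times> N'" if "N \<subset> N'" for N N' using that SM_zero[OF D_SM] by blast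
    qed (use D_times_SM in auto)
  qed
  thus ?thesis unfolding P.canon_def K_colon using frac_K w by (simp add: canon_def)
qed

text \<open>Since \<open>S = R0 + (n \<times> J)\<close>, simple \<open>S\<close>-modules remain simple over \<open>R0\<close>.\<close>

lemma len_P_R0:
  assumes Y: "Y \<in> P.SM" and H: "H \<in> P.SM" "H \<subseteq> Y" and fin: "P.len H Y = enat k"
  shows "R0.len H Y = enat k"
  using H fin
proof (induction k arbitrary: H)
  case 0
  hence "H = Y" using P.len_zero_eq[OF _ Y] by (simp add: zero_enat_def)
  thus ?case using R0.len_self by (simp add: zero_enat_def)
next
  case (Suc k)
  obtain Z where Z: "Z \<in> P.SM" "H \<subset> Z" "Z \<subseteq> Y" "P.len H Z = 1" "P.len Z Y = enat k"
    using P.composition_step[OF Suc.prems(1) Y Suc.prems(2,3)] .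
  have "R0.len H Z = P.len H Z"
  proof (rule chain_len_cong)
    fix N assume N: "H \<subseteq> N" "N \<subseteq> Z"
    show "N \<in> R0.SM \<longleftrightarrow> N \<in> P.SM"
    proof
      assume NR: "N \<in> R0.SM"
      show "N \<in> P.SM"
      proof (rule P.SM_I)
        show "N \<subseteq> carrier P" using R0.SM_sub[OF NR] .
        show "\<zero>\<^bsub>P\<^esub> \<in> N" using R0.SM_zero[OF NR] .
        show "p \<oplus>\<^bsub>P\<^esub> q \<in> N" if "p \<in> N" "q \<in> N" for p q using R0.SM_add[OF NR that] .
        fix s p assume "s \<in> S" and p: "p \<in> N"
        then obtain r i where s: "s = (r, i)" "r \<in> A" "i \<in> J" by auto
        have c: "r \<in> carrier Q" "i \<in> carrier Q" using s A_car SM_car[OF J(1)] by auto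
        have pc: "p \<in> carrier P" using R0.SM_car[OF NR p] .
        have "(r, \<zero>) \<otimes>\<^bsub>P\<^esub> p \<in> N" using R0.SM_smult[OF NR _ p, of "(r, \<zero>)"] s by simp
        moreover have "(\<zero>, i) \<otimes>\<^bsub>P\<^esub> p \<in> H"
          using P.simple_killed[OF Suc.prems(1) Z(1,2,4), of "(\<zero>, i)" p] s p N SM_zero[OF n_SM] by blast
        ultimately have "(r, \<zero>) \<otimes>\<^bsub>P\<^esub> p \<oplus>\<^bsub>P\<^esub> (\<zero>, i) \<otimes>\<^bsub>P\<^esub> p \<in> N" using N R0.SM_add[OF NR] by blast
        moreover have "(r, \<zero>) \<otimes>\<^bsub>P\<^esub> p \<oplus>\<^bsub>P\<^esub> (\<zero>, i) \<otimes>\<^bsub>P\<^esub> p = ((r, \<zero>) \<oplus>\<^bsub>P\<^esub> (\<zero>, i)) \<otimes>\<^bsub>P\<^esub> p"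
          using c pc by (intro P.l_distr[symmetric]) auto
        moreover have "(r, \<zero>) \<oplus>\<^bsub>P\<^esub> (\<zero>, i) = s" using s c by simp
        ultimately show "s \<otimes>\<^bsub>P\<^esub> p \<in> N" by simp
      qed
    qed (rule SM_R0)
  qed
  hence "R0.len H Z = 1" using Z by simp
  moreover have "R0.len Z Y = enat k" using Suc.IH[OF Z(1,3,5)] .
  moreover have "R0.len H Y = R0.len H Z + R0.len Z Y"
    using Z Suc.prems Y by (intro R0.len_add SM_R0) auto
  ultimately show ?case by (simp add: one_enat_def)
qed

abbreviation "zP \<equiv> (z, \<zero>)"

lemma z_car: "z \<in> carrier Q" "inv z \<in> carrier Q" using z by auto

lemma zP_unit: "zP \<in> Units P" "inv\<^bsub>P\<^esub> zP = (inv z, \<zero>)"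
  using quad_scalar_unit[OF ab_car z(1)] by auto

lemma zP_K: "zP \<in> K" using z SM_zero[OF omega_SM] by simp

lemma dil_prod: assumes "X1 \<subseteq> carrier Q" "X2 \<subseteq> carrier Q"
  shows "dilate P zP (X1 \<times> X2) = dilate Q z X1 \<times> dilate Q z X2"
proof -
  have "zP \<otimes>\<^bsub>P\<^esub> (x, y) = (z \<otimes> x, z \<otimes> y)" if "x \<in> X1" "y \<in> X2" for x y
    using that assms z_car by (intro scalar_mult_P) auto
  hence "dilate P zP (X1 \<times> X2) = (\<lambda>(x, y). (z \<otimes> x, z \<otimes> y)) ` (X1 \<times> X2)"
    unfolding dilate_def by (intro image_cong) auto
  thus ?thesis by (auto simp: dilate_def)
qed

text \<open>Over \<open>A\<close> the quotient \<open>K / z S\<close> is the direct sum of \<open>D / z A\<close> and \<open>\<omega> / z J\<close>.\<close>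

lemma length_split: "P.len (dilate P zP S) K = len (dilate Q z A) D + len (dilate Q z J) \<omega>"
proof -
  have Acar: "A \<subseteq> carrier Q" "J \<subseteq> carrier Q" using A_car SM_sub[OF J(1)] by auto
  have zA: "dilate Q z A \<in> SM" "dilate Q z J \<in> SM" using SM_dil[OF z_car(1)] A_SM J(1) by auto
  have f: "P.frac (dilate P zP S)" using P.frac_dil[OF zP_unit(1) P.frac_A] .
  have sub: "dilate P zP S \<subseteq> K" using P.dil_A_sub[OF K_SM zP_K] .
  have ds: "dilate P zP S = dilate Q z A \<times> dilate Q z J" using dil_prod[OF Acar] .
  obtain k where k: "P.len (dilate P zP S) K = enat k"
    using P.len_finite[OF f frac_K sub] by auto
  have zJ: "dilate Q z J \<subseteq> \<omega>" using D_mult_J z by (auto simp: dilate_def)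
  have zD: "dilate Q z A \<subseteq> D" using dil_A_sub[OF D_SM z(2)] .
  have "P.len (dilate P zP S) K = R0.len (dilate P zP S) K"
    using len_P_R0[OF K_SM P.frac_SM[OF f] sub k] k by simp
  also have "\<dots> = R0.len (dilate Q z A \<times> dilate Q z J) K" unfolding ds ..
  also have "\<dots> = R0.len (dilate Q z A \<times> dilate Q z J) (D \<times> dilate Q z J) + R0.len (D \<times> dilate Q z J) K"
    using zJ zD by (intro R0.len_add R0_prod zA D_SM omega_SM) auto
  also have "\<dots> = len (dilate Q z A) D + len (dilate Q z J) \<omega>"
    using len_fst[OF zA, of D] len_snd[OF D_SM zA(2), of \<omega>] by simp
  finally show ?thesis .
qed

text \<open>Duality over \<open>A\<close> turns \<open>z A \<subseteq> D\<close> into \<open>J \<subseteq> z\<^sup>-\<^sup>1 \<omega>\<close>.\<close>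

lemma length_dual: "len (dilate Q z A) D = len (dilate Q z J) \<omega>"
proof -
  have f: "frac (dilate Q z A)" using frac_dil[OF z(1) frac_A] .
  have sub: "dilate Q z A \<subseteq> D" using dil_A_sub[OF D_SM z(2)] .
  have Acar: "A \<subseteq> carrier Q" "J \<subseteq> carrier Q" using A_car SM_sub[OF J(1)] by auto
  have "len (dilate Q z A) D = len (colonq Q \<omega> D) (colonq Q \<omega> (dilate Q z A))"
    using len_colon[OF w f D_frac sub] by simp
  also have "colonq Q \<omega> D = J" using colon_colon[OF w frac_J] .
  also have "colonq Q \<omega> (dilate Q z A) = dilate Q (inv z) \<omega>"
    using colon_dil[OF z(1) frac_car[OF omega_frac] Acar(1)] colon_A[OF omega_SM] by simp
  also have "len J (dilate Q (inv z) \<omega>) = len (dilate Q z J) (dilate Q z (dilate Q (inv z) \<omega>))"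
    using Acar frac_car[OF omega_frac] z_car by (intro len_dil[symmetric] z(1)) (auto simp: dilate_def)
  also have "dilate Q z (dilate Q (inv z) \<omega>) = \<omega>" using dil_inv(2)[OF z(1) frac_car[OF omega_frac]] .
  finally show ?thesis .
qed

text \<open>With \<open>\<omega>' = u K\<close> and \<open>p = u z\<close>, the element \<open>p\<close> is in \<open>\<omega>' \<subseteq> (n : n)\<close>, and \<open>p\<^sup>-\<^sup>1 = z\<^sup>-\<^sup>1 u\<^sup>-\<^sup>1\<close> is in
  \<open>z\<^sup>-\<^sup>1 K \<subseteq> W + W t\<close>, because \<open>1 \<in> u K\<close>. The colon of \<open>n\<close> by the ring \<open>W + W t\<close> is a module over both
  \<open>(n : n)\<close> and \<open>W + W t\<close>. So \<open>p\<close> maps it onto itself, and \<open>len_dil_A_cong\<close> compares \<open>z\<close> with \<open>u\<^sup>-\<^sup>1\<close>.\<close>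

theorem almost_gorenstein_quad_type:
  assumes w': "P.canon \<omega>'" and S\<omega>': "S \<subseteq> \<omega>'"
    and wn': "\<And>x r. x \<in> \<omega>' \<Longrightarrow> r \<in> n \<times> J \<Longrightarrow> x \<otimes>\<^bsub>P\<^esub> r \<in> n \<times> J"
  shows "P.len S (colonq P S (n \<times> J)) = 2 * len (dilate Q z A) D + 1"
proof -
  obtain u where u: "u \<in> Units P" "\<omega>' = dilate P u K" using P.canon_unique[OF canon_K w'] .
  note uc = P.Units_closed[OF u(1)] P.Units_inv_closed[OF u(1)]
  note zPc = P.Units_closed[OF zP_unit(1)]
  define p where "p = u \<otimes>\<^bsub>P\<^esub> zP"
  have pU: "p \<in> Units P" unfolding p_def using u(1) zP_unit(1) by (rule P.Units_m_closed)
  note pc = P.Units_closed[OF pU] P.Units_inv_closed[OF pU]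
  have p\<omega>: "p \<in> \<omega>'" unfolding p_def u(2) dilate_def using zP_K by blast
  have "\<one>\<^bsub>P\<^esub> \<in> dilate P u K" using subsetD[OF S\<omega>' P.A_one] unfolding u(2) .
  then obtain k where k: "\<one>\<^bsub>P\<^esub> = u \<otimes>\<^bsub>P\<^esub> k" "k \<in> K" unfolding dilate_def by (rule imageE)
  have kc: "k \<in> carrier P" using P.SM_car[OF K_SM k(2)] .
  have iu: "inv\<^bsub>P\<^esub> u = k" using P.comm_inv_char[OF uc(1) kc k(1)[symmetric]] .
  have iuK: "inv\<^bsub>P\<^esub> u \<in> K" unfolding iu using k(2) .
  have ip: "inv\<^bsub>P\<^esub> p = inv\<^bsub>P\<^esub> zP \<otimes>\<^bsub>P\<^esub> inv\<^bsub>P\<^esub> u"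
  proof (rule P.comm_inv_char[OF pc(1)])
    have "p \<otimes>\<^bsub>P\<^esub> (inv\<^bsub>P\<^esub> zP \<otimes>\<^bsub>P\<^esub> inv\<^bsub>P\<^esub> u) = (u \<otimes>\<^bsub>P\<^esub> inv\<^bsub>P\<^esub> u) \<otimes>\<^bsub>P\<^esub> (zP \<otimes>\<^bsub>P\<^esub> inv\<^bsub>P\<^esub> zP)"
      unfolding p_def using uc zPc P.Units_inv_closed[OF zP_unit(1)] by (simp only: P.m_ac P.m_closed)
    also have "\<dots> = \<one>\<^bsub>P\<^esub>"
      unfolding P.Units_r_inv[OF u(1)] P.Units_r_inv[OF zP_unit(1)] using P.l_one[OF P.one_closed] .
    finally show "p \<otimes>\<^bsub>P\<^esub> (inv\<^bsub>P\<^esub> zP \<otimes>\<^bsub>P\<^esub> inv\<^bsub>P\<^esub> u) = \<one>\<^bsub>P\<^esub>" .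
    show "inv\<^bsub>P\<^esub> zP \<otimes>\<^bsub>P\<^esub> inv\<^bsub>P\<^esub> u \<in> carrier P"
      using P.Units_inv_closed[OF zP_unit(1)] uc(2) by (rule P.m_closed)
  qed
  have ipW: "inv\<^bsub>P\<^esub> p \<in> W \<times> W"
  proof -
    obtain j v where jv: "inv\<^bsub>P\<^esub> u = (j, v)" "j \<in> D" "v \<in> \<omega>" using iuK by auto
    have c: "j \<in> carrier Q" "v \<in> carrier Q" using jv SM_car[OF D_SM] SM_car[OF omega_SM] by auto
    have "inv\<^bsub>P\<^esub> p = (inv z \<otimes> j, inv z \<otimes> v)"
      unfolding ip zP_unit(2) jv(1) using scalar_mult_P[OF z_car(2) c] .
    thus ?thesis using zW[OF jv(2)] zW[of v] jv(3) omega_sub_D by auto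
  qed
  have Wneg: "\<ominus> x \<in> W" if "x \<in> W" for x
  proof -
    have "\<ominus> \<one> \<in> W" using A_neg A_one W(2) by blast
    hence "\<ominus> \<one> \<otimes> x \<in> W" using W(4) that by blast
    thus ?thesis using that W(1) by (auto simp: l_minus)
  qed
  have WW: "p \<otimes>\<^bsub>P\<^esub> q \<in> W \<times> W" if pq: "p \<in> W \<times> W" "q \<in> W \<times> W" for p q
  proof -
    obtain x y s t where e: "p = (x, y)" "q = (s, t)" and m: "x \<in> W" "y \<in> W" "s \<in> W" "t \<in> W"
      using pq by blast
    have abW: "a \<in> W" "b \<in> W" using ab W(2) by auto
    show ?thesis unfolding e using m abW W(3,4) Wneg by (simp add: a_minus_def)
  qed
  have WWc: "W \<times> W \<subseteq> carrier P" using W(1) by auto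
  define B where "B = colonq P (n \<times> J) (W \<times> W)"
  have BS: "B \<in> P.SM" unfolding B_def using P.SM_colon[OF P.n_SM WWc] .
  have one: "\<one>\<^bsub>P\<^esub> \<in> W \<times> W" using A_one A_zero W(2) by auto
  have Bn: "B \<subseteq> n \<times> J"
  proof
    fix q assume q: "q \<in> B"
    have "q \<otimes>\<^bsub>P\<^esub> \<one>\<^bsub>P\<^esub> \<in> n \<times> J" using P.colonD[OF q[unfolded B_def] one] .
    thus "q \<in> n \<times> J" using P.r_one[OF P.SM_car[OF BS q]] by (simp only:)
  qed
  hence BA: "B \<subseteq> S" using P.n_sub by blast
  have Bf: "P.frac B"
  proof -
    obtain d where d: "d \<in> Units Q" "dilate Q d W \<subseteq> A" using Wfrac by blast
    obtain i where i: "i \<in> J" "i \<in> Units Q" using J_unit by blast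
    obtain r where r: "r \<in> n" "r \<in> Units Q" using n_reg by blast
    have c: "d \<in> carrier Q" "i \<in> carrier Q" "r \<in> carrier Q" using d i r by auto
    let ?e = "d \<otimes> (i \<otimes> r)"
    have "(?e, \<zero>) \<in> B" unfolding B_def
    proof (rule P.colonI)
      show "(?e, \<zero>) \<in> carrier P" using c by simp
      fix q assume "q \<in> W \<times> W"
      then obtain x y where xy: "q = (x, y)" "x \<in> W" "y \<in> W" by auto
      have xc: "x \<in> carrier Q" "y \<in> carrier Q" using xy W(1) by auto
      have dx: "d \<otimes> x \<in> A" "d \<otimes> y \<in> A" using xy d(2) by (auto simp: dilate_def)
      have iA: "i \<in> A" "r \<in> A" using i J_sub_A r n_sub by auto
      have "((d \<otimes> x) \<otimes> i) \<otimes> r \<in> n" using SM_smult[OF n_SM A_mult[OF dx(1) iA(1)] r(1)] .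
      moreover have "((d \<otimes> y) \<otimes> r) \<otimes> i \<in> J" using SM_smult[OF J(1) A_mult[OF dx(2) iA(2)] i(1)] .
      moreover have "((d \<otimes> x) \<otimes> i) \<otimes> r = ?e \<otimes> x" "((d \<otimes> y) \<otimes> r) \<otimes> i = ?e \<otimes> y"
        using c xc by (simp_all add: m_ac)
      ultimately have "(?e \<otimes> x, ?e \<otimes> y) \<in> n \<times> J" by simp
      moreover have "(?e, \<zero>) \<otimes>\<^bsub>P\<^esub> q = (?e \<otimes> x, ?e \<otimes> y)" unfolding xy(1) using c xc by (intro scalar_mult_P) auto
      ultimately show "(?e, \<zero>) \<otimes>\<^bsub>P\<^esub> q \<in> n \<times> J" by (simp only:)
    qed
    moreover have "(?e, \<zero>) \<in> Units P"
      by (rule quad_scalar_unit(1)[OF ab_car]) (use d i r in simp)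
    moreover have "dilate P \<one>\<^bsub>P\<^esub> B \<subseteq> S" using P.dil_one[OF P.SM_sub[OF BS]] BA by (simp only:)
    ultimately show ?thesis using P.fracI[OF BS P.Units_one_closed] by metis
  qed
  have pB: "p \<otimes>\<^bsub>P\<^esub> q \<in> B" if q: "q \<in> B" for q
  proof -
    have qc: "q \<in> carrier P" using P.SM_car[OF BS q] .
    show ?thesis unfolding B_def
    proof (rule P.colonI)
      show "p \<otimes>\<^bsub>P\<^esub> q \<in> carrier P" using pc(1) qc by (rule P.m_closed)
      fix v assume v: "v \<in> W \<times> W"
      have "p \<otimes>\<^bsub>P\<^esub> (q \<otimes>\<^bsub>P\<^esub> v) \<in> n \<times> J" using wn'[OF p\<omega> P.colonD[OF q[unfolded B_def] v]] .
      thus "p \<otimes>\<^bsub>P\<^esub> q \<otimes>\<^bsub>P\<^esub> v \<in> n \<times> J" using P.m_assoc[OF pc(1) qc subsetD[OF WWc v]] by (simp only:)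
    qed
  qed
  have ipB: "inv\<^bsub>P\<^esub> p \<otimes>\<^bsub>P\<^esub> q \<in> B" if q: "q \<in> B" for q
  proof -
    have qc: "q \<in> carrier P" using P.SM_car[OF BS q] .
    show ?thesis unfolding B_def
    proof (rule P.colonI)
      show "inv\<^bsub>P\<^esub> p \<otimes>\<^bsub>P\<^esub> q \<in> carrier P" using pc(2) qc by (rule P.m_closed)
      fix v assume v: "v \<in> W \<times> W"
      have "q \<otimes>\<^bsub>P\<^esub> (inv\<^bsub>P\<^esub> p \<otimes>\<^bsub>P\<^esub> v) \<in> n \<times> J" using P.colonD[OF q[unfolded B_def] WW[OF ipW v]] .
      moreover have "q \<otimes>\<^bsub>P\<^esub> (inv\<^bsub>P\<^esub> p \<otimes>\<^bsub>P\<^esub> v) = inv\<^bsub>P\<^esub> p \<otimes>\<^bsub>P\<^esub> q \<otimes>\<^bsub>P\<^esub> v"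
        using pc(2) qc subsetD[OF WWc v] by (simp only: P.m_ac P.m_closed)
      ultimately show "inv\<^bsub>P\<^esub> p \<otimes>\<^bsub>P\<^esub> q \<otimes>\<^bsub>P\<^esub> v \<in> n \<times> J" by (simp only:)
    qed
  qed
  have "dilate P p B = B"
  proof
    show "dilate P p B \<subseteq> B" using pB by (auto simp: dilate_def)
    show "B \<subseteq> dilate P p B"
    proof
      fix q assume q: "q \<in> B"
      have qc: "q \<in> carrier P" using P.SM_car[OF BS q] .
      have "p \<otimes>\<^bsub>P\<^esub> (inv\<^bsub>P\<^esub> p \<otimes>\<^bsub>P\<^esub> q) = (p \<otimes>\<^bsub>P\<^esub> inv\<^bsub>P\<^esub> p) \<otimes>\<^bsub>P\<^esub> q"
        using P.m_assoc[OF pc qc] by (simp only:)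
      also have "\<dots> = q" using P.Units_r_inv[OF pU] P.l_one[OF qc] by (simp only:)
      finally have "q = p \<otimes>\<^bsub>P\<^esub> (inv\<^bsub>P\<^esub> p \<otimes>\<^bsub>P\<^esub> q)" by (rule sym)
      thus "q \<in> dilate P p B" unfolding dilate_def using ipB[OF q] by (rule image_eqI)
    qed
  qed
  hence "dilate P (inv\<^bsub>P\<^esub> u) B = dilate P (inv\<^bsub>P\<^esub> u) (dilate P p B)" by simp
  also have "\<dots> = dilate P (inv\<^bsub>P\<^esub> u \<otimes>\<^bsub>P\<^esub> p) B" using P.dil_dil[OF uc(2) pc(1) P.SM_sub[OF BS]] .
  also have "inv\<^bsub>P\<^esub> u \<otimes>\<^bsub>P\<^esub> p = zP"
  proof -
    have "inv\<^bsub>P\<^esub> u \<otimes>\<^bsub>P\<^esub> p = (inv\<^bsub>P\<^esub> u \<otimes>\<^bsub>P\<^esub> u) \<otimes>\<^bsub>P\<^esub> zP"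
      unfolding p_def using P.m_assoc[OF uc(2,1) zPc] by (rule sym)
    thus ?thesis using P.Units_l_inv[OF u(1)] P.l_one[OF zPc] by (simp only:)
  qed
  finally have eq: "dilate P zP B = dilate P (inv\<^bsub>P\<^esub> u) B" by (rule sym)
  have "P.len (dilate P zP S) K = P.len (dilate P (inv\<^bsub>P\<^esub> u) S) K"
    using P.len_dil_A_cong[OF frac_K Bf BA zP_unit(1) zP_K P.Units_inv_Units[OF u(1)] iuK eq] .
  also have "\<dots> = P.len (dilate P u (dilate P (inv\<^bsub>P\<^esub> u) S)) (dilate P u K)"
    using P.SM_sub[OF P.SM_dil[OF uc(2) P.A_SM]] P.SM_sub[OF K_SM] by (intro P.len_dil[symmetric] u(1))
  also have "\<dots> = P.len S \<omega>'"
    using P.dil_inv(2)[OF u(1) P.SM_sub[OF P.A_SM]] u(2) by (simp only:)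
  finally have "P.len S \<omega>' = len (dilate Q z A) D + len (dilate Q z J) \<omega>" using length_split by simp
  also have "\<dots> = 2 * len (dilate Q z A) D" using length_dual by (simp add: mult_2)
  finally show ?thesis using P.almost_gorenstein_type[OF w' S\<omega>' wn'] by simp
qed

end

section \<open>The quotient of the Rees algebra\<close>

text \<open>The first isomorphism theorem yields homomorphisms onto an image, which are to be read as maps into the whole ring.\<close>

lemma ring_hom_extend_codomain:
  assumes "h \<in> ring_hom T (E\<lparr>carrier := C\<rparr>)" "C \<subseteq> carrier E"
  shows "h \<in> ring_hom T E"
  using assms unfolding ring_hom_def by auto

context cring
begin

lemma ideal_power_0: "ideal_power R J 0 = carrier R"
  by (simp add: ideal_power_def ideals_set_def)

lemma ideal_power_Suc: "ideal_power R J (Suc k) = ideal_power R J k \<cdot> J"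
  by (simp add: ideal_power_def ideals_set_def)

lemma ideal_power_ideal: "ideal J R \<Longrightarrow> ideal (ideal_power R J k) R"
  by (induction k) (simp_all add: ideal_power_0 ideal_power_Suc oneideal ideal_prod_is_ideal)

lemma ideal_power_1: assumes "ideal J R" shows "ideal_power R J 1 = J"
  using ideal_prod_commute[OF oneideal assms] ideal_prod_one[OF assms]
  by (simp add: ideal_power_0 ideal_power_Suc)

lemma ideal_power_le: assumes "ideal J R" "0 < k" shows "ideal_power R J k \<subseteq> J"
proof -
  obtain l where "k = Suc l" using assms(2) gr0_implies_Suc by blast
  thus ?thesis using ideal_prod_inter[OF ideal_power_ideal[OF assms(1), of l] assms(1)]
    by (auto simp: ideal_power_Suc)
qed

lemma ideal_power_mult:
  assumes J: "ideal J R" and x: "x \<in> ideal_power R J k" and y: "y \<in> ideal_power R J l"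
  shows "x \<otimes> y \<in> ideal_power R J (k + l)"
proof -
  interpret M: comm_monoid "ideals_set R" by (rule ideals_set_is_comm_monoid)
  have "J \<in> carrier (ideals_set R)" using J by (simp add: ideals_set_def)
  from M.nat_pow_mult[OF this, of k l] have "ideal_power R J k \<cdot> ideal_power R J l = ideal_power R J (k + l)"
    by (simp add: ideal_power_def ideals_set_def)
  moreover have "x \<otimes> y \<in> ideal_power R J k \<cdot> ideal_power R J l" using x y by (rule ideal_prod.prod)
  ultimately show ?thesis by simp
qed

lemma ideal_finsum:
  assumes J: "ideal J R" and fin: "finite T" and f: "\<And>i. i \<in> T \<Longrightarrow> f i \<in> J"
  shows "finsum R f T \<in> J"
proof -
  interpret J: ideal J R by fact
  show ?thesis using fin f
  proof (induction T)
    case (insert t T)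
    hence "finsum R f (insert t T) = f t \<oplus> finsum R f T"
      by (intro finsum_insert) (auto intro: J.Icarr)
    thus ?case using insert by simp
  qed simp
qed

text \<open>The quotient is identified with \<open>R \<times> I\<close> by evaluation at the adjoined root. A polynomial in the
  kernel is divisible by the monic quadratic polynomial, as its remainder has degree below two and
  vanishes only if its two coefficients do.\<close>

theorem rees_quotient_embedding:
  assumes I: "ideal I R" and a: "a \<in> carrier R" and b: "b \<in> carrier R" and ne: "\<one> \<noteq> \<zero>"
  shows "\<exists>h. h \<in> ring_hom (rees_quotient R I a b) (quad_ext R a b) \<and>
    inj_on h (carrier (rees_quotient R I a b)) \<and> h ` carrier (rees_quotient R I a b) = carrier R \<times> I"
proof -
  let ?E = "quad_ext R a b" and ?U = "UP R"
  interpret I: ideal I R by fact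
  interpret E: cring ?E using cring_quad_ext[OF a b] .
  define \<phi> where "\<phi> = (\<lambda>r :: 'a. (r, \<zero>))"
  define \<tau> where "\<tau> = (\<zero>, \<one>)"
  have \<phi>: "\<phi> \<in> ring_hom R ?E"
    by (rule ring_hom_memI) (use a b in \<open>simp_all add: \<phi>_def a_minus_def\<close>)
  interpret \<phi>: ring_hom_cring R ?E \<phi>
    using \<phi> E.is_cring is_cring by (simp add: ring_hom_cring_def ring_hom_cring_axioms_def)
  interpret U: UP_cring R ?U by unfold_locales simp
  interpret V: UP_pre_univ_prop R ?E \<phi> ?U by unfold_locales simp
  have \<tau>: "\<tau> \<in> carrier ?E" by (simp add: \<tau>_def)
  define ev where "ev = UnivPoly.eval R ?E \<phi> \<tau>"
  have evh: "ev \<in> ring_hom ?U ?E" unfolding ev_def by (rule V.eval_ring_hom[OF \<tau>])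
  have ev_monom: "ev (up_ring.monom ?U r k) = \<phi> r \<otimes>\<^bsub>?E\<^esub> \<tau> [^]\<^bsub>?E\<^esub> k" if "r \<in> carrier R" for r k
    unfolding ev_def by (rule V.eval_monom[OF that \<tau>])
  have ev_add: "ev (p \<oplus>\<^bsub>?U\<^esub> q) = ev p \<oplus>\<^bsub>?E\<^esub> ev q" if "p \<in> carrier ?U" "q \<in> carrier ?U" for p q
    using ring_hom_add[OF evh that] .
  have ev_mult: "ev (p \<otimes>\<^bsub>?U\<^esub> q) = ev p \<otimes>\<^bsub>?E\<^esub> ev q" if "p \<in> carrier ?U" "q \<in> carrier ?U" for p q
    using ring_hom_mult[OF evh that] .
  have ev_closed: "ev p \<in> carrier ?E" if "p \<in> carrier ?U" for p
    using ring_hom_closed[OF evh that] .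
  have scal: "(r, \<zero>) \<otimes>\<^bsub>?E\<^esub> (x, y) = (r \<otimes> x, r \<otimes> y)"
    if "r \<in> carrier R" "x \<in> carrier R" "y \<in> carrier R" for r x y
    using quad_scalar_mult[OF a b that] .
  have pow0: "\<tau> [^]\<^bsub>?E\<^esub> (0::nat) = (\<one>, \<zero>)" by simp
  have pow1: "\<tau> [^]\<^bsub>?E\<^esub> (1::nat) = (\<zero>, \<one>)" using \<tau> a b by (simp add: \<tau>_def a_minus_def)
  have pow2: "\<tau> [^]\<^bsub>?E\<^esub> (2::nat) = (\<ominus> b, \<ominus> a)"
    using \<tau> a b by (simp add: numeral_2_eq_2 \<tau>_def a_minus_def)
  have ev0: "ev (up_ring.monom ?U r 0) = (r, \<zero>)" if "r \<in> carrier R" for r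
    unfolding ev_monom[OF that] pow0 \<phi>_def using scal[OF that one_closed zero_closed] that by simp
  have ev1: "ev (up_ring.monom ?U r 1) = (\<zero>, r)" if "r \<in> carrier R" for r
    unfolding ev_monom[OF that] pow1 \<phi>_def using scal[OF that zero_closed one_closed] that by simp
  define g where "g = quadratic R a b"
  have mc: "up_ring.monom ?U \<one> 2 \<in> carrier ?U" "up_ring.monom ?U a 1 \<in> carrier ?U" "up_ring.monom ?U b 0 \<in> carrier ?U"
    using a b by (simp_all add: U.monom_closed)
  have gc: "g \<in> carrier ?U" unfolding g_def quadratic_def using mc by (intro U.P.a_closed)
  have gcoeff: "up_ring.coeff ?U g k = (if k = 2 then \<one> else if k = 1 then a else if k = 0 then b else \<zero>)" for k
    unfolding g_def quadratic_def using a b mc by simp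
  have g0: "g \<noteq> \<zero>\<^bsub>?U\<^esub>" using gcoeff[of 2] ne by (metis U.coeff_zero)
  have degg: "deg R g = 2"
  proof (rule le_antisym)
    show "deg R g \<le> 2" by (rule U.deg_aboveI[OF _ gc]) (simp add: gcoeff)
    show "2 \<le> deg R g" by (rule U.deg_belowI[OF _ gc]) (simp add: gcoeff ne)
  qed
  have evg: "ev g = \<zero>\<^bsub>?E\<^esub>"
  proof -
    have "ev g = (ev (up_ring.monom ?U \<one> 2) \<oplus>\<^bsub>?E\<^esub> ev (up_ring.monom ?U a 1)) \<oplus>\<^bsub>?E\<^esub> ev (up_ring.monom ?U b 0)"
      unfolding g_def quadratic_def using mc U.P.a_closed[OF mc(1,2)] by (simp only: ev_add)
    also have "ev (up_ring.monom ?U \<one> 2) = (\<ominus> b, \<ominus> a)"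
      unfolding ev_monom[OF one_closed] pow2 \<phi>_def using scal[of \<one> "\<ominus> b" "\<ominus> a"] a b by simp
    finally show ?thesis using ev0[OF b] ev1[OF a] a b by (simp add: l_neg)
  qed
  have ker: "p \<in> PIdl\<^bsub>?U\<^esub> g \<longleftrightarrow> ev p = \<zero>\<^bsub>?E\<^esub>" if p: "p \<in> carrier ?U" for p
  proof
    assume "p \<in> PIdl\<^bsub>?U\<^esub> g"
    then obtain q where q: "q \<in> carrier ?U" "p = q \<otimes>\<^bsub>?U\<^esub> g" by (auto simp: cgenideal_def)
    thus "ev p = \<zero>\<^bsub>?E\<^esub>" using ev_mult[OF q(1) gc] evg E.r_null[OF ev_closed[OF q(1)]] by (simp only:)
  next
    assume 0: "ev p = \<zero>\<^bsub>?E\<^esub>"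
    obtain q r k where qr: "q \<in> carrier ?U" "r \<in> carrier ?U"
      "up_ring.coeff ?U g (deg R g) [^] (k::nat) \<odot>\<^bsub>?U\<^esub> p = g \<otimes>\<^bsub>?U\<^esub> q \<oplus>\<^bsub>?U\<^esub> r"
      "r = \<zero>\<^bsub>?U\<^esub> \<or> deg R r < deg R g" using U.long_div_theorem[OF gc p g0] by blast
    have e: "p = g \<otimes>\<^bsub>?U\<^esub> q \<oplus>\<^bsub>?U\<^esub> r" using qr(3) p degg gcoeff[of 2] by simp
    have rdeg: "up_ring.coeff ?U r m = \<zero>" if "2 \<le> m" for m
      using qr(2,4) that degg U.deg_aboveD[of r m] by auto
    define r' where "r' = up_ring.monom ?U (up_ring.coeff ?U r 0) 0 \<oplus>\<^bsub>?U\<^esub> up_ring.monom ?U (up_ring.coeff ?U r 1) 1"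
    have rc: "up_ring.coeff ?U r 0 \<in> carrier R" "up_ring.coeff ?U r 1 \<in> carrier R" using qr(2) by (simp_all add: U.coeff_closed)
    note rm = U.monom_closed[OF rc(1), of 0] U.monom_closed[OF rc(2), of 1]
    have r': "r = r'"
    proof (rule U.up_eqI[OF _ qr(2)])
      show "r' \<in> carrier ?U" unfolding r'_def using rm by (rule U.P.a_closed)
      fix m
      show "up_ring.coeff ?U r m = up_ring.coeff ?U r' m"
      proof -
        consider "m = 0" | "m = 1" | "2 \<le> m" by linarith
        thus ?thesis unfolding r'_def using rc rm rdeg[of m] by cases auto
      qed
    qed
    have "ev p = ev g \<otimes>\<^bsub>?E\<^esub> ev q \<oplus>\<^bsub>?E\<^esub> ev r"
      unfolding e using ev_add[OF U.P.m_closed[OF gc qr(1)] qr(2)] ev_mult[OF gc qr(1)] by (simp only:)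
    also have "\<dots> = ev r" unfolding evg using ev_closed[OF qr(1)] ev_closed[OF qr(2)] by (simp del: quad_ext_simps)
    also have "\<dots> = (up_ring.coeff ?U r 0, up_ring.coeff ?U r 1)"
      using ev_add[OF rm] ev0[OF rc(1)] ev1[OF rc(2)] rc unfolding r'_def[symmetric] r'[symmetric] by simp
    finally have "(up_ring.coeff ?U r 0, up_ring.coeff ?U r 1) = (\<zero>, \<zero>)"
      unfolding 0 quad_ext_simps(5) by (rule sym)
    hence rz: "up_ring.coeff ?U r 0 = \<zero>" "up_ring.coeff ?U r 1 = \<zero>" unfolding prod.inject by blast+
    have "r = \<zero>\<^bsub>?U\<^esub>"
    proof (rule U.up_eqI[OF _ qr(2) U.P.zero_closed])
      fix m :: nat
      consider "m = 0" | "m = 1" | "2 \<le> m" by linarith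
      thus "up_ring.coeff ?U r m = up_ring.coeff ?U \<zero>\<^bsub>?U\<^esub> m" using rz rdeg[of m] by cases auto
    qed
    hence "p = q \<otimes>\<^bsub>?U\<^esub> g" using e U.P.m_comm[OF gc qr(1)] U.P.r_zero[OF U.P.m_closed[OF gc qr(1)]] by simp
    thus "p \<in> PIdl\<^bsub>?U\<^esub> g" unfolding cgenideal_def using qr(1) by blast
  qed
  let ?T = "rees_algebra R I"
  have Tc: "carrier ?T = {p \<in> carrier ?U. \<forall>k. up_ring.coeff ?U p k \<in> ideal_power R I k}"
    by (simp add: rees_algebra_def)
  have pI: "ideal (ideal_power R I k) R" for k using ideal_power_ideal[OF I] .
  have T_E: "p \<in> carrier ?U" "up_ring.coeff ?U p k \<in> ideal_power R I k" if "p \<in> carrier ?T" for p k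
    using that by (auto simp: Tc)
  have T_I: "p \<in> carrier ?T" if "p \<in> carrier ?U" "\<And>k. up_ring.coeff ?U p k \<in> ideal_power R I k" for p
    using that by (auto simp: Tc)
  have monomT: "up_ring.monom ?U r k \<in> carrier ?T" if "r \<in> carrier R" "r \<in> ideal_power R I k" for r k
    using that additive_subgroup.zero_closed[OF ideal.axioms(1)[OF pI]]
    by (intro T_I) (auto simp: U.monom_closed)
  have addT: "p \<oplus>\<^bsub>?U\<^esub> q \<in> carrier ?T" if "p \<in> carrier ?T" "q \<in> carrier ?T" for p q
  proof (rule T_I)
    show "p \<oplus>\<^bsub>?U\<^esub> q \<in> carrier ?U" using T_E(1)[OF that(1)] T_E(1)[OF that(2)] by (rule U.P.a_closed)
    show "up_ring.coeff ?U (p \<oplus>\<^bsub>?U\<^esub> q) k \<in> ideal_power R I k" for k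
      using U.coeff_add[OF T_E(1)[OF that(1)] T_E(1)[OF that(2)], of k]
        additive_subgroup.a_closed[OF ideal.axioms(1)[OF pI] T_E(2)[OF that(1)] T_E(2)[OF that(2)]] by simp
  qed
  have multT: "p \<otimes>\<^bsub>?U\<^esub> q \<in> carrier ?T" if "p \<in> carrier ?T" "q \<in> carrier ?T" for p q
  proof (rule T_I)
    note pq = T_E(1)[OF that(1)] T_E(1)[OF that(2)]
    show "p \<otimes>\<^bsub>?U\<^esub> q \<in> carrier ?U" using pq by (rule U.P.m_closed)
    show "up_ring.coeff ?U (p \<otimes>\<^bsub>?U\<^esub> q) k \<in> ideal_power R I k" for k
      unfolding U.coeff_mult[OF pq]
    proof (rule ideal_finsum[OF pI])
      fix i assume i: "i \<in> {..k}"
      have "up_ring.coeff ?U p i \<otimes> up_ring.coeff ?U q (k - i) \<in> ideal_power R I (i + (k - i))"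
        by (rule ideal_power_mult[OF I T_E(2)[OF that(1)] T_E(2)[OF that(2)]])
      thus "up_ring.coeff ?U p i \<otimes> up_ring.coeff ?U q (k - i) \<in> ideal_power R I k" using i by simp
    qed simp
  qed
  have one1: "\<one>\<^bsub>?U\<^esub> \<in> carrier ?T"
    using monomT[of \<one> 0] by (simp add: ideal_power_0 U.monom_one)
  have negT: "\<ominus>\<^bsub>?U\<^esub> p \<in> carrier ?T" if "p \<in> carrier ?T" for p
  proof (rule T_I)
    show "\<ominus>\<^bsub>?U\<^esub> p \<in> carrier ?U" using T_E(1)[OF that] by (rule U.P.a_inv_closed)
    show "up_ring.coeff ?U (\<ominus>\<^bsub>?U\<^esub> p) k \<in> ideal_power R I k" for k
      using U.coeff_a_inv[OF T_E(1)[OF that], of k]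
        additive_subgroup.a_inv_closed[OF ideal.axioms(1)[OF pI] T_E(2)[OF that]] by simp
  qed
  have "subring (carrier ?T) ?U"
  proof (rule U.P.subringI)
    show "carrier ?T \<subseteq> carrier ?U" by (simp add: Tc)
  qed (rule one1 negT addT multT; assumption?)+
  from U.P.subring_is_ring[OF this] have Tring: "ring ?T" by (simp add: rees_algebra_def)
  have ops: "monoid.mult ?T = monoid.mult ?U" "add ?T = add ?U" "\<one>\<^bsub>?T\<^esub> = \<one>\<^bsub>?U\<^esub>" "\<zero>\<^bsub>?T\<^esub> = \<zero>\<^bsub>?U\<^esub>"
    by (simp_all add: rees_algebra_def)
  have "ev \<in> ring_hom ?T ?E"
    by (rule ring_hom_memI) (simp_all only: ops ev_closed ev_add ev_mult T_E(1) ring_hom_one[OF evh])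
  then interpret T: ring_hom_ring ?T ?E ev by (rule ring_hom_ringI2[OF Tring E.ring_axioms])
  have kerT: "a_kernel ?T ?E ev = PIdl\<^bsub>?U\<^esub> g \<inter> carrier ?T"
    using ker T_E(1) unfolding a_kernel_def' by blast
  have "ev ` carrier ?T = carrier R \<times> I"
  proof
    show "ev ` carrier ?T \<subseteq> carrier R \<times> I"
    proof (rule image_subsetI)
      fix p assume p: "p \<in> carrier ?T"
      have pc: "p \<in> carrier ?U" using T_E(1)[OF p] .
      have mon: "\<phi> (up_ring.coeff ?U p i) \<otimes>\<^bsub>?E\<^esub> \<tau> [^]\<^bsub>?E\<^esub> i \<in> carrier R \<times> I" for i
      proof -
        have cc: "up_ring.coeff ?U p i \<in> carrier R" using pc by (simp add: U.coeff_closed)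
        have "\<tau> [^]\<^bsub>?E\<^esub> i \<in> carrier ?E" using \<tau> by (rule E.nat_pow_closed)
        then obtain x y where xy: "\<tau> [^]\<^bsub>?E\<^esub> i = (x, y)" "x \<in> carrier R" "y \<in> carrier R" by auto
        have e: "\<phi> (up_ring.coeff ?U p i) \<otimes>\<^bsub>?E\<^esub> \<tau> [^]\<^bsub>?E\<^esub> i = (up_ring.coeff ?U p i \<otimes> x, up_ring.coeff ?U p i \<otimes> y)"
          unfolding xy(1) \<phi>_def using scal[OF cc xy(2,3)] .
        show ?thesis
        proof (cases "i = 0")
          case True
          hence "y = \<zero>" using xy(1) pow0 by simp
          thus ?thesis unfolding e using cc xy by simp
        next
          case False
          hence "up_ring.coeff ?U p i \<in> I" using T_E(2)[OF p, of i] ideal_power_le[OF I, of i] by auto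
          thus ?thesis unfolding e using cc xy by (simp add: I.I_r_closed)
        qed
      qed
      have "(\<Oplus>\<^bsub>?E\<^esub>i\<in>M. \<phi> (up_ring.coeff ?U p i) \<otimes>\<^bsub>?E\<^esub> \<tau> [^]\<^bsub>?E\<^esub> i) \<in> carrier R \<times> I" if "finite M" for M
        using that
      proof (induction M)
        case (insert m M)
        have c: "\<phi> (up_ring.coeff ?U p i) \<otimes>\<^bsub>?E\<^esub> \<tau> [^]\<^bsub>?E\<^esub> i \<in> carrier ?E" for i using mon[of i] I.Icarr by auto
        have "(\<Oplus>\<^bsub>?E\<^esub>i\<in>insert m M. \<phi> (up_ring.coeff ?U p i) \<otimes>\<^bsub>?E\<^esub> \<tau> [^]\<^bsub>?E\<^esub> i) =
          \<phi> (up_ring.coeff ?U p m) \<otimes>\<^bsub>?E\<^esub> \<tau> [^]\<^bsub>?E\<^esub> m \<oplus>\<^bsub>?E\<^esub> (\<Oplus>\<^bsub>?E\<^esub>i\<in>M. \<phi> (up_ring.coeff ?U p i) \<otimes>\<^bsub>?E\<^esub> \<tau> [^]\<^bsub>?E\<^esub> i)"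
          by (rule E.finsum_insert[OF insert(1,2)]) (use c in blast)+
        moreover have "v \<oplus>\<^bsub>?E\<^esub> w \<in> carrier R \<times> I" if "v \<in> carrier R \<times> I" "w \<in> carrier R \<times> I" for v w
          using that by auto
        ultimately show ?case using insert.IH mon[of m] by (simp only:)
      qed simp
      thus "ev p \<in> carrier R \<times> I" unfolding ev_def U.eval_on_carrier[OF pc] by blast
    qed
    show "carrier R \<times> I \<subseteq> ev ` carrier ?T"
    proof
      fix v assume "v \<in> carrier R \<times> I"
      then obtain r i where ri: "v = (r, i)" "r \<in> carrier R" "i \<in> I" by auto
      have ic: "i \<in> carrier R" using ri I.Icarr by blast
      have m: "up_ring.monom ?U r 0 \<in> carrier ?T" "up_ring.monom ?U i 1 \<in> carrier ?T"
        using ri ic ideal_power_1[OF I] by (auto intro!: monomT simp: ideal_power_0)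
      have "ev (up_ring.monom ?U r 0 \<oplus>\<^bsub>?U\<^esub> up_ring.monom ?U i 1) = v"
        unfolding ev_add[OF T_E(1)[OF m(1)] T_E(1)[OF m(2)]] ev0[OF ri(2)] ev1[OF ic] ri(1) using ri ic by simp
      thus "v \<in> ev ` carrier ?T" using addT[OF m] by blast
    qed
  qed
  moreover have "(\<lambda>C. the_elem (ev ` C)) \<in> ring_iso (rees_quotient R I a b) (?E\<lparr>carrier := ev ` carrier ?T\<rparr>)"
    using T.FactRing_iso_set_aux unfolding rees_quotient_def kerT g_def .
  ultimately have iso: "(\<lambda>C. the_elem (ev ` C)) \<in> ring_iso (rees_quotient R I a b) (?E\<lparr>carrier := carrier R \<times> I\<rparr>)"
    by simp
  hence hom: "(\<lambda>C. the_elem (ev ` C)) \<in> ring_hom (rees_quotient R I a b) (?E\<lparr>carrier := carrier R \<times> I\<rparr>)"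
    and bij: "bij_betw (\<lambda>C. the_elem (ev ` C)) (carrier (rees_quotient R I a b)) (carrier R \<times> I)"
    by (simp_all add: ring_iso_def)
  have "(\<lambda>C. the_elem (ev ` C)) \<in> ring_hom (rees_quotient R I a b) ?E"
  proof (rule ring_hom_extend_codomain[OF hom])
    show "carrier R \<times> I \<subseteq> carrier ?E" using I.Icarr by auto
  qed
  thus ?thesis using bij unfolding bij_betw_def by blast
qed

end

section \<open>Fractional canonical ideals and reductions\<close>

lemma (in cring) submodule_as_module:
  assumes "H \<in> submods TF (emb ` carrier R)"
  shows "module R (as_module R H)"
proof -
  interpret M: module R TF by (rule module_TF)
  have "submodule H R TF" using assms submodules_TF by blast
  from submodule.submodule_is_module[OF this M.module_axioms] show ?thesis by (simp add: as_module_def)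
qed

lemma as_module_simps [simp]: "carrier (as_module R H) = H"
  "add (as_module R H) = add (total_fractions R)" "smult (as_module R H) = smult (total_fractions R)"
  by (simp_all add: as_module_def)

context one_dim_cm
begin

lemma fractional_E:
  assumes "fractional_ideal R H"
  shows "H \<in> submods TF (emb ` carrier R)" "\<exists>y\<in>reg. \<forall>q\<in>H. emb y \<otimes>\<^bsub>TF\<^esub> q \<in> emb ` carrier R"
  using assms submodules_TF unfolding fractional_ideal_def scale_def frac_embed_def by blast+

lemma local_order_TF: "local_order TF (emb ` carrier R) (emb ` \<mm>)"
  using local_order_image[OF cring_TF emb_hom emb_inj emb_unit emb_denom] .

text \<open>The type of the module \<open>\<omega>\<close> is one, and by \<open>module_type_colon\<close> it can be computed in any ring \<open>P\<close> that receives the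
  total ring of fractions.\<close>

lemma canon_image:
  assumes P: "cring P" and h: "h \<in> ring_hom R P" and inj: "inj_on h (carrier R)"
    and units: "\<And>r. r \<in> reg \<Longrightarrow> h r \<in> Units P"
    and denom: "\<And>q. q \<in> carrier P \<Longrightarrow> \<exists>s\<in>reg. h s \<otimes>\<^bsub>P\<^esub> q \<in> h ` carrier R"
    and frac: "fractional_ideal R \<omega>" and can: "canonical_module R (as_module R \<omega>)"
    and R\<omega>: "frac_embed R (carrier R) \<subseteq> \<omega>"
  shows "local_order.canon P (h ` carrier R) (h ` \<mm>) (extend P h ` \<omega>)"
proof -
  interpret V: local_order P "h ` carrier R" "h ` \<mm>" by (rule local_order_image[OF P h inj units denom])
  interpret TF: cring TF by (rule cring_TF)
  let ?e = "extend P h"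
  have ex: "?e (emb x) = h x" if "x \<in> carrier R" for x by (rule extend_emb[OF P h inj units that])
  have exh: "?e \<in> ring_hom TF P" by (rule extend_hom[OF P h inj units])
  have exi: "inj_on ?e (carrier TF)" by (rule extend_inj[OF P h inj units])
  note \<omega>S = fractional_E(1)[OF frac]
  have \<omega>c: "q \<in> carrier TF" if "q \<in> \<omega>" for q using \<omega>S that by (auto simp: submods_def)
  have add\<omega>: "p \<oplus>\<^bsub>TF\<^esub> q \<in> \<omega>" if "p \<in> \<omega>" "q \<in> \<omega>" for p q using \<omega>S that by (auto simp: submods_def)
  have sm\<omega>: "emb r \<otimes>\<^bsub>TF\<^esub> q \<in> \<omega>" if "r \<in> carrier R" "q \<in> \<omega>" for r q using \<omega>S that by (auto simp: submods_def)
  have one\<omega>: "emb \<one> \<in> \<omega>" using R\<omega> unfolding frac_embed_def by blast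
  have eone: "?e (emb \<one>) = \<one>\<^bsub>P\<^esub>" using ring_hom_one[OF exh] unfolding TF_one .
  have emult: "?e (emb r \<otimes>\<^bsub>TF\<^esub> q) = h r \<otimes>\<^bsub>P\<^esub> ?e q" if "r \<in> carrier R" "q \<in> \<omega>" for r q
    using ring_hom_mult[OF exh, of "emb r" q] ex[OF that(1)] \<omega>c[OF that(2)] fr_closed[OF that(1) reg_one] by simp
  obtain y where y: "y \<in> reg" "\<And>q. q \<in> \<omega> \<Longrightarrow> emb y \<otimes>\<^bsub>TF\<^esub> q \<in> emb ` carrier R"
    using fractional_E(2)[OF frac] by blast
  have SM: "?e ` \<omega> \<in> V.SM"
  proof (rule V.SM_I)
    show "?e ` \<omega> \<subseteq> carrier P" using ring_hom_closed[OF exh] \<omega>c by blast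
    have "\<zero>\<^bsub>TF\<^esub> \<in> \<omega>" using \<omega>S by (simp add: submods_def)
    moreover have "?e \<zero>\<^bsub>TF\<^esub> = \<zero>\<^bsub>P\<^esub>"
      using ring_hom_zero[OF exh TF.ring_axioms V.ring_axioms] .
    ultimately show "\<zero>\<^bsub>P\<^esub> \<in> ?e ` \<omega>" by (metis image_eqI)
  next
    fix p q assume "p \<in> ?e ` \<omega>" "q \<in> ?e ` \<omega>"
    then obtain s t where st: "s \<in> \<omega>" "t \<in> \<omega>" "p = ?e s" "q = ?e t" by blast
    have "p \<oplus>\<^bsub>P\<^esub> q = ?e (s \<oplus>\<^bsub>TF\<^esub> t)"
      unfolding st(3,4) using ring_hom_add[OF exh \<omega>c[OF st(1)] \<omega>c[OF st(2)]] by simp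
    thus "p \<oplus>\<^bsub>P\<^esub> q \<in> ?e ` \<omega>" using add\<omega>[OF st(1,2)] by blast
  next
    fix r q assume "r \<in> h ` carrier R" "q \<in> ?e ` \<omega>"
    then obtain s t where st: "s \<in> carrier R" "t \<in> \<omega>" "r = h s" "q = ?e t" by blast
    have "r \<otimes>\<^bsub>P\<^esub> q = ?e (emb s \<otimes>\<^bsub>TF\<^esub> t)" unfolding st(3,4) using emult[OF st(1,2)] by simp
    thus "r \<otimes>\<^bsub>P\<^esub> q \<in> ?e ` \<omega>" using sm\<omega>[OF st(1,2)] by blast
  qed
  have "V.frac (?e ` \<omega>)"
  proof (rule V.fracI[OF SM units[OF y(1)] _ V.Units_one_closed])
    show "\<one>\<^bsub>P\<^esub> \<in> ?e ` \<omega>" using one\<omega> eone by (metis image_eqI)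
    show "dilate P (h y) (?e ` \<omega>) \<subseteq> h ` carrier R"
    proof
      fix p assume "p \<in> dilate P (h y) (?e ` \<omega>)"
      then obtain q where q: "q \<in> \<omega>" "p = h y \<otimes>\<^bsub>P\<^esub> ?e q" by (auto simp: dilate_def)
      obtain r where r: "r \<in> carrier R" "emb y \<otimes>\<^bsub>TF\<^esub> q = emb r" using y(2)[OF q(1)] by blast
      have "p = h r" using emult[OF reg_closed[OF y(1)] q(1)] q(2) r ex[OF r(1)] by simp
      thus "p \<in> h ` carrier R" using r by blast
    qed
  qed
  moreover have "V.len (?e ` \<omega>) (colonq P (?e ` \<omega>) (h ` \<mm>)) = 1"
  proof -
    obtain r0 where "r0 \<in> reg" "r0 \<in> \<mm>" using regular_in_m .
    hence reg0: "\<exists>r\<in>\<mm>. h r \<in> Units P" using units by blast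
    have "module_type R (as_module R \<omega>) = V.len (?e ` carrier (as_module R \<omega>)) (colonq P (?e ` carrier (as_module R \<omega>)) (h ` \<mm>))"
    proof (rule module_type_colon[OF P h reg0 submodule_as_module[OF \<omega>S]])
      show "?e q \<in> carrier P" if "q \<in> carrier (as_module R \<omega>)" for q
        using ring_hom_closed[OF exh \<omega>c] that by simp
      show "inj_on ?e (carrier (as_module R \<omega>))"
        using inj_on_subset[OF exi] \<omega>c by (simp add: subset_iff)
      show "?e (p \<oplus>\<^bsub>as_module R \<omega>\<^esub> q) = ?e p \<oplus>\<^bsub>P\<^esub> ?e q"
        if "p \<in> carrier (as_module R \<omega>)" "q \<in> carrier (as_module R \<omega>)" for p q
        using ring_hom_add[OF exh] \<omega>c that by simp
      show "?e (r \<odot>\<^bsub>as_module R \<omega>\<^esub> q) = h r \<otimes>\<^bsub>P\<^esub> ?e q"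
        if "r \<in> carrier R" "q \<in> carrier (as_module R \<omega>)" for r q
        using emult[of r q] smult_eq[of r q] \<omega>c[of q] that by simp
    qed
    thus ?thesis using can by (simp add: canonical_module_def)
  qed
  ultimately show ?thesis unfolding V.canon_def by blast
qed

text \<open>This makes \<open>canon_image\<close> applicable to \<open>Q(R)\<close> itself.\<close>

lemma extend_self: assumes "q \<in> carrier TF" shows "extend TF emb q = q"
proof -
  interpret TF: cring TF by (rule cring_TF)
  obtain r s where rs: "r \<in> carrier R" "s \<in> reg" "q = fr r s" using assms by (rule TF_E)
  have exh: "extend TF emb \<in> ring_hom TF TF" by (rule extend_hom[OF cring_TF emb_hom emb_inj emb_unit])
  have ex: "extend TF emb (emb x) = emb x" if "x \<in> carrier R" for x
    by (rule extend_emb[OF cring_TF emb_hom emb_inj emb_unit that])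
  have sU: "emb s \<in> Units TF" using emb_unit[OF rs(2)] .
  have sc: "s \<in> carrier R" using reg_closed[OF rs(2)] .
  have "emb s \<otimes>\<^bsub>TF\<^esub> extend TF emb q = extend TF emb (emb s \<otimes>\<^bsub>TF\<^esub> q)"
    using ring_hom_mult[OF exh TF.Units_closed[OF sU] assms] ex[OF sc] by simp
  also have "emb s \<otimes>\<^bsub>TF\<^esub> q = emb r" unfolding rs(3) using emb_mult_fr[OF rs(2,1)] .
  also have "extend TF emb (emb r) = emb r" using ex[OF rs(1)] .
  also have "\<dots> = emb s \<otimes>\<^bsub>TF\<^esub> q" unfolding rs(3) using emb_mult_fr[OF rs(2,1)] by simp
  finally show ?thesis
    using TF.Units_l_cancel[OF sU ring_hom_closed[OF exh assms] assms] by simp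
qed

lemma canon_TF:
  assumes frac: "fractional_ideal R \<omega>" and can: "canonical_module R (as_module R \<omega>)"
    and R\<omega>: "frac_embed R (carrier R) \<subseteq> \<omega>"
  shows "local_order.canon TF (emb ` carrier R) (emb ` \<mm>) \<omega>"
proof -
  have "q \<in> carrier TF" if "q \<in> \<omega>" for q
    using fractional_E(1)[OF frac] that by (auto simp: submods_def)
  hence "extend TF emb ` \<omega> = \<omega>" using extend_self by force
  thus ?thesis using canon_image[OF cring_TF emb_hom emb_inj emb_unit emb_denom frac can R\<omega>] by simp
qed

lemma pow_in_ideal_power:
  assumes "ideal J R" "y \<in> J" shows "y [^] (k :: nat) \<in> ideal_power R J k"
proof (induction k)
  case (Suc k)
  thus ?case using ideal_prod.prod[OF Suc assms(2), of R] by (simp add: ideal_power_Suc)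
qed (simp add: ideal_power_0)

lemma reg_pow: assumes "y \<in> reg" shows "y [^] (k :: nat) \<in> reg"
  by (induction k) (simp_all add: reg_one reg_mult assms)

lemma principal_prod:
  assumes x: "x \<in> carrier R" and K: "ideal K R" and s: "s \<in> (PIdl x) \<cdot> K"
  shows "\<exists>c\<in>K. s = x \<otimes> c"
  using s
proof (induction s rule: ideal_prod.induct)
  interpret K: ideal K R by fact
  case (prod i j)
  then obtain r where r: "r \<in> carrier R" "i = r \<otimes> x" by (auto simp: cgenideal_def)
  hence "i \<otimes> j = x \<otimes> (r \<otimes> j)" using x K.Icarr[OF prod(2)] by (simp add: m_ac)
  thus ?case using K.I_l_closed[OF prod(2) r(1)] by blast
next
  interpret K: ideal K R by fact
  case (sum s1 s2)
  then obtain c1 c2 where c: "c1 \<in> K" "c2 \<in> K" "s1 = x \<otimes> c1" "s2 = x \<otimes> c2" by blast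
  hence "s1 \<oplus> s2 = x \<otimes> (c1 \<oplus> c2)" using x K.Icarr by (simp add: r_distr)
  thus ?case using K.a_closed[OF c(1,2)] by blast
qed

text \<open>With \<open>J = y H\<close> and \<open>z = x / y\<close>, up to a unit of \<open>R\<close>, being a reduction means \<open>x J\<^sup>k = J\<^sup>k\<^sup>+\<^sup>1\<close> for some
  \<open>k\<close>. Hence \<open>z\<^sup>-\<^sup>1 H = x\<^sup>-\<^sup>1 J\<close> maps \<open>J\<^sup>k\<close> into itself, and \<open>W\<close> can be taken to be \<open>(J\<^sup>k : J\<^sup>k)\<close>. As \<open>J\<close> contains
  \<open>y\<close>, the regular element \<open>y\<^sup>k\<^sup>+\<^sup>1\<close> is a multiple of \<open>x\<close>, so \<open>x\<close> is regular and \<open>z\<close> invertible.\<close>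

lemma reduction_overring:
  assumes red: "fractional_minimal_reduction R z H" and one: "emb \<one> \<in> H"
  obtains W where "z \<in> Units TF" "z \<in> H" "W \<subseteq> carrier TF" "emb ` carrier R \<subseteq> W"
    "\<And>p q. p \<in> W \<Longrightarrow> q \<in> W \<Longrightarrow> p \<oplus>\<^bsub>TF\<^esub> q \<in> W" "\<And>p q. p \<in> W \<Longrightarrow> q \<in> W \<Longrightarrow> p \<otimes>\<^bsub>TF\<^esub> q \<in> W"
    "\<exists>d\<in>Units TF. dilate TF d W \<subseteq> emb ` carrier R" "\<And>j. j \<in> H \<Longrightarrow> inv\<^bsub>TF\<^esub> z \<otimes>\<^bsub>TF\<^esub> j \<in> W"
proof -
  interpret TF: cring TF by (rule cring_TF)
  interpret emb: ring_hom_cring R TF emb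
    using emb_hom TF.is_cring is_cring by (simp add: ring_hom_cring_def ring_hom_cring_axioms_def)
  have frac: "fractional_ideal R H" and zc: "z \<in> carrier TF"
    using red by (simp_all add: fractional_minimal_reduction_def)
  note HS = fractional_E(1)[OF frac]
  have Hc: "q \<in> carrier TF" if "q \<in> H" for q using HS that by (auto simp: submods_def)
  have smH: "emb r \<otimes>\<^bsub>TF\<^esub> q \<in> H" if "r \<in> carrier R" "q \<in> H" for r q using HS that by (auto simp: submods_def)
  obtain x y where xy: "x \<in> carrier R" "y \<in> reg"
    and yH: "scale R (emb y) H \<subseteq> frac_embed R (carrier R)"
    and mr: "minimal_reduction R (PIdl x) {r \<in> carrier R. emb r \<in> scale R (emb y) H}"
    and zR: "scale R z (frac_embed R (carrier R)) = scale R (fr x y) (frac_embed R (carrier R))"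
    using red unfolding fractional_minimal_reduction_def by blast
  define J where "J = {r \<in> carrier R. emb r \<in> scale R (emb y) H}"
  have "reduction R (PIdl x) J" using mr unfolding minimal_reduction_def J_def by blast
  then obtain k where J: "ideal J R" "PIdl x \<subseteq> J" "(PIdl x) \<cdot> ideal_power R J k = ideal_power R J (Suc k)"
    unfolding reduction_def by blast
  note yc = reg_closed[OF xy(2)]
  have yU: "emb y \<in> Units TF" using emb_unit[OF xy(2)] .
  have eyc: "emb y \<in> carrier TF" "emb x \<in> carrier TF" using yc xy by auto
  have J_E: "\<exists>r\<in>J. emb y \<otimes>\<^bsub>TF\<^esub> q = emb r" if q: "q \<in> H" for q
  proof -
    have m: "emb y \<otimes>\<^bsub>TF\<^esub> q \<in> scale R (emb y) H" using q by (auto simp: scale_def)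
    hence "emb y \<otimes>\<^bsub>TF\<^esub> q \<in> emb ` carrier R" using yH unfolding frac_embed_def by blast
    then obtain r where "r \<in> carrier R" "emb y \<otimes>\<^bsub>TF\<^esub> q = emb r" by blast
    thus ?thesis using m unfolding J_def by auto
  qed
  have yJ: "y \<in> J"
  proof -
    obtain r where r: "r \<in> J" "emb y \<otimes>\<^bsub>TF\<^esub> emb \<one> = emb r" using J_E[OF one] by blast
    have "emb y = emb r" using r(2) eyc unfolding TF_one[symmetric] by simp
    hence "y = r" using emb_inj yc r(1) unfolding J_def inj_on_def by blast
    thus ?thesis using r by simp
  qed
  define Jk where "Jk = ideal_power R J k"
  have Jk: "ideal Jk R" unfolding Jk_def by (rule ideal_power_ideal[OF J(1)])
  interpret Jk: ideal Jk R by (rule Jk)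
  have xreg: "x \<in> reg"
  proof -
    have "y [^] Suc k \<in> (PIdl x) \<cdot> Jk" using pow_in_ideal_power[OF J(1) yJ, of "Suc k"] J(3) by (simp add: Jk_def)
    then obtain c where c: "c \<in> Jk" "y [^] Suc k = x \<otimes> c" using principal_prod[OF xy(1) Jk] by blast
    have cc: "c \<in> carrier R" using Jk.Icarr[OF c(1)] .
    have "v = \<zero>" if v: "v \<in> carrier R" "x \<otimes> v = \<zero>" for v
    proof (rule reg_zero[OF reg_pow[OF xy(2), of "Suc k"] v(1)])
      have "y [^] Suc k \<otimes> v = c \<otimes> (x \<otimes> v)" unfolding c(2) using xy(1) cc v(1) by (simp add: m_ac)
      thus "y [^] Suc k \<otimes> v = \<zero>" unfolding v(2) using cc by simp
    qed
    thus ?thesis using xy(1) unfolding regular_elements_def by blast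
  qed
  define \<xi> where "\<xi> = fr x y"
  have \<xi>c: "\<xi> \<in> carrier TF" unfolding \<xi>_def using fr_closed[OF xy] .
  have y\<xi>: "emb y \<otimes>\<^bsub>TF\<^esub> \<xi> = emb x" unfolding \<xi>_def using emb_mult_fr[OF xy(2,1)] .
  have "z \<otimes>\<^bsub>TF\<^esub> emb \<one> \<in> scale R z (frac_embed R (carrier R))"
    unfolding scale_def frac_embed_def by (intro imageI one_closed)
  hence "z \<in> scale R \<xi> (frac_embed R (carrier R))"
    using zR zc unfolding \<xi>_def TF_one[symmetric] by simp
  then obtain e where e: "e \<in> carrier R" "z = \<xi> \<otimes>\<^bsub>TF\<^esub> emb e" by (auto simp: scale_def frac_embed_def)
  have "\<xi> \<otimes>\<^bsub>TF\<^esub> emb \<one> \<in> scale R \<xi> (frac_embed R (carrier R))"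
    unfolding scale_def frac_embed_def by (intro imageI one_closed)
  hence "\<xi> \<in> scale R z (frac_embed R (carrier R))"
    using zR \<xi>c unfolding \<xi>_def TF_one[symmetric] by simp
  then obtain f where f: "f \<in> carrier R" "\<xi> = z \<otimes>\<^bsub>TF\<^esub> emb f" by (auto simp: scale_def frac_embed_def)
  have efc: "emb e \<in> carrier TF" "emb f \<in> carrier TF" using e f by auto
  have zU: "z \<in> Units TF"
  proof -
    \<comment> \<open>\<open>z\<close> divides the unit \<open>x\<close>, as \<open>x = y \<xi> = y z f\<close>.\<close>
    have xU: "emb x \<in> Units TF" using emb_unit[OF xreg] .
    note ix = TF.Units_inv_closed[OF xU]
    have "z \<otimes>\<^bsub>TF\<^esub> ((emb y \<otimes>\<^bsub>TF\<^esub> emb f) \<otimes>\<^bsub>TF\<^esub> inv\<^bsub>TF\<^esub> (emb x)) =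
        (emb y \<otimes>\<^bsub>TF\<^esub> (z \<otimes>\<^bsub>TF\<^esub> emb f)) \<otimes>\<^bsub>TF\<^esub> inv\<^bsub>TF\<^esub> (emb x)"
      using zc eyc efc ix by (simp only: TF.m_ac TF.m_closed)
    also have "\<dots> = \<one>\<^bsub>TF\<^esub>" unfolding f(2)[symmetric] y\<xi> using TF.Units_r_inv[OF xU] .
    finally show ?thesis
      by (rule TF.unit_if_inverse[OF zc TF.m_closed[OF TF.m_closed[OF eyc(1) efc(2)] ix]])
  qed
  have \<xi>H: "\<xi> \<in> H"
  proof -
    have "x \<in> J" using J(2) cgenideal_self[OF xy(1)] by blast
    hence "emb x \<in> scale R (emb y) H" by (simp add: J_def)
    then obtain q where q: "q \<in> H" "emb x = emb y \<otimes>\<^bsub>TF\<^esub> q" by (auto simp: scale_def)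
    have "emb y \<otimes>\<^bsub>TF\<^esub> q = emb y \<otimes>\<^bsub>TF\<^esub> \<xi>" unfolding y\<xi> using q(2) by (rule sym)
    hence "q = \<xi>" unfolding TF.Units_l_cancel[OF yU Hc[OF q(1)] \<xi>c] .
    thus ?thesis using q(1) by (simp only:)
  qed
  have zH: "z \<in> H" using smH[OF e(1) \<xi>H] unfolding TF.m_comm[OF efc(1) \<xi>c] e(2)[symmetric] .
  define W where "W = colonq TF (emb ` Jk) (emb ` Jk)"
  have mc: "emb r \<in> carrier TF" "r \<in> carrier R" if "r \<in> Jk" for r using Jk.Icarr[OF that] by auto
  have W_I: "p \<in> W" if "p \<in> carrier TF" "\<And>r. r \<in> Jk \<Longrightarrow> p \<otimes>\<^bsub>TF\<^esub> emb r \<in> emb ` Jk" for p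
    using that by (auto simp: W_def colonq_def)
  have W_E: "p \<in> carrier TF" "\<exists>s\<in>Jk. p \<otimes>\<^bsub>TF\<^esub> emb r = emb s" if "p \<in> W" "r \<in> Jk" for p r
    using that by (auto simp: W_def colonq_def)
  have Wc: "p \<in> carrier TF" if "p \<in> W" for p using that by (simp add: W_def colonq_def)
  show thesis
  proof
    show "z \<in> Units TF" "z \<in> H" using zU zH .
    show "W \<subseteq> carrier TF" using Wc by blast
    show "emb ` carrier R \<subseteq> W"
    proof
      fix p assume "p \<in> emb ` carrier R"
      then obtain r where r: "r \<in> carrier R" "p = emb r" by blast
      show "p \<in> W"
      proof (rule W_I)
        show "p \<in> carrier TF" using r by simp
        fix s assume s: "s \<in> Jk"
        have "p \<otimes>\<^bsub>TF\<^esub> emb s = emb (r \<otimes> s)" unfolding r(2) using emb.hom_mult[OF r(1) mc(2)[OF s]] by simp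
        thus "p \<otimes>\<^bsub>TF\<^esub> emb s \<in> emb ` Jk" using Jk.I_l_closed[OF s r(1)] by blast
      qed
    qed
    show "p \<oplus>\<^bsub>TF\<^esub> q \<in> W" if pq: "p \<in> W" "q \<in> W" for p q
    proof (rule W_I)
      show "p \<oplus>\<^bsub>TF\<^esub> q \<in> carrier TF" using Wc[OF pq(1)] Wc[OF pq(2)] by simp
      fix r assume r: "r \<in> Jk"
      obtain s t where st: "s \<in> Jk" "t \<in> Jk" "p \<otimes>\<^bsub>TF\<^esub> emb r = emb s" "q \<otimes>\<^bsub>TF\<^esub> emb r = emb t"
        using W_E(2)[OF pq(1) r] W_E(2)[OF pq(2) r] by blast
      have "(p \<oplus>\<^bsub>TF\<^esub> q) \<otimes>\<^bsub>TF\<^esub> emb r = emb (s \<oplus> t)"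
        using TF.l_distr[OF Wc[OF pq(1)] Wc[OF pq(2)] mc(1)[OF r]] st emb.hom_add[OF mc(2)[OF st(1)] mc(2)[OF st(2)]] by simp
      thus "(p \<oplus>\<^bsub>TF\<^esub> q) \<otimes>\<^bsub>TF\<^esub> emb r \<in> emb ` Jk" using Jk.a_closed[OF st(1,2)] by blast
    qed
    show "p \<otimes>\<^bsub>TF\<^esub> q \<in> W" if pq: "p \<in> W" "q \<in> W" for p q
    proof (rule W_I)
      show "p \<otimes>\<^bsub>TF\<^esub> q \<in> carrier TF" using Wc[OF pq(1)] Wc[OF pq(2)] by simp
      fix r assume r: "r \<in> Jk"
      obtain s where s: "s \<in> Jk" "q \<otimes>\<^bsub>TF\<^esub> emb r = emb s" using W_E(2)[OF pq(2) r] by blast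
      obtain t where t: "t \<in> Jk" "p \<otimes>\<^bsub>TF\<^esub> emb s = emb t" using W_E(2)[OF pq(1) s(1)] by blast
      have "p \<otimes>\<^bsub>TF\<^esub> q \<otimes>\<^bsub>TF\<^esub> emb r = emb t"
        using TF.m_assoc[OF Wc[OF pq(1)] Wc[OF pq(2)] mc(1)[OF r]] s t by simp
      thus "p \<otimes>\<^bsub>TF\<^esub> q \<otimes>\<^bsub>TF\<^esub> emb r \<in> emb ` Jk" using t by blast
    qed
    have "dilate TF (emb (y [^] k)) W \<subseteq> emb ` carrier R"
    proof
      fix p assume "p \<in> dilate TF (emb (y [^] k)) W"
      then obtain q where q: "q \<in> W" "p = emb (y [^] k) \<otimes>\<^bsub>TF\<^esub> q" by (auto simp: dilate_def)
      have yk: "y [^] k \<in> Jk" unfolding Jk_def by (rule pow_in_ideal_power[OF J(1) yJ])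
      obtain s where s: "s \<in> Jk" "q \<otimes>\<^bsub>TF\<^esub> emb (y [^] k) = emb s" using W_E(2)[OF q(1) yk] by blast
      have "p = emb s" unfolding q(2) using TF.m_comm[OF mc(1)[OF yk] Wc[OF q(1)]] s by simp
      thus "p \<in> emb ` carrier R" using mc(2)[OF s(1)] by blast
    qed
    thus "\<exists>d\<in>Units TF. dilate TF d W \<subseteq> emb ` carrier R" using emb_unit[OF reg_pow[OF xy(2)]] by blast
    show "inv\<^bsub>TF\<^esub> z \<otimes>\<^bsub>TF\<^esub> j \<in> W" if j: "j \<in> H" for j
    proof (rule W_I)
      note jc = Hc[OF j] and izc = TF.Units_inv_closed[OF zU]
      show "inv\<^bsub>TF\<^esub> z \<otimes>\<^bsub>TF\<^esub> j \<in> carrier TF" using jc izc by simp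
      fix r assume r: "r \<in> Jk"
      obtain j' where j': "j' \<in> J" "emb y \<otimes>\<^bsub>TF\<^esub> j = emb j'" using J_E[OF j] by blast
      have j'c: "j' \<in> carrier R" using j'(1) by (simp add: J_def)
      have "j' \<otimes> r \<in> ideal_power R J (Suc k)"
        using ideal_power_mult[OF J(1), of r k j' 1] r j' ideal_power_1[OF J(1)] m_comm[OF j'c mc(2)[OF r]]
        by (simp add: Jk_def)
      hence "j' \<otimes> r \<in> (PIdl x) \<cdot> Jk" using J(3) by (simp add: Jk_def)
      then obtain c where c: "c \<in> Jk" "j' \<otimes> r = x \<otimes> c" using principal_prod[OF xy(1) Jk] by blast
      note cc = mc[OF c(1)] and rc = mc[OF r]
      have "emb y \<otimes>\<^bsub>TF\<^esub> (j \<otimes>\<^bsub>TF\<^esub> emb r) = (emb y \<otimes>\<^bsub>TF\<^esub> j) \<otimes>\<^bsub>TF\<^esub> emb r"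
        using TF.m_assoc[OF eyc(1) jc rc(1)] by simp
      also have "\<dots> = emb (j' \<otimes> r)" unfolding j'(2) using emb.hom_mult[OF j'c rc(2)] by simp
      also have "\<dots> = (emb y \<otimes>\<^bsub>TF\<^esub> \<xi>) \<otimes>\<^bsub>TF\<^esub> emb c" unfolding c(2) y\<xi> using emb.hom_mult[OF xy(1) cc(2)] by simp
      also have "\<dots> = emb y \<otimes>\<^bsub>TF\<^esub> (\<xi> \<otimes>\<^bsub>TF\<^esub> emb c)" using TF.m_assoc[OF eyc(1) \<xi>c cc(1)] .
      finally have "j \<otimes>\<^bsub>TF\<^esub> emb r = \<xi> \<otimes>\<^bsub>TF\<^esub> emb c"
        using TF.Units_l_cancel[OF yU TF.m_closed[OF jc rc(1)] TF.m_closed[OF \<xi>c cc(1)]] by simp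
      also have "\<dots> = z \<otimes>\<^bsub>TF\<^esub> (emb f \<otimes>\<^bsub>TF\<^esub> emb c)" unfolding f(2) using TF.m_assoc[OF zc efc(2) cc(1)] .
      also have "\<dots> = z \<otimes>\<^bsub>TF\<^esub> emb (f \<otimes> c)" using emb.hom_mult[OF f(1) cc(2)] by simp
      finally have e1: "j \<otimes>\<^bsub>TF\<^esub> emb r = z \<otimes>\<^bsub>TF\<^esub> emb (f \<otimes> c)" .
      have fcc: "emb (f \<otimes> c) \<in> carrier TF" using f cc by simp
      have "inv\<^bsub>TF\<^esub> z \<otimes>\<^bsub>TF\<^esub> j \<otimes>\<^bsub>TF\<^esub> emb r = inv\<^bsub>TF\<^esub> z \<otimes>\<^bsub>TF\<^esub> (z \<otimes>\<^bsub>TF\<^esub> emb (f \<otimes> c))"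
        unfolding e1[symmetric] using TF.m_assoc[OF izc jc rc(1)] .
      also have "\<dots> = emb (f \<otimes> c)"
        using TF.m_assoc[OF izc zc fcc] TF.Units_l_inv[OF zU] TF.l_one[OF fcc] by simp
      finally show "inv\<^bsub>TF\<^esub> z \<otimes>\<^bsub>TF\<^esub> j \<otimes>\<^bsub>TF\<^esub> emb r \<in> emb ` Jk" using Jk.I_l_closed[OF c(1) f(1)] by blast
    qed
  qed
qed

end

section \<open>The type of the quotient\<close>

text \<open>The task is to realise \<open>S\<close> as \<open>A \<times> J\<close> in the quadratic extension of \<open>Q(R)\<close> and to transport its maximal ideal, its
  type and its canonical ideal there, so that \<open>almost_gorenstein_quad_type\<close> applies.\<close>

lemma almost_gorenstein_rees_type:
  fixes R :: "('a, 'm) ring_scheme" and I :: "'a set" and a b :: 'a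
  assumes R1: "one_dim_cm_local_ring R"
    and frac: "fractional_ideal R \<omega>" and can: "canonical_module R (as_module R \<omega>)"
    and R\<omega>: "frac_embed R (carrier R) \<subseteq> \<omega>"
    and I: "ideal I R" and rad: "radical R I = max_ideal R"
    and D: "D = colon R \<omega> (frac_embed R I)"
    and red: "fractional_minimal_reduction R z D"
    and ab: "a \<in> carrier R" "b \<in> carrier R"
    and AG: "almost_gorenstein (rees_quotient R I a b)"
  shows "cm_type (rees_quotient R I a b) =
           2 * quotient_length R (scale R (inv\<^bsub>total_fractions R\<^esub> z) D) (frac_embed R (carrier R)) + 1"
    and "quotient_length R (scale R (inv\<^bsub>total_fractions R\<^esub> z) D) (frac_embed R (carrier R)) =
           quotient_length R \<omega> (scale R z (frac_embed R I))"
proof -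
  let ?S = "rees_quotient R I a b"
  interpret R: one_dim_cm R using R1 by (simp add: one_dim_cm_def)
  have S1: "one_dim_cm_local_ring ?S" using AG by (simp add: almost_gorenstein_def)
  interpret S: one_dim_cm ?S using S1 by (simp add: one_dim_cm_def)
  let ?Q = "total_fractions R" and ?e = "\<lambda>r. fraction R r \<one>\<^bsub>R\<^esub>"
  let ?A = "?e ` carrier R" and ?n = "?e ` max_ideal R" and ?J = "?e ` I"
  let ?a = "?e a" and ?b = "?e b"
  let ?P = "quad_ext ?Q ?a ?b"
  interpret Q: local_order ?Q ?A ?n by (rule R.local_order_TF)
  interpret emb: ring_hom_cring R ?Q ?e
    using R.emb_hom Q.is_cring R.is_cring by (simp add: ring_hom_cring_def ring_hom_cring_axioms_def)
  interpret I: ideal I R by (rule I)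
  have abQ: "?a \<in> carrier ?Q" "?b \<in> carrier ?Q" using ab by auto
  interpret P: cring ?P by (rule Q.cring_quad_ext[OF abQ])
  have einj: "x = y" if "?e x = ?e y" "x \<in> carrier R" "y \<in> carrier R" for x y
    using R.emb_inj that by (auto dest: inj_onD)
  have ne: "\<one>\<^bsub>R\<^esub> \<noteq> \<zero>\<^bsub>R\<^esub>"
    using R.one_notin_m additive_subgroup.zero_closed[OF ideal.axioms(1)[OF R.m_ideal]] by metis
  have Im: "I \<subseteq> max_ideal R"
  proof
    fix x assume x: "x \<in> I"
    hence xc: "x \<in> carrier R" by (rule I.Icarr)
    have "x [^]\<^bsub>R\<^esub> (1::nat) \<in> I" using x xc by simp
    hence "x \<in> radical R I" unfolding radical_def using xc by blast
    thus "x \<in> max_ideal R" using rad by simp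
  qed
  obtain i0 where i0: "i0 \<in> I" "i0 \<in> regular_elements R"
  proof -
    obtain r where r: "r \<in> regular_elements R" "r \<in> max_ideal R" by (rule R.regular_in_m)
    hence "r \<in> radical R I" using rad by simp
    then obtain k where "r [^]\<^bsub>R\<^esub> (k::nat) \<in> I" unfolding radical_def by blast
    thus thesis using that R.reg_pow[OF r(1)] by blast
  qed
  have JS: "?J \<in> submods ?Q ?A"
  proof (rule Q.SM_I)
    show "?J \<subseteq> carrier ?Q" using I.Icarr by auto
    have "?e \<zero>\<^bsub>R\<^esub> = \<zero>\<^bsub>?Q\<^esub>" by (rule emb.hom_zero)
    thus "\<zero>\<^bsub>?Q\<^esub> \<in> ?J" using I.zero_closed by (metis image_eqI)
  next
    fix p q assume "p \<in> ?J" "q \<in> ?J"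
    then obtain x y where "x \<in> I" "y \<in> I" "p = ?e x" "q = ?e y" by blast
    thus "p \<oplus>\<^bsub>?Q\<^esub> q \<in> ?J" using emb.hom_add[of x y] I.Icarr I.a_closed by (metis image_eqI)
  next
    fix p q assume "p \<in> ?A" "q \<in> ?J"
    then obtain x y where "x \<in> carrier R" "y \<in> I" "p = ?e x" "q = ?e y" by blast
    thus "p \<otimes>\<^bsub>?Q\<^esub> q \<in> ?J" using emb.hom_mult[of x y] I.Icarr I.I_l_closed by (metis image_eqI)
  qed
  have Junit: "?e i0 \<in> ?J" "?e i0 \<in> Units ?Q" using i0 R.emb_unit by auto
  have w: "Q.canon \<omega>" by (rule R.canon_TF[OF frac can R\<omega>])
  have A\<omega>: "?A \<subseteq> \<omega>" using R\<omega> by (simp add: frac_embed_def)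
  have Deq: "D = colonq ?Q \<omega> ?J" unfolding D R.colon_eq R.frac_embed_eq ..
  have wS: "\<omega> \<in> submods ?Q ?A" using Q.frac_SM[OF Q.canon_frac[OF w]] .
  have JA: "?J \<subseteq> ?A" using I.Icarr by blast
  have "?e \<one>\<^bsub>R\<^esub> \<in> D" unfolding Deq
  proof (rule Q.colonI)
    show "?e \<one>\<^bsub>R\<^esub> \<in> carrier ?Q" by (rule emb.hom_closed[OF R.one_closed])
    fix y assume "y \<in> ?J"
    then obtain i where i: "i \<in> I" "y = ?e i" by blast
    have "?e \<one>\<^bsub>R\<^esub> \<otimes>\<^bsub>?Q\<^esub> y = ?e i"
      unfolding i(2) using emb.hom_mult[OF R.one_closed I.Icarr[OF i(1)]] R.l_one[OF I.Icarr[OF i(1)]] by simp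
    thus "?e \<one>\<^bsub>R\<^esub> \<otimes>\<^bsub>?Q\<^esub> y \<in> \<omega>" using A\<omega> I.Icarr[OF i(1)] by auto
  qed
  from R.reduction_overring[OF red this]
  obtain W where z: "z \<in> Units ?Q" "z \<in> D" and W: "W \<subseteq> carrier ?Q" "?A \<subseteq> W"
    "\<And>p q. p \<in> W \<Longrightarrow> q \<in> W \<Longrightarrow> p \<oplus>\<^bsub>?Q\<^esub> q \<in> W" "\<And>p q. p \<in> W \<Longrightarrow> q \<in> W \<Longrightarrow> p \<otimes>\<^bsub>?Q\<^esub> q \<in> W"
    "\<exists>d\<in>Units ?Q. dilate ?Q d W \<subseteq> ?A" and zW: "\<And>j. j \<in> D \<Longrightarrow> inv\<^bsub>?Q\<^esub> z \<otimes>\<^bsub>?Q\<^esub> j \<in> W" by metis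
  obtain h0 where h0: "h0 \<in> ring_hom ?S (quad_ext R a b)" "inj_on h0 (carrier ?S)"
    "h0 ` carrier ?S = carrier R \<times> I"
    using R.rees_quotient_embedding[OF I ab ne] by blast
  define h where "h s = (?e (fst (h0 s)), ?e (snd (h0 s)))" for s
  have h0c: "fst (h0 s) \<in> carrier R" "snd (h0 s) \<in> I" "snd (h0 s) \<in> carrier R" if "s \<in> carrier ?S" for s
  proof -
    have "h0 s \<in> carrier R \<times> I" using h0(3) that by blast
    thus "fst (h0 s) \<in> carrier R" "snd (h0 s) \<in> I" "snd (h0 s) \<in> carrier R" using I.Icarr by auto
  qed
  have eminus: "?e (x \<ominus>\<^bsub>R\<^esub> y) = ?e x \<ominus>\<^bsub>?Q\<^esub> ?e y" if "x \<in> carrier R" "y \<in> carrier R" for x y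
    using that by (simp add: a_minus_def)
  have hS: "h \<in> ring_hom ?S ?P"
  proof (rule ring_hom_memI)
    fix s assume s: "s \<in> carrier ?S"
    show "h s \<in> carrier ?P" using h0c[OF s] by (simp add: h_def)
    fix t assume t: "t \<in> carrier ?S"
    note c = h0c[OF s] h0c[OF t]
    obtain x y u v where xy: "h0 s = (x, y)" "h0 t = (u, v)" by (metis surj_pair)
    have d: "x \<in> carrier R" "y \<in> carrier R" "u \<in> carrier R" "v \<in> carrier R" using c xy by auto
    have "h0 (s \<otimes>\<^bsub>?S\<^esub> t) = (x, y) \<otimes>\<^bsub>quad_ext R a b\<^esub> (u, v)" using ring_hom_mult[OF h0(1) s t] xy by simp
    thus "h (s \<otimes>\<^bsub>?S\<^esub> t) = h s \<otimes>\<^bsub>?P\<^esub> h t" using d ab by (simp add: h_def xy eminus)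
    have "h0 (s \<oplus>\<^bsub>?S\<^esub> t) = (x, y) \<oplus>\<^bsub>quad_ext R a b\<^esub> (u, v)" using ring_hom_add[OF h0(1) s t] xy by simp
    thus "h (s \<oplus>\<^bsub>?S\<^esub> t) = h s \<oplus>\<^bsub>?P\<^esub> h t" using d by (simp add: h_def xy)
  next
    have "h0 \<one>\<^bsub>?S\<^esub> = (\<one>\<^bsub>R\<^esub>, \<zero>\<^bsub>R\<^esub>)" using ring_hom_one[OF h0(1)] by simp
    thus "h \<one>\<^bsub>?S\<^esub> = \<one>\<^bsub>?P\<^esub>" using emb.hom_one emb.hom_zero by (simp add: h_def)
  qed
  have hinj: "inj_on h (carrier ?S)"
  proof (rule inj_onI)
    fix s t assume s: "s \<in> carrier ?S" and t: "t \<in> carrier ?S" and eq: "h s = h t"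
    have "fst (h0 s) = fst (h0 t)" "snd (h0 s) = snd (h0 t)"
      using eq einj h0c[OF s] h0c[OF t] by (auto simp: h_def)
    hence "h0 s = h0 t" by (rule prod_eqI)
    thus "s = t" by (rule inj_onD[OF h0(2) _ s t])
  qed
  have him: "h ` carrier ?S = ?A \<times> ?J"
  proof -
    have "h ` carrier ?S = (\<lambda>(x, y). (?e x, ?e y)) ` (h0 ` carrier ?S)"
      by (auto simp: h_def image_iff split_beta)
    also have "\<dots> = ?A \<times> ?J" unfolding h0(3) by auto
    finally show ?thesis .
  qed
  interpret h: ring_hom_cring ?S ?P h
    using hS P.is_cring S.is_cring by (simp add: ring_hom_cring_def ring_hom_cring_axioms_def)
  have hz: "s = \<zero>\<^bsub>?S\<^esub>" if "s \<in> carrier ?S" "h s = \<zero>\<^bsub>?P\<^esub>" for s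
    by (rule inj_onD[OF hinj]) (use that in simp_all)
  \<comment> \<open>Denominators for both coordinates; the factor \<open>i0\<close> moves the second one from \<open>A\<close> into \<open>J\<close>.\<close>
  have common: "\<exists>d. d \<in> ?A \<and> d \<in> Units ?Q \<and> d \<otimes>\<^bsub>?Q\<^esub> x \<in> ?A \<and> d \<otimes>\<^bsub>?Q\<^esub> y \<in> ?J"
    if xy: "x \<in> carrier ?Q" "y \<in> carrier ?Q" for x y
  proof -
    obtain s where s: "s \<in> ?A" "s \<in> Units ?Q" "s \<otimes>\<^bsub>?Q\<^esub> x \<in> ?A" using Q.denom[OF xy(1)] by blast
    obtain t where t: "t \<in> ?A" "t \<in> Units ?Q" "t \<otimes>\<^bsub>?Q\<^esub> y \<in> ?A" using Q.denom[OF xy(2)] by blast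
    let ?i = "?e i0"
    have iA: "?i \<in> ?A" using Junit JA by blast
    note c = Q.A_car[OF s(1)] Q.A_car[OF t(1)] Q.A_car[OF iA] xy
    have "(t \<otimes>\<^bsub>?Q\<^esub> ?i) \<otimes>\<^bsub>?Q\<^esub> (s \<otimes>\<^bsub>?Q\<^esub> x) \<in> ?A" by (rule Q.A_mult[OF Q.A_mult[OF t(1) iA] s(3)])
    moreover have "(t \<otimes>\<^bsub>?Q\<^esub> ?i) \<otimes>\<^bsub>?Q\<^esub> (s \<otimes>\<^bsub>?Q\<^esub> x) = (s \<otimes>\<^bsub>?Q\<^esub> t \<otimes>\<^bsub>?Q\<^esub> ?i) \<otimes>\<^bsub>?Q\<^esub> x"
      using c by (simp only: Q.m_ac Q.m_closed)
    moreover have "(s \<otimes>\<^bsub>?Q\<^esub> (t \<otimes>\<^bsub>?Q\<^esub> y)) \<otimes>\<^bsub>?Q\<^esub> ?i \<in> ?J"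
      by (rule Q.SM_smult[OF JS Q.A_mult[OF s(1) t(3)] Junit(1)])
    moreover have "(s \<otimes>\<^bsub>?Q\<^esub> (t \<otimes>\<^bsub>?Q\<^esub> y)) \<otimes>\<^bsub>?Q\<^esub> ?i = (s \<otimes>\<^bsub>?Q\<^esub> t \<otimes>\<^bsub>?Q\<^esub> ?i) \<otimes>\<^bsub>?Q\<^esub> y"
      using c by (simp only: Q.m_ac Q.m_closed)
    moreover have "s \<otimes>\<^bsub>?Q\<^esub> t \<otimes>\<^bsub>?Q\<^esub> ?i \<in> ?A" by (rule Q.A_mult[OF Q.A_mult[OF s(1) t(1)] iA])
    moreover have "s \<otimes>\<^bsub>?Q\<^esub> t \<otimes>\<^bsub>?Q\<^esub> ?i \<in> Units ?Q" using s t Junit by (intro Q.Units_m_closed)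
    ultimately show ?thesis by metis
  qed
  have denomP: "\<exists>s d. s \<in> carrier ?S \<and> h s = (d, \<zero>\<^bsub>?Q\<^esub>) \<and> d \<in> Units ?Q \<and> h s \<otimes>\<^bsub>?P\<^esub> p \<in> h ` carrier ?S"
    if p: "p \<in> carrier ?P" for p
  proof -
    obtain x y where xy: "p = (x, y)" "x \<in> carrier ?Q" "y \<in> carrier ?Q" using p by auto
    obtain d where d: "d \<in> ?A" "d \<in> Units ?Q" "d \<otimes>\<^bsub>?Q\<^esub> x \<in> ?A" "d \<otimes>\<^bsub>?Q\<^esub> y \<in> ?J"
      using common[OF xy(2,3)] by blast
    have "(d, \<zero>\<^bsub>?Q\<^esub>) \<in> h ` carrier ?S" unfolding him using d(1) Q.SM_zero[OF JS] by blast
    then obtain s where s: "(d, \<zero>\<^bsub>?Q\<^esub>) = h s" "s \<in> carrier ?S" by (rule imageE)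
    have "h s \<otimes>\<^bsub>?P\<^esub> p = (d \<otimes>\<^bsub>?Q\<^esub> x, d \<otimes>\<^bsub>?Q\<^esub> y)"
      unfolding s(1)[symmetric] xy(1) by (rule Q.quad_scalar_mult[OF abQ Q.A_car[OF d(1)] xy(2,3)])
    hence "h s \<otimes>\<^bsub>?P\<^esub> p \<in> h ` carrier ?S" unfolding him using d(3,4) by simp
    thus ?thesis using s d(2) by metis
  qed
  have reg_of_unit: "s \<in> regular_elements ?S" if s: "s \<in> carrier ?S" "h s \<in> Units ?P" for s
    unfolding regular_elements_def
  proof (intro CollectI conjI ballI impI s(1))
    fix t assume t: "t \<in> carrier ?S" "s \<otimes>\<^bsub>?S\<^esub> t = \<zero>\<^bsub>?S\<^esub>"
    note hc = h.hom_closed[OF s(1)] h.hom_closed[OF t(1)]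
    have "h s \<otimes>\<^bsub>?P\<^esub> h t = \<zero>\<^bsub>?P\<^esub>"
      unfolding h.hom_mult[OF s(1) t(1), symmetric] t(2) by (rule h.hom_zero)
    hence "h s \<otimes>\<^bsub>?P\<^esub> h t = h s \<otimes>\<^bsub>?P\<^esub> \<zero>\<^bsub>?P\<^esub>" unfolding P.r_null[OF hc(1)] .
    hence "h t = \<zero>\<^bsub>?P\<^esub>" unfolding P.Units_l_cancel[OF s(2) hc(2) P.zero_closed] .
    thus "t = \<zero>\<^bsub>?S\<^esub>" by (rule hz[OF t(1)])
  qed
  have hunits: "h s \<in> Units ?P" if s: "s \<in> regular_elements ?S" for s
  proof -
    have sc: "s \<in> carrier ?S" by (rule S.reg_closed[OF s])
    show ?thesis
    proof (rule Q.quad_unit[OF abQ _ h.hom_closed[OF sc]])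
      show "x \<in> Units ?Q" if "x \<in> carrier ?Q" "\<And>c. c \<in> carrier ?Q \<Longrightarrow> x \<otimes>\<^bsub>?Q\<^esub> c = \<zero>\<^bsub>?Q\<^esub> \<Longrightarrow> c = \<zero>\<^bsub>?Q\<^esub>" for x
        using R.TF_unit[OF that(1)] that(2) by blast
      fix p assume p: "p \<in> carrier ?P" "h s \<otimes>\<^bsub>?P\<^esub> p = \<zero>\<^bsub>?P\<^esub>"
      obtain t d where t: "t \<in> carrier ?S" "h t = (d, \<zero>\<^bsub>?Q\<^esub>)" "d \<in> Units ?Q" "h t \<otimes>\<^bsub>?P\<^esub> p \<in> h ` carrier ?S"
        using denomP[OF p(1)] by blast
      obtain v where v: "h t \<otimes>\<^bsub>?P\<^esub> p = h v" "v \<in> carrier ?S" using t(4) by (rule imageE)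
      note tc = h.hom_closed[OF t(1)] and sc' = h.hom_closed[OF sc]
      have "h (s \<otimes>\<^bsub>?S\<^esub> v) = h s \<otimes>\<^bsub>?P\<^esub> (h t \<otimes>\<^bsub>?P\<^esub> p)" unfolding v(1) by (rule h.hom_mult[OF sc v(2)])
      also have "\<dots> = h t \<otimes>\<^bsub>?P\<^esub> (h s \<otimes>\<^bsub>?P\<^esub> p)" by (rule P.m_lcomm[OF sc' tc p(1)])
      also have "\<dots> = \<zero>\<^bsub>?P\<^esub>" unfolding p(2) by (rule P.r_null[OF tc])
      finally have "s \<otimes>\<^bsub>?S\<^esub> v = \<zero>\<^bsub>?S\<^esub>" by (rule hz[OF S.m_closed[OF sc v(2)]])
      hence "v = \<zero>\<^bsub>?S\<^esub>" by (rule S.reg_zero[OF s v(2)])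
      hence "h t \<otimes>\<^bsub>?P\<^esub> p = \<zero>\<^bsub>?P\<^esub>" unfolding v(1) using h.hom_zero by (simp only:)
      hence "h t \<otimes>\<^bsub>?P\<^esub> p = h t \<otimes>\<^bsub>?P\<^esub> \<zero>\<^bsub>?P\<^esub>" unfolding P.r_null[OF tc] .
      moreover have "h t \<in> Units ?P" unfolding t(2) by (rule Q.quad_scalar_unit(1)[OF abQ t(3)])
      ultimately show "p = \<zero>\<^bsub>?P\<^esub>" using P.Units_l_cancel[OF _ p(1) P.zero_closed] by blast
    qed
  qed
  have hdenom: "\<exists>s\<in>regular_elements ?S. h s \<otimes>\<^bsub>?P\<^esub> p \<in> h ` carrier ?S" if p: "p \<in> carrier ?P" for p
  proof -
    obtain t d where t: "t \<in> carrier ?S" "h t = (d, \<zero>\<^bsub>?Q\<^esub>)" "d \<in> Units ?Q" "h t \<otimes>\<^bsub>?P\<^esub> p \<in> h ` carrier ?S"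
      using denomP[OF p] by blast
    have "h t \<in> Units ?P" unfolding t(2) by (rule Q.quad_scalar_unit(1)[OF abQ t(3)])
    thus ?thesis using reg_of_unit[OF t(1)] t(4) by blast
  qed
  have LO: "local_order ?P (h ` carrier ?S) (h ` max_ideal ?S)"
    by (rule S.local_order_image[OF P.is_cring hS hinj hunits hdenom])
  interpret L: local_order ?P "h ` carrier ?S" "h ` max_ideal ?S" by (rule LO)
  have Jn: "?J \<subseteq> ?n" using Im by blast
  have scal: "(r, \<zero>\<^bsub>?Q\<^esub>) \<otimes>\<^bsub>?P\<^esub> (x, y) = (r \<otimes>\<^bsub>?Q\<^esub> x, r \<otimes>\<^bsub>?Q\<^esub> y)"
    if "r \<in> carrier ?Q" "x \<in> carrier ?Q" "y \<in> carrier ?Q" for r x y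
    by (rule Q.quad_scalar_mult[OF abQ that])
  \<comment> \<open>A unit \<open>r + i t\<close> of \<open>S\<close> has \<open>r x - b i y = 1\<close> for some \<open>x\<close> and \<open>y\<close>, which is impossible for \<open>r\<close> in
    the maximal ideal, as \<open>i\<close> and \<open>y\<close> are in \<open>J\<close>.\<close>
  have NM: "?n \<times> ?J \<subseteq> h ` max_ideal ?S"
  proof
    fix p assume "p \<in> ?n \<times> ?J"
    then obtain r i where p: "p = (r, i)" "r \<in> ?n" "i \<in> ?J" by auto
    have pA: "p \<in> h ` carrier ?S" unfolding him using p Q.n_sub by blast
    show "p \<in> h ` max_ideal ?S"
    proof (rule ccontr)
      assume "p \<notin> h ` max_ideal ?S"
      then obtain q where q: "q \<in> h ` carrier ?S" "p \<otimes>\<^bsub>?P\<^esub> q = \<one>\<^bsub>?P\<^esub>" using L.A_unit[OF pA] by blast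
      obtain x y where xy: "q = (x, y)" "x \<in> ?A" "y \<in> ?J" using q(1) unfolding him by blast
      have eq: "r \<otimes>\<^bsub>?Q\<^esub> x \<ominus>\<^bsub>?Q\<^esub> ?b \<otimes>\<^bsub>?Q\<^esub> (i \<otimes>\<^bsub>?Q\<^esub> y) = \<one>\<^bsub>?Q\<^esub>" using q(2) unfolding p(1) xy(1) by simp
      have yA: "y \<in> ?A" and iA: "i \<in> ?A" using xy p JA by blast+
      have rc: "r \<in> carrier ?Q" using p(2) Q.n_car by blast
      have bA: "?b \<in> ?A" using ab by blast
      have "x \<otimes>\<^bsub>?Q\<^esub> r \<in> ?n" by (rule Q.SM_smult[OF Q.n_SM xy(2) p(2)])
      hence 1: "r \<otimes>\<^bsub>?Q\<^esub> x \<in> ?n" using Q.m_comm[OF rc Q.A_car[OF xy(2)]] by (simp only:)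
      have yn: "y \<in> ?n" using Jn xy(3) by blast
      have 2: "?b \<otimes>\<^bsub>?Q\<^esub> (i \<otimes>\<^bsub>?Q\<^esub> y) \<in> ?n" by (intro Q.SM_smult[OF Q.n_SM] bA iA yn)
      show False using Q.SM_diff[OF Q.n_SM 1 2] Q.one_notin unfolding eq by blast
    qed
  qed
  have MN: "h ` max_ideal ?S \<subseteq> ?n \<times> ?J"
  proof
    fix p assume p: "p \<in> h ` max_ideal ?S"
    hence "p \<in> ?A \<times> ?J" using L.n_sub unfolding him by blast
    then obtain x y where xy: "p = (x, y)" "x \<in> ?A" "y \<in> ?J" by blast
    note c = Q.A_car[OF xy(2)] Q.SM_car[OF JS xy(3)]
    have "x \<in> ?n"
    proof (rule ccontr)
      assume "x \<notin> ?n"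
      then obtain x' where x': "x' \<in> ?A" "x \<otimes>\<^bsub>?Q\<^esub> x' = \<one>\<^bsub>?Q\<^esub>" using Q.A_unit[OF xy(2)] by blast
      have "(\<zero>\<^bsub>?Q\<^esub>, y) \<in> h ` max_ideal ?S" using NM Q.SM_zero[OF Q.n_SM] xy(3) by blast
      hence "p \<ominus>\<^bsub>?P\<^esub> (\<zero>\<^bsub>?Q\<^esub>, y) \<in> h ` max_ideal ?S" by (rule L.SM_diff[OF L.n_SM p])
      moreover have "p \<ominus>\<^bsub>?P\<^esub> (\<zero>\<^bsub>?Q\<^esub>, y) = (x, \<zero>\<^bsub>?Q\<^esub>)"
      proof -
        have zc: "(\<zero>\<^bsub>?Q\<^esub>, y) \<in> carrier ?P" "(x, \<zero>\<^bsub>?Q\<^esub>) \<in> carrier ?P" using c by auto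
        have "p = (x, \<zero>\<^bsub>?Q\<^esub>) \<oplus>\<^bsub>?P\<^esub> (\<zero>\<^bsub>?Q\<^esub>, y)" unfolding xy(1) using c by simp
        hence "p \<ominus>\<^bsub>?P\<^esub> (\<zero>\<^bsub>?Q\<^esub>, y) = ((x, \<zero>\<^bsub>?Q\<^esub>) \<oplus>\<^bsub>?P\<^esub> (\<zero>\<^bsub>?Q\<^esub>, y)) \<ominus>\<^bsub>?P\<^esub> (\<zero>\<^bsub>?Q\<^esub>, y)" by (simp only:)
        also have "\<dots> = (x, \<zero>\<^bsub>?Q\<^esub>) \<oplus>\<^bsub>?P\<^esub> ((\<zero>\<^bsub>?Q\<^esub>, y) \<oplus>\<^bsub>?P\<^esub> \<ominus>\<^bsub>?P\<^esub> (\<zero>\<^bsub>?Q\<^esub>, y))"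
          unfolding a_minus_def by (rule P.a_assoc[OF zc(2,1) P.a_inv_closed[OF zc(1)]])
        also have "\<dots> = (x, \<zero>\<^bsub>?Q\<^esub>)" unfolding P.r_neg[OF zc(1)] by (rule P.r_zero[OF zc(2)])
        finally show ?thesis .
      qed
      ultimately have "(x, \<zero>\<^bsub>?Q\<^esub>) \<in> h ` max_ideal ?S" by (simp only:)
      moreover have "(x', \<zero>\<^bsub>?Q\<^esub>) \<in> h ` carrier ?S" unfolding him using x'(1) Q.SM_zero[OF JS] by blast
      ultimately have m: "(x', \<zero>\<^bsub>?Q\<^esub>) \<otimes>\<^bsub>?P\<^esub> (x, \<zero>\<^bsub>?Q\<^esub>) \<in> h ` max_ideal ?S"
        using L.SM_smult[OF L.n_SM] by blast
      have "(x', \<zero>\<^bsub>?Q\<^esub>) \<otimes>\<^bsub>?P\<^esub> (x, \<zero>\<^bsub>?Q\<^esub>) = (x' \<otimes>\<^bsub>?Q\<^esub> x, x' \<otimes>\<^bsub>?Q\<^esub> \<zero>\<^bsub>?Q\<^esub>)"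
        by (rule scal[OF Q.A_car[OF x'(1)] c(1) Q.zero_closed])
      also have "\<dots> = \<one>\<^bsub>?P\<^esub>"
        using x'(2) Q.m_comm[OF c(1) Q.A_car[OF x'(1)]] Q.r_null[OF Q.A_car[OF x'(1)]] by simp
      finally show False using m L.one_notin by (simp only:)
    qed
    thus "p \<in> ?n \<times> ?J" using xy by blast
  qed
  have hmax: "h ` max_ideal ?S = ?n \<times> ?J" using NM MN by (rule subset_antisym[rotated])
  have LO': "local_order ?P (?A \<times> ?J) (?n \<times> ?J)" using LO unfolding him hmax .
  interpret V: quad_setup ?Q ?A ?n ?J ?a ?b \<omega> z W
  proof (intro quad_setup.intro quad_setup_axioms.intro)
    show "local_order ?Q ?A ?n" by (rule R.local_order_TF)
    show "?J \<in> submods ?Q ?A" "?J \<subseteq> ?n" using JS Jn .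
    show "\<exists>i\<in>?J. i \<in> Units ?Q" using Junit by blast
    show "?a \<in> ?A" "?b \<in> ?A" using ab by blast+
    show "Q.canon \<omega>" "?A \<subseteq> \<omega>" using w A\<omega> .
    show "z \<in> Units ?Q" "z \<in> colonq ?Q \<omega> ?J" using z unfolding Deq .
    show "W \<subseteq> carrier ?Q" "?A \<subseteq> W" using W(1,2) .
    show "\<exists>d\<in>Units ?Q. dilate ?Q d W \<subseteq> ?A" using W(5) .
    show "local_order ?P (?A \<times> ?J) (?n \<times> ?J)" by (rule LO')
  qed (use W(3,4) zW Deq in blast)+
  obtain \<omega>S where \<omega>S: "fractional_ideal ?S \<omega>S" "canonical_module ?S (as_module ?S \<omega>S)"
      "frac_embed ?S (carrier ?S) \<subseteq> \<omega>S"
      "\<omega>S \<subseteq> colon ?S (frac_embed ?S (max_ideal ?S)) (frac_embed ?S (max_ideal ?S))"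
    using AG unfolding almost_gorenstein_def by blast
  let ?x = "S.extend ?P h"
  have exe: "?x (fraction ?S s \<one>\<^bsub>?S\<^esub>) = h s" if "s \<in> carrier ?S" for s
    by (rule S.extend_emb[OF P.is_cring hS hinj hunits that])
  have exh: "?x \<in> ring_hom (total_fractions ?S) ?P" by (rule S.extend_hom[OF P.is_cring hS hinj hunits])
  have w': "V.P.canon (?x ` \<omega>S)"
    using S.canon_image[OF P.is_cring hS hinj hunits hdenom \<omega>S(1,2,3)] unfolding him hmax .
  have S\<omega>': "?A \<times> ?J \<subseteq> ?x ` \<omega>S"
  proof
    fix p assume "p \<in> ?A \<times> ?J"
    then obtain s where s: "p = h s" "s \<in> carrier ?S" unfolding him[symmetric] by (rule imageE)
    have "fraction ?S s \<one>\<^bsub>?S\<^esub> \<in> \<omega>S" using \<omega>S(3) s(2) unfolding frac_embed_def by blast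
    thus "p \<in> ?x ` \<omega>S" using exe[OF s(2)] s(1) by (metis image_eqI)
  qed
  have wn': "p \<otimes>\<^bsub>?P\<^esub> r \<in> ?n \<times> ?J" if p: "p \<in> ?x ` \<omega>S" and r: "r \<in> ?n \<times> ?J" for p r
  proof -
    obtain q where q: "p = ?x q" "q \<in> \<omega>S" using p by (rule imageE)
    obtain s where s: "r = h s" "s \<in> max_ideal ?S" using r unfolding hmax[symmetric] by (rule imageE)
    have sc: "s \<in> carrier ?S" using S.m_sub s(2) by blast
    let ?f = "fraction ?S s \<one>\<^bsub>?S\<^esub>"
    have qc: "q \<in> colonq (total_fractions ?S) (frac_embed ?S (max_ideal ?S)) (frac_embed ?S (max_ideal ?S))"
      using \<omega>S(4) q(2) unfolding S.colon_eq by blast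
    hence qcar: "q \<in> carrier (total_fractions ?S)" by (simp add: colonq_def)
    have "q \<otimes>\<^bsub>total_fractions ?S\<^esub> ?f \<in> frac_embed ?S (max_ideal ?S)"
      using qc s(2) unfolding colonq_def frac_embed_def by blast
    then obtain t where t: "t \<in> max_ideal ?S" "q \<otimes>\<^bsub>total_fractions ?S\<^esub> ?f = fraction ?S t \<one>\<^bsub>?S\<^esub>"
      unfolding frac_embed_def by blast
    have fc: "?f \<in> carrier (total_fractions ?S)" by (rule S.fr_closed[OF sc S.reg_one])
    have "p \<otimes>\<^bsub>?P\<^esub> r = ?x (q \<otimes>\<^bsub>total_fractions ?S\<^esub> ?f)"
      unfolding q(1) s(1) exe[OF sc, symmetric] by (rule ring_hom_mult[OF exh qcar fc, symmetric])
    also have "\<dots> = h t" unfolding t(2) using exe S.m_sub t(1) by blast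
    finally show ?thesis unfolding hmax[symmetric] using t(1) by blast
  qed
  have main: "V.P.len (?A \<times> ?J) (colonq ?P (?A \<times> ?J) (?n \<times> ?J)) = 2 * Q.len (dilate ?Q z ?A) (colonq ?Q \<omega> ?J) + 1"
    by (rule V.almost_gorenstein_quad_type[OF w' S\<omega>' wn'])
  have type: "cm_type ?S = V.P.len (?A \<times> ?J) (colonq ?P (?A \<times> ?J) (?n \<times> ?J))"
  proof -
    obtain r0 where "r0 \<in> regular_elements ?S" "r0 \<in> max_ideal ?S" by (rule S.regular_in_m)
    hence reg0: "\<exists>r\<in>max_ideal ?S. h r \<in> Units ?P" using hunits by blast
    have "module_type ?S (ring_module ?S) = mlen ?P (h ` carrier ?S) (h ` carrier (ring_module ?S))
        (colonq ?P (h ` carrier (ring_module ?S)) (h ` max_ideal ?S))"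
    proof (rule S.module_type_colon[OF P.is_cring hS reg0 S.module_ring_module])
      show "inj_on h (carrier (ring_module ?S))" using hinj by simp
      show "h m \<in> carrier ?P" if "m \<in> carrier (ring_module ?S)" for m
        by (rule h.hom_closed) (use that in simp)
      show "h (s \<oplus>\<^bsub>ring_module ?S\<^esub> t) = h s \<oplus>\<^bsub>?P\<^esub> h t"
        if "s \<in> carrier (ring_module ?S)" "t \<in> carrier (ring_module ?S)" for s t
        using h.hom_add[of s t] that by (simp only: ring_module_simps)
      show "h (s \<odot>\<^bsub>ring_module ?S\<^esub> t) = h s \<otimes>\<^bsub>?P\<^esub> h t"
        if "s \<in> carrier ?S" "t \<in> carrier (ring_module ?S)" for s t
        using h.hom_mult[of s t] that by (simp only: ring_module_simps)
    qed
    thus ?thesis unfolding cm_type_def ring_module_simps him hmax .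
  qed
  have izU: "inv\<^bsub>?Q\<^esub> z \<in> Units ?Q" using z(1) by (rule Q.Units_inv_Units)
  note izc = Q.Units_closed[OF izU] and zc = Q.Units_closed[OF z(1)]
  have Acar: "?A \<subseteq> carrier ?Q" using Q.A_car by blast
  have DS: "D \<in> submods ?Q ?A" unfolding Deq by (rule V.D_SM)
  have zA: "dilate ?Q z ?A \<subseteq> D" by (rule Q.dil_A_sub[OF DS z(2)])
  have izD: "dilate ?Q (inv\<^bsub>?Q\<^esub> z) D \<in> submods ?Q ?A" by (rule Q.SM_dil[OF izc DS])
  have iz: "dilate ?Q (inv\<^bsub>?Q\<^esub> z) (dilate ?Q z ?A) = ?A" by (rule Q.dil_inv(1)[OF z(1) Acar])
  have AzD: "?A \<subseteq> dilate ?Q (inv\<^bsub>?Q\<^esub> z) D" using Q.dil_mono[OF zA, of "inv\<^bsub>?Q\<^esub> z"] unfolding iz .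
  have "quotient_length R (scale R (inv\<^bsub>?Q\<^esub> z) D) (frac_embed R (carrier R)) = Q.len ?A (dilate ?Q (inv\<^bsub>?Q\<^esub> z) D)"
    unfolding R.scale_eq R.frac_embed_eq by (rule R.quotient_length_eq[OF Q.A_SM izD AzD])
  also have "\<dots> = Q.len (dilate ?Q z ?A) D"
    using Q.len_dil[OF izU Q.SM_sub[OF Q.SM_dil[OF zc Q.A_SM]] Q.SM_sub[OF DS]] unfolding iz .
  finally have l1: "quotient_length R (scale R (inv\<^bsub>?Q\<^esub> z) D) (frac_embed R (carrier R)) = Q.len (dilate ?Q z ?A) D" .
  have zJ: "dilate ?Q z ?J \<subseteq> \<omega>" using V.D_mult_J z(2) unfolding Deq dilate_def by blast
  have l2: "quotient_length R \<omega> (scale R z (frac_embed R I)) = Q.len (dilate ?Q z ?J) \<omega>"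
    unfolding R.scale_eq R.frac_embed_eq by (rule R.quotient_length_eq[OF Q.SM_dil[OF zc JS] wS zJ])
  show "cm_type ?S = 2 * quotient_length R (scale R (inv\<^bsub>?Q\<^esub> z) D) (frac_embed R (carrier R)) + 1"
    unfolding type main Deq[symmetric] l1 ..
  show "quotient_length R (scale R (inv\<^bsub>?Q\<^esub> z) D) (frac_embed R (carrier R)) =
      quotient_length R \<omega> (scale R z (frac_embed R I))"
    unfolding l1 l2 using V.length_dual unfolding Deq .
qed

theorem proposition2p6:
  fixes R :: "('a, 'm) ring_scheme"
    and I :: "'a set"
    and \<omega> I_dual :: "('a \<times> 'a) set set"
    and z :: "('a \<times> 'a) set"
    and a b :: 'a
  assumes "one_dim_cm_local_ring R"
    and "infinite (carrier (R Quot max_ideal R))"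
    and "fractional_ideal R \<omega>"
    and "canonical_module R (as_module R \<omega>)"
    and "frac_embed R (carrier R) \<subseteq> \<omega>" and "\<omega> \<subseteq> integral_closure R"
    and "primary_ideal R I" and "radical R I = max_ideal R"
    and "I_dual = colon R \<omega> (frac_embed R I)"
    and "fractional_minimal_reduction R z I_dual"
    and "a \<in> carrier R" and "b \<in> carrier R"
    and "almost_gorenstein (rees_quotient R I a b)"
  shows "cm_type (rees_quotient R I a b) =
           2 * quotient_length R (scale R (inv\<^bsub>total_fractions R\<^esub> z) I_dual) (frac_embed R (carrier R)) + 1 \<and>
         2 * quotient_length R (scale R (inv\<^bsub>total_fractions R\<^esub> z) I_dual) (frac_embed R (carrier R)) + 1 =
           2 * quotient_length R \<omega> (scale R z (frac_embed R I)) + 1"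
proof -
  have "ideal I R" using assms(7) by (simp add: primary_ideal_def)
  from almost_gorenstein_rees_type[OF assms(1,3,4,5) this assms(8-13)] show ?thesis by simp
qed

end
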